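(* Let $\gamma_1,\delta_1>0$, $\gamma=\frac{7}{48}$, $\gamma_2,\delta_2\in\mathbb{R}$, let $\sigma_0>0$, and let $\eta_0\in H^{\sigma_0,2}(\mathbb{R})$ be real-valued. Let $\eta\in C([0,\infty);H^2(\mathbb{R}))$ be the (unique) global solution of the Cauchy problem for the fifth order KdV-BBM equation $$\partial_t\eta+\partial_x\eta-\gamma_1\partial_t\partial_x^2\eta+\gamma_2\partial_x^3\eta+\delta_1\partial_t\partial_x^4\eta+\delta_2\partial_x^5\eta=-\tfrac34\partial_x(\eta^2)-\gamma\partial_x^3(\eta^2)+\tfrac{7}{48}\partial_x(\eta_x^2)+\tfrac18\partial_x(\eta^3),\qquad \eta(x,0)=\eta_0(x).$$ Then there exists a function $\sigma:(0,\infty)\to(0,\infty)$ such that $$\eta(t)\in H^{\sigma(t),2}(\mathbb{R})\quad\text{for all } t>0,$$ and $\sigma$ satisfies the asymptotic lower bound $$\sigma(t)\ge \frac{C}{\sqrt{t}}\quad\text{as } t\to\infty$$ (i.e. for all sufficiently large $t$), where $C>0$ is a constant depending on the initial data norm $\|\eta_0\|_{H^{\sigma_0,2}(\mathbb{R})}$.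
   Context: The unknown $\eta=\eta(x,t)$ is real-valued, $x\in\mathbb{R}$; $\gamma,\gamma_1,\gamma_2,\delta_1,\delta_2$ are fixed real constants (the coefficients of the equation), on which constants may also depend. Modified Gevrey space: for $\sigma\ge0$ and $s\in\mathbb{R}$, $H^{\sigma,s}(\mathbb{R})$ is the space of $f$ with finite norm $$\|f\|_{H^{\sigma,s}(\mathbb{R})}=\big\|\cosh(\sigma|\xi|)\,\langle\xi\rangle^s\,\widehat f(\xi)\big\|_{L^2_\xi(\mathbb{R})},\qquad \langle\xi\rangle=\sqrt{1+\xi^2},$$ where $\widehat f(\xi)=\int_{\mathbb R} e^{-ix\xi}f(x)\,dx$. For $\sigma=0$ it is the Sobolev space $H^s(\mathbb{R})$. Notion of solution: with $\varphi(\xi)=1+\gamma_1\xi^2+\delta_1\xi^4$, $$\phi(\xi)=\frac{\xi(1-\gamma_2\xi^2+\delta_2\xi^4)}{\varphi(\xi)},\quad \tau(\xi)=\frac{\xi(3-4\gamma\xi^2)}{4\varphi(\xi)},\quad \psi(\xi)=\frac{\xi}{\varphi(\xi)},$$ and $\phi(D),\tau(D),\psi(D)$ the corresponding Fourier multipliers ($D=-i\partial_x$), the Cauchy problem is understood in the integral form $$\eta(t)=e^{-it\phi(D)}\eta_0-i\int_0^t e^{-i(t-s)\phi(D)}F(\eta)(s)\,ds,\qquad F(\eta)=\tau(D)\eta^2-\tfrac{7}{48}\psi(D)\eta_x^2-\tfrac18\psi(D)\eta^3 .$$ It is known that for $\gamma_1,\delta_1>0$, $\gamma=7/48$ and data in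 $H^2(\mathbb{R})$ (in particular in $H^{\sigma_0,2}(\mathbb{R})\hookrightarrow H^2(\mathbb{R})$) there is a unique global solution in $C([0,\infty);H^2(\mathbb{R}))$. *)

theory Defs
  imports "HOL-Analysis.Analysis"
begin

section \<open>Square integrable functions and the Fourier transform\<close>

text \<open>
  Elements of $L^2$ are represented by Borel functions; every notion below is invariant under
  changes on null sets, and identities between elements of $L^2$ are stated almost everywhere.
\<close>

definition L2_space :: "(real \<Rightarrow> complex) set" where
  "L2_space = {f \<in> borel_measurable lborel. integrable lborel (\<lambda>x. (norm (f x))\<^sup>2)}"

definition L2_norm :: "(real \<Rightarrow> complex) \<Rightarrow> real" where
  "L2_norm f = sqrt (LINT x|lborel. (norm (f x))\<^sup>2)"

text \<open>
  The transform with kernel \<open>exp (- \<i> x \<xi>)\<close>, without a normalising factor, extended to all of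
  $L^2$: the limit in $L^2$ of the transforms of the truncations to \<open>{-R..R}\<close>.  The
  \<open>ennreal\<close>-valued integral avoids a spurious zero for integrands that are not integrable.
\<close>

definition is_fourier_transform :: "(real \<Rightarrow> complex) \<Rightarrow> (real \<Rightarrow> complex) \<Rightarrow> bool" where
  "is_fourier_transform f g \<longleftrightarrow> g \<in> L2_space \<and>
     ((\<lambda>R. \<integral>\<^sup>+ \<xi>. ennreal ((norm ((LINT x:{-R..R}|lborel.
              exp (- (\<i> * of_real x * of_real \<xi>)) * f x) - g \<xi>))\<^sup>2) \<partial>lborel) \<longlongrightarrow> 0) at_top"

definition fourier :: "(real \<Rightarrow> complex) \<Rightarrow> real \<Rightarrow> complex" where
  "fourier f = (SOME g. is_fourier_transform f g)"

text \<open>\<open>fourier_multiplier m f\<close> is $m(D)f$ with $D = -i\partial_x$, for $m \hat f \in L^2$.\<close>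

definition fourier_multiplier :: "(real \<Rightarrow> complex) \<Rightarrow> (real \<Rightarrow> complex) \<Rightarrow> real \<Rightarrow> complex" where
  "fourier_multiplier m f =
     (SOME u. u \<in> L2_space \<and> (AE \<xi> in lborel. fourier u \<xi> = m \<xi> * fourier f \<xi>))"

definition deriv_x :: "(real \<Rightarrow> complex) \<Rightarrow> real \<Rightarrow> complex" where
  "deriv_x = fourier_multiplier (\<lambda>\<xi>. \<i> * of_real \<xi>)"


section \<open>Modified Gevrey spaces\<close>

text \<open>
  The elements are taken in $L^2$, which is no restriction if \<open>\<sigma> > 0\<close> or \<open>s \<ge> 0\<close>.  The norm
  is meaningful on members of the space only.
\<close>

definition gevrey_weight :: "real \<Rightarrow> real \<Rightarrow> real \<Rightarrow> real" where
  "gevrey_weight \<sigma> s \<xi> = cosh (\<sigma> * \<bar>\<xi>\<bar>) * sqrt (1 + \<xi>\<^sup>2) powr s"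

definition gevrey_space :: "real \<Rightarrow> real \<Rightarrow> (real \<Rightarrow> complex) set" where
  "gevrey_space \<sigma> s =
     {f \<in> L2_space. (\<lambda>\<xi>. of_real (gevrey_weight \<sigma> s \<xi>) * fourier f \<xi>) \<in> L2_space}"

definition gevrey_norm :: "real \<Rightarrow> real \<Rightarrow> (real \<Rightarrow> complex) \<Rightarrow> real" where
  "gevrey_norm \<sigma> s f = L2_norm (\<lambda>\<xi>. of_real (gevrey_weight \<sigma> s \<xi>) * fourier f \<xi>)"

abbreviation sobolev_space :: "real \<Rightarrow> (real \<Rightarrow> complex) set" where
  "sobolev_space s \<equiv> gevrey_space 0 s"

abbreviation sobolev_norm :: "real \<Rightarrow> (real \<Rightarrow> complex) \<Rightarrow> real" where
  "sobolev_norm s \<equiv> gevrey_norm 0 s"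

abbreviation complexify :: "(real \<Rightarrow> real) \<Rightarrow> real \<Rightarrow> complex" where
  "complexify f \<equiv> (\<lambda>x. complex_of_real (f x))"

text \<open>
  The integral over \<open>{a..b}\<close> of a curve with values in $H^s$, as the limit of Riemann sums in the
  norm of $H^s$.  It is only used for continuous curves, where it is the Bochner integral.
\<close>

definition has_sobolev_integral ::
    "real \<Rightarrow> (real \<Rightarrow> real \<Rightarrow> complex) \<Rightarrow> (real \<Rightarrow> complex) \<Rightarrow> real \<Rightarrow> real \<Rightarrow> bool" where
  "has_sobolev_integral s g I a b \<longleftrightarrow>
     (\<forall>r\<in>{a..b}. g r \<in> sobolev_space s) \<and> I \<in> sobolev_space s \<and>
     (\<forall>\<epsilon>>0. \<exists>\<delta>>0. \<forall>p. p tagged_division_of {a..b} \<and> (\<lambda>r. ball r \<delta>) fine p \<longrightarrow>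
        sobolev_norm s (\<lambda>x. (\<Sum>(r, K)\<in>p. of_real (measure lborel K) * g r x) - I x) < \<epsilon>)"


section \<open>The fifth order KdV-BBM equation\<close>

text \<open>
  The Fourier transform turns
  $$\partial_t\eta+\partial_x\eta-\gamma_1\partial_t\partial_x^2\eta+\gamma_2\partial_x^3\eta
    +\delta_1\partial_t\partial_x^4\eta+\delta_2\partial_x^5\eta
    =-\tfrac34\partial_x(\eta^2)-\gamma\partial_x^3(\eta^2)+\tfrac{7}{48}\partial_x(\eta_x^2)
    +\tfrac18\partial_x(\eta^3)$$
  into $i\partial_t\eta = \phi(D)\eta + F(\eta)$, with the symbols and the nonlinearity $F$ below.
  The Cauchy problem is understood in the corresponding integral (Duhamel) form.
\<close>

definition kdvbbm_denom :: "real \<Rightarrow> real \<Rightarrow> real \<Rightarrow> real" where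
  "kdvbbm_denom \<gamma>1 \<delta>1 \<xi> = 1 + \<gamma>1 * \<xi>^2 + \<delta>1 * \<xi>^4"

definition kdvbbm_phi :: "real \<Rightarrow> real \<Rightarrow> real \<Rightarrow> real \<Rightarrow> real \<Rightarrow> real" where
  "kdvbbm_phi \<gamma>1 \<gamma>2 \<delta>1 \<delta>2 \<xi> =
     \<xi> * (1 - \<gamma>2 * \<xi>^2 + \<delta>2 * \<xi>^4) / kdvbbm_denom \<gamma>1 \<delta>1 \<xi>"

definition kdvbbm_tau :: "real \<Rightarrow> real \<Rightarrow> real \<Rightarrow> real \<Rightarrow> real" where
  "kdvbbm_tau \<gamma> \<gamma>1 \<delta>1 \<xi> = \<xi> * (3 - 4 * \<gamma> * \<xi>^2) / (4 * kdvbbm_denom \<gamma>1 \<delta>1 \<xi>)"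

definition kdvbbm_psi :: "real \<Rightarrow> real \<Rightarrow> real \<Rightarrow> real" where
  "kdvbbm_psi \<gamma>1 \<delta>1 \<xi> = \<xi> / kdvbbm_denom \<gamma>1 \<delta>1 \<xi>"

definition kdvbbm_propagator ::
    "real \<Rightarrow> real \<Rightarrow> real \<Rightarrow> real \<Rightarrow> real \<Rightarrow> (real \<Rightarrow> complex) \<Rightarrow> real \<Rightarrow> complex" where
  "kdvbbm_propagator \<gamma>1 \<gamma>2 \<delta>1 \<delta>2 t =
     fourier_multiplier (\<lambda>\<xi>. exp (- (\<i> * of_real t * of_real (kdvbbm_phi \<gamma>1 \<gamma>2 \<delta>1 \<delta>2 \<xi>))))"

definition kdvbbm_nonlinearity ::
    "real \<Rightarrow> real \<Rightarrow> real \<Rightarrow> (real \<Rightarrow> complex) \<Rightarrow> real \<Rightarrow> complex" where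
  "kdvbbm_nonlinearity \<gamma> \<gamma>1 \<delta>1 u = (\<lambda>x.
       fourier_multiplier (\<lambda>\<xi>. of_real (kdvbbm_tau \<gamma> \<gamma>1 \<delta>1 \<xi>)) (\<lambda>y. (u y)^2) x
     - 7/48 * fourier_multiplier (\<lambda>\<xi>. of_real (kdvbbm_psi \<gamma>1 \<delta>1 \<xi>)) (\<lambda>y. (deriv_x u y)^2) x
     - 1/8 * fourier_multiplier (\<lambda>\<xi>. of_real (kdvbbm_psi \<gamma>1 \<delta>1 \<xi>)) (\<lambda>y. (u y)^3) x)"

text \<open>
  \<open>\<eta> t x\<close> is the value at time \<open>t\<close> and position \<open>x\<close>; the values at negative times are irrelevant.
  The three conjuncts say that \<open>\<eta>\<close> is in $C([0,\infty);H^2)$ and satisfies the integral equation.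
\<close>

definition kdvbbm_global_solution ::
    "real \<Rightarrow> real \<Rightarrow> real \<Rightarrow> real \<Rightarrow> real \<Rightarrow> (real \<Rightarrow> real) \<Rightarrow> (real \<Rightarrow> real \<Rightarrow> real) \<Rightarrow> bool" where
  "kdvbbm_global_solution \<gamma> \<gamma>1 \<gamma>2 \<delta>1 \<delta>2 \<eta>0 \<eta> \<longleftrightarrow>
     (\<forall>t\<ge>0. complexify (\<eta> t) \<in> sobolev_space 2) \<and>
     (\<forall>t\<ge>0. ((\<lambda>s. sobolev_norm 2 (complexify (\<lambda>x. \<eta> s x - \<eta> t x))) \<longlongrightarrow> 0) (at t within {0..})) \<and>
     (\<forall>t\<ge>0. \<exists>I.
        has_sobolev_integral 2
          (\<lambda>s. kdvbbm_propagator \<gamma>1 \<gamma>2 \<delta>1 \<delta>2 (t - s)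
                 (kdvbbm_nonlinearity \<gamma> \<gamma>1 \<delta>1 (complexify (\<eta> s)))) I 0 t \<and>
        (AE x in lborel. complexify (\<eta> t) x
           = kdvbbm_propagator \<gamma>1 \<gamma>2 \<delta>1 \<delta>2 t (complexify \<eta>0) x - \<i> * I x))"

end

(*
  The proof works with the Fourier side a(t) of the solution. For the weight
  W = cosh (sigma * min |xi| N), which is bounded, so that no a priori regularity is needed, the
  energy E = int W^2 (1 + gamma1 xi^2 + delta1 xi^4) |a|^2 dxi is finite and differentiable in time.
  Its derivative is a cubic plus a quartic form in a. Symmetrised over the frequencies
  x + y + z = 0, the symbol of the cubic form is a sum of W^2 * (3/4 t - 7/48 t^3 + 7/48 xyz) over
  t = x, y, z. For W = 1 it vanishes, precisely because gamma = 7/48; hence only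
  W^2 - 1 = sinh^2 (sigma * min |xi| N) = O(sigma^2 xi^2 W^2) contributes, and the cancellation between
  the two high frequencies saves the derivative that H^2 cannot afford. The quartic form is
  treated in the same way. Thus |E'| <= C sigma^2 (E^(3/2) + E^2) uniformly in N, a continuity argument
  keeps E bounded on [0, T] as long as sigma^2 T is small, and Fatou's lemma lets N tend to infinity.
*)
theory Submission
  imports "HOL-Probability.Probability" Defs
begin

section \<open>Square integrable functions\<close>

text \<open>The rate 1 / sqrt t is the quadratic factor \<sigma>^2 read backwards: over [0, T] the
  continuity argument tolerates an energy growth of order \<sigma>^2 T, so \<sigma> may be of order
  1 / sqrt T. The factor \<open>Dn\<close> in the energy is the common denominator of
  \<open>\<tau>\<close> and \<open>\<psi>\<close>: with it the nonlinearity becomes polynomials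
  times convolutions, and only then is exact symmetrisation possible. Reality of the solution enters
  as a(-\<xi>) = cnj (a \<xi>), which makes the energy derivative a form in \<open>a\<close> alone
  over frequencies with sum zero, open to all permutations. Two obstacles shape the rest. The
  dispersion symbol \<open>\<phi>\<close> may grow linearly, so the solution need not be
  differentiable in time with values in H^2; the energy is differentiated along the profile
  e^(it\<phi>) a, which has the same modulus as \<open>a\<close>, and the one derivative gained by
  the nonlinearity pays for \<open>\<phi>\<close>. Moreover the equation is given only as a limit of
  Riemann sums in H^2, and transforms are chosen representatives, so identities on the Fourier side
  hold almost everywhere only.\<close>

lemma L2_measurable [measurable_dest]: "f \<in> L2_space \<Longrightarrow> f \<in> borel_measurable borel"
  by (simp add: L2_space_def)

lemma L2_integrable: "f \<in> L2_space \<Longrightarrow> integrable lborel (\<lambda>x. (norm (f x))\<^sup>2)"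
  by (simp add: L2_space_def)

lemma L2_norm_nonneg [simp]: "0 \<le> L2_norm f"
  by (simp add: L2_norm_def integral_nonneg_AE)

lemma L2_norm_sq: "(L2_norm f)\<^sup>2 = (LINT x|lborel. (norm (f x))\<^sup>2)"
  by (simp add: L2_norm_def integral_nonneg_AE)

lemma L2_nn_integral:
  assumes "f \<in> L2_space"
  shows "(\<integral>\<^sup>+x. ennreal ((norm (f x))\<^sup>2) \<partial>lborel) = ennreal ((L2_norm f)\<^sup>2)"
  unfolding L2_norm_sq by (rule nn_integral_eq_integral[OF L2_integrable[OF assms]]) simp

text \<open>\<open>L2_norm\<close> is 0 by default where the squared modulus is not integrable, so a
  bound on it alone does not show membership. A bound on the \<open>ennreal\<close> integral gives
  membership and norm at once; domination, Young's inequality and Fatou arguments all go through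
  it.\<close>

lemma L2_by_nn_integral:
  assumes [measurable]: "f \<in> borel_measurable borel"
    and le: "(\<integral>\<^sup>+x. ennreal ((norm (f x))\<^sup>2) \<partial>lborel) \<le> ennreal (c\<^sup>2)" and "0 \<le> c"
  shows "f \<in> L2_space" "L2_norm f \<le> c"
proof -
  have "(\<integral>\<^sup>+x. ennreal (norm ((norm (f x))\<^sup>2)) \<partial>lborel) < \<infinity>"
    using le by (auto simp: less_top[symmetric] top_unique)
  then have "integrable lborel (\<lambda>x. (norm (f x))\<^sup>2)"
    by (intro integrableI_bounded) auto
  then show *: "f \<in> L2_space" by (simp add: L2_space_def)
  have "(L2_norm f)\<^sup>2 \<le> c\<^sup>2"
    using le unfolding L2_nn_integral[OF *] by (simp add: ennreal_le_iff)
  then show "L2_norm f \<le> c" using \<open>0 \<le> c\<close> power2_le_imp_le by blast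
qed

lemma L2_dominated:
  assumes [measurable]: "f \<in> borel_measurable borel" and g: "g \<in> L2_space"
    and le: "AE x in lborel. norm (f x) \<le> c * norm (g x)" and "0 \<le> c"
  shows "f \<in> L2_space" "L2_norm f \<le> c * L2_norm g"
proof -
  note [measurable] = L2_measurable[OF g]
  have "(\<integral>\<^sup>+x. ennreal ((norm (f x))\<^sup>2) \<partial>lborel) \<le> (\<integral>\<^sup>+x. ennreal (c\<^sup>2) * ennreal ((norm (g x))\<^sup>2) \<partial>lborel)"
  proof (rule nn_integral_mono_AE)
    show "AE x in lborel. ennreal ((norm (f x))\<^sup>2) \<le> ennreal (c\<^sup>2) * ennreal ((norm (g x))\<^sup>2)"
      using le
    proof eventually_elim
      case (elim x)
      have "(norm (f x))\<^sup>2 \<le> (c * norm (g x))\<^sup>2" using elim by (intro power_mono) auto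
      then show ?case by (simp add: power_mult_distrib ennreal_leI flip: ennreal_mult)
    qed
  qed
  also have "\<dots> = ennreal (c\<^sup>2) * ennreal ((L2_norm g)\<^sup>2)"
    by (subst nn_integral_cmult) (auto simp: L2_nn_integral[OF g])
  also have "\<dots> = ennreal ((c * L2_norm g)\<^sup>2)"
    by (simp add: power_mult_distrib flip: ennreal_mult)
  finally have *: "(\<integral>\<^sup>+x. ennreal ((norm (f x))\<^sup>2) \<partial>lborel) \<le> ennreal ((c * L2_norm g)\<^sup>2)" .
  show "f \<in> L2_space" "L2_norm f \<le> c * L2_norm g"
    using L2_by_nn_integral[OF _ *] \<open>0 \<le> c\<close> by auto
qed

lemma L2_cong_AE:
  assumes [measurable]: "f \<in> borel_measurable borel" and g: "g \<in> L2_space"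
    and "AE x in lborel. f x = g x"
  shows "f \<in> L2_space" "L2_norm f = L2_norm g"
proof -
  note [measurable] = L2_measurable[OF g]
  show "f \<in> L2_space" by (rule L2_dominated(1)[OF assms(1) g, of 1]) (use assms in \<open>auto elim: AE_mp\<close>)
  show "L2_norm f = L2_norm g" unfolding L2_norm_def
    by (rule arg_cong[where f=sqrt], rule integral_cong_AE) (use assms(3) in \<open>auto elim: AE_mp\<close>)
qed

lemma L2_norm_cong_AE:
  assumes "f \<in> borel_measurable borel" "g \<in> borel_measurable borel" "AE x in lborel. f x = g x"
  shows "L2_norm f = L2_norm g"
  unfolding L2_norm_def
  by (rule arg_cong[where f=sqrt], rule integral_cong_AE) (use assms in \<open>auto elim: AE_mp\<close>)

lemma L2_norm_eq:
  assumes "\<And>x. norm (f x) = norm (g x)"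
  shows "L2_norm f = L2_norm g"
  using assms by (simp add: L2_norm_def)

lemma L2_zero [simp]: "(\<lambda>x. 0) \<in> L2_space" "L2_norm (\<lambda>x. 0) = 0"
  by (auto simp: L2_space_def L2_norm_def)

lemma L2_scale: "f \<in> L2_space \<Longrightarrow> (\<lambda>x. c * f x) \<in> L2_space"
  unfolding L2_space_def by (auto simp: norm_mult power_mult_distrib)

lemma L2_norm_scale: "L2_norm (\<lambda>x. c * f x) = norm c * L2_norm f"
  by (simp add: L2_norm_def norm_mult power_mult_distrib real_sqrt_mult)

lemma borel_measurable_cnj [measurable]: "cnj \<in> borel_measurable borel"
  by (intro borel_measurable_continuous_onI continuous_intros)

lemma L2_cnj: "f \<in> L2_space \<Longrightarrow> (\<lambda>x. cnj (f x)) \<in> L2_space"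
  by (auto simp: L2_space_def intro: measurable_compose[OF _ borel_measurable_cnj])

lemma L2_norm_cnj [simp]: "L2_norm (\<lambda>x. cnj (f x)) = L2_norm f"
  by (simp add: L2_norm_def)

lemma lborel_integral_reflect:
  fixes f :: "real \<Rightarrow> 'a :: {banach, second_countable_topology}"
  shows "(LINT x|lborel. f (- x)) = (LINT x|lborel. f x)"
  using lborel_integral_real_affine[of "-1" f 0] by simp

lemma L2_reflect: "f \<in> L2_space \<Longrightarrow> (\<lambda>x. f (- x)) \<in> L2_space"
  using lborel_integrable_real_affine[of "\<lambda>x. (norm (f x))\<^sup>2" "-1" 0]
  by (auto simp: L2_space_def)

lemma L2_norm_reflect: "L2_norm (\<lambda>x. f (- x)) = L2_norm f"
  by (simp add: L2_norm_def lborel_integral_reflect[of "\<lambda>x. (norm (f x))\<^sup>2"])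

lemma L2_norm_uminus: "L2_norm (\<lambda>x. - f x) = L2_norm f"
  by (simp add: L2_norm_def)

lemma L2_norm_minus_commute: "L2_norm (\<lambda>x. f x - g x) = L2_norm (\<lambda>x. g x - f x)"
  by (simp add: L2_norm_def norm_minus_commute)

lemma L2_add:
  assumes f: "f \<in> L2_space" and g: "g \<in> L2_space" shows "(\<lambda>x. f x + g x) \<in> L2_space"
proof -
  note [measurable] = L2_measurable[OF f] L2_measurable[OF g]
  have "integrable lborel (\<lambda>x. (norm (f x + g x))\<^sup>2)"
  proof (rule Bochner_Integration.integrable_bound)
    show "integrable lborel (\<lambda>x. 2 * (norm (f x))\<^sup>2 + 2 * (norm (g x))\<^sup>2)"
      using L2_integrable[OF f] L2_integrable[OF g] by auto
    have "(norm (f x + g x))\<^sup>2 \<le> 2 * (norm (f x))\<^sup>2 + 2 * (norm (g x))\<^sup>2" for x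
    proof -
      have "(norm (f x + g x))\<^sup>2 \<le> (norm (f x) + norm (g x))\<^sup>2"
        by (intro power_mono norm_triangle_ineq) auto
      also have "\<dots> \<le> 2 * (norm (f x))\<^sup>2 + 2 * (norm (g x))\<^sup>2"
        using sum_squares_bound[of "norm (f x)" "norm (g x)"] by (simp add: power2_sum)
      finally show ?thesis .
    qed
    then show "AE x in lborel. norm ((norm (f x + g x))\<^sup>2) \<le> norm (2 * (norm (f x))\<^sup>2 + 2 * (norm (g x))\<^sup>2)"
      by simp
  qed simp
  then show ?thesis by (simp add: L2_space_def)
qed

lemma L2_diff: "f \<in> L2_space \<Longrightarrow> g \<in> L2_space \<Longrightarrow> (\<lambda>x. f x - g x) \<in> L2_space"
  using L2_add[of f "\<lambda>x. (-1) * g x"] L2_scale[of g "-1"] by simp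

lemma L2_sum: "(\<And>i. i \<in> A \<Longrightarrow> f i \<in> L2_space) \<Longrightarrow> (\<lambda>x. \<Sum>i\<in>A. f i x) \<in> L2_space"
  by (induction A rule: infinite_finite_induct) (auto intro!: L2_add)

lemma ennreal_power2_le_imp_le:
  assumes "a\<^sup>2 \<le> (ennreal b)\<^sup>2" shows "a \<le> ennreal b"
proof (cases a)
  case (real r)
  show ?thesis
  proof (cases "0 \<le> b")
    case True
    then have "r\<^sup>2 \<le> b\<^sup>2" using assms real by (simp add: ennreal_power ennreal_le_iff)
    then show ?thesis using True real power2_le_imp_le by (auto intro: ennreal_leI)
  next
    case False
    then show ?thesis using assms real by (auto simp: ennreal_neg ennreal_power)
  qed
next
  case top
  then show ?thesis using assms by (simp add: top_unique power_eq_top_ennreal)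
qed

text \<open>The \<open>ennreal\<close> form comes first because integrability of the product is
  itself a consequence of the inequality.\<close>

lemma L2_CS_nn:
  assumes f: "f \<in> L2_space" and g: "g \<in> L2_space"
  shows "(\<integral>\<^sup>+x. ennreal (norm (f x * g x)) \<partial>lborel) \<le> ennreal (L2_norm f * L2_norm g)"
proof -
  note [measurable] = L2_measurable[OF f] L2_measurable[OF g]
  have "(\<integral>\<^sup>+x. ennreal (norm (f x)) * ennreal (norm (g x)) \<partial>lborel)\<^sup>2
    \<le> (\<integral>\<^sup>+x. (ennreal (norm (f x)))\<^sup>2 \<partial>lborel) * (\<integral>\<^sup>+x. (ennreal (norm (g x)))\<^sup>2 \<partial>lborel)"
    by (rule Cauchy_Schwarz_nn_integral) auto
  also have "\<dots> = ennreal ((L2_norm f * L2_norm g)\<^sup>2)"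
    by (simp add: ennreal_power L2_nn_integral[OF f] L2_nn_integral[OF g] power_mult_distrib ennreal_mult)
  also have "\<dots> = (ennreal (L2_norm f * L2_norm g))\<^sup>2"
    by (simp add: ennreal_power)
  finally have "(\<integral>\<^sup>+x. ennreal (norm (f x)) * ennreal (norm (g x)) \<partial>lborel) \<le> ennreal (L2_norm f * L2_norm g)"
    by (rule ennreal_power2_le_imp_le)
  then show ?thesis by (simp add: norm_mult ennreal_mult)
qed

lemma L2_mult_integrable:
  assumes f: "f \<in> L2_space" and g: "g \<in> L2_space"
  shows "integrable lborel (\<lambda>x. f x * g x)"
proof (rule integrableI_bounded)
  note [measurable] = L2_measurable[OF f] L2_measurable[OF g]
  show "(\<lambda>x. f x * g x) \<in> borel_measurable lborel" by simp
  show "(\<integral>\<^sup>+x. ennreal (norm (f x * g x)) \<partial>lborel) < \<infinity>"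
    using le_less_trans[OF L2_CS_nn[OF f g] ennreal_less_top] by simp
qed

lemma L2_CS_abs:
  assumes f: "f \<in> L2_space" and g: "g \<in> L2_space"
  shows "(LINT x|lborel. norm (f x * g x)) \<le> L2_norm f * L2_norm g"
proof -
  have "ennreal (LINT x|lborel. norm (f x * g x)) \<le> ennreal (L2_norm f * L2_norm g)"
    using L2_CS_nn[OF f g] L2_mult_integrable[OF f g]
    by (subst nn_integral_eq_integral[symmetric]) auto
  then show ?thesis by (simp add: ennreal_le_iff)
qed

lemma L2_CS:
  assumes f: "f \<in> L2_space" and g: "g \<in> L2_space"
  shows "norm (LINT x|lborel. f x * g x) \<le> L2_norm f * L2_norm g"
  by (rule order_trans[OF integral_norm_bound L2_CS_abs[OF f g]])

lemma L2_triangle: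
  assumes f: "f \<in> L2_space" and g: "g \<in> L2_space"
  shows "L2_norm (\<lambda>x. f x + g x) \<le> L2_norm f + L2_norm g"
proof -
  note [measurable] = L2_measurable[OF f] L2_measurable[OF g]
  have i: "integrable lborel (\<lambda>x. norm (f x * g x))"
    using L2_mult_integrable[OF f g] by auto
  have "(L2_norm (\<lambda>x. f x + g x))\<^sup>2
     \<le> (LINT x|lborel. (norm (f x))\<^sup>2 + (norm (g x))\<^sup>2 + 2 * norm (f x * g x))"
    unfolding L2_norm_sq
  proof (rule integral_mono)
    show "integrable lborel (\<lambda>x. (norm (f x + g x))\<^sup>2)"
      by (rule L2_integrable[OF L2_add[OF f g]])
    show "integrable lborel (\<lambda>x. (norm (f x))\<^sup>2 + (norm (g x))\<^sup>2 + 2 * norm (f x * g x))"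
      using i L2_integrable[OF f] L2_integrable[OF g] by auto
    show "(norm (f x + g x))\<^sup>2 \<le> (norm (f x))\<^sup>2 + (norm (g x))\<^sup>2 + 2 * norm (f x * g x)" for x
      using power_mono[OF norm_triangle_ineq[of "f x" "g x"], of 2]
      by (simp add: power2_sum norm_mult)
  qed
  also have "\<dots> = (L2_norm f)\<^sup>2 + (L2_norm g)\<^sup>2 + 2 * (LINT x|lborel. norm (f x * g x))"
    using i L2_integrable[OF f] L2_integrable[OF g] by (simp add: L2_norm_sq)
  also have "\<dots> \<le> (L2_norm f + L2_norm g)\<^sup>2"
    using L2_CS_abs[OF f g] by (simp add: power2_sum)
  finally show ?thesis by (rule power2_le_imp_le) simp
qed

lemma L2_triangle_diff:
  assumes f: "f \<in> L2_space" and g: "g \<in> L2_space" and h: "h \<in> L2_space"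
  shows "L2_norm (\<lambda>x. f x - h x) \<le> L2_norm (\<lambda>x. f x - g x) + L2_norm (\<lambda>x. g x - h x)"
  using L2_triangle[OF L2_diff[OF f g] L2_diff[OF g h]] by simp

lemma L2_triangle_minus:
  assumes f: "f \<in> L2_space" and g: "g \<in> L2_space"
  shows "L2_norm (\<lambda>x. f x - g x) \<le> L2_norm f + L2_norm g"
  using L2_triangle[OF f L2_scale[OF g, of "-1"]] L2_norm_scale[of "-1" g] by simp

lemma L2_norm_eq_0:
  assumes f: "f \<in> L2_space"
  shows "L2_norm f = 0 \<longleftrightarrow> (AE x in lborel. f x = 0)"
proof -
  have "L2_norm f = 0 \<longleftrightarrow> (LINT x|lborel. (norm (f x))\<^sup>2) = 0"
    by (simp add: L2_norm_def)
  also have "\<dots> \<longleftrightarrow> (AE x in lborel. (norm (f x))\<^sup>2 = 0)"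
    by (rule integral_nonneg_eq_0_iff_AE[OF L2_integrable[OF f]]) simp
  finally show ?thesis by simp
qed

text \<open>Riesz-Fischer. A subsequence whose gaps in norm are below (1/2)^k converges almost
  everywhere; Fatou's lemma, with n fixed and the subsequence index going to infinity, turns this
  into convergence in norm of the whole sequence.\<close>

lemma L2_complete:
  assumes u: "\<And>n. u n \<in> L2_space"
    and cauchy: "\<And>e. e > 0 \<Longrightarrow> \<exists>N. \<forall>m\<ge>N. \<forall>n\<ge>N. L2_norm (\<lambda>x. u m x - u n x) < e"
  shows "\<exists>g\<in>L2_space. (\<lambda>n. L2_norm (\<lambda>x. u n x - g x)) \<longlonglongrightarrow> 0"
proof -
  note [measurable] = L2_measurable[OF u]
  have "\<exists>r::nat\<Rightarrow>nat. \<forall>k. (\<forall>n\<ge>r k. \<forall>m\<ge>r k. L2_norm (\<lambda>x. u m x - u n x) < (1/2)^k) \<and> r k < r (Suc k)"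
  proof (rule dependent_nat_choice)
    show "\<exists>x. \<forall>n\<ge>x. \<forall>m\<ge>x. L2_norm (\<lambda>x. u m x - u n x) < (1/2)^0"
      using cauchy[of 1] by auto
    fix x k
    obtain N where "\<forall>m\<ge>N. \<forall>n\<ge>N. L2_norm (\<lambda>x. u m x - u n x) < (1/2)^(Suc k)"
      using cauchy[of "(1/2)^(Suc k)"] by auto
    then show "\<exists>y. (\<forall>n\<ge>y. \<forall>m\<ge>y. L2_norm (\<lambda>x. u m x - u n x) < (1/2)^(Suc k)) \<and> x < y"
      by (intro exI[of _ "max N (Suc x)"]) auto
  qed
  then obtain r :: "nat \<Rightarrow> nat" where r: "\<And>k n m. r k \<le> n \<Longrightarrow> r k \<le> m \<Longrightarrow> L2_norm (\<lambda>x. u m x - u n x) < (1/2)^k"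
    and mono: "\<And>k. r k < r (Suc k)" by blast
  have smono: "strict_mono r" using mono by (simp add: strict_mono_Suc_iff)
  define d where "d k x = u (r (Suc k)) x - u (r k) x" for k x
  have d2: "d k \<in> L2_space" for k unfolding d_def by (intro L2_diff u)
  note [measurable] = L2_measurable[OF d2]
  have dn: "L2_norm (d k) < (1/2)^k" for k
    unfolding d_def by (rule r) (use mono[of k] in auto)
  \<comment> \<open>The weight 2^k balances two needs: the k-th integral is at most 2^k * (1/2)^(2k)
    = (1/2)^k, so the sum is finite, and finiteness at x forces \<open>norm (d k x)\<close> to decay
    like sqrt (1/2)^k, so the differences are summable.\<close>
  have "(\<integral>\<^sup>+x. (\<Sum>k. ennreal (2^k) * ennreal ((norm (d k x))\<^sup>2)) \<partial>lborel)
      = (\<Sum>k. ennreal (2^k) * ennreal ((L2_norm (d k))\<^sup>2))"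
    by (subst nn_integral_suminf) (auto simp: nn_integral_cmult L2_nn_integral[OF d2])
  also have "\<dots> \<le> (\<Sum>k. ennreal ((1/2)^k))"
  proof (rule suminf_le)
    fix k
    have "2^k * (L2_norm (d k))\<^sup>2 \<le> 2^k * ((1/2)^k)\<^sup>2"
      using dn[of k] by (intro mult_left_mono power_mono) auto
    also have "\<dots> = (1/2::real)^k"
      by (simp add: power2_eq_square field_simps)
    finally show "ennreal (2^k) * ennreal ((L2_norm (d k))\<^sup>2) \<le> ennreal ((1/2)^k)"
      by (simp add: ennreal_leI flip: ennreal_mult)
  qed auto
  also have "\<dots> < \<infinity>"
    by (subst suminf_ennreal_eq[OF _ geometric_sums]) auto
  finally have "(\<integral>\<^sup>+x. (\<Sum>k. ennreal (2^k) * ennreal ((norm (d k x))\<^sup>2)) \<partial>lborel) \<noteq> \<infinity>" by simp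
  then have "AE x in lborel. (\<Sum>k. ennreal (2^k) * ennreal ((norm (d k x))\<^sup>2)) \<noteq> \<infinity>"
    by (intro nn_integral_noteq_infinite) auto
  then have conv: "AE x in lborel. convergent (\<lambda>k. u (r k) x)"
  proof eventually_elim
    case (elim x)
    obtain C where C: "(\<Sum>k. ennreal (2^k) * ennreal ((norm (d k x))\<^sup>2)) = ennreal C" "C \<ge> 0"
      using elim by (cases "(\<Sum>k. ennreal (2^k) * ennreal ((norm (d k x))\<^sup>2))") auto
    have bd: "norm (d k x) \<le> sqrt C * (sqrt (1/2))^k" for k
    proof -
      have "ennreal (2^k * (norm (d k x))\<^sup>2) \<le> ennreal C"
        using sum_le_suminf[of "\<lambda>k. ennreal (2^k) * ennreal ((norm (d k x))\<^sup>2)" "{k}"] C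
        by (simp add: ennreal_mult)
      then have "2^k * (norm (d k x))\<^sup>2 \<le> C" using C(2) by (simp add: ennreal_le_iff)
      then have "(norm (d k x))\<^sup>2 \<le> C * (1/2)^k" by (simp add: field_simps)
      then have "sqrt ((norm (d k x))\<^sup>2) \<le> sqrt (C * (1/2)^k)" by (rule real_sqrt_le_mono)
      then show ?thesis by (simp add: real_sqrt_mult real_sqrt_power)
    qed
    have "summable (\<lambda>k. sqrt C * (sqrt (1/2))^k)"
      by (intro summable_mult summable_geometric) auto
    then have "summable (\<lambda>k. d k x)"
      by (rule summable_comparison_test'[where N=0]) (use bd in auto)
    then have "convergent (\<lambda>n. \<Sum>k<n. d k x)" by (simp add: summable_iff_convergent)
    moreover have "(\<Sum>k<n. d k x) = u (r n) x - u (r 0) x" for n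
      by (induction n) (auto simp: d_def)
    ultimately have "convergent (\<lambda>n. u (r n) x - u (r 0) x)" by simp
    then show ?case using convergent_diff_const_right_iff by blast
  qed
  \<comment> \<open>Where the subsequence diverges, \<open>lim\<close> takes a default value that is
    the same for all such x; measurability of g is therefore not affected.\<close>
  define g where "g x = lim (\<lambda>k. u (r k) x)" for x
  have [measurable]: "g \<in> borel_measurable borel" unfolding g_def by (rule borel_measurable_lim_metric) auto
  have close: "(\<lambda>x. u n x - g x) \<in> L2_space \<and> L2_norm (\<lambda>x. u n x - g x) \<le> (1/2)^k" if n: "r k \<le> n" for k n
  proof -
    have "(\<integral>\<^sup>+x. ennreal ((norm (u n x - g x))\<^sup>2) \<partial>lborel)
      = (\<integral>\<^sup>+x. liminf (\<lambda>j. ennreal ((norm (u n x - u (r j) x))\<^sup>2)) \<partial>lborel)"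
    proof (rule nn_integral_cong_AE)
      show "AE x in lborel. ennreal ((norm (u n x - g x))\<^sup>2) = liminf (\<lambda>j. ennreal ((norm (u n x - u (r j) x))\<^sup>2))"
        using conv
      proof eventually_elim
        case (elim x)
        then have "(\<lambda>k. u (r k) x) \<longlonglongrightarrow> g x" unfolding g_def by (simp add: convergent_LIMSEQ_iff)
        then have "(\<lambda>j. ennreal ((norm (u n x - u (r j) x))\<^sup>2)) \<longlonglongrightarrow> ennreal ((norm (u n x - g x))\<^sup>2)"
          by (intro tendsto_intros)
        then show ?case using lim_imp_Liminf[OF sequentially_bot] by metis
      qed
    qed
    also have "\<dots> \<le> liminf (\<lambda>j. \<integral>\<^sup>+x. ennreal ((norm (u n x - u (r j) x))\<^sup>2) \<partial>lborel)"
      by (rule nn_integral_liminf) auto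
    also have "\<dots> \<le> ennreal (((1/2)^k)\<^sup>2)"
    proof (rule Liminf_le)
      show "\<forall>\<^sub>F j in sequentially. (\<integral>\<^sup>+x. ennreal ((norm (u n x - u (r j) x))\<^sup>2) \<partial>lborel) \<le> ennreal (((1/2)^k)\<^sup>2)"
        using eventually_ge_at_top[of k]
      proof eventually_elim
        case (elim j)
        have "r k \<le> r j" using smono elim by (simp add: strict_mono_less_eq)
        then have "L2_norm (\<lambda>x. u n x - u (r j) x) < (1/2)^k" using n r by blast
        then have "(L2_norm (\<lambda>x. u n x - u (r j) x))\<^sup>2 \<le> ((1/2)^k)\<^sup>2"
          by (intro power_mono) auto
        then show ?case
          by (subst L2_nn_integral) (auto intro!: L2_diff u ennreal_leI)
      qed
    qed simp
    finally have *: "(\<integral>\<^sup>+x. ennreal ((norm (u n x - g x))\<^sup>2) \<partial>lborel) \<le> ennreal (((1/2)^k)\<^sup>2)" .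
    show ?thesis using L2_by_nn_integral[OF _ *] by auto
  qed
  have "g \<in> L2_space"
    using L2_diff[OF u[of "r 0"] conjunct1[OF close[of 0 "r 0"]]] by simp
  moreover have "(\<lambda>n. L2_norm (\<lambda>x. u n x - g x)) \<longlonglongrightarrow> 0"
  proof (rule LIMSEQ_I)
    fix e :: real assume "0 < e"
    then obtain k where "(1/2)^k < e" using real_arch_pow_inv[of e "1/2"] by auto
    then show "\<exists>no. \<forall>n\<ge>no. norm (L2_norm (\<lambda>x. u n x - g x) - 0) < e"
      using close[of k] by (intro exI[of _ "r k"]) fastforce
  qed
  ultimately show ?thesis by blast
qed

section \<open>Continuity of translations\<close>

lemma tendsto_0_squeeze:
  fixes f :: "nat \<Rightarrow> 'a :: real_normed_vector"
  assumes "g \<longlonglongrightarrow> 0" and "\<And>n. norm (f n) \<le> g n"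
  shows "f \<longlonglongrightarrow> 0"
  by (rule Lim_null_comparison[OF always_eventually assms(1)]) (use assms(2) in blast)

lemma lborel_integral_shift:
  fixes f :: "real \<Rightarrow> 'a :: {banach, second_countable_topology}"
  shows "(LINT x|lborel. f (t + x)) = (LINT x|lborel. f x)"
  using lborel_integral_real_affine[of 1 f t] by simp

lemma lborel_integrable_shift:
  fixes f :: "real \<Rightarrow> 'a :: {banach, second_countable_topology}"
  shows "integrable lborel f \<Longrightarrow> integrable lborel (\<lambda>x. f (t + x))"
  using lborel_integrable_real_affine[of f 1 t] by simp

text \<open>Continuity at 0 of translations in L1, in sequential form, so that dominated convergence
  applies directly.\<close>

definition translation_continuous :: "(real \<Rightarrow> real) \<Rightarrow> bool" where
  "translation_continuous f \<longleftrightarrow>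
     (\<forall>h. h \<longlonglongrightarrow> 0 \<longrightarrow> (\<lambda>n. LINT x|lborel. \<bar>f (h n + x) - f x\<bar>) \<longlonglongrightarrow> 0)"

text \<open>Closure under L1 limits. Translation preserves the L1 norm of f - g, so an approximation
  within e / 4 costs e / 4 twice, and g contributes less than another e / 4.\<close>

lemma translation_continuous_approx:
  assumes f: "integrable lborel f"
    and approx: "\<And>e. e > 0 \<Longrightarrow> \<exists>g. integrable lborel g \<and> translation_continuous g \<and>
       (LINT x|lborel. \<bar>f x - g x\<bar>) \<le> e"
  shows "translation_continuous f"
  unfolding translation_continuous_def
proof (intro allI impI LIMSEQ_I)
  fix h :: "nat \<Rightarrow> real" and e :: real assume h: "h \<longlonglongrightarrow> 0" and e: "0 < e"
  obtain g where g: "integrable lborel g" "translation_continuous g"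
    and fg: "(LINT x|lborel. \<bar>f x - g x\<bar>) \<le> e / 4" using approx[of "e/4"] e by auto
  note i = f g(1) lborel_integrable_shift[OF f] lborel_integrable_shift[OF g(1)]
  obtain N where N: "\<And>n. n \<ge> N \<Longrightarrow> \<bar>LINT x|lborel. \<bar>g (h n + x) - g x\<bar>\<bar> < e / 4"
  proof -
    have "(\<lambda>n. LINT x|lborel. \<bar>g (h n + x) - g x\<bar>) \<longlonglongrightarrow> 0"
      using g(2) h unfolding translation_continuous_def by blast
    from LIMSEQ_D[OF this, of "e/4"] e show ?thesis using that by auto
  qed
  have "norm ((LINT x|lborel. \<bar>f (h n + x) - f x\<bar>) - 0) < e" if "n \<ge> N" for n
  proof -
    have "(LINT x|lborel. \<bar>f (h n + x) - f x\<bar>)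
       \<le> (LINT x|lborel. \<bar>f (h n + x) - g (h n + x)\<bar> + \<bar>g (h n + x) - g x\<bar> + \<bar>f x - g x\<bar>)"
      by (rule integral_mono) (use i in auto)
    also have "\<dots> = (LINT x|lborel. \<bar>f (h n + x) - g (h n + x)\<bar>) + (LINT x|lborel. \<bar>g (h n + x) - g x\<bar>)
       + (LINT x|lborel. \<bar>f x - g x\<bar>)"
      using i by simp
    also have "(LINT x|lborel. \<bar>f (h n + x) - g (h n + x)\<bar>) = (LINT x|lborel. \<bar>f x - g x\<bar>)"
      by (rule lborel_integral_shift[of "\<lambda>x. \<bar>f x - g x\<bar>"])
    finally show ?thesis using N[OF that] fg e by (simp add: integral_nonneg_AE)
  qed
  then show "\<exists>no. \<forall>n\<ge>no. norm ((LINT x|lborel. \<bar>f (h n + x) - f x\<bar>) - 0) < e" by blast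
qed

text \<open>The indicator and its translate have the same integral, so the L1 distance is twice the
  integral of the positive part of \<open>ind x - ind (h n + x)\<close>. That part has the fixed
  integrable majorant \<open>ind\<close>, and at a point of U it vanishes eventually because U is
  open. The negative part admits neither argument directly.\<close>

lemma translation_continuous_open:
  assumes U: "open U" and fin: "emeasure lborel U < \<infinity>"
  shows "translation_continuous (indicator U)"
  unfolding translation_continuous_def
proof (intro allI impI)
  fix h :: "nat \<Rightarrow> real" assume h: "h \<longlonglongrightarrow> 0"
  have [measurable]: "U \<in> sets borel" using U by simp
  define ind where "ind = (indicator U :: real \<Rightarrow> real)"
  have i: "integrable lborel ind" unfolding ind_def using fin by (simp add: integrable_indicator_iff)
  note [measurable] = borel_measurable_integrable[OF i]
  note ish = lborel_integrable_shift[OF i]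
  have "(LINT x|lborel. \<bar>ind (h n + x) - ind x\<bar>) = 2 * (LINT x|lborel. max 0 (ind x - ind (h n + x)))" for n
  proof -
    have "(LINT x|lborel. \<bar>ind (h n + x) - ind x\<bar>)
      = (LINT x|lborel. 2 * max 0 (ind x - ind (h n + x)) + (ind (h n + x) - ind x))"
      by (rule Bochner_Integration.integral_cong) (auto simp: max_def abs_if)
    also have "\<dots> = 2 * (LINT x|lborel. max 0 (ind x - ind (h n + x)))"
      using i ish[of "h n"] by (simp add: lborel_integral_shift)
    finally show ?thesis .
  qed
  moreover have "(\<lambda>n. LINT x|lborel. max 0 (ind x - ind (h n + x))) \<longlonglongrightarrow> integral\<^sup>L lborel (\<lambda>x::real. 0::real)"
  proof (rule integral_dominated_convergence[where w=ind])
    show "AE x in lborel. (\<lambda>n. max 0 (ind x - ind (h n + x))) \<longlonglongrightarrow> 0"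
    proof (rule AE_I2)
      fix x
      show "(\<lambda>n. max 0 (ind x - ind (h n + x))) \<longlonglongrightarrow> 0"
      proof (cases "x \<in> U")
        case True
        have "(\<lambda>n. h n + x) \<longlonglongrightarrow> 0 + x" by (intro tendsto_intros h)
        then have "\<forall>\<^sub>F n in sequentially. h n + x \<in> U" using topological_tendstoD[OF _ U] True by simp
        then have "\<forall>\<^sub>F n in sequentially. 0 = max 0 (ind x - ind (h n + x))"
          by eventually_elim (use True in \<open>simp add: ind_def\<close>)
        then show ?thesis by (rule Lim_transform_eventually[rotated]) simp
      qed (simp add: ind_def)
    qed
    show "AE x in lborel. norm (max 0 (ind x - ind (h n + x))) \<le> ind x" for n
      by (rule AE_I2) (auto simp: ind_def indicator_def)
  qed (use i in auto)
  ultimately show "(\<lambda>n. LINT x|lborel. \<bar>indicator U (h n + x) - (indicator U x :: real)\<bar>) \<longlonglongrightarrow> 0"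
    unfolding ind_def[symmetric] by (simp add: tendsto_mult_right_zero)
qed

text \<open>Outer regularity replaces a set of finite measure by an open set that exceeds it by
  small measure; sums and limits follow from the triangle inequality and
  \<open>translation_continuous_approx\<close>.\<close>

lemma translation_continuous_integrable:
  fixes f :: "real \<Rightarrow> real"
  assumes "integrable lborel f"
  shows "translation_continuous f"
  using assms
proof (induction rule: integrable_induct)
  case (base A c)
  have [measurable]: "A \<in> sets borel" using base by simp
  have iA: "integrable lborel (indicator A :: real \<Rightarrow> real)" using base by (simp add: integrable_indicator_iff)
  have "translation_continuous (indicator A)"
  proof (rule translation_continuous_approx[OF iA])
    fix e :: real assume e: "0 < e"
    obtain U where U: "open U" "A \<subseteq> U" and em: "emeasure lborel (U - A) < e"
      using outer_regular_lborel[of A e] e by auto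
    have [measurable]: "U \<in> sets borel" using U by simp
    have "emeasure lborel U \<le> emeasure lborel A + emeasure lborel (U - A)"
      using emeasure_subadditive[of A lborel "U - A"] U by (simp add: Un_absorb1)
    also have "\<dots> < \<infinity>" using base(2) em by (auto simp: less_top[symmetric])
    finally have fU: "emeasure lborel U < \<infinity>" .
    have "(LINT x|lborel. \<bar>indicator A x - (indicator U x :: real)\<bar>) = (LINT x|lborel. indicator (U - A) x)"
      by (rule Bochner_Integration.integral_cong) (use U in \<open>auto simp: indicator_def\<close>)
    also have "\<dots> = measure lborel (U - A)" by simp
    also have "\<dots> \<le> e" using em e by (simp add: measure_def enn2real_leI)
    finally show "\<exists>g. integrable lborel g \<and> translation_continuous g \<and> (LINT x|lborel. \<bar>indicator A x - g x\<bar>) \<le> e"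
      using translation_continuous_open[OF U(1) fU] fU
      by (intro exI[of _ "indicator U"]) (auto simp: integrable_indicator_iff)
  qed
  moreover have "(LINT x|lborel. \<bar>indicator A (h + x) *\<^sub>R c - indicator A x *\<^sub>R c\<bar>) =
     (LINT x|lborel. \<bar>indicator A (h + x) - indicator A x\<bar>) * \<bar>c\<bar>" for h
  proof -
    have "\<bar>indicator A (h + x) *\<^sub>R c - indicator A x *\<^sub>R c\<bar> = \<bar>indicator A (h + x) - indicator A x\<bar> * \<bar>c\<bar>" for x
      by (simp flip: abs_mult left_diff_distrib)
    then show ?thesis by simp
  qed
  ultimately show ?case
    unfolding translation_continuous_def by (simp add: tendsto_mult_left_zero)
next
  case (add f g)
  have "(LINT x|lborel. \<bar>f (h + x) + g (h + x) - (f x + g x)\<bar>)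
     \<le> (LINT x|lborel. \<bar>f (h + x) - f x\<bar>) + (LINT x|lborel. \<bar>g (h + x) - g x\<bar>)" for h
  proof -
    note i = add(1,2) lborel_integrable_shift[OF add(1), of h] lborel_integrable_shift[OF add(2), of h]
    have "(LINT x|lborel. \<bar>f (h + x) + g (h + x) - (f x + g x)\<bar>)
      \<le> (LINT x|lborel. \<bar>f (h + x) - f x\<bar> + \<bar>g (h + x) - g x\<bar>)"
      by (rule integral_mono) (use i in auto)
    then show ?thesis using i by simp
  qed
  moreover have "(\<lambda>n. (LINT x|lborel. \<bar>f (h n + x) - f x\<bar>) + (LINT x|lborel. \<bar>g (h n + x) - g x\<bar>)) \<longlonglongrightarrow> 0"
    if "h \<longlonglongrightarrow> 0" for h
  proof -
    have "(\<lambda>n. LINT x|lborel. \<bar>f (h n + x) - f x\<bar>) \<longlonglongrightarrow> 0" "(\<lambda>n. LINT x|lborel. \<bar>g (h n + x) - g x\<bar>) \<longlonglongrightarrow> 0"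
      using add.IH that unfolding translation_continuous_def by blast+
    from tendsto_add[OF this] show ?thesis by simp
  qed
  ultimately show ?case
    unfolding translation_continuous_def
  proof (intro allI impI)
    fix h :: "nat \<Rightarrow> real" assume "h \<longlonglongrightarrow> 0"
    assume *: "\<And>h. (LINT x|lborel. \<bar>f (h + x) + g (h + x) - (f x + g x)\<bar>)
      \<le> (LINT x|lborel. \<bar>f (h + x) - f x\<bar>) + (LINT x|lborel. \<bar>g (h + x) - g x\<bar>)"
      and lim: "\<And>h. h \<longlonglongrightarrow> 0 \<Longrightarrow>
        (\<lambda>n. (LINT x|lborel. \<bar>f (h n + x) - f x\<bar>) + (LINT x|lborel. \<bar>g (h n + x) - g x\<bar>)) \<longlonglongrightarrow> 0"
    show "(\<lambda>n. LINT x|lborel. \<bar>f (h n + x) + g (h n + x) - (f x + g x)\<bar>) \<longlonglongrightarrow> 0"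
      by (rule tendsto_0_squeeze[OF lim[OF \<open>h \<longlonglongrightarrow> 0\<close>]]) (use * in \<open>simp add: integral_nonneg_AE\<close>)
  qed
next
  case (lim f s)
  show ?case
  proof (rule translation_continuous_approx[OF lim(4)])
    fix e :: real assume e: "0 < e"
    note [measurable] = borel_measurable_integrable[OF lim(1)] borel_measurable_integrable[OF lim(4)]
    have "(\<lambda>i. LINT x|lborel. \<bar>f x - s i x\<bar>) \<longlonglongrightarrow> integral\<^sup>L lborel (\<lambda>x::real. 0::real)"
    \<comment> \<open>The induction rule supplies approximants with modulus at most 2 * |f x|, hence
      the majorant 3 * |f x| for the difference.\<close>
    proof (rule integral_dominated_convergence[where w="\<lambda>x. 3 * \<bar>f x\<bar>"])
      show "AE x in lborel. (\<lambda>i. \<bar>f x - s i x\<bar>) \<longlonglongrightarrow> 0"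
      proof (rule AE_I2)
        fix x
        have "(\<lambda>i. \<bar>f x - s i x\<bar>) \<longlonglongrightarrow> \<bar>f x - f x\<bar>" using lim(2)[of x] by (intro tendsto_intros) auto
        then show "(\<lambda>i. \<bar>f x - s i x\<bar>) \<longlonglongrightarrow> 0" by simp
      qed
      show "AE x in lborel. norm \<bar>f x - s i x\<bar> \<le> 3 * \<bar>f x\<bar>" for i
      proof (rule AE_I2)
        fix x show "norm \<bar>f x - s i x\<bar> \<le> 3 * \<bar>f x\<bar>" using lim(3)[of x i] by simp
      qed
    qed (use lim(4) in auto)
    then have "\<forall>\<^sub>F i in sequentially. (LINT x|lborel. \<bar>f x - s i x\<bar>) < e"
      using e by (intro order_tendstoD(2)[of _ 0]) auto
    then obtain i where "(LINT x|lborel. \<bar>f x - s i x\<bar>) < e" by (auto dest: eventually_happens)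
    then show "\<exists>g. integrable lborel g \<and> translation_continuous g \<and> (LINT x|lborel. \<bar>f x - g x\<bar>) \<le> e"
      using lim(1,5) by (intro exI[of _ "s i"]) auto
  qed
qed

text \<open>For equal signs |a - b| \<le> |a + b|, which bounds the square by |a^2 - b^2|. For
  opposite signs a^2 and b^2 both occur in full on the right, and (a - b)^2 \<le> 2 (a^2 +
  b^2).\<close>

lemma square_diff_le_parts:
  fixes a b :: real
  shows "(a - b)\<^sup>2 \<le> 2 * (\<bar>(max a 0)\<^sup>2 - (max b 0)\<^sup>2\<bar> + \<bar>(max (-a) 0)\<^sup>2 - (max (-b) 0)\<^sup>2\<bar>)"
proof -
  have same: "(x - y)\<^sup>2 \<le> \<bar>x\<^sup>2 - y\<^sup>2\<bar>" if "x \<ge> 0" "y \<ge> 0" for x y :: real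
  proof -
    have "\<bar>x - y\<bar> * \<bar>x - y\<bar> \<le> \<bar>x - y\<bar> * (x + y)" using that by (intro mult_left_mono) auto
    also have "\<dots> = \<bar>x\<^sup>2 - y\<^sup>2\<bar>" using that by (simp add: power2_eq_square square_diff_square_factored abs_mult)
    finally show ?thesis by (simp add: power2_eq_square)
  qed
  have opp: "(x - y)\<^sup>2 \<le> 2 * (x\<^sup>2 + y\<^sup>2)" for x y :: real
    using sum_squares_bound[of x "-y"] by (simp add: power2_diff)
  consider "a \<ge> 0" "b \<ge> 0" | "a < 0" "b < 0" | "a \<ge> 0" "b < 0" | "a < 0" "b \<ge> 0" by linarith
  then show ?thesis
  proof cases
    case 1 then show ?thesis using order_trans[OF same[of a b], of "2 * \<bar>a\<^sup>2 - b\<^sup>2\<bar>"] by simp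
  next
    case 2 then show ?thesis using order_trans[OF same[of "-a" "-b"], of "2 * \<bar>a\<^sup>2 - b\<^sup>2\<bar>"] by (simp add: power2_commute)
  next
    case 3 then show ?thesis using opp[of a b] by simp
  next
    case 4 then show ?thesis using opp[of a b] by simp
  qed
qed

lemma L2_shift: "f \<in> L2_space \<Longrightarrow> (\<lambda>x. f (t + x)) \<in> L2_space"
  using lborel_integrable_shift[of "\<lambda>x. (norm (f x))\<^sup>2" t] by (auto simp: L2_space_def)

lemma L2_norm_shift: "L2_norm (\<lambda>x. f (t + x)) = L2_norm f"
  by (simp add: L2_norm_def lborel_integral_shift[of "\<lambda>x. (norm (f x))\<^sup>2"])

text \<open>
  Continuity in $L^2$ follows from continuity in $L^1$ of the squares of the positive and negative
  parts of the real and imaginary parts, because $|a - b|^2 \le |a^2 - b^2|$ for $a, b \ge 0$.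
\<close>

lemma L2_translation:
  assumes f: "f \<in> L2_space" and h: "h \<longlonglongrightarrow> 0"
  shows "(\<lambda>n. L2_norm (\<lambda>x. f (h n + x) - f x)) \<longlonglongrightarrow> 0"
proof -
  note [measurable] = L2_measurable[OF f]
  define p where "p = (\<lambda>(k::nat) x. if k = 0 then (max (Re (f x)) 0)\<^sup>2 else if k = 1 then (max (- Re (f x)) 0)\<^sup>2
     else if k = 2 then (max (Im (f x)) 0)\<^sup>2 else (max (- Im (f x)) 0)\<^sup>2)"
  have max_sq: "(max a 0)\<^sup>2 \<le> a\<^sup>2" "(max (-a) 0)\<^sup>2 \<le> a\<^sup>2" for a :: real
    by (auto simp: max_def)
  have ip: "integrable lborel (p k)" for k
  proof (rule Bochner_Integration.integrable_bound[OF L2_integrable[OF f]])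
    show "p k \<in> borel_measurable lborel" unfolding p_def by simp
    show "AE x in lborel. norm (p k x) \<le> norm ((norm (f x))\<^sup>2)"
    proof (rule AE_I2)
      fix x
      have "norm (p k x) = p k x" by (simp add: p_def)
      also have "\<dots> \<le> (Re (f x))\<^sup>2 + (Im (f x))\<^sup>2"
        unfolding p_def using max_sq[of "Re (f x)"] max_sq[of "Im (f x)"]
          zero_le_power2[of "Re (f x)"] zero_le_power2[of "Im (f x)"]
        by (simp only: split: if_split) linarith
      finally show "norm (p k x) \<le> norm ((norm (f x))\<^sup>2)" by (simp add: cmod_power2)
    qed
  qed
  have pt: "(norm (f y - f x))\<^sup>2 \<le> 2 * (\<Sum>k<4. \<bar>p k y - p k x\<bar>)" for x y
  proof -
    have sum4: "(\<Sum>k<4. F k) = F 0 + F 1 + F 2 + F 3" for F :: "nat \<Rightarrow> real"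
      by (simp add: numeral_eq_Suc)
    have p: "p 0 z = (max (Re (f z)) 0)\<^sup>2" "p 1 z = (max (- Re (f z)) 0)\<^sup>2"
      "p 2 z = (max (Im (f z)) 0)\<^sup>2" "p 3 z = (max (- Im (f z)) 0)\<^sup>2" for z
      unfolding p_def by simp_all
    have "(norm (f y - f x))\<^sup>2 = (Re (f y) - Re (f x))\<^sup>2 + (Im (f y) - Im (f x))\<^sup>2"
      by (simp add: cmod_power2)
    also note add_mono[OF square_diff_le_parts square_diff_le_parts]
    finally show ?thesis unfolding sum4 p by (simp only: distrib_left add.assoc)
  qed
  have le: "(L2_norm (\<lambda>x. f (h n + x) - f x))\<^sup>2 \<le> 2 * (\<Sum>k<4. LINT x|lborel. \<bar>p k (h n + x) - p k x\<bar>)" for n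
  proof -
    have "(L2_norm (\<lambda>x. f (h n + x) - f x))\<^sup>2 \<le> (LINT x|lborel. 2 * (\<Sum>k<4. \<bar>p k (h n + x) - p k x\<bar>))"
      unfolding L2_norm_sq
      by (rule integral_mono)
         (use pt ip lborel_integrable_shift[OF ip] L2_integrable[OF L2_diff[OF L2_shift[OF f] f]] in auto)
    also have "\<dots> = 2 * (\<Sum>k<4. LINT x|lborel. \<bar>p k (h n + x) - p k x\<bar>)"
      using ip lborel_integrable_shift[OF ip] by simp
    finally show ?thesis .
  qed
  have lim: "(\<lambda>n. 2 * (\<Sum>k<4. LINT x|lborel. \<bar>p k (h n + x) - p k x\<bar>)) \<longlonglongrightarrow> 2 * (\<Sum>k<(4::nat). 0)"
    using translation_continuous_integrable[OF ip] h unfolding translation_continuous_def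
    by (intro tendsto_intros) auto
  have "(\<lambda>n. (L2_norm (\<lambda>x. f (h n + x) - f x))\<^sup>2) \<longlonglongrightarrow> 0"
    by (rule tendsto_0_squeeze[OF lim[unfolded sum.neutral_const mult_zero_right]]) (use le in simp)
  then have "(\<lambda>n. sqrt ((L2_norm (\<lambda>x. f (h n + x) - f x))\<^sup>2)) \<longlonglongrightarrow> sqrt 0"
    by (intro tendsto_intros)
  then show ?thesis by simp
qed

text \<open>The autocorrelation: its transform is the squared modulus of the transform of f, up to a
  reflection, and its value at 0 is the squared norm of f. Plancherel's identity amounts to Fourier
  inversion for this one function at the single point 0.\<close>

definition autocorr :: "(real \<Rightarrow> complex) \<Rightarrow> real \<Rightarrow> complex" where
  "autocorr f h = (LINT x|lborel. f x * cnj (f (h + x)))"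

lemma autocorr_bound:
  assumes f: "f \<in> L2_space" shows "norm (autocorr f h) \<le> (L2_norm f)\<^sup>2"
  unfolding autocorr_def using L2_CS[OF f L2_cnj[OF L2_shift[OF f]], of h]
  by (simp add: power2_eq_square L2_norm_shift)

text \<open>Cauchy-Schwarz reduces continuity at 0 to continuity of translations in L2.\<close>

lemma autocorr_tendsto:
  assumes f: "f \<in> L2_space" and h: "h \<longlonglongrightarrow> 0"
  shows "(\<lambda>n. autocorr f (h n)) \<longlonglongrightarrow> of_real ((L2_norm f)\<^sup>2)"
proof -
  have eq: "autocorr f t - of_real ((L2_norm f)\<^sup>2) = (LINT x|lborel. f x * cnj (f (t + x) - f x))" for t
  proof -
    have "of_real ((L2_norm f)\<^sup>2) = (LINT x|lborel. f x * cnj (f x))"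
      unfolding L2_norm_sq integral_complex_of_real[symmetric]
      by (simp add: complex_norm_square del: of_real_power flip: of_real_power)
    then show ?thesis unfolding autocorr_def
      using L2_mult_integrable[OF f L2_cnj[OF f]] L2_mult_integrable[OF f L2_cnj[OF L2_shift[OF f]]]
      by (simp add: right_diff_distrib)
  qed
  have "norm (autocorr f t - of_real ((L2_norm f)\<^sup>2)) \<le> L2_norm f * L2_norm (\<lambda>x. f (t + x) - f x)" for t
    unfolding eq using L2_CS[OF f L2_cnj[OF L2_diff[OF L2_shift[OF f] f]], of t]
    by (simp only: L2_norm_cnj)
  moreover have "(\<lambda>n. L2_norm f * L2_norm (\<lambda>x. f (h n + x) - f x)) \<longlonglongrightarrow> 0"
    using tendsto_mult_left[OF L2_translation[OF f h]] by simp
  ultimately have "(\<lambda>n. autocorr f (h n) - of_real ((L2_norm f)\<^sup>2)) \<longlonglongrightarrow> 0"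
    by (rule tendsto_0_squeeze[rotated])
  then show ?thesis by (simp add: LIM_zero_iff)
qed

section \<open>The Fourier transform on $L^2$\<close>

text \<open>The transform of integrable functions, with a definite value at every point. The
  transform \<open>fourier\<close> on L2 is tied to it through truncations.\<close>

definition fourier_int :: "(real \<Rightarrow> complex) \<Rightarrow> real \<Rightarrow> complex" where
  "fourier_int f \<xi> = (LINT x|lborel. exp (- (\<i> * of_real x * of_real \<xi>)) * f x)"

lemma norm_fourier_int_kernel [simp]: "norm (exp (- (\<i> * of_real x * of_real y))) = 1"
  using norm_exp_i_times[of "- (x * y)"] by (simp add: mult.assoc)

lemma fourier_int_integrable:
  assumes "integrable lborel f"
  shows "integrable lborel (\<lambda>x. exp (- (\<i> * of_real x * of_real \<xi>)) * f x)"
proof -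
  note [measurable] = borel_measurable_integrable[OF assms]
  show ?thesis
    by (rule Bochner_Integration.integrable_bound[OF assms]) (auto simp: norm_mult)
qed

lemma fourier_int_measurable [measurable]:
  assumes [measurable]: "f \<in> borel_measurable borel"
  shows "fourier_int f \<in> borel_measurable borel"
  unfolding fourier_int_def[abs_def] by measurable

lemma fourier_int_bound:
  assumes "integrable lborel f"
  shows "norm (fourier_int f \<xi>) \<le> (LINT x|lborel. norm (f x))"
  unfolding fourier_int_def by (rule order_trans[OF integral_norm_bound]) (simp add: norm_mult)

lemma fourier_int_diff:
  assumes "integrable lborel f" "integrable lborel g"
  shows "fourier_int (\<lambda>x. f x - g x) \<xi> = fourier_int f \<xi> - fourier_int g \<xi>"
  unfolding fourier_int_def using fourier_int_integrable[OF assms(1)] fourier_int_integrable[OF assms(2)]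
  by (simp add: right_diff_distrib)

section \<open>Fubini identities for the transform on L1\<close>

lemma integrable_pair_mult:
  fixes p q :: "real \<Rightarrow> complex"
  assumes p: "integrable lborel p" and q: "integrable lborel q"
  shows "integrable (lborel \<Otimes>\<^sub>M lborel) (\<lambda>(x, y). p x * q y)"
proof (rule lborel_pair.Fubini_integrable)
  note [measurable] = borel_measurable_integrable[OF p] borel_measurable_integrable[OF q]
  show "(\<lambda>(x, y). p x * q y) \<in> borel_measurable (lborel \<Otimes>\<^sub>M lborel)" by measurable
  show "integrable lborel (\<lambda>x. LINT y|lborel. norm (case (x, y) of (x, y) \<Rightarrow> p x * q y))"
    using p by (simp add: norm_mult)
  show "AE x in lborel. integrable lborel (\<lambda>y. case (x, y) of (x, y) \<Rightarrow> p x * q y)"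
    using q by simp
qed

lemma integrable_pair_shift:
  fixes p q :: "real \<Rightarrow> complex"
  assumes p: "integrable lborel p" and q: "integrable lborel q"
  shows "integrable (lborel \<Otimes>\<^sub>M lborel) (\<lambda>(x, y). p x * q (y + x))"
proof (rule lborel_pair.Fubini_integrable)
  note [measurable] = borel_measurable_integrable[OF p] borel_measurable_integrable[OF q]
  have i: "integrable lborel (\<lambda>y. q (y + x))" for x
    using lborel_integrable_shift[OF q, of x] by (simp add: add.commute)
  have "(LINT y|lborel. norm (q (y + x))) = (LINT y|lborel. norm (q y))" for x
    using lborel_integral_shift[of "\<lambda>y. norm (q y)" x] by (simp add: add.commute)
  then show "integrable lborel (\<lambda>x. LINT y|lborel. norm (case (x, y) of (x, y) \<Rightarrow> p x * q (y + x)))"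
    using p by (simp add: norm_mult)
  show "(\<lambda>(x, y). p x * q (y + x)) \<in> borel_measurable (lborel \<Otimes>\<^sub>M lborel)" by measurable
  show "AE x in lborel. integrable lborel (\<lambda>y. case (x, y) of (x, y) \<Rightarrow> p x * q (y + x))"
    using i by simp
qed

text \<open>Fubini's theorem; the kernel is symmetric in its two variables, so the same integral is
  a transform of p or of q.\<close>

lemma fourier_int_multiplication:
  assumes p: "integrable lborel p" and q: "integrable lborel q"
  shows "(LINT \<xi>|lborel. fourier_int p \<xi> * q \<xi>) = (LINT x|lborel. p x * fourier_int q x)"
proof -
  note [measurable] = borel_measurable_integrable[OF p] borel_measurable_integrable[OF q]
  have "integrable (lborel \<Otimes>\<^sub>M lborel)
      (\<lambda>(x, \<xi>). exp (- (\<i> * of_real x * of_real \<xi>)) * p x * q \<xi>)"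
    by (rule Bochner_Integration.integrable_bound[OF integrable_pair_mult[OF p q]])
       (auto simp: norm_mult)
  from lborel_pair.Fubini_integral[OF this]
  have "(LINT \<xi>|lborel. LINT x|lborel. exp (- (\<i> * of_real x * of_real \<xi>)) * p x * q \<xi>)
     = (LINT x|lborel. LINT \<xi>|lborel. exp (- (\<i> * of_real x * of_real \<xi>)) * p x * q \<xi>)" .
  moreover have "(LINT x|lborel. exp (- (\<i> * of_real x * of_real \<xi>)) * p x * q \<xi>) = fourier_int p \<xi> * q \<xi>" for \<xi>
    unfolding fourier_int_def by simp
  moreover have "(LINT \<xi>|lborel. exp (- (\<i> * of_real x * of_real \<xi>)) * p x * q \<xi>) = p x * fourier_int q x" for x
    unfolding fourier_int_def by (simp add: mult_ac flip: integral_mult_right_zero)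
  ultimately show ?thesis by (simp only:)
qed

lemma autocorr_integrable:
  assumes p: "integrable lborel p"
  shows "integrable lborel (autocorr p)"
proof -
  have "integrable lborel (\<lambda>x. cnj (p x))" using p by simp
  from lborel_pair.integrable_snd[OF integrable_pair_shift[OF p this]]
  show ?thesis unfolding autocorr_def[abs_def] by simp
qed

text \<open>Substitute h + x for the variable of the conjugate factor and exchange the integrals:
  the phases in x cancel and a phase in h remains. Its sign is that of the conjugate, hence the
  reflection on the right.\<close>

lemma fourier_int_norm_square:
  assumes f: "integrable lborel f"
  shows "of_real ((norm (fourier_int f \<xi>))\<^sup>2) = fourier_int (autocorr f) (- \<xi>)"
proof -
  note [measurable] = borel_measurable_integrable[OF f]
  have cf: "integrable lborel (\<lambda>x. cnj (f x))" using f by simp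
  have cnj_fourier_int: "cnj (fourier_int f \<xi>) = (LINT h|lborel. exp (\<i> * of_real (h + x) * of_real \<xi>) * cnj (f (h + x)))" for x
  proof -
    have "cnj (fourier_int f \<xi>) = (LINT y|lborel. exp (\<i> * of_real y * of_real \<xi>) * cnj (f y))"
      unfolding fourier_int_def by (simp add: exp_cnj flip: Bochner_Integration.integral_cnj)
    then show ?thesis
      using lborel_integral_shift[of "\<lambda>y. exp (\<i> * of_real y * of_real \<xi>) * cnj (f y)" x]
      by (simp add: add.commute)
  qed
  have i: "integrable (lborel \<Otimes>\<^sub>M lborel)
      (\<lambda>(x, h). exp (\<i> * of_real h * of_real \<xi>) * (f x * cnj (f (h + x))))"
    by (rule Bochner_Integration.integrable_bound[OF integrable_pair_shift[OF f cf]])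
       (auto simp: norm_mult)
  have "of_real ((norm (fourier_int f \<xi>))\<^sup>2) = fourier_int f \<xi> * cnj (fourier_int f \<xi>)"
    by (simp add: complex_norm_square del: of_real_power flip: of_real_power)
  also have "\<dots> = (LINT x|lborel. exp (- (\<i> * of_real x * of_real \<xi>)) * f x * cnj (fourier_int f \<xi>))"
    unfolding fourier_int_def by simp
  also have "\<dots> = (LINT x|lborel. LINT h|lborel. exp (\<i> * of_real h * of_real \<xi>) * (f x * cnj (f (h + x))))"
  proof (rule Bochner_Integration.integral_cong[OF refl])
    fix x
    show "exp (- (\<i> * of_real x * of_real \<xi>)) * f x * cnj (fourier_int f \<xi>)
      = (LINT h|lborel. exp (\<i> * of_real h * of_real \<xi>) * (f x * cnj (f (h + x))))"
      unfolding cnj_fourier_int[of x] integral_mult_right_zero[symmetric]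
    proof (rule Bochner_Integration.integral_cong[OF refl])
      fix h
      have "exp (- (\<i> * of_real x * of_real \<xi>)) * exp (\<i> * of_real (h + x) * of_real \<xi>)
         = exp (\<i> * of_real h * of_real \<xi>)"
        unfolding exp_add[symmetric] by (simp add: algebra_simps)
      then show "exp (- (\<i> * of_real x * of_real \<xi>)) * f x * (exp (\<i> * of_real (h + x) * of_real \<xi>) * cnj (f (h + x)))
         = exp (\<i> * of_real h * of_real \<xi>) * (f x * cnj (f (h + x)))"
        by (metis (no_types, lifting) mult.assoc mult.left_commute)
    qed
  qed
  also have "\<dots> = (LINT h|lborel. LINT x|lborel. exp (\<i> * of_real h * of_real \<xi>) * (f x * cnj (f (h + x))))"
    by (rule lborel_pair.Fubini_integral[OF i, symmetric])
  also have "\<dots> = fourier_int (autocorr f) (- \<xi>)"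
    unfolding fourier_int_def autocorr_def by simp
  finally show ?thesis .
qed

text \<open>Normalised to the value 1 at the origin instead of to unit mass:
  \<open>gauss (e * \<xi>)\<close> increases to 1 as e decreases to 0 and serves as a convergence
  factor.\<close>

definition gauss :: "real \<Rightarrow> real" where "gauss x = exp (- (x\<^sup>2) / 2)"

lemma gauss_measurable [measurable]: "gauss \<in> borel_measurable borel"
  unfolding gauss_def[abs_def] by measurable

lemma gauss_normal: "gauss x = sqrt (2 * pi) * std_normal_density x"
  by (simp add: gauss_def std_normal_density_def)

lemma gauss_integrable: "integrable lborel gauss"
  unfolding gauss_normal[abs_def] using integrable_normal_density[of 1 0] by simp

lemma gauss_integral: "(LINT x|lborel. gauss x) = sqrt (2 * pi)"
  unfolding gauss_normal[abs_def] using integral_normal_density[of 1 0] by simp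

text \<open>Read off from the characteristic function of the standard normal distribution; the
  argument - t accounts for the opposite sign in the exponent.\<close>

lemma fourier_int_gauss: "fourier_int (\<lambda>x. of_real (gauss x)) t = of_real (sqrt (2 * pi) * gauss t)"
proof -
  have "of_real (gauss t) = char std_normal_distribution (- t)"
    by (simp add: char_std_normal_distribution gauss_def)
  also have "\<dots> = (LINT x|lborel. std_normal_density x *\<^sub>R exp (\<i> * of_real (- t * x)))"
    unfolding char_def by (subst integral_density) (auto simp: normal_density_nonneg)
  finally have "of_real (gauss t) = (LINT x|lborel. std_normal_density x *\<^sub>R exp (\<i> * of_real (- t * x)))" .
  then have "of_real (sqrt (2 * pi)) * of_real (gauss t)
     = (LINT x|lborel. of_real (sqrt (2 * pi)) * (std_normal_density x *\<^sub>R exp (\<i> * of_real (- t * x))))"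
    by (simp only: integral_mult_right_zero)
  also have "\<dots> = fourier_int (\<lambda>x. of_real (gauss x)) t"
    unfolding fourier_int_def gauss_normal
    by (rule Bochner_Integration.integral_cong) (auto simp: scaleR_conv_of_real mult_ac)
  finally show ?thesis by simp
qed

lemma fourier_int_gauss_scaled:
  assumes e: "e > 0"
  shows "fourier_int (\<lambda>x. of_real (gauss (e * x))) t = of_real (sqrt (2 * pi) / e * gauss (t / e))"
proof -
  have "fourier_int (\<lambda>x. of_real (gauss (e * x))) t = \<bar>1/e\<bar> *\<^sub>R fourier_int (\<lambda>x. of_real (gauss x)) (t / e)"
    unfolding fourier_int_def
    by (subst lborel_integral_real_affine[where c="1/e" and t=0]) (use e in \<open>auto simp: mult_ac\<close>)
  then show ?thesis unfolding fourier_int_gauss using e by (simp add: scaleR_conv_of_real)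
qed

text \<open>
  The Gaussian mean of $|\hat f|^2$ is the Gaussian mean of the autocorrelation of \<open>f\<close>, at the
  reciprocal scale; as \<open>e\<close> tends to 0 this gives Plancherel's identity.
\<close>

lemma fourier_int_gauss_mean:
  assumes f: "integrable lborel f" and e: "e > 0"
  shows "integrable lborel (\<lambda>\<xi>. (norm (fourier_int f \<xi>))\<^sup>2 * gauss (e * \<xi>))"
    and "of_real (LINT \<xi>|lborel. (norm (fourier_int f \<xi>))\<^sup>2 * gauss (e * \<xi>))
       = of_real (sqrt (2 * pi)) * (LINT z|lborel. autocorr f (e * z) * of_real (gauss z))"
proof -
  note [measurable] = borel_measurable_integrable[OF f]
  have ge: "integrable lborel (\<lambda>\<xi>. gauss (e * \<xi>))"
    using lborel_integrable_real_affine[OF gauss_integrable, of e 0] e by simp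
  have ige: "integrable lborel (\<lambda>\<xi>. complex_of_real (gauss (e * \<xi>)))" using ge by simp
  show "integrable lborel (\<lambda>\<xi>. (norm (fourier_int f \<xi>))\<^sup>2 * gauss (e * \<xi>))"
  proof (rule Bochner_Integration.integrable_bound)
    show "integrable lborel (\<lambda>\<xi>. (LINT x|lborel. norm (f x))\<^sup>2 * gauss (e * \<xi>))" using ge by simp
    show "AE \<xi> in lborel. norm ((norm (fourier_int f \<xi>))\<^sup>2 * gauss (e * \<xi>)) \<le> norm ((LINT x|lborel. norm (f x))\<^sup>2 * gauss (e * \<xi>))"
      using fourier_int_bound[OF f] by (auto intro!: AE_I2 mult_right_mono power_mono simp: abs_mult)
  qed simp
  have "of_real (LINT \<xi>|lborel. (norm (fourier_int f \<xi>))\<^sup>2 * gauss (e * \<xi>))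
    = (LINT \<xi>|lborel. fourier_int (autocorr f) (- \<xi>) * of_real (gauss (e * \<xi>)))"
    unfolding integral_complex_of_real[symmetric] by (simp only: of_real_mult fourier_int_norm_square[OF f])
  also have "\<dots> = (LINT \<xi>|lborel. fourier_int (autocorr f) \<xi> * of_real (gauss (e * \<xi>)))"
    using lborel_integral_reflect[of "\<lambda>\<xi>. fourier_int (autocorr f) \<xi> * of_real (gauss (e * \<xi>))"]
    by (simp add: gauss_def)
  also have "\<dots> = (LINT h|lborel. autocorr f h * of_real (sqrt (2 * pi) / e * gauss (h / e)))"
    by (simp only: fourier_int_multiplication[OF autocorr_integrable[OF f] ige] fourier_int_gauss_scaled[OF e])
  also have "\<dots> = \<bar>e\<bar> *\<^sub>R (LINT z|lborel. autocorr f (0 + e * z) * of_real (sqrt (2 * pi) / e * gauss ((0 + e * z) / e)))"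
    by (rule lborel_integral_real_affine) (use e in simp)
  also have "\<dots> = (LINT z|lborel. of_real (sqrt (2 * pi)) * (autocorr f (e * z) * of_real (gauss z)))"
    unfolding integral_scaleR_right[symmetric]
    by (rule Bochner_Integration.integral_cong) (use e in \<open>auto simp: scaleR_conv_of_real\<close>)
  also have "\<dots> = of_real (sqrt (2 * pi)) * (LINT z|lborel. autocorr f (e * z) * of_real (gauss z))"
    by simp
  finally show "of_real (LINT \<xi>|lborel. (norm (fourier_int f \<xi>))\<^sup>2 * gauss (e * \<xi>))
       = of_real (sqrt (2 * pi)) * (LINT z|lborel. autocorr f (e * z) * of_real (gauss z))" .
qed

text \<open>In the Gaussian means the autocorrelation is evaluated at \<open>e n * z\<close>, so it
  tends to its value at 0 under a Gaussian majorant. One factor sqrt (2 pi) stems from the mean, the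
  other from the integral of \<open>gauss\<close>.\<close>

lemma fourier_int_plancherel:
  assumes f: "integrable lborel f" and f2: "f \<in> L2_space"
  shows "fourier_int f \<in> L2_space" and "L2_norm (fourier_int f) = sqrt (2 * pi) * L2_norm f"
proof -
  note [measurable] = borel_measurable_integrable[OF f] borel_measurable_integrable[OF autocorr_integrable[OF f]]
  define e where "e n = 1 / real (Suc n)" for n
  have e: "e n > 0" for n by (simp add: e_def)
  have e0: "e \<longlonglongrightarrow> 0" unfolding e_def by (rule LIMSEQ_Suc[OF lim_1_over_n])
  have "(\<lambda>n. LINT z|lborel. autocorr f (e n * z) * of_real (gauss z))
     \<longlonglongrightarrow> (LINT z|lborel. of_real ((L2_norm f)\<^sup>2) * of_real (gauss z))"
  proof (rule integral_dominated_convergence[where w="\<lambda>z. (L2_norm f)\<^sup>2 * gauss z"])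
    show "integrable lborel (\<lambda>z. (L2_norm f)\<^sup>2 * gauss z)" using gauss_integrable by simp
    show "AE z in lborel. (\<lambda>n. autocorr f (e n * z) * of_real (gauss z)) \<longlonglongrightarrow> of_real ((L2_norm f)\<^sup>2) * of_real (gauss z)"
    proof (rule AE_I2)
      fix z
      have "(\<lambda>n. e n * z) \<longlonglongrightarrow> 0" using tendsto_mult_left_zero[OF e0] .
      then show "(\<lambda>n. autocorr f (e n * z) * of_real (gauss z)) \<longlonglongrightarrow> of_real ((L2_norm f)\<^sup>2) * of_real (gauss z)"
        by (intro tendsto_intros autocorr_tendsto f2)
    qed
    show "AE z in lborel. norm (autocorr f (e n * z) * of_real (gauss z)) \<le> (L2_norm f)\<^sup>2 * gauss z" for n
      by (rule AE_I2) (simp add: norm_mult gauss_def autocorr_bound[OF f2])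
  qed simp_all
  also have "(LINT z|lborel. of_real ((L2_norm f)\<^sup>2) * complex_of_real (gauss z)) = of_real ((L2_norm f)\<^sup>2 * sqrt (2 * pi))"
    by (simp add: gauss_integral)
  finally have "(\<lambda>n. Re (of_real (sqrt (2 * pi)) * (LINT z|lborel. autocorr f (e n * z) * of_real (gauss z))))
     \<longlonglongrightarrow> Re (of_real (sqrt (2 * pi)) * of_real ((L2_norm f)\<^sup>2 * sqrt (2 * pi)))"
    by (intro tendsto_intros)
  then have lim: "(\<lambda>n. LINT \<xi>|lborel. (norm (fourier_int f \<xi>))\<^sup>2 * gauss (e n * \<xi>)) \<longlonglongrightarrow> 2 * pi * (L2_norm f)\<^sup>2"
    unfolding fourier_int_gauss_mean(2)[OF f e, symmetric] by (simp add: mult_ac)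
  \<comment> \<open>Monotone convergence is the right tool here, as integrability of the squared
    modulus is part of the claim: the weights increase with n because e n decreases.\<close>
  have "has_bochner_integral lborel (\<lambda>\<xi>. (norm (fourier_int f \<xi>))\<^sup>2) (2 * pi * (L2_norm f)\<^sup>2)"
  proof (rule has_bochner_integral_monotone_convergence[OF _ _ _ lim])
    show "integrable lborel (\<lambda>\<xi>. (norm (fourier_int f \<xi>))\<^sup>2 * gauss (e n * \<xi>))" for n
      by (rule fourier_int_gauss_mean(1)[OF f e])
    show "AE \<xi> in lborel. mono (\<lambda>n. (norm (fourier_int f \<xi>))\<^sup>2 * gauss (e n * \<xi>))"
    proof (rule AE_I2, rule monoI)
      fix \<xi> and m n :: nat assume "m \<le> n"
      then have "e n \<le> e m" by (simp add: e_def frac_le)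
      then have "(e n * \<xi>)\<^sup>2 \<le> (e m * \<xi>)\<^sup>2"
        using e[of n] by (simp add: power_mult_distrib mult_right_mono power_mono)
      then show "(norm (fourier_int f \<xi>))\<^sup>2 * gauss (e m * \<xi>) \<le> (norm (fourier_int f \<xi>))\<^sup>2 * gauss (e n * \<xi>)"
        unfolding gauss_def by (intro mult_left_mono) auto
    qed
    show "AE \<xi> in lborel. (\<lambda>n. (norm (fourier_int f \<xi>))\<^sup>2 * gauss (e n * \<xi>)) \<longlonglongrightarrow> (norm (fourier_int f \<xi>))\<^sup>2"
    proof (rule AE_I2)
      fix \<xi>
      have "(\<lambda>n. (norm (fourier_int f \<xi>))\<^sup>2 * exp (- ((e n * \<xi>)\<^sup>2) / 2)) \<longlonglongrightarrow> (norm (fourier_int f \<xi>))\<^sup>2 * exp (- ((0 * \<xi>)\<^sup>2) / 2)"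
        by (intro tendsto_intros e0) auto
      then show "(\<lambda>n. (norm (fourier_int f \<xi>))\<^sup>2 * gauss (e n * \<xi>)) \<longlonglongrightarrow> (norm (fourier_int f \<xi>))\<^sup>2"
        by (simp add: gauss_def)
    qed
  qed simp
  then have i: "integrable lborel (\<lambda>\<xi>. (norm (fourier_int f \<xi>))\<^sup>2)"
    and v: "(LINT \<xi>|lborel. (norm (fourier_int f \<xi>))\<^sup>2) = 2 * pi * (L2_norm f)\<^sup>2"
    by (auto simp: has_bochner_integral_iff)
  show "fourier_int f \<in> L2_space" using i by (simp add: L2_space_def)
  show "L2_norm (fourier_int f) = sqrt (2 * pi) * L2_norm f"
    unfolding L2_norm_def[of "fourier_int f"] v by (simp add: real_sqrt_mult)
qed

section \<open>Extension of the transform to L2 by truncation\<close>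

definition trunc :: "real \<Rightarrow> (real \<Rightarrow> complex) \<Rightarrow> real \<Rightarrow> complex" where
  "trunc R f x = indicator {-R..R} x *\<^sub>R f x"

lemma L2_indicator: "(\<lambda>x. complex_of_real (indicator {a..b} x)) \<in> L2_space"
proof -
  have "(norm (complex_of_real (indicator {a..b} x)))\<^sup>2 = indicator {a..b} x" for x
    by (simp add: indicator_def)
  then show ?thesis by (simp add: L2_space_def integrable_indicator_iff emeasure_lborel_Icc_eq)
qed

lemma trunc_L2:
  assumes f: "f \<in> L2_space" shows "trunc R f \<in> L2_space"
proof (rule L2_dominated(1)[OF _ f, of _ 1])
  note [measurable] = L2_measurable[OF f]
  show "trunc R f \<in> borel_measurable borel" unfolding trunc_def[abs_def] by measurable
  show "AE x in lborel. norm (trunc R f x) \<le> 1 * norm (f x)" by (simp add: trunc_def indicator_def)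
qed simp

lemma trunc_integrable: "f \<in> L2_space \<Longrightarrow> integrable lborel (trunc R f)"
  using L2_mult_integrable[OF L2_indicator, of f "-R" R]
  by (simp add: trunc_def[abs_def] scaleR_conv_of_real)

lemma trunc_tendsto:
  assumes f: "f \<in> L2_space"
  shows "((\<lambda>R. L2_norm (\<lambda>x. trunc R f x - f x)) \<longlongrightarrow> 0) at_top"
proof -
  note [measurable] = L2_measurable[OF f] L2_measurable[OF trunc_L2[OF f]]
  have "((\<lambda>R. LINT x|lborel. (norm (trunc R f x - f x))\<^sup>2) \<longlongrightarrow> integral\<^sup>L lborel (\<lambda>x::real. (norm (0::complex))\<^sup>2)) at_top"
  proof (rule integral_dominated_convergence_at_top[where w="\<lambda>x. (norm (f x))\<^sup>2"])
    show "AE x in lborel. ((\<lambda>R. (norm (trunc R f x - f x))\<^sup>2) \<longlongrightarrow> (norm (0::complex))\<^sup>2) at_top"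
    proof (rule AE_I2)
      fix x
      have "\<forall>\<^sub>F R in at_top. (norm (0::complex))\<^sup>2 = (norm (trunc R f x - f x))\<^sup>2"
        using eventually_ge_at_top[of "\<bar>x\<bar>"]
        by eventually_elim (auto simp: trunc_def indicator_def)
      then show "((\<lambda>R. (norm (trunc R f x - f x))\<^sup>2) \<longlongrightarrow> (norm (0::complex))\<^sup>2) at_top"
        by (rule Lim_transform_eventually[rotated]) simp
    qed
    show "\<forall>\<^sub>F R in at_top. AE x in lborel. norm ((norm (trunc R f x - f x))\<^sup>2) \<le> (norm (f x))\<^sup>2"
      by (rule always_eventually) (auto simp: trunc_def indicator_def)
  qed (use L2_integrable[OF f] in auto)
  from tendsto_real_sqrt[OF this] show ?thesis by (simp add: L2_norm_def)
qed

lemma L2_norm_diff_tendsto: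
  assumes u: "\<And>n. u n \<in> L2_space" and g: "g \<in> L2_space" and v: "v \<in> L2_space"
    and lim: "(\<lambda>n. L2_norm (\<lambda>x. u n x - g x)) \<longlonglongrightarrow> 0"
  shows "(\<lambda>n. L2_norm (\<lambda>x. v x - u n x)) \<longlonglongrightarrow> L2_norm (\<lambda>x. v x - g x)"
proof -
  have "norm (L2_norm (\<lambda>x. v x - u n x) - L2_norm (\<lambda>x. v x - g x)) \<le> L2_norm (\<lambda>x. u n x - g x)" for n
    using L2_triangle_diff[OF v u[of n] g] L2_triangle_diff[OF v g u[of n]] L2_norm_minus_commute[of g "u n"]
    by simp
  then have "(\<lambda>n. L2_norm (\<lambda>x. v x - u n x) - L2_norm (\<lambda>x. v x - g x)) \<longlonglongrightarrow> 0"
    by (rule tendsto_0_squeeze[OF lim])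
  then show ?thesis by (simp add: LIM_zero_iff)
qed

text \<open>Up to sqrt (2 pi) the transform is isometric, so the transforms of truncations form a
  Cauchy sequence. The limit g is described by its distance to the transform of every integrable h
  in L2: truncations as h yield the defining property of the transform, and h = f yields agreement
  with \<open>fourier_int\<close>.\<close>

lemma fourier_int_extension:
  assumes f: "f \<in> L2_space"
  shows "\<exists>g\<in>L2_space. \<forall>h\<in>L2_space. integrable lborel h \<longrightarrow>
    L2_norm (\<lambda>x. fourier_int h x - g x) = sqrt (2 * pi) * L2_norm (\<lambda>x. h x - f x)"
proof -
  have F2: "fourier_int h \<in> L2_space" if "h \<in> L2_space" "integrable lborel h" for h using fourier_int_plancherel that by blast
  have dist: "L2_norm (\<lambda>x. fourier_int h x - fourier_int k x) = sqrt (2 * pi) * L2_norm (\<lambda>x. h x - k x)"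
    if "h \<in> L2_space" "integrable lborel h" "k \<in> L2_space" "integrable lborel k" for h k
    using fourier_int_plancherel(2)[of "\<lambda>x. h x - k x"] that by (simp add: fourier_int_diff[symmetric] L2_diff)
  define u where "u n = trunc (real n) f" for n
  have u: "u n \<in> L2_space" "integrable lborel (u n)" for n
    unfolding u_def by (auto intro: trunc_L2 trunc_integrable f)
  have ulim: "(\<lambda>n. L2_norm (\<lambda>x. u n x - f x)) \<longlonglongrightarrow> 0"
    unfolding u_def by (rule filterlim_compose[OF trunc_tendsto[OF f] filterlim_real_sequentially])
  have "\<exists>g\<in>L2_space. (\<lambda>n. L2_norm (\<lambda>x. fourier_int (u n) x - g x)) \<longlonglongrightarrow> 0"
  proof (rule L2_complete)
    fix e :: real assume e: "e > 0"
    then have "e / (2 * sqrt (2 * pi)) > 0" by simp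
    then obtain N where N: "\<And>n. n \<ge> N \<Longrightarrow> L2_norm (\<lambda>x. u n x - f x) < e / (2 * sqrt (2 * pi))"
      using LIMSEQ_D[OF ulim] by fastforce
    have "L2_norm (\<lambda>x. fourier_int (u m) x - fourier_int (u n) x) < e" if "m \<ge> N" "n \<ge> N" for m n
    proof -
      have "L2_norm (\<lambda>x. u m x - u n x) \<le> L2_norm (\<lambda>x. u m x - f x) + L2_norm (\<lambda>x. u n x - f x)"
        using L2_triangle_diff[OF u(1) f u(1), of m n] L2_norm_minus_commute[of f "u n"] by simp
      also have "\<dots> < e / (2 * sqrt (2 * pi)) + e / (2 * sqrt (2 * pi))"
        using N that by (intro add_strict_mono) auto
      also have "\<dots> = e / sqrt (2 * pi)" by simp
      finally have "sqrt (2 * pi) * L2_norm (\<lambda>x. u m x - u n x) < e"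
        by (simp add: field_simps)
      then show ?thesis using dist u by simp
    qed
    then show "\<exists>N. \<forall>m\<ge>N. \<forall>n\<ge>N. L2_norm (\<lambda>x. fourier_int (u m) x - fourier_int (u n) x) < e" by blast
  qed (use u F2 in blast)
  then obtain g where g: "g \<in> L2_space" and glim: "(\<lambda>n. L2_norm (\<lambda>x. fourier_int (u n) x - g x)) \<longlonglongrightarrow> 0" by blast
  have "L2_norm (\<lambda>x. fourier_int h x - g x) = sqrt (2 * pi) * L2_norm (\<lambda>x. h x - f x)"
    if h: "h \<in> L2_space" "integrable lborel h" for h
  proof (rule LIMSEQ_unique)
    show "(\<lambda>n. L2_norm (\<lambda>x. fourier_int h x - fourier_int (u n) x)) \<longlonglongrightarrow> L2_norm (\<lambda>x. fourier_int h x - g x)"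
      by (rule L2_norm_diff_tendsto[OF _ g _ glim]) (use F2 u h in auto)
    show "(\<lambda>n. L2_norm (\<lambda>x. fourier_int h x - fourier_int (u n) x)) \<longlonglongrightarrow> sqrt (2 * pi) * L2_norm (\<lambda>x. h x - f x)"
      unfolding dist[OF h u] by (intro tendsto_intros L2_norm_diff_tendsto[OF u(1) f h(1) ulim])
  qed
  then show ?thesis using g by blast
qed

text \<open>Truncations are integrable, so their transforms lie in L2 by Plancherel and the
  \<open>ennreal\<close> integral in the definition is the square of a genuine norm.\<close>

lemma is_fourier_transform_iff:
  assumes f: "f \<in> L2_space"
  shows "is_fourier_transform f g \<longleftrightarrow> g \<in> L2_space \<and>
    ((\<lambda>R. L2_norm (\<lambda>x. fourier_int (trunc R f) x - g x)) \<longlongrightarrow> 0) at_top"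
proof (cases "g \<in> L2_space")
  case True
  have "(LINT x:{-R..R}|lborel. exp (- (\<i> * of_real x * of_real \<xi>)) * f x) = fourier_int (trunc R f) \<xi>" for R \<xi>
    unfolding fourier_int_def trunc_def set_lebesgue_integral_def by (simp add: mult_scaleR_right)
  then have "(\<integral>\<^sup>+ \<xi>. ennreal ((norm ((LINT x:{-R..R}|lborel.
              exp (- (\<i> * of_real x * of_real \<xi>)) * f x) - g \<xi>))\<^sup>2) \<partial>lborel)
     = ennreal ((L2_norm (\<lambda>x. fourier_int (trunc R f) x - g x))\<^sup>2)" for R
    by (simp add: L2_nn_integral L2_diff fourier_int_plancherel trunc_L2 trunc_integrable f True)
  moreover have "((\<lambda>R. ennreal ((L2_norm (\<lambda>x. fourier_int (trunc R f) x - g x))\<^sup>2)) \<longlongrightarrow> 0) at_top \<longleftrightarrow>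
     ((\<lambda>R. L2_norm (\<lambda>x. fourier_int (trunc R f) x - g x)) \<longlongrightarrow> 0) at_top" (is "?A \<longleftrightarrow> ?B")
  proof
    assume ?A
    then have "((\<lambda>R. (L2_norm (\<lambda>x. fourier_int (trunc R f) x - g x))\<^sup>2) \<longlongrightarrow> 0) at_top"
      by (subst (asm) tendsto_ennreal_iff[where x=0, simplified]) auto
    from tendsto_real_sqrt[OF this] show ?B by simp
  next
    assume ?B
    from tendsto_power[OF this, of 2] show ?A
      by (subst tendsto_ennreal_iff[where x=0, simplified]) auto
  qed
  ultimately show ?thesis using True by (simp add: is_fourier_transform_def)
qed (simp add: is_fourier_transform_def)

lemma is_fourier_transform_exists:
  assumes f: "f \<in> L2_space" shows "\<exists>g. is_fourier_transform f g"
proof -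
  obtain g where g: "g \<in> L2_space" and eq: "\<And>h. h \<in> L2_space \<Longrightarrow> integrable lborel h \<Longrightarrow>
    L2_norm (\<lambda>x. fourier_int h x - g x) = sqrt (2 * pi) * L2_norm (\<lambda>x. h x - f x)"
    using fourier_int_extension[OF f] by blast
  have "((\<lambda>R. L2_norm (\<lambda>x. fourier_int (trunc R f) x - g x)) \<longlongrightarrow> 0) at_top"
    unfolding eq[OF trunc_L2[OF f] trunc_integrable[OF f]]
    using tendsto_mult_right_zero[OF trunc_tendsto[OF f]] by blast
  then show ?thesis using g is_fourier_transform_iff[OF f] by blast
qed

lemma is_fourier_transform_fourier: "f \<in> L2_space \<Longrightarrow> is_fourier_transform f (fourier f)"
  unfolding fourier_def using is_fourier_transform_exists by (rule someI_ex)

lemma fourier_L2: "f \<in> L2_space \<Longrightarrow> fourier f \<in> L2_space"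
  using is_fourier_transform_fourier is_fourier_transform_def by blast

text \<open>\<open>fourier\<close> picks one representative. The rules for sums, multiples,
  conjugates and reflections are obtained by checking \<open>is_fourier_transform\<close> for a
  candidate and quoting this lemma, hence they hold almost everywhere.\<close>

lemma is_fourier_transform_unique:
  assumes f: "f \<in> L2_space" and g: "is_fourier_transform f g"
  shows "AE x in lborel. fourier f x = g x"
proof -
  note g' = g[unfolded is_fourier_transform_iff[OF f]]
  note h' = is_fourier_transform_fourier[OF f, unfolded is_fourier_transform_iff[OF f]]
  let ?T = "\<lambda>R. fourier_int (trunc R f)"
  have T: "?T R \<in> L2_space" for R using fourier_int_plancherel trunc_L2[OF f] trunc_integrable[OF f] by blast
  have "L2_norm (\<lambda>x. fourier f x - g x) \<le> L2_norm (\<lambda>x. ?T R x - fourier f x) + L2_norm (\<lambda>x. ?T R x - g x)" for R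
    using L2_triangle_diff[of "fourier f" "?T R" g] T h' g' L2_norm_minus_commute[of "fourier f" "?T R"] by simp
  moreover have "((\<lambda>R. L2_norm (\<lambda>x. ?T R x - fourier f x) + L2_norm (\<lambda>x. ?T R x - g x)) \<longlongrightarrow> 0 + 0) at_top"
    using g' h' by (intro tendsto_add) auto
  ultimately have "L2_norm (\<lambda>x. fourier f x - g x) \<le> 0 + 0"
    by (intro tendsto_lowerbound[OF _ always_eventually]) auto
  then have "L2_norm (\<lambda>x. fourier f x - g x) = 0" using L2_norm_nonneg by (metis add_0 order_antisym)
  then show ?thesis
    using L2_norm_eq_0[OF L2_diff] g' h' by fastforce
qed

lemma fourier_int_fourier_dist:
  assumes f: "f \<in> L2_space" and h: "h \<in> L2_space" "integrable lborel h"
  shows "L2_norm (\<lambda>x. fourier_int h x - fourier f x) = sqrt (2 * pi) * L2_norm (\<lambda>x. h x - f x)"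
proof -
  obtain g where g: "g \<in> L2_space" and eq: "\<And>h. h \<in> L2_space \<Longrightarrow> integrable lborel h \<Longrightarrow>
    L2_norm (\<lambda>x. fourier_int h x - g x) = sqrt (2 * pi) * L2_norm (\<lambda>x. h x - f x)"
    using fourier_int_extension[OF f] by blast
  have "((\<lambda>R. L2_norm (\<lambda>x. fourier_int (trunc R f) x - g x)) \<longlongrightarrow> 0) at_top"
    unfolding eq[OF trunc_L2[OF f] trunc_integrable[OF f]]
    using tendsto_mult_right_zero[OF trunc_tendsto[OF f]] by blast
  then have "is_fourier_transform f g" using g is_fourier_transform_iff[OF f] by blast
  from is_fourier_transform_unique[OF f this] have ae: "AE x in lborel. fourier f x = g x" .
  have "L2_norm (\<lambda>x. fourier_int h x - fourier f x) = L2_norm (\<lambda>x. fourier_int h x - g x)"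
    by (rule L2_norm_cong_AE)
       (use ae g L2_measurable[OF fourier_L2[OF f]] L2_measurable[OF h(1)] in \<open>auto elim: AE_mp\<close>)
  then show ?thesis using eq h by simp
qed

lemma fourier_eq_fourier_int:
  assumes "f \<in> L2_space" "integrable lborel f"
  shows "AE x in lborel. fourier f x = fourier_int f x"
proof -
  have "L2_norm (\<lambda>x. fourier_int f x - fourier f x) = 0" using fourier_int_fourier_dist[OF assms(1) assms] by simp
  then have "AE x in lborel. fourier_int f x - fourier f x = 0"
    using L2_norm_eq_0[OF L2_diff[OF fourier_int_plancherel(1)[OF assms(2,1)] fourier_L2[OF assms(1)]]] by blast
  then show ?thesis by eventually_elim simp
qed

section \<open>Plancherel, inversion and products\<close>

lemma fourier_measurable: "f \<in> L2_space \<Longrightarrow> fourier f \<in> borel_measurable borel"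
  by (rule L2_measurable[OF fourier_L2])

text \<open>Equality at every point: truncated integrals do not see null sets, so both functions
  have the same defining predicate and the choice operator returns the same representative.\<close>

lemma fourier_cong_AE:
  assumes "AE x in lborel. f x = g x"
    and "f \<in> borel_measurable borel" "g \<in> borel_measurable borel"
  shows "fourier f = fourier g"
proof -
  have "(LINT x:{-R..R}|lborel. exp (- (\<i> * of_real x * of_real \<xi>)) * f x)
    = (LINT x:{-R..R}|lborel. exp (- (\<i> * of_real x * of_real \<xi>)) * g x)" for R \<xi>
    unfolding set_lebesgue_integral_def
    by (rule integral_cong_AE) (use assms in \<open>auto elim: AE_mp\<close>)
  then show ?thesis by (simp add: fourier_def is_fourier_transform_def)
qed

lemma fourier_norm:
  assumes f: "f \<in> L2_space" shows "L2_norm (fourier f) = sqrt (2 * pi) * L2_norm f"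
proof -
  \<comment> \<open>The distance formula, applied to the zero function.\<close>
  have "L2_norm (\<lambda>x. fourier_int (\<lambda>x. 0) x - fourier f x) = sqrt (2 * pi) * L2_norm (\<lambda>x. 0 - f x)"
    by (rule fourier_int_fourier_dist[OF f]) auto
  then show ?thesis by (simp add: fourier_int_def L2_norm_uminus)
qed

lemma fourier_trunc_tendsto:
  assumes "f \<in> L2_space"
  shows "((\<lambda>R. L2_norm (\<lambda>x. fourier_int (trunc R f) x - fourier f x)) \<longlongrightarrow> 0) at_top"
  using is_fourier_transform_fourier[OF assms] is_fourier_transform_iff[OF assms] by blast

lemma fourier_int_trunc_L2: "f \<in> L2_space \<Longrightarrow> fourier_int (trunc R f) \<in> L2_space"
  by (intro fourier_int_plancherel trunc_L2 trunc_integrable)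

lemma tendsto_0_squeeze_filter:
  fixes f g :: "'a \<Rightarrow> real"
  assumes "(g \<longlongrightarrow> 0) F" and "\<And>n. 0 \<le> f n" "\<And>n. f n \<le> g n"
  shows "(f \<longlongrightarrow> 0) F"
  by (rule tendsto_sandwich[OF _ _ tendsto_const assms(1)]) (use assms in auto)

lemma fourier_add:
  assumes f: "f \<in> L2_space" and g: "g \<in> L2_space"
  shows "AE \<xi> in lborel. fourier (\<lambda>x. f x + g x) \<xi> = fourier f \<xi> + fourier g \<xi>"
proof (rule is_fourier_transform_unique[OF L2_add[OF f g]],
       unfold is_fourier_transform_iff[OF L2_add[OF f g]], intro conjI)
  show "(\<lambda>\<xi>. fourier f \<xi> + fourier g \<xi>) \<in> L2_space" by (intro L2_add fourier_L2 f g)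
  have fourier_int_add: "fourier_int (trunc R (\<lambda>x. f x + g x)) \<xi> = fourier_int (trunc R f) \<xi> + fourier_int (trunc R g) \<xi>" for R \<xi>
  proof -
    have "fourier_int (trunc R (\<lambda>x. f x + g x)) \<xi> = fourier_int (\<lambda>x. trunc R f x - (- trunc R g x)) \<xi>"
      by (simp add: trunc_def[abs_def] scaleR_add_right)
    also have "\<dots> = fourier_int (trunc R f) \<xi> - fourier_int (\<lambda>x. - trunc R g x) \<xi>"
      using trunc_integrable[OF f] trunc_integrable[OF g] by (intro fourier_int_diff) auto
    also have "fourier_int (\<lambda>x. - trunc R g x) \<xi> = - fourier_int (trunc R g) \<xi>" by (simp add: fourier_int_def)
    finally show ?thesis by simp
  qed
  show "((\<lambda>R. L2_norm (\<lambda>x. fourier_int (trunc R (\<lambda>x. f x + g x)) x - (fourier f x + fourier g x))) \<longlongrightarrow> 0) at_top"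
  proof (rule tendsto_0_squeeze_filter)
    show "((\<lambda>R. L2_norm (\<lambda>x. fourier_int (trunc R f) x - fourier f x) + L2_norm (\<lambda>x. fourier_int (trunc R g) x - fourier g x)) \<longlongrightarrow> 0) at_top"
      using tendsto_add[OF fourier_trunc_tendsto[OF f] fourier_trunc_tendsto[OF g]] by simp
    show "L2_norm (\<lambda>x. fourier_int (trunc R (\<lambda>x. f x + g x)) x - (fourier f x + fourier g x))
      \<le> L2_norm (\<lambda>x. fourier_int (trunc R f) x - fourier f x) + L2_norm (\<lambda>x. fourier_int (trunc R g) x - fourier g x)" for R
      using L2_triangle[OF L2_diff[OF fourier_int_trunc_L2[OF f, of R] fourier_L2[OF f]] L2_diff[OF fourier_int_trunc_L2[OF g, of R] fourier_L2[OF g]]]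
      by (simp add: fourier_int_add algebra_simps)
  qed simp
qed

lemma fourier_scale:
  assumes f: "f \<in> L2_space"
  shows "AE \<xi> in lborel. fourier (\<lambda>x. c * f x) \<xi> = c * fourier f \<xi>"
proof (rule is_fourier_transform_unique[OF L2_scale[OF f]],
       unfold is_fourier_transform_iff[OF L2_scale[OF f]], intro conjI)
  show "(\<lambda>\<xi>. c * fourier f \<xi>) \<in> L2_space" by (intro L2_scale fourier_L2 f)
  have "fourier_int (trunc R (\<lambda>x. c * f x)) \<xi> = c * fourier_int (trunc R f) \<xi>" for R \<xi>
    by (simp add: fourier_int_def trunc_def[abs_def] mult.left_commute flip: integral_mult_right_zero)
  then have "L2_norm (\<lambda>x. fourier_int (trunc R (\<lambda>x. c * f x)) x - c * fourier f x)
     = norm c * L2_norm (\<lambda>x. fourier_int (trunc R f) x - fourier f x)" for R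
    by (simp flip: L2_norm_scale right_diff_distrib)
  then show "((\<lambda>R. L2_norm (\<lambda>x. fourier_int (trunc R (\<lambda>x. c * f x)) x - c * fourier f x)) \<longlongrightarrow> 0) at_top"
    using tendsto_mult_right_zero[OF fourier_trunc_tendsto[OF f]] by simp
qed

lemma fourier_lin:
  assumes f: "f \<in> L2_space" and g: "g \<in> L2_space"
  shows "AE \<xi> in lborel. fourier (\<lambda>x. f x + c * g x) \<xi> = fourier f \<xi> + c * fourier g \<xi>"
  using fourier_add[OF f L2_scale[OF g, of c]] fourier_scale[OF g, of c] by eventually_elim simp

lemma fourier_diff:
  assumes f: "f \<in> L2_space" and g: "g \<in> L2_space"
  shows "AE \<xi> in lborel. fourier (\<lambda>x. f x - g x) \<xi> = fourier f \<xi> - fourier g \<xi>"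
  using fourier_lin[OF f g, of "-1"] by simp

lemma fourier_sum:
  assumes "finite A" and f: "\<And>i. i \<in> A \<Longrightarrow> f i \<in> L2_space"
  shows "AE \<xi> in lborel. fourier (\<lambda>x. \<Sum>i\<in>A. c i * f i x) \<xi> = (\<Sum>i\<in>A. c i * fourier (f i) \<xi>)"
  using assms
proof (induction A rule: finite_induct)
  case empty
  have "AE \<xi> in lborel. fourier (\<lambda>x. 0 * (0::complex)) \<xi> = 0 * fourier (\<lambda>x. 0) \<xi>"
    by (rule fourier_scale) simp
  then show ?case by simp
next
  case (insert a A)
  have s: "(\<lambda>x. \<Sum>i\<in>A. c i * f i x) \<in> L2_space" using insert.prems by (auto intro!: L2_sum L2_scale)
  have "f a \<in> L2_space" using insert.prems by simp
  from fourier_lin[OF s this, of "c a"] insert.IH insert.prems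
  have "AE \<xi> in lborel. fourier (\<lambda>x. (\<Sum>i\<in>A. c i * f i x) + c a * f a x) \<xi> = (\<Sum>i\<in>A. c i * fourier (f i) \<xi>) + c a * fourier (f a) \<xi>"
    by (auto elim!: eventually_elim2)
  then show ?case using insert.hyps by (simp add: add.commute)
qed

text \<open>The source of the symmetry a(-\<xi>) = cnj (a \<xi>) of real solutions.\<close>

lemma fourier_cnj:
  assumes f: "f \<in> L2_space"
  shows "AE \<xi> in lborel. fourier (\<lambda>x. cnj (f x)) \<xi> = cnj (fourier f (- \<xi>))"
proof (rule is_fourier_transform_unique[OF L2_cnj[OF f]],
       unfold is_fourier_transform_iff[OF L2_cnj[OF f]], intro conjI)
  show "(\<lambda>\<xi>. cnj (fourier f (- \<xi>))) \<in> L2_space" by (intro L2_cnj L2_reflect fourier_L2 f)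
  have "fourier_int (trunc R (\<lambda>x. cnj (f x))) \<xi> = cnj (fourier_int (trunc R f) (- \<xi>))" for R \<xi>
    by (simp add: fourier_int_def trunc_def[abs_def] exp_cnj flip: Bochner_Integration.integral_cnj)
  then have "L2_norm (\<lambda>x. fourier_int (trunc R (\<lambda>x. cnj (f x))) x - cnj (fourier f (- x)))
     = L2_norm (\<lambda>x. fourier_int (trunc R f) x - fourier f x)" for R
    using L2_norm_reflect[of "\<lambda>x. fourier_int (trunc R f) x - fourier f x"]
    by (simp flip: complex_cnj_diff)
  then show "((\<lambda>R. L2_norm (\<lambda>x. fourier_int (trunc R (\<lambda>x. cnj (f x))) x - cnj (fourier f (- x)))) \<longlongrightarrow> 0) at_top"
    using fourier_trunc_tendsto[OF f] by simp
qed

lemma fourier_reflect: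
  assumes f: "f \<in> L2_space"
  shows "AE \<xi> in lborel. fourier (\<lambda>x. f (- x)) \<xi> = fourier f (- \<xi>)"
proof (rule is_fourier_transform_unique[OF L2_reflect[OF f]],
       unfold is_fourier_transform_iff[OF L2_reflect[OF f]], intro conjI)
  show "(\<lambda>\<xi>. fourier f (- \<xi>)) \<in> L2_space" by (intro L2_reflect fourier_L2 f)
  have "fourier_int (trunc R (\<lambda>x. f (- x))) \<xi> = fourier_int (trunc R f) (- \<xi>)" for R \<xi>
  proof -
    have "indicator {-R..R} (- x) = (indicator {-R..R} x :: real)" for x :: real
      by (auto simp: indicator_def)
    then show ?thesis
      unfolding fourier_int_def trunc_def[abs_def]
      by (subst lborel_integral_reflect[symmetric]) simp
  qed
  then have "L2_norm (\<lambda>x. fourier_int (trunc R (\<lambda>x. f (- x))) x - fourier f (- x))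
     = L2_norm (\<lambda>x. fourier_int (trunc R f) x - fourier f x)" for R
    using L2_norm_reflect[of "\<lambda>x. fourier_int (trunc R f) x - fourier f x"] by simp
  then show "((\<lambda>R. L2_norm (\<lambda>x. fourier_int (trunc R (\<lambda>x. f (- x))) x - fourier f (- x))) \<longlongrightarrow> 0) at_top"
    using fourier_trunc_tendsto[OF f] by simp
qed

lemma AE_shift_reflect:
  assumes "AE x in lborel. P x"
  shows "AE x in lborel. P (t - x :: real)"
proof -
  obtain N where N: "{x. \<not> P x} \<subseteq> N" "N \<in> null_sets lborel"
    using assms unfolding eventually_ae_filter by auto
  then have [measurable]: "N \<in> sets borel" by auto
  have "AE x in lborel. x \<notin> N" using N(2) by (rule AE_not_in)
  from AE_borel_affine[of "-1" "\<lambda>x. x \<notin> N" t, OF _ _ this]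
  have "AE x in lborel. t - x \<notin> N" by simp
  then show ?thesis by eventually_elim (use N in auto)
qed

lemma AE_reflect: "AE x in lborel. P x \<Longrightarrow> AE x in lborel. P (- x :: real)"
  using AE_shift_reflect[of P 0] by simp

section \<open>Parseval's identity and Fourier inversion\<close>

lemma L2_polarization:
  assumes f: "f \<in> L2_space" and g: "g \<in> L2_space"
  shows "4 * (LINT x|lborel. f x * cnj (g x)) = (\<Sum>c\<in>{1, -1, \<i>, -\<i>}. c * of_real ((L2_norm (\<lambda>x. f x + c * g x))\<^sup>2))"
proof -
  have sq: "of_real ((L2_norm h)\<^sup>2) = (LINT x|lborel. h x * cnj (h x))" for h
    unfolding L2_norm_sq integral_complex_of_real[symmetric]
    by (simp add: complex_norm_square del: of_real_power flip: of_real_power)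
  have h: "(\<lambda>x. f x + c * g x) \<in> L2_space" for c by (intro L2_add L2_scale f g)
  have i: "integrable lborel (\<lambda>x. c * ((f x + c * g x) * cnj (f x + c * g x)))" for c
    by (intro integrable_mult_right L2_mult_integrable h L2_cnj)
  \<comment> \<open>The polarization sum runs over a set, so the four units must be known to be
    distinct before it can be expanded.\<close>
  have dist: "1 \<noteq> (-1::complex)" "1 \<noteq> \<i>" "1 \<noteq> -\<i>" "-1 \<noteq> \<i>" "-1 \<noteq> -\<i>" "\<i> \<noteq> -\<i>"
    by (auto simp: complex_eq_iff)
  have "(\<Sum>c\<in>{1, -1, \<i>, -\<i>}. c * of_real ((L2_norm (\<lambda>x. f x + c * g x))\<^sup>2))
     = (\<Sum>c\<in>{1, -1, \<i>, -\<i>}. LINT x|lborel. c * ((f x + c * g x) * cnj (f x + c * g x)))"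
    unfolding sq by simp
  also have "\<dots> = (LINT x|lborel. (\<Sum>c\<in>{1, -1, \<i>, -\<i>}. c * ((f x + c * g x) * cnj (f x + c * g x))))"
    by (rule Bochner_Integration.integral_sum[symmetric]) (rule i)
  also have "\<dots> = (LINT x|lborel. 4 * (f x * cnj (g x)))"
  proof (rule Bochner_Integration.integral_cong[OF refl])
    fix x
    show "(\<Sum>c\<in>{1, -1, \<i>, -\<i>}. c * ((f x + c * g x) * cnj (f x + c * g x))) = 4 * (f x * cnj (g x))"
      using dist by (simp add: complex_eq_iff) (simp add: algebra_simps)
  qed
  finally show ?thesis by simp
qed

lemma fourier_inner:
  assumes f: "f \<in> L2_space" and g: "g \<in> L2_space"
  shows "(LINT x|lborel. fourier f x * cnj (fourier g x)) = complex_of_real (2 * pi) * (LINT x|lborel. f x * cnj (g x))"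
proof -
  have "L2_norm (\<lambda>x. fourier f x + c * fourier g x) = sqrt (2 * pi) * L2_norm (\<lambda>x. f x + c * g x)" for c
  proof -
    have h: "(\<lambda>x. f x + c * g x) \<in> L2_space" by (intro L2_add L2_scale f g)
    have "L2_norm (\<lambda>x. fourier f x + c * fourier g x) = L2_norm (fourier (\<lambda>x. f x + c * g x))"
      using fourier_lin[OF f g, of c]
      by (intro L2_norm_cong_AE L2_measurable L2_add L2_scale fourier_L2 f g h) (auto elim: AE_mp)
    then show ?thesis using fourier_norm[OF h] by simp
  qed
  then have "4 * (LINT x|lborel. fourier f x * cnj (fourier g x)) = complex_of_real (2 * pi) * (4 * (LINT x|lborel. f x * cnj (g x)))"
    unfolding L2_polarization[OF f g] L2_polarization[OF fourier_L2[OF f] fourier_L2[OF g]]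
    by (simp add: power_mult_distrib sum_distrib_left mult_ac)
  then show ?thesis by simp
qed

lemma L2_product_tendsto:
  assumes u: "\<And>n. u n \<in> L2_space" "u' \<in> L2_space" and v: "\<And>n. v n \<in> L2_space" "v' \<in> L2_space"
    and ul: "(\<lambda>n. L2_norm (\<lambda>x. u n x - u' x)) \<longlonglongrightarrow> 0"
    and vl: "(\<lambda>n. L2_norm (\<lambda>x. v n x - v' x)) \<longlonglongrightarrow> 0"
  shows "(\<lambda>n. LINT x|lborel. u n x * v n x) \<longlonglongrightarrow> (LINT x|lborel. u' x * v' x)"
proof -
  have le: "norm ((LINT x|lborel. u n x * v n x) - (LINT x|lborel. u' x * v' x))
     \<le> L2_norm (\<lambda>x. u n x - u' x) * (L2_norm (\<lambda>x. v n x - v' x) + L2_norm v') + L2_norm u' * L2_norm (\<lambda>x. v n x - v' x)" for n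
  proof -
    have "(LINT x|lborel. u n x * v n x) - (LINT x|lborel. u' x * v' x)
       = (LINT x|lborel. u n x * v n x - u' x * v' x)"
      using L2_mult_integrable[OF u(1) v(1)] L2_mult_integrable[OF u(2) v(2)] by simp
    also have "\<dots> = (LINT x|lborel. (u n x - u' x) * v n x + u' x * (v n x - v' x))"
      by (simp add: algebra_simps)
    also have "\<dots> = (LINT x|lborel. (u n x - u' x) * v n x) + (LINT x|lborel. u' x * (v n x - v' x))"
      by (intro Bochner_Integration.integral_add L2_mult_integrable L2_diff u v)
    also have "norm \<dots> \<le> L2_norm (\<lambda>x. u n x - u' x) * L2_norm (v n) + L2_norm u' * L2_norm (\<lambda>x. v n x - v' x)"
      using L2_CS[OF L2_diff[OF u(1) u(2)] v(1)] L2_CS[OF u(2) L2_diff[OF v(1) v(2)]]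
      by (intro norm_triangle_mono) auto
    also have "L2_norm (\<lambda>x. u n x - u' x) * L2_norm (v n) \<le>
        L2_norm (\<lambda>x. u n x - u' x) * (L2_norm (\<lambda>x. v n x - v' x) + L2_norm v')"
      using L2_triangle[OF L2_diff[OF v(1) v(2)] v(2), of n] by (intro mult_left_mono) auto
    finally show ?thesis by simp
  qed
  have lim: "(\<lambda>n. L2_norm (\<lambda>x. u n x - u' x) * (L2_norm (\<lambda>x. v n x - v' x) + L2_norm v') + L2_norm u' * L2_norm (\<lambda>x. v n x - v' x))
     \<longlonglongrightarrow> 0 * (0 + L2_norm v') + L2_norm u' * 0"
    by (intro tendsto_intros ul vl)
  have "(\<lambda>n. (LINT x|lborel. u n x * v n x) - (LINT x|lborel. u' x * v' x)) \<longlonglongrightarrow> 0"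
    by (rule tendsto_0_squeeze[OF lim[unfolded mult_zero_left mult_zero_right add_0] le])
  then show ?thesis by (simp add: LIM_zero_iff)
qed

text \<open>For truncations this is Fubini's theorem; both sides are continuous in the pair (f, g)
  with respect to the L2 norm.\<close>

lemma fourier_multiplication:
  assumes f: "f \<in> L2_space" and g: "g \<in> L2_space"
  shows "(LINT x|lborel. fourier f x * g x) = (LINT x|lborel. f x * fourier g x)"
proof (rule LIMSEQ_unique)
  have tr: "(\<lambda>n. L2_norm (\<lambda>x. trunc (real n) h x - h x)) \<longlonglongrightarrow> 0" if "h \<in> L2_space" for h
    by (rule filterlim_compose[OF trunc_tendsto[OF that] filterlim_real_sequentially])
  have Ftr: "(\<lambda>n. L2_norm (\<lambda>x. fourier_int (trunc (real n) h) x - fourier h x)) \<longlonglongrightarrow> 0" if "h \<in> L2_space" for h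
    by (rule filterlim_compose[OF fourier_trunc_tendsto[OF that] filterlim_real_sequentially])
  show "(\<lambda>n. LINT x|lborel. fourier_int (trunc (real n) f) x * trunc (real n) g x) \<longlonglongrightarrow> (LINT x|lborel. fourier f x * g x)"
    by (intro L2_product_tendsto fourier_int_trunc_L2 trunc_L2 fourier_L2 f g tr Ftr)
  show "(\<lambda>n. LINT x|lborel. fourier_int (trunc (real n) f) x * trunc (real n) g x) \<longlonglongrightarrow> (LINT x|lborel. f x * fourier g x)"
    unfolding fourier_int_multiplication[OF trunc_integrable[OF f] trunc_integrable[OF g]]
    by (intro L2_product_tendsto fourier_int_trunc_L2 trunc_L2 fourier_L2 f g tr Ftr)
qed

text \<open>Inversion by duality. Testing against g, the multiplication formula moves one transform
  onto g, and the transform of g is the conjugate of that of k(x) = cnj (g (-x)); Parseval's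
  identity then evaluates the pairing. The difference d of both sides annihilates every g in L2, in
  particular its own conjugate.\<close>

lemma fourier_fourier:
  assumes f: "f \<in> L2_space"
  shows "AE x in lborel. fourier (fourier f) x = complex_of_real (2 * pi) * f (- x)"
proof -
  define d where "d x = fourier (fourier f) x - complex_of_real (2 * pi) * f (- x)" for x
  have d: "d \<in> L2_space"
    unfolding d_def[abs_def] by (intro L2_diff fourier_L2 L2_scale L2_reflect f)
  have orth: "(LINT x|lborel. d x * g x) = 0" if g: "g \<in> L2_space" for g
  proof -
    define k where "k x = cnj (g (- x))" for x
    have k: "k \<in> L2_space" unfolding k_def[abs_def] by (intro L2_cnj L2_reflect g)
    have "AE \<xi> in lborel. fourier k \<xi> = cnj (fourier g \<xi>)"
      using fourier_cnj[OF L2_reflect[OF g]] AE_reflect[OF fourier_reflect[OF g]]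
      unfolding k_def[abs_def] by eventually_elim simp
    then have Fk: "AE \<xi> in lborel. fourier f \<xi> * fourier g \<xi> = fourier f \<xi> * cnj (fourier k \<xi>)"
      by eventually_elim simp
    have "(LINT x|lborel. fourier (fourier f) x * g x) = (LINT x|lborel. fourier f x * fourier g x)"
      by (rule fourier_multiplication[OF fourier_L2[OF f] g])
    also have "\<dots> = (LINT x|lborel. fourier f x * cnj (fourier k x))"
      by (rule integral_cong_AE)
         (use Fk fourier_measurable[OF f] fourier_measurable[OF g] fourier_measurable[OF k] in auto)
    also have "\<dots> = complex_of_real (2 * pi) * (LINT x|lborel. f x * cnj (k x))" by (rule fourier_inner[OF f k])
    also have "(LINT x|lborel. f x * cnj (k x)) = (LINT x|lborel. f (- x) * g x)"
      using lborel_integral_reflect[of "\<lambda>x. f (- x) * g x"] by (simp add: k_def)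
    finally have "(LINT x|lborel. fourier (fourier f) x * g x) - (LINT x|lborel. complex_of_real (2 * pi) * f (- x) * g x) = 0"
      by (simp add: mult.assoc)
    then show ?thesis
      unfolding d_def left_diff_distrib
      using L2_mult_integrable[OF fourier_L2[OF fourier_L2[OF f]] g] L2_mult_integrable[OF L2_scale[OF L2_reflect[OF f], of "complex_of_real (2 * pi)"] g]
      by (subst Bochner_Integration.integral_diff) auto
  qed
  have "of_real ((L2_norm d)\<^sup>2) = (LINT x|lborel. d x * cnj (d x))"
    unfolding L2_norm_sq integral_complex_of_real[symmetric]
    by (simp add: complex_norm_square del: of_real_power flip: of_real_power)
  then have "L2_norm d = 0" using orth[OF L2_cnj[OF d]] by simp
  then have "AE x in lborel. d x = 0" using L2_norm_eq_0[OF d] by simp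
  then show ?thesis unfolding d_def by eventually_elim simp
qed

text \<open>Shows that the choice in \<open>fourier_multiplier\<close> is made from a nonempty set.
  The preimage is given by the inversion formula.\<close>

lemma fourier_surj:
  assumes g: "g \<in> L2_space"
  shows "\<exists>u. u \<in> L2_space \<and> (AE \<xi> in lborel. fourier u \<xi> = g \<xi>)"
proof (intro exI conjI)
  let ?h = "\<lambda>x. fourier g (- x)"
  have h: "?h \<in> L2_space" by (intro L2_reflect fourier_L2 g)
  show "(\<lambda>x. of_real (1 / (2 * pi)) * ?h x) \<in> L2_space" by (intro L2_scale h)
  show "AE \<xi> in lborel. fourier (\<lambda>x. of_real (1 / (2 * pi)) * ?h x) \<xi> = g \<xi>"
    using fourier_scale[OF h, of "of_real (1 / (2 * pi))"] fourier_reflect[OF fourier_L2[OF g]] AE_reflect[OF fourier_fourier[OF g]]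
    by eventually_elim simp
qed

lemma fourier_multiplier:
  assumes "(\<lambda>\<xi>. m \<xi> * fourier f \<xi>) \<in> L2_space"
  shows "fourier_multiplier m f \<in> L2_space"
    and "AE \<xi> in lborel. fourier (fourier_multiplier m f) \<xi> = m \<xi> * fourier f \<xi>"
  using someI_ex[OF fourier_surj[OF assms]] unfolding fourier_multiplier_def[symmetric] by auto

section \<open>Convolution and the transform of a product\<close>

definition conv :: "(real \<Rightarrow> complex) \<Rightarrow> (real \<Rightarrow> complex) \<Rightarrow> real \<Rightarrow> complex" where
  "conv p q \<xi> = (LINT \<eta>|lborel. p \<eta> * q (\<xi> - \<eta>))"

lemma conv_measurable [measurable]:
  assumes [measurable]: "p \<in> borel_measurable borel" "q \<in> borel_measurable borel"
  shows "conv p q \<in> borel_measurable borel"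
  unfolding conv_def[abs_def] by measurable

lemma conv_reflect: "conv p q \<xi> = (LINT \<eta>|lborel. p (- \<eta>) * q (\<xi> + \<eta>))"
  unfolding conv_def using lborel_integral_reflect[of "\<lambda>\<eta>. p \<eta> * q (\<xi> - \<eta>)"] by simp

text \<open>Changes on null sets leave every value of a convolution intact, since each value is an
  integral. Transforms known almost everywhere can therefore be substituted inside
  \<open>conv\<close>.\<close>

lemma conv_cong_AE:
  assumes [measurable]: "p \<in> borel_measurable borel" "q \<in> borel_measurable borel"
     "p' \<in> borel_measurable borel" "q' \<in> borel_measurable borel"
    and p: "AE x in lborel. p x = p' x" and q: "AE x in lborel. q x = q' x"
  shows "conv p q \<xi> = conv p' q' \<xi>"
  unfolding conv_def
  by (rule integral_cong_AE) (use p AE_shift_reflect[OF q, of \<xi>] in \<open>auto elim: eventually_elim2\<close>)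

lemma conv_integrable_pair:
  fixes p q :: "real \<Rightarrow> complex"
  assumes p: "integrable lborel p" and q: "integrable lborel q"
  shows "integrable (lborel \<Otimes>\<^sub>M lborel) (\<lambda>(x, y). p (- x) * q (y + x))"
  using lborel_integrable_real_affine[OF p, of "-1" 0] by (intro integrable_pair_shift q) auto

lemma conv_integrable:
  assumes p: "integrable lborel p" and q: "integrable lborel q"
  shows "integrable lborel (conv p q)"
  using lborel_pair.integrable_snd[OF conv_integrable_pair[OF p q]]
  unfolding conv_reflect[abs_def] by simp

lemma fourier_int_conv:
  assumes p: "integrable lborel p" and q: "integrable lborel q"
  shows "fourier_int (conv p q) x = fourier_int p x * fourier_int q x"
proof -
  note [measurable] = borel_measurable_integrable[OF p] borel_measurable_integrable[OF q]
  let ?e = "\<lambda>\<xi>. exp (- (\<i> * of_real \<xi> * of_real x))"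
  have "integrable (lborel \<Otimes>\<^sub>M lborel) (\<lambda>(\<eta>, \<xi>). ?e \<xi> * (p (- \<eta>) * q (\<xi> + \<eta>)))"
    by (rule Bochner_Integration.integrable_bound[OF conv_integrable_pair[OF p q]])
       (auto simp: norm_mult)
  from lborel_pair.Fubini_integral[OF this]
  have "(LINT \<xi>|lborel. LINT \<eta>|lborel. ?e \<xi> * (p (- \<eta>) * q (\<xi> + \<eta>)))
     = (LINT \<eta>|lborel. LINT \<xi>|lborel. ?e \<xi> * (p (- \<eta>) * q (\<xi> + \<eta>)))" .
  moreover have "(LINT \<eta>|lborel. ?e \<xi> * (p (- \<eta>) * q (\<xi> + \<eta>))) = ?e \<xi> * conv p q \<xi>" for \<xi>
    unfolding conv_reflect by simp
  moreover have "(LINT \<xi>|lborel. ?e \<xi> * (p (- \<eta>) * q (\<xi> + \<eta>))) = ?e (- \<eta>) * p (- \<eta>) * fourier_int q x" for \<eta>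
  proof -
    have "?e \<xi> = ?e (- \<eta>) * ?e (\<eta> + \<xi>)" for \<xi>
      unfolding exp_add[symmetric] by (simp add: algebra_simps)
    then have "(LINT \<xi>|lborel. ?e \<xi> * (p (- \<eta>) * q (\<xi> + \<eta>)))
       = (LINT \<xi>|lborel. ?e (- \<eta>) * p (- \<eta>) * (?e (\<eta> + \<xi>) * q (\<eta> + \<xi>)))"
      by (intro Bochner_Integration.integral_cong) (auto simp: add.commute)
    also have "\<dots> = ?e (- \<eta>) * p (- \<eta>) * (LINT \<xi>|lborel. ?e (\<eta> + \<xi>) * q (\<eta> + \<xi>))"
      by (rule integral_mult_right_zero)
    also have "(LINT \<xi>|lborel. ?e (\<eta> + \<xi>) * q (\<eta> + \<xi>)) = fourier_int q x"
      unfolding fourier_int_def by (rule lborel_integral_shift[of "\<lambda>\<xi>. ?e \<xi> * q \<xi>"])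
    finally show ?thesis .
  qed
  ultimately have "fourier_int (conv p q) x = (LINT \<eta>|lborel. ?e (- \<eta>) * p (- \<eta>) * fourier_int q x)"
    unfolding fourier_int_def[of "conv p q"] by (simp only:)
  also have "\<dots> = fourier_int p x * fourier_int q x"
    unfolding fourier_int_def[of p] using lborel_integral_reflect[of "\<lambda>\<eta>. ?e \<eta> * p \<eta> * fourier_int q x"] by simp
  finally show ?thesis .
qed

lemma nn_integral_reflect_shift:
  fixes f :: "real \<Rightarrow> ennreal"
  assumes [measurable]: "f \<in> borel_measurable borel"
  shows "(\<integral>\<^sup>+\<eta>. f (\<xi> - \<eta>) \<partial>lborel) = (\<integral>\<^sup>+\<eta>. f \<eta> \<partial>lborel)"
  using nn_integral_real_affine[of f "-1" \<xi>] by simp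

lemma nn_integral_shift:
  fixes f :: "real \<Rightarrow> ennreal"
  assumes [measurable]: "f \<in> borel_measurable borel"
  shows "(\<integral>\<^sup>+\<eta>. f (t + \<eta>) \<partial>lborel) = (\<integral>\<^sup>+\<eta>. f \<eta> \<partial>lborel)"
  using nn_integral_real_affine[of f 1 t] by simp

text \<open>For a function that is not integrable the Bochner integral is 0 by default and the
  inequality persists. Estimates of \<open>conv\<close> can thus precede any proof that its integral
  converges.\<close>

lemma norm_integral_le_nn_integral:
  fixes f :: "'a \<Rightarrow> 'b::{banach, second_countable_topology}"
  shows "ennreal (norm (LINT x|M. f x)) \<le> (\<integral>\<^sup>+x. ennreal (norm (f x)) \<partial>M)"
proof (cases "integrable M f")
  case True then show ?thesis by (rule integral_norm_bound_ennreal)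
qed (simp add: not_integrable_integral_eq)

text \<open>Young's inequality for L1 and L2: split |p q| as sqrt |p| times sqrt |p| |q|, apply
  Cauchy-Schwarz, and integrate in \<xi> first. The modulus stays inside the integral so that
  weights can be distributed over the factors in \<open>conv_weight\<close>.\<close>

lemma young_nn:
  assumes p: "integrable lborel p" and q: "q \<in> L2_space"
  shows "(\<integral>\<^sup>+\<xi>. (\<integral>\<^sup>+\<eta>. ennreal (norm (p \<eta> * q (\<xi> - \<eta>))) \<partial>lborel)\<^sup>2 \<partial>lborel)
     \<le> ennreal (((LINT x|lborel. norm (p x)) * L2_norm q)\<^sup>2)"
proof -
  note [measurable] = borel_measurable_integrable[OF p] L2_measurable[OF q]
  let ?P = "LINT x|lborel. norm (p x)"
  have P: "(\<integral>\<^sup>+x. ennreal (norm (p x)) \<partial>lborel) = ennreal ?P"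
    using p by (intro nn_integral_eq_integral) auto
  have sq: "(ennreal (sqrt a))\<^sup>2 = ennreal a" if "a \<ge> 0" for a using that by (simp add: ennreal_power)
  have "(\<integral>\<^sup>+\<eta>. ennreal (norm (p \<eta> * q (\<xi> - \<eta>))) \<partial>lborel)\<^sup>2
     \<le> ennreal ?P * (\<integral>\<^sup>+\<eta>. ennreal (norm (p \<eta>)) * ennreal ((norm (q (\<xi> - \<eta>)))\<^sup>2) \<partial>lborel)" for \<xi>
  proof -
    have split: "ennreal (norm (p \<eta> * q (\<xi> - \<eta>)))
       = ennreal (sqrt (norm (p \<eta>))) * ennreal (sqrt (norm (p \<eta>)) * norm (q (\<xi> - \<eta>)))" for \<eta>
      by (simp add: norm_mult flip: ennreal_mult mult.assoc)
    have "(\<integral>\<^sup>+\<eta>. ennreal (norm (p \<eta> * q (\<xi> - \<eta>))) \<partial>lborel)\<^sup>2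
      \<le> (\<integral>\<^sup>+\<eta>. (ennreal (sqrt (norm (p \<eta>))))\<^sup>2 \<partial>lborel) * (\<integral>\<^sup>+\<eta>. (ennreal (sqrt (norm (p \<eta>)) * norm (q (\<xi> - \<eta>))))\<^sup>2 \<partial>lborel)"
      unfolding split by (rule Cauchy_Schwarz_nn_integral) auto
    also have "\<dots> = ennreal ?P * (\<integral>\<^sup>+\<eta>. ennreal (norm (p \<eta>)) * ennreal ((norm (q (\<xi> - \<eta>)))\<^sup>2) \<partial>lborel)"
      by (simp add: P[symmetric] ennreal_power power_mult_distrib ennreal_mult)
    finally show ?thesis .
  qed
  then have "(\<integral>\<^sup>+\<xi>. (\<integral>\<^sup>+\<eta>. ennreal (norm (p \<eta> * q (\<xi> - \<eta>))) \<partial>lborel)\<^sup>2 \<partial>lborel)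
     \<le> (\<integral>\<^sup>+\<xi>. ennreal ?P * (\<integral>\<^sup>+\<eta>. ennreal (norm (p \<eta>)) * ennreal ((norm (q (\<xi> - \<eta>)))\<^sup>2) \<partial>lborel) \<partial>lborel)"
    by (rule nn_integral_mono)
  also have "\<dots> = ennreal ?P * (\<integral>\<^sup>+\<xi>. \<integral>\<^sup>+\<eta>. ennreal (norm (p \<eta>)) * ennreal ((norm (q (\<xi> - \<eta>)))\<^sup>2) \<partial>lborel \<partial>lborel)"
    by (rule nn_integral_cmult) measurable
  also have "(\<integral>\<^sup>+\<xi>. \<integral>\<^sup>+\<eta>. ennreal (norm (p \<eta>)) * ennreal ((norm (q (\<xi> - \<eta>)))\<^sup>2) \<partial>lborel \<partial>lborel)
     = (\<integral>\<^sup>+\<eta>. \<integral>\<^sup>+\<xi>. ennreal (norm (p \<eta>)) * ennreal ((norm (q (\<xi> - \<eta>)))\<^sup>2) \<partial>lborel \<partial>lborel)"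
    by (rule lborel_pair.Fubini') measurable
  also have "\<dots> = (\<integral>\<^sup>+\<eta>. ennreal (norm (p \<eta>)) * ennreal ((L2_norm q)\<^sup>2) \<partial>lborel)"
  proof (rule nn_integral_cong)
    fix \<eta>
    have "(\<integral>\<^sup>+\<xi>. ennreal ((norm (q (\<xi> - \<eta>)))\<^sup>2) \<partial>lborel) = ennreal ((L2_norm q)\<^sup>2)"
      using nn_integral_shift[of "\<lambda>\<xi>. ennreal ((norm (q \<xi>))\<^sup>2)" "- \<eta>"] L2_nn_integral[OF q] by simp
    then show "(\<integral>\<^sup>+\<xi>. ennreal (norm (p \<eta>)) * ennreal ((norm (q (\<xi> - \<eta>)))\<^sup>2) \<partial>lborel) = ennreal (norm (p \<eta>)) * ennreal ((L2_norm q)\<^sup>2)"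
      by (subst nn_integral_cmult) auto
  qed
  also have "\<dots> = ennreal ?P * ennreal ((L2_norm q)\<^sup>2)"
    by (subst nn_integral_multc) (auto simp: P)
  also have "ennreal ?P * \<dots> = ennreal ((?P * L2_norm q)\<^sup>2)"
    by (simp add: power_mult_distrib power2_eq_square mult_ac flip: ennreal_mult)
  finally show ?thesis .
qed

lemma young:
  assumes p: "integrable lborel p" and q: "q \<in> L2_space"
  shows "conv p q \<in> L2_space" and "L2_norm (conv p q) \<le> (LINT x|lborel. norm (p x)) * L2_norm q"
proof -
  note [measurable] = borel_measurable_integrable[OF p] L2_measurable[OF q]
  have "(\<integral>\<^sup>+\<xi>. ennreal ((norm (conv p q \<xi>))\<^sup>2) \<partial>lborel)
     \<le> (\<integral>\<^sup>+\<xi>. (\<integral>\<^sup>+\<eta>. ennreal (norm (p \<eta> * q (\<xi> - \<eta>))) \<partial>lborel)\<^sup>2 \<partial>lborel)"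
    unfolding conv_def
    by (intro nn_integral_mono) (auto simp: ennreal_power[symmetric] intro!: power_mono_ennreal norm_integral_le_nn_integral)
  also note young_nn[OF p q]
  finally show "conv p q \<in> L2_space" "L2_norm (conv p q) \<le> (LINT x|lborel. norm (p x)) * L2_norm q"
    by (auto intro!: L2_by_nn_integral)
qed

text \<open>The convolution w of the transforms lies in L1 and L2, and by inversion of u and of v
  its transform is 4 pi^2 u(-x) v(-x). Transforming once more and inverting w costs 2 pi, which
  leaves 1 / (2 pi). This also proves that the product is square integrable.\<close>

lemma fourier_product:
  assumes u: "u \<in> L2_space" and v: "v \<in> L2_space"
    and iu: "integrable lborel (fourier u)" and iv: "integrable lborel (fourier v)"
  shows "(\<lambda>x. u x * v x) \<in> L2_space"
    and "AE \<xi> in lborel. fourier (\<lambda>x. u x * v x) \<xi> = of_real (1 / (2 * pi)) * conv (fourier u) (fourier v) \<xi>"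
proof -
  note [measurable] = L2_measurable[OF u] L2_measurable[OF v]
  define w where "w = conv (fourier u) (fourier v)"
  have w: "w \<in> L2_space" "integrable lborel w"
    unfolding w_def by (intro young fourier_L2 conv_integrable u v iu iv)+
  have "AE x in lborel. fourier w x = fourier_int w x" by (rule fourier_eq_fourier_int[OF w])
  moreover have "AE x in lborel. complex_of_real (2 * pi) * u (- x) = fourier_int (fourier u) x"
    using fourier_eq_fourier_int[OF fourier_L2[OF u] iu] fourier_fourier[OF u] by eventually_elim simp
  moreover have "AE x in lborel. complex_of_real (2 * pi) * v (- x) = fourier_int (fourier v) x"
    using fourier_eq_fourier_int[OF fourier_L2[OF v] iv] fourier_fourier[OF v] by eventually_elim simp
  ultimately have Fw: "AE x in lborel. fourier w x = complex_of_real (4 * pi\<^sup>2) * (u (- x) * v (- x))"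
  proof eventually_elim
    case (elim x)
    have "fourier w x = (complex_of_real (2 * pi) * u (- x)) * (complex_of_real (2 * pi) * v (- x))"
      unfolding elim unfolding w_def by (rule fourier_int_conv[OF iu iv])
    then show ?case by (simp add: power2_eq_square)
  qed
  have r: "(\<lambda>x. u (- x) * v (- x)) \<in> L2_space"
  proof (rule L2_dominated(1)[OF _ fourier_L2[OF w(1)], of _ "1 / (4 * pi\<^sup>2)"])
    show "AE x in lborel. norm (u (- x) * v (- x)) \<le> 1 / (4 * pi\<^sup>2) * norm (fourier w x)"
      using Fw by eventually_elim (simp add: norm_mult norm_power)
  qed auto
  show uv: "(\<lambda>x. u x * v x) \<in> L2_space" using L2_reflect[OF r] by simp
  have "fourier (fourier w) = fourier (\<lambda>x. complex_of_real (4 * pi\<^sup>2) * (u (- x) * v (- x)))"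
    by (rule fourier_cong_AE[OF Fw]) (use fourier_measurable[OF w(1)] in auto)
  then have "AE x in lborel. fourier (\<lambda>x. complex_of_real (4 * pi\<^sup>2) * (u (- x) * v (- x))) x = complex_of_real (2 * pi) * w (- x)"
    using fourier_fourier[OF w(1)] by simp
  then have "AE x in lborel. complex_of_real (4 * pi\<^sup>2) * fourier (\<lambda>x. u x * v x) (- x) = complex_of_real (2 * pi) * w (- x)"
    using fourier_scale[OF r, of "complex_of_real (4 * pi\<^sup>2)"] fourier_reflect[OF uv] by eventually_elim simp
  from AE_reflect[OF this]
  show "AE \<xi> in lborel. fourier (\<lambda>x. u x * v x) \<xi> = of_real (1 / (2 * pi)) * conv (fourier u) (fourier v) \<xi>"
    unfolding w_def by eventually_elim (simp add: field_simps power2_eq_square)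
qed

section \<open>The symbol of the energy\<close>

lemma sinh_diff_le:
  fixes u v :: real assumes "0 \<le> v" "v \<le> u"
  shows "sinh u - sinh v \<le> (u - v) * cosh u"
proof (cases "u = v")
  case False
  then have "v < u" using assms by simp
  have "(sinh has_real_derivative cosh t) (at t)" for t :: real
    using has_field_derivative_sinh[OF DERIV_ident, of t UNIV] by simp
  then obtain z where z: "v < z" "z < u" "sinh u - sinh v = (u - v) * cosh z"
    using MVT2[OF \<open>v < u\<close>, of sinh cosh] by blast
  then have "cosh z \<le> cosh u" using assms by (subst cosh_real_nonneg_le_iff) auto
  then show ?thesis using z assms by (simp add: mult_left_mono)
qed simp

text \<open>
  The truncation of the Gevrey weight.  It is bounded, but since \<open>\<lambda>\<xi>. min \<bar>\<xi>\<bar> N\<close> is subadditive it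
  is still submultiplicative up to the factor 2, uniformly in \<open>N\<close>.
\<close>

definition gw :: "real \<Rightarrow> real \<Rightarrow> real \<Rightarrow> real" where
  "gw \<sigma> N \<xi> = cosh (\<sigma> * min \<bar>\<xi>\<bar> N)"

lemma gw_measurable [measurable]: "gw \<sigma> N \<in> borel_measurable borel"
proof -
  have "continuous_on UNIV (gw \<sigma> N)" unfolding gw_def[abs_def] by (intro continuous_intros)
  then show ?thesis by (rule borel_measurable_continuous_onI)
qed

lemma gw_ge_1: "1 \<le> gw \<sigma> N \<xi>"
  by (simp add: gw_def cosh_real_ge_1)

lemma gw_pos [simp]: "0 < gw \<sigma> N \<xi>" "0 \<le> gw \<sigma> N \<xi>"
  using gw_ge_1[of \<sigma> N \<xi>] by auto

lemma gw_minus [simp]: "gw \<sigma> N (- \<xi>) = gw \<sigma> N \<xi>" "gw \<sigma> N \<bar>\<xi>\<bar> = gw \<sigma> N \<xi>"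
  by (simp_all add: gw_def)

lemma gw_bounded:
  assumes "0 \<le> \<sigma>" "0 \<le> N" shows "gw \<sigma> N \<xi> \<le> cosh (\<sigma> * N)"
  unfolding gw_def using assms by (subst cosh_real_nonneg_le_iff) (auto intro: mult_left_mono)

lemma gw_le_mult:
  assumes "0 \<le> \<sigma>" "0 \<le> N" and "\<bar>z\<bar> \<le> \<bar>x\<bar> + \<bar>y\<bar>"
  shows "gw \<sigma> N z \<le> 2 * gw \<sigma> N x * gw \<sigma> N y"
proof -
  let ?a = "\<sigma> * min \<bar>x\<bar> N" and ?b = "\<sigma> * min \<bar>y\<bar> N"
  have ab: "0 \<le> ?a" "0 \<le> ?b" using assms by auto
  have "gw \<sigma> N z \<le> cosh (?a + ?b)"
    unfolding gw_def using assms by (subst cosh_real_nonneg_le_iff) (auto simp: distrib_left[symmetric] intro!: mult_left_mono)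
  also have "\<dots> = cosh ?a * cosh ?b + sinh ?a * sinh ?b" by (rule cosh_add)
  also have "sinh ?a * sinh ?b \<le> cosh ?a * cosh ?b"
    using ab by (intro mult_mono) (auto simp: sinh_le_cosh_real)
  finally show ?thesis by (simp add: gw_def)
qed

definition gexc :: "real \<Rightarrow> real \<Rightarrow> real \<Rightarrow> real" where
  "gexc \<sigma> N \<xi> = (sinh (\<sigma> * min \<bar>\<xi>\<bar> N))\<^sup>2"

lemma gw_square: "(gw \<sigma> N \<xi>)\<^sup>2 = 1 + gexc \<sigma> N \<xi>"
  unfolding gw_def gexc_def by (simp add: cosh_square_eq)

lemma gexc_minus [simp]: "gexc \<sigma> N (- \<xi>) = gexc \<sigma> N \<xi>"
  by (simp add: gexc_def)

lemma gexc_nonneg [simp]: "0 \<le> gexc \<sigma> N \<xi>"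
  by (simp add: gexc_def)

text \<open>The estimate sinh u \<le> u * cosh u, squared. Both powers of \<sigma> matter: with a
  single one the argument would only reach a radius of order 1 / t.\<close>

lemma gexc_le:
  assumes "0 \<le> \<sigma>" "0 \<le> N" shows "gexc \<sigma> N \<xi> \<le> \<sigma>\<^sup>2 * \<xi>\<^sup>2 * (gw \<sigma> N \<xi>)\<^sup>2"
proof -
  let ?u = "\<sigma> * min \<bar>\<xi>\<bar> N"
  have u: "0 \<le> ?u" "?u \<le> \<sigma> * \<bar>\<xi>\<bar>" using assms by (auto intro: mult_left_mono)
  have "sinh ?u \<le> ?u * cosh ?u" using sinh_diff_le[of 0 ?u] u by simp
  also have "\<dots> \<le> \<sigma> * \<bar>\<xi>\<bar> * cosh ?u" using u by (intro mult_right_mono) auto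
  finally have "(sinh ?u)\<^sup>2 \<le> (\<sigma> * \<bar>\<xi>\<bar> * cosh ?u)\<^sup>2" using u by (intro power_mono) auto
  then show ?thesis by (simp add: gexc_def gw_def power_mult_distrib)
qed

text \<open>One of the two factors \<open>gw \<sigma> N z\<close> is traded for
  \<open>gw \<sigma> N x * gw \<sigma> N y\<close>, so that each of the three functions in a
  trilinear integral receives its weight exactly once.\<close>

lemma gexc_triple:
  assumes "0 \<le> \<sigma>" "0 \<le> N" and "x + y + z = 0"
  shows "gexc \<sigma> N z \<le> 2 * \<sigma>\<^sup>2 * z\<^sup>2 * (gw \<sigma> N x * gw \<sigma> N y * gw \<sigma> N z)"
proof -
  have "gexc \<sigma> N z \<le> \<sigma>\<^sup>2 * z\<^sup>2 * (gw \<sigma> N z * gw \<sigma> N z)"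
    using gexc_le[OF assms(1,2)] by (simp add: power2_eq_square)
  also have "\<dots> \<le> \<sigma>\<^sup>2 * z\<^sup>2 * (2 * gw \<sigma> N x * gw \<sigma> N y * gw \<sigma> N z)"
    using assms by (intro mult_left_mono mult_right_mono gw_le_mult) auto
  finally show ?thesis by (simp add: mult_ac)
qed

text \<open>Term by term the symbol is of size \<sigma>^2 X^5 with X = x + y, which would put five
  derivatives on the two high frequencies. The difference between the high frequencies X and x gains
  a factor y, so the low frequency takes one of the five.\<close>

lemma cubic_symbol_pos_aux:
  assumes s: "0 \<le> \<sigma>" "0 \<le> N" and xy: "0 \<le> y" "y \<le> x"
  shows "\<bar>gexc \<sigma> N (x + y) * (x + y)^3 - gexc \<sigma> N x * x^3 - gexc \<sigma> N y * y^3\<bar>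
    \<le> 40 * \<sigma>\<^sup>2 * (y * x\<^sup>2 * (x + y)\<^sup>2) * (gw \<sigma> N x * gw \<sigma> N y * gw \<sigma> N (x + y))"
proof -
  define X where "X = x + y"
  define c where "c = gw \<sigma> N X"
  have X: "0 \<le> X" "x \<le> X" "y \<le> X" "X \<le> 2 * x" "0 \<le> x" "X - x = y" using xy by (auto simp: X_def)
  \<comment> \<open>Here \<open>inv_jb_norm\<close> is the label of a local fact, unrelated to the
    constant of the same name in the section on weighted spaces.\<close>
  have inv_jb_norm: "0 \<le> c" by (simp add: c_def)
  have yX: "0 \<le> y * X^4" using X xy by simp
  have gX: "gexc \<sigma> N X \<le> \<sigma>\<^sup>2 * X\<^sup>2 * c\<^sup>2" unfolding c_def by (rule gexc_le[OF s])
  have "gw \<sigma> N y \<le> c"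
    unfolding c_def gw_def using s xy X by (subst cosh_real_nonneg_le_iff) (auto intro!: mult_left_mono)
  then have "\<sigma>\<^sup>2 * y\<^sup>2 * (gw \<sigma> N y)\<^sup>2 \<le> \<sigma>\<^sup>2 * y\<^sup>2 * c\<^sup>2" by (intro mult_left_mono power_mono) auto
  then have gy: "gexc \<sigma> N y \<le> \<sigma>\<^sup>2 * y\<^sup>2 * c\<^sup>2" using gexc_le[OF s, of y] by linarith
  \<comment> \<open>Truncation at N does not increase distances, so the arguments u and v differ by
    at most \<sigma> y. In the factorisation of sinh^2 u - sinh^2 v the difference yields the power
    of y and the sum the power of X.\<close>
  have diff: "0 \<le> gexc \<sigma> N X - gexc \<sigma> N x" "gexc \<sigma> N X - gexc \<sigma> N x \<le> 2 * \<sigma>\<^sup>2 * y * X * c\<^sup>2"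
  proof -
    let ?u = "\<sigma> * min \<bar>X\<bar> N" and ?v = "\<sigma> * min \<bar>x\<bar> N"
    have uv: "0 \<le> ?v" "?v \<le> ?u" "?u - ?v \<le> \<sigma> * y" "?u \<le> \<sigma> * X"
      using s X xy by (auto simp: right_diff_distrib[symmetric] intro!: mult_left_mono)
    have sv: "0 \<le> sinh ?v" "sinh ?v \<le> sinh ?u" using uv by auto
    have "sinh ?u - sinh ?v \<le> (?u - ?v) * cosh ?u" using uv by (intro sinh_diff_le) auto
    also have "\<dots> \<le> \<sigma> * y * cosh ?u" using uv by (intro mult_right_mono) auto
    finally have d: "sinh ?u - sinh ?v \<le> \<sigma> * y * c" by (simp add: c_def gw_def)
    have "sinh ?u - sinh 0 \<le> (?u - 0) * cosh ?u"
      by (rule sinh_diff_le[OF order_refl order_trans[OF uv(1,2)]])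
    then have "sinh ?u \<le> ?u * cosh ?u" by (simp only: sinh_0 diff_0_right)
    also have "\<dots> \<le> \<sigma> * X * cosh ?u" by (rule mult_right_mono[OF uv(4)]) simp
    finally have "sinh ?u + sinh ?v \<le> 2 * (\<sigma> * X * c)" using sv(2) unfolding c_def gw_def by linarith
    from mult_mono[OF d this] have "(sinh ?u - sinh ?v) * (sinh ?u + sinh ?v) \<le> (\<sigma> * y * c) * (2 * (\<sigma> * X * c))"
      using add_nonneg_nonneg[OF order_trans[OF sv] sv(1)] mult_nonneg_nonneg[OF mult_nonneg_nonneg[OF s(1) xy(1)] inv_jb_norm]
      by blast
    then show "gexc \<sigma> N X - gexc \<sigma> N x \<le> 2 * \<sigma>\<^sup>2 * y * X * c\<^sup>2"
      by (simp add: gexc_def power2_eq_square algebra_simps)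
    show "0 \<le> gexc \<sigma> N X - gexc \<sigma> N x"
      using sv by (simp add: gexc_def power_mono)
  qed
  have cube: "X^3 - x^3 = y * (X\<^sup>2 + X * x + x\<^sup>2)"
    unfolding X_def by (simp add: power2_eq_square power3_eq_cube algebra_simps)
  have "X * x \<le> X\<^sup>2" "x\<^sup>2 \<le> X\<^sup>2" using X by (auto simp: power2_eq_square intro: mult_mono)
  then have "X\<^sup>2 + X * x + x\<^sup>2 \<le> 3 * X\<^sup>2" by simp
  then have cube': "0 \<le> X^3 - x^3" "X^3 - x^3 \<le> y * (3 * X\<^sup>2)"
    unfolding cube using X(1,5) xy(1)
    by (auto intro!: mult_left_mono mult_nonneg_nonneg add_nonneg_nonneg simp only: zero_le_power2)
  have t1: "0 \<le> gexc \<sigma> N X * (X^3 - x^3)" "gexc \<sigma> N X * (X^3 - x^3) \<le> \<sigma>\<^sup>2 * X\<^sup>2 * c\<^sup>2 * (y * (3 * X\<^sup>2))"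
    using cube' gX by (auto intro!: mult_mono)
  have "x^3 \<le> X^3" using X by (intro power_mono) auto
  then have t2: "0 \<le> (gexc \<sigma> N X - gexc \<sigma> N x) * x^3" "(gexc \<sigma> N X - gexc \<sigma> N x) * x^3 \<le> 2 * \<sigma>\<^sup>2 * y * X * c\<^sup>2 * X^3"
    using diff X by (auto intro!: mult_mono)
  have "y\<^sup>2 * y^3 \<le> y * X^4"
    using mult_left_mono[OF power_mono[of y X 4], of y] X xy by (simp add: numeral_eq_Suc)
  then have "\<sigma>\<^sup>2 * c\<^sup>2 * (y\<^sup>2 * y^3) \<le> \<sigma>\<^sup>2 * c\<^sup>2 * (y * X^4)" by (intro mult_left_mono) auto
  moreover have "gexc \<sigma> N y * y^3 \<le> \<sigma>\<^sup>2 * y\<^sup>2 * c\<^sup>2 * y^3" using gy xy by (intro mult_right_mono) auto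
  ultimately have t3: "0 \<le> gexc \<sigma> N y * y^3" "gexc \<sigma> N y * y^3 \<le> \<sigma>\<^sup>2 * c\<^sup>2 * (y * X^4)"
    using xy by (auto simp: mult_ac)
  \<comment> \<open>Difference either the cube or the excess; each of the two pieces carries a
    factor y, and the remaining term is already of low frequency.\<close>
  have e: "gexc \<sigma> N X * X^3 - gexc \<sigma> N x * x^3 - gexc \<sigma> N y * y^3
    = gexc \<sigma> N X * (X^3 - x^3) + (gexc \<sigma> N X - gexc \<sigma> N x) * x^3 - gexc \<sigma> N y * y^3"
    by (simp add: algebra_simps)
  have p: "\<sigma>\<^sup>2 * X\<^sup>2 * c\<^sup>2 * (y * (3 * X\<^sup>2)) = 3 * (\<sigma>\<^sup>2 * c\<^sup>2 * (y * X^4))"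
    "2 * \<sigma>\<^sup>2 * y * X * c\<^sup>2 * X^3 = 2 * (\<sigma>\<^sup>2 * c\<^sup>2 * (y * X^4))"
    by (simp_all add: power2_eq_square power3_eq_cube power4_eq_xxxx)
  have nn: "0 \<le> \<sigma>\<^sup>2 * c\<^sup>2 * (y * X^4)" using yX by simp
  have "\<bar>gexc \<sigma> N X * X^3 - gexc \<sigma> N x * x^3 - gexc \<sigma> N y * y^3\<bar> \<le> 5 * (\<sigma>\<^sup>2 * c\<^sup>2 * (y * X^4))"
    unfolding e using t1 t2 t3 p nn by (auto simp: abs_le_iff)
  \<comment> \<open>The constant is 40 = 5 * 2 * 4: the 5 is 3 + 2 from the two differences, the 2
    is the loss in \<open>gw_le_mult\<close>, and the 4 comes from X \<le> 2 * x.\<close>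
  also have "\<dots> \<le> 5 * (\<sigma>\<^sup>2 * (2 * gw \<sigma> N x * gw \<sigma> N y * c) * (y * (4 * x\<^sup>2 * X\<^sup>2)))"
  proof -
    have "X\<^sup>2 * X\<^sup>2 \<le> (2 * x)\<^sup>2 * X\<^sup>2" using X by (intro mult_right_mono power_mono) auto
    then have "X^4 \<le> 4 * x\<^sup>2 * X\<^sup>2" by (simp add: power_mult_distrib power4_eq_xxxx power2_eq_square)
    moreover have "c * c \<le> (2 * gw \<sigma> N x * gw \<sigma> N y) * c"
      unfolding c_def by (intro mult_right_mono gw_le_mult s) (auto simp: X_def)
    ultimately show ?thesis
      using xy inv_jb_norm by (intro mult_left_mono mult_mono) (auto simp: power2_eq_square)
  qed
  finally show ?thesis by (simp add: X_def c_def mult_ac)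
qed

text \<open>
  The admissible distribution of derivatives: in a trilinear convolution integral of functions in
  $H^2$, two factors can carry two derivatives each (in $L^2$) and the third one only one, so that its
  transform is still in $L^1$.
\<close>

definition Jq :: "real \<Rightarrow> real \<Rightarrow> real \<Rightarrow> real" where
  "Jq x y z = \<bar>x\<bar> * y\<^sup>2 * z\<^sup>2 + x\<^sup>2 * \<bar>y\<bar> * z\<^sup>2 + x\<^sup>2 * y\<^sup>2 * \<bar>z\<bar>"

lemma Jq_commute: "Jq x y z = Jq y x z" "Jq x y z = Jq x z y"
  by (auto simp: Jq_def)

lemma cubic_symbol_pos:
  assumes s: "0 \<le> \<sigma>" "0 \<le> N" and xy: "0 \<le> y" "0 \<le> x"
  shows "\<bar>gexc \<sigma> N (x + y) * (x + y)^3 - gexc \<sigma> N x * x^3 - gexc \<sigma> N y * y^3\<bar>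
    \<le> 40 * \<sigma>\<^sup>2 * Jq x y (x + y) * (gw \<sigma> N x * gw \<sigma> N y * gw \<sigma> N (x + y))"
proof (cases "y \<le> x")
  case True
  have "y * x\<^sup>2 * (x + y)\<^sup>2 \<le> Jq x y (x + y)" using xy by (simp add: Jq_def mult_ac)
  then have "40 * \<sigma>\<^sup>2 * (y * x\<^sup>2 * (x + y)\<^sup>2) * (gw \<sigma> N x * gw \<sigma> N y * gw \<sigma> N (x + y))
    \<le> 40 * \<sigma>\<^sup>2 * Jq x y (x + y) * (gw \<sigma> N x * gw \<sigma> N y * gw \<sigma> N (x + y))"
    by (intro mult_right_mono mult_left_mono) auto
  with cubic_symbol_pos_aux[OF s xy(1) True] show ?thesis by linarith
next
  case False
  have "x * y\<^sup>2 * (y + x)\<^sup>2 \<le> Jq x y (x + y)" using xy by (simp add: Jq_def mult_ac add.commute)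
  then have "40 * \<sigma>\<^sup>2 * (x * y\<^sup>2 * (y + x)\<^sup>2) * (gw \<sigma> N y * gw \<sigma> N x * gw \<sigma> N (y + x))
    \<le> 40 * \<sigma>\<^sup>2 * Jq x y (x + y) * (gw \<sigma> N y * gw \<sigma> N x * gw \<sigma> N (y + x))"
    by (intro mult_right_mono mult_left_mono) auto
  with cubic_symbol_pos_aux[OF s xy(2), of y] False
  have "\<bar>gexc \<sigma> N (y + x) * (y + x)^3 - gexc \<sigma> N y * y^3 - gexc \<sigma> N x * x^3\<bar>
    \<le> 40 * \<sigma>\<^sup>2 * Jq x y (x + y) * (gw \<sigma> N y * gw \<sigma> N x * gw \<sigma> N (y + x))" by linarith
  moreover have "gexc \<sigma> N (y + x) * (y + x)^3 - gexc \<sigma> N y * y^3 - gexc \<sigma> N x * x^3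
    = gexc \<sigma> N (x + y) * (x + y)^3 - gexc \<sigma> N x * x^3 - gexc \<sigma> N y * y^3" by (simp add: add.commute)
  moreover have "gw \<sigma> N y * gw \<sigma> N x * gw \<sigma> N (y + x) = gw \<sigma> N x * gw \<sigma> N y * gw \<sigma> N (x + y)"
    by (simp add: ac_simps)
  ultimately show ?thesis by (simp only:)
qed

text \<open>The symbol is odd and the bound even under a common change of sign, so both frequencies
  may be taken nonnegative.\<close>

lemma cubic_symbol_same_sign:
  assumes s: "0 \<le> \<sigma>" "0 \<le> N" and xy: "0 \<le> x * y" and xyz: "x + y + z = 0"
  shows "\<bar>gexc \<sigma> N x * x^3 + gexc \<sigma> N y * y^3 + gexc \<sigma> N z * z^3\<bar>
    \<le> 40 * \<sigma>\<^sup>2 * Jq x y z * (gw \<sigma> N x * gw \<sigma> N y * gw \<sigma> N z)"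
proof -
  have z: "z = - (x + y)" using xyz by simp
  show ?thesis
  proof (cases "0 \<le> x \<and> 0 \<le> y")
    case True
    have J: "Jq x y (- (x + y)) = Jq x y (x + y)" unfolding Jq_def power2_minus abs_minus_cancel ..
    have cube: "(- (x + y))^3 = - ((x + y)^3)" by (rule power_minus_odd) simp
    show ?thesis
      using cubic_symbol_pos[OF s, of y x] True
      unfolding z J cube gexc_minus gw_minus by (simp add: abs_le_iff)
  next
    case False
    then have "0 \<le> - x" "0 \<le> - y" using xy by (auto simp: zero_le_mult_iff)
    moreover have J: "Jq x y (- (x + y)) = Jq (- x) (- y) (- x + - y)"
      unfolding minus_add_distrib[symmetric] Jq_def power2_minus abs_minus_cancel ..
    moreover have "(- x + - y)^3 = (- (x + y))^3" "(- x)^3 = - (x^3)" "(- y)^3 = - (y^3)" by simp_all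
    moreover have "gexc \<sigma> N (- x + - y) = gexc \<sigma> N (- (x + y))" "gw \<sigma> N (- x + - y) = gw \<sigma> N (- (x + y))" by simp_all
    ultimately show ?thesis
      using cubic_symbol_pos[OF s, of "- y" "- x"]
      unfolding z by (simp only: gexc_minus gw_minus abs_le_iff) (simp add: algebra_simps)
  qed
qed

text \<open>Among three real numbers two have a nonnegative product; the third is minus their sum,
  and both sides are symmetric.\<close>

lemma cubic_symbol:
  assumes s: "0 \<le> \<sigma>" "0 \<le> N" and xyz: "x + y + z = 0"
  shows "\<bar>gexc \<sigma> N x * x^3 + gexc \<sigma> N y * y^3 + gexc \<sigma> N z * z^3\<bar>
    \<le> 40 * \<sigma>\<^sup>2 * Jq x y z * (gw \<sigma> N x * gw \<sigma> N y * gw \<sigma> N z)"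
proof -
  have "0 \<le> x * y \<or> 0 \<le> x * z \<or> 0 \<le> y * z"
    by (auto simp: zero_le_mult_iff not_le)
  then consider "0 \<le> x * y" | "0 \<le> x * z" | "0 \<le> y * z" by blast
  then show ?thesis
  proof cases
    case 1 then show ?thesis using cubic_symbol_same_sign[OF s _ xyz] by blast
  next
    case 2 then show ?thesis using cubic_symbol_same_sign[OF s, of x z y] xyz
      by (simp add: Jq_commute(2)[of x z y] add_ac mult_ac)
  next
    case 3 then show ?thesis using cubic_symbol_same_sign[OF s, of y z x] xyz
      by (simp add: Jq_commute(2)[of y z x] Jq_commute(1)[of y x z] add_ac mult_ac)
  qed
qed

text \<open>Comparable to the bracket sqrt (1 + \<xi>^2) (see \<open>jb_sq_le\<close> and
  \<open>jb_sq_ge\<close>), but it turns the triangle inequality into the linear and multiplicative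
  rules \<open>jb_add\<close> and \<open>jb_mult\<close>.\<close>

definition jb :: "real \<Rightarrow> real" where "jb \<xi> = 1 + \<bar>\<xi>\<bar>"

lemma jb_ge_1: "1 \<le> jb \<xi>" and jb_abs: "\<bar>\<xi>\<bar> \<le> jb \<xi>" and jb_pos [simp]: "0 < jb \<xi>" "0 \<le> jb \<xi>"
  and jb_minus [simp]: "jb (- \<xi>) = jb \<xi>"
  by (auto simp: jb_def)

lemma jb_measurable [measurable]: "jb \<in> borel_measurable borel"
  unfolding jb_def[abs_def] by measurable

text \<open>The inhomogeneous version of \<open>Jq\<close>, which also dominates symbols of degree
  below five, such as those of the linear term.\<close>

definition Jj :: "real \<Rightarrow> real \<Rightarrow> real \<Rightarrow> real" where
  "Jj x y z = jb x * (jb y)\<^sup>2 * (jb z)\<^sup>2 + (jb x)\<^sup>2 * jb y * (jb z)\<^sup>2 + (jb x)\<^sup>2 * (jb y)\<^sup>2 * jb z"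

lemma Jj_nonneg: "0 \<le> Jj x y z"
  unfolding Jj_def by (intro add_nonneg_nonneg mult_nonneg_nonneg) auto

lemma Jj_commute: "Jj x y z = Jj y x z" "Jj x y z = Jj x z y"
  by (auto simp: Jj_def)

lemma jb_sq: "\<xi>\<^sup>2 \<le> (jb \<xi>)\<^sup>2"
  using power_mono[OF jb_abs[of \<xi>], of 2] by simp

lemma Jq_le_Jj: "Jq x y z \<le> Jj x y z"
  unfolding Jq_def Jj_def by (intro add_mono mult_mono jb_sq jb_abs) auto

lemma jb_le_sq: "jb \<xi> \<le> (jb \<xi>)\<^sup>2"
  using jb_ge_1[of \<xi>] by (simp add: power2_eq_square)

text \<open>No slot of \<open>Jj\<close> admits three derivatives, so one power of |z| is moved to x
  or y by means of |z| \<le> jb x + jb y.\<close>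

lemma cube_le_Jj:
  assumes "x + y + z = 0" shows "\<bar>z\<bar>^3 \<le> Jj x y z"
proof -
  have "\<bar>z\<bar> \<le> jb x + jb y" using assms by (auto simp: jb_def)
  then have "z\<^sup>2 * \<bar>z\<bar> \<le> (jb z)\<^sup>2 * (jb x + jb y)" by (intro mult_mono jb_sq) auto
  also have "\<dots> = (jb z)\<^sup>2 * (jb x * 1) + (jb z)\<^sup>2 * (1 * jb y)" by (simp add: algebra_simps)
  also have "\<dots> \<le> (jb z)\<^sup>2 * ((jb x)\<^sup>2 * jb y) + (jb z)\<^sup>2 * (jb x * (jb y)\<^sup>2)"
    by (intro add_mono mult_left_mono mult_mono jb_le_sq jb_ge_1 order_trans[OF jb_ge_1 jb_le_sq]) auto
  also have "\<dots> \<le> Jj x y z" unfolding Jj_def by (simp add: mult_ac)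
  finally show ?thesis by (simp add: power3_eq_cube power2_eq_square mult_ac)
qed

lemma abs_triple_le_Jj:
  "\<bar>x * y * z\<bar> \<le> Jj x y z"
proof -
  have "\<bar>x * y * z\<bar> = \<bar>x\<bar> * \<bar>y\<bar> * \<bar>z\<bar>" by (simp add: abs_mult)
  also have "\<dots> \<le> jb x * jb y * jb z" by (intro mult_mono jb_abs) auto
  also have "\<dots> \<le> jb x * (jb y)\<^sup>2 * (jb z)\<^sup>2" by (intro mult_mono jb_le_sq) auto
  also have "\<dots> \<le> Jj x y z" unfolding Jj_def by (simp add: add.assoc)
  finally show ?thesis .
qed

text \<open>\<open>gexc\<close> adds two powers to the factor already present, one too many; the
  surplus power of |c| is replaced by |a| + |b|. Summed over the three frequencies, each monomial of
  \<open>Jq\<close> occurs twice, whence 4 = 2 * 2.\<close>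

lemma triple_weight_le:
  assumes s: "0 \<le> \<sigma>" "0 \<le> N" and xyz: "x + y + z = 0"
  shows "\<bar>x * y * z\<bar> * (gexc \<sigma> N x + gexc \<sigma> N y + gexc \<sigma> N z)
     \<le> 4 * \<sigma>\<^sup>2 * Jj x y z * (gw \<sigma> N x * gw \<sigma> N y * gw \<sigma> N z)"
proof -
  define G where "G = gw \<sigma> N x * gw \<sigma> N y * gw \<sigma> N z"
  have G: "0 \<le> G" by (simp add: G_def)
  have one: "\<bar>a * b * c\<bar> * gexc \<sigma> N c \<le> 2 * \<sigma>\<^sup>2 * G * (a\<^sup>2 * \<bar>b\<bar> * c\<^sup>2 + \<bar>a\<bar> * b\<^sup>2 * c\<^sup>2)"
    if abc: "a + b + c = 0" and G': "G = gw \<sigma> N a * gw \<sigma> N b * gw \<sigma> N c" for a b c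
  proof -
    have "\<bar>a * b * c\<bar> * gexc \<sigma> N c \<le> \<bar>a * b * c\<bar> * (2 * \<sigma>\<^sup>2 * c\<^sup>2 * G)"
      unfolding G' by (intro mult_left_mono gexc_triple s abc) auto
    also have "\<dots> = 2 * \<sigma>\<^sup>2 * G * (\<bar>a\<bar> * \<bar>b\<bar> * c\<^sup>2 * \<bar>c\<bar>)" by (simp add: abs_mult)
    also have "\<dots> \<le> 2 * \<sigma>\<^sup>2 * G * (\<bar>a\<bar> * \<bar>b\<bar> * c\<^sup>2 * (\<bar>a\<bar> + \<bar>b\<bar>))"
      using abc G by (intro mult_left_mono) auto
    also have "\<bar>a\<bar> * \<bar>b\<bar> * c\<^sup>2 * (\<bar>a\<bar> + \<bar>b\<bar>) = \<bar>a\<bar>\<^sup>2 * \<bar>b\<bar> * c\<^sup>2 + \<bar>a\<bar> * \<bar>b\<bar>\<^sup>2 * c\<^sup>2"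
      by (simp only: power2_eq_square) (simp only: algebra_simps)
    finally show ?thesis by (simp only: power2_abs)
  qed
  have "\<bar>x * y * z\<bar> * gexc \<sigma> N z \<le> 2 * \<sigma>\<^sup>2 * G * (x\<^sup>2 * \<bar>y\<bar> * z\<^sup>2 + \<bar>x\<bar> * y\<^sup>2 * z\<^sup>2)"
    by (rule one[OF xyz]) (simp add: G_def)
  moreover have "\<bar>y * z * x\<bar> * gexc \<sigma> N x \<le> 2 * \<sigma>\<^sup>2 * G * (y\<^sup>2 * \<bar>z\<bar> * x\<^sup>2 + \<bar>y\<bar> * z\<^sup>2 * x\<^sup>2)"
    by (rule one) (use xyz in \<open>auto simp: G_def\<close>)
  moreover have "\<bar>z * x * y\<bar> * gexc \<sigma> N y \<le> 2 * \<sigma>\<^sup>2 * G * (z\<^sup>2 * \<bar>x\<bar> * y\<^sup>2 + \<bar>z\<bar> * x\<^sup>2 * y\<^sup>2)"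
    by (rule one) (use xyz in \<open>auto simp: G_def\<close>)
  moreover have "y * z * x = x * y * z" "z * x * y = x * y * z" by simp_all
  ultimately have "\<bar>x * y * z\<bar> * (gexc \<sigma> N x + gexc \<sigma> N y + gexc \<sigma> N z)
     \<le> 2 * \<sigma>\<^sup>2 * G * (2 * Jq x y z)"
    unfolding Jq_def by (simp add: distrib_left mult_ac)
  also have "\<dots> \<le> 2 * \<sigma>\<^sup>2 * G * (2 * Jj x y z)"
    using G Jq_le_Jj[of x y z] by (intro mult_left_mono) auto
  finally show ?thesis by (simp add: G_def mult_ac)
qed

lemma linear_weight_le:
  assumes s: "0 \<le> \<sigma>" "0 \<le> N" and xyz: "x + y + z = 0"
  shows "\<bar>z\<bar> * gexc \<sigma> N z \<le> 2 * \<sigma>\<^sup>2 * Jj x y z * (gw \<sigma> N x * gw \<sigma> N y * gw \<sigma> N z)"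
proof -
  have "\<bar>z\<bar> * gexc \<sigma> N z \<le> \<bar>z\<bar> * (2 * \<sigma>\<^sup>2 * z\<^sup>2 * (gw \<sigma> N x * gw \<sigma> N y * gw \<sigma> N z))"
    by (intro mult_left_mono gexc_triple s xyz) auto
  also have "\<dots> = 2 * \<sigma>\<^sup>2 * \<bar>z\<bar>^3 * (gw \<sigma> N x * gw \<sigma> N y * gw \<sigma> N z)"
    by (simp add: power3_eq_cube power2_eq_square)
  also have "\<dots> \<le> 2 * \<sigma>\<^sup>2 * Jj x y z * (gw \<sigma> N x * gw \<sigma> N y * gw \<sigma> N z)"
    by (intro mult_right_mono mult_left_mono cube_le_Jj xyz) auto
  finally show ?thesis .
qed

text \<open>If x + y + z = 0 then x^3 + y^3 + z^3 = 3xyz, so for weight 1 the sum vanishes exactly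
  when the coefficients of t^3 and of xyz are opposite. The former is - \<gamma>, the latter stems
  from the term with the squared derivative; this is the role of 7/48.\<close>

lemma symmetrized_symbol_le:
  assumes s: "0 \<le> \<sigma>" "0 \<le> N" and xyz: "x + y + z = 0"
  shows "\<bar>\<Sum>t\<leftarrow>[x, y, z]. (gw \<sigma> N t)\<^sup>2 * (3/4 * t - 7/48 * t^3 + 7/48 * (x * y * z))\<bar>
    \<le> 12 * \<sigma>\<^sup>2 * (Jj x y z * (gw \<sigma> N x * gw \<sigma> N y * gw \<sigma> N z))"
proof -
  define R where "R = \<sigma>\<^sup>2 * (Jj x y z * (gw \<sigma> N x * gw \<sigma> N y * gw \<sigma> N z))"
  define g where "g = gexc \<sigma> N"
  have z: "z = - x - y" using xyz by simp
  have R0: "0 \<le> R" unfolding R_def by (intro mult_nonneg_nonneg Jj_nonneg) auto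
  have g0: "0 \<le> g t" for t by (simp add: g_def)
  have id: "(3/4 * x - 7/48 * x^3 + 7/48 * (x * y * z)) + (3/4 * y - 7/48 * y^3 + 7/48 * (x * y * z))
    + (3/4 * z - 7/48 * z^3 + 7/48 * (x * y * z)) = 0"
    unfolding z by (simp add: power3_eq_cube field_simps)
  have "(\<Sum>t\<leftarrow>[x, y, z]. (gw \<sigma> N t)\<^sup>2 * (3/4 * t - 7/48 * t^3 + 7/48 * (x * y * z)))
    = (\<Sum>t\<leftarrow>[x, y, z]. g t * (3/4 * t - 7/48 * t^3 + 7/48 * (x * y * z)))"
    using id by (simp add: gw_square distrib_right g_def)
  also have "\<dots> = 3/4 * (x * g x + y * g y + z * g z) - 7/48 * (g x * x^3 + g y * y^3 + g z * z^3)
     + 7/48 * ((x * y * z) * (g x + g y + g z))"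
    by (simp add: algebra_simps)
  finally have eq: "(\<Sum>t\<leftarrow>[x, y, z]. (gw \<sigma> N t)\<^sup>2 * (3/4 * t - 7/48 * t^3 + 7/48 * (x * y * z))) = \<dots>" .
  have "40 * \<sigma>\<^sup>2 * Jq x y z * (gw \<sigma> N x * gw \<sigma> N y * gw \<sigma> N z) \<le> 40 * \<sigma>\<^sup>2 * Jj x y z * (gw \<sigma> N x * gw \<sigma> N y * gw \<sigma> N z)"
    by (intro mult_right_mono mult_left_mono Jq_le_Jj) auto
  then have A: "\<bar>g x * x^3 + g y * y^3 + g z * z^3\<bar> \<le> 40 * R"
    using order_trans[OF cubic_symbol[OF s xyz]] by (simp only: R_def g_def mult.assoc)
  have "\<bar>(x * y * z) * (g x + g y + g z)\<bar> = \<bar>x * y * z\<bar> * (g x + g y + g z)"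
    using g0 by (simp add: abs_mult)
  then have B: "\<bar>(x * y * z) * (g x + g y + g z)\<bar> \<le> 4 * R"
    using triple_weight_le[OF s xyz] by (simp add: R_def g_def mult_ac)
  have C: "\<bar>z * g z\<bar> \<le> 2 * R"
    using linear_weight_le[OF s xyz] g0[of z] by (simp add: R_def g_def abs_mult mult_ac)
  have D: "\<bar>y * g y\<bar> \<le> 2 * R"
    using linear_weight_le[OF s, of z x y] xyz g0[of y] Jj_commute(1)[of z x y] Jj_commute(2)[of x z y]
    by (simp add: R_def g_def abs_mult mult_ac)
  have E: "\<bar>x * g x\<bar> \<le> 2 * R"
    using linear_weight_le[OF s, of z y x] xyz g0[of x] Jj_commute(1)[of z y x] Jj_commute(2)[of y z x] Jj_commute(1)[of x y z]
    by (simp add: R_def g_def abs_mult mult_ac)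
  \<comment> \<open>The three contributions add up to 3/4 * 6 + 7/48 * 40 + 7/48 * 4, which is below
    12.\<close>
  have aux: "\<bar>3/4 * (a + b + c) - 7/48 * P + 7/48 * Q\<bar> \<le> 12 * R"
    if "\<bar>P\<bar> \<le> 40 * R" "\<bar>Q\<bar> \<le> 4 * R" "\<bar>a\<bar> \<le> 2 * R" "\<bar>b\<bar> \<le> 2 * R" "\<bar>c\<bar> \<le> 2 * R" for a b c P Q :: real
  proof -
    have "\<bar>3/4 * a + 3/4 * b + 3/4 * c - 7/48 * P + 7/48 * Q\<bar> \<le> 12 * R" using that R0 by linarith
    then show ?thesis by (simp only: distrib_left)
  qed
  have "\<bar>(\<Sum>t\<leftarrow>[x, y, z]. (gw \<sigma> N t)\<^sup>2 * (3/4 * t - 7/48 * t^3 + 7/48 * (x * y * z)))\<bar> \<le> 12 * R"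
    unfolding eq by (rule aux[OF A B E D C])
  then show ?thesis by (simp add: R_def mult_ac)
qed

section \<open>Weighted spaces and trilinear integrals\<close>

definition wt :: "(real \<Rightarrow> real) \<Rightarrow> (real \<Rightarrow> complex) \<Rightarrow> real \<Rightarrow> complex" where
  "wt w a = (\<lambda>\<xi>. of_real (w \<xi>) * a \<xi>)"

lemma wt_measurable [measurable]:
  "w \<in> borel_measurable borel \<Longrightarrow> a \<in> borel_measurable borel \<Longrightarrow> wt w a \<in> borel_measurable borel"
  unfolding wt_def by measurable

lemma norm_wt: "0 \<le> w \<xi> \<Longrightarrow> norm (wt w a \<xi>) = w \<xi> * norm (a \<xi>)"
  by (simp add: wt_def norm_mult)

text \<open>The Fourier image of H^2, with \<open>jb\<close> in place of the bracket.\<close>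

definition X2 :: "(real \<Rightarrow> complex) set" where
  "X2 = {a \<in> borel_measurable borel. wt (\<lambda>\<xi>. (jb \<xi>)\<^sup>2) a \<in> L2_space}"

definition X2_norm :: "(real \<Rightarrow> complex) \<Rightarrow> real" where
  "X2_norm a = L2_norm (wt (\<lambda>\<xi>. (jb \<xi>)\<^sup>2) a)"

lemma X2_measurable: "a \<in> X2 \<Longrightarrow> a \<in> borel_measurable borel"
  by (simp add: X2_def)

lemma X2_wt_L2: "a \<in> X2 \<Longrightarrow> wt (\<lambda>\<xi>. (jb \<xi>)\<^sup>2) a \<in> L2_space"
  by (simp add: X2_def)

lemma X2_norm_nonneg [simp]: "0 \<le> X2_norm a"
  by (simp add: X2_norm_def)

text \<open>Lets Cauchy-Schwarz convert one spare derivative in L2 into integrability of the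
  transform. The majorant is the integrable function 1 / (1 + x^2), assembled from two
  half-lines.\<close>

lemma jb_inverse_L2: "(\<lambda>\<xi>. complex_of_real (1 / jb \<xi>)) \<in> L2_space"
proof -
  define f :: "real \<Rightarrow> real" where "f = (\<lambda>x. indicator {0<..} x * (1 / (1 + x\<^sup>2)))"
  have "set_integrable lborel {0<..} (\<lambda>x::real. 1 / (1 + x\<^sup>2))"
    using integrable_I0i_1_div_plus_square
    by (simp add: interval_lebesgue_integrable_def einterval_def zero_ereal_def greaterThan_def)
  then have f: "integrable lborel f" by (simp add: f_def set_integrable_def)
  then have f': "integrable lborel (\<lambda>x. f (- x))" using lborel_integrable_real_affine[of f "-1" 0] by simp
  have "integrable lborel (\<lambda>x. (norm (complex_of_real (1 / jb x)))\<^sup>2)"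
  proof (rule Bochner_Integration.integrable_bound)
    \<comment> \<open>The function f vanishes at 0, so the origin needs a summand of its own for the
      bound to hold everywhere.\<close>
    show "integrable lborel (\<lambda>x. f x + f (- x) + indicator {0..0} x)"
      using f f' by (auto simp: integrable_indicator_iff emeasure_lborel_Icc_eq)
    show "AE x in lborel. norm ((norm (complex_of_real (1 / jb x)))\<^sup>2) \<le> norm (f x + f (- x) + indicator {0..0} x)"
    proof (rule AE_I2)
      fix x :: real
      have "1 + x\<^sup>2 \<le> (jb x)\<^sup>2" by (simp add: jb_def power2_sum)
      then have "1 / (jb x)\<^sup>2 \<le> 1 / (1 + x\<^sup>2)" by (intro frac_le) (auto intro: add_pos_nonneg)
      moreover have "1 / (1 + x\<^sup>2) \<le> f x + f (- x) + indicator {0..0} x"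
        by (cases x "0::real" rule: linorder_cases) (auto simp: f_def)
      ultimately show "norm ((norm (complex_of_real (1 / jb x)))\<^sup>2) \<le> norm (f x + f (- x) + indicator {0..0} x)"
        by (simp add: norm_divide power_divide)
    qed
  qed simp
  then show ?thesis by (simp add: L2_space_def)
qed

definition inv_jb_norm :: real where "inv_jb_norm = L2_norm (\<lambda>\<xi>. complex_of_real (1 / jb \<xi>))"

lemma inv_jb_norm_nonneg [simp]: "0 \<le> inv_jb_norm" by (simp add: inv_jb_norm_def)

text \<open>One of the two powers of \<open>jb\<close> is spent against 1 / \<open>jb\<close>; the
  other remains. This is the factor with a single derivative in \<open>Jj\<close>.\<close>

lemma X2_j:
  assumes a: "a \<in> X2"
  shows "wt jb a \<in> L2_space" "L2_norm (wt jb a) \<le> X2_norm a"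
    and "integrable lborel (wt jb a)" "(LINT \<xi>|lborel. norm (wt jb a \<xi>)) \<le> inv_jb_norm * X2_norm a"
proof -
  note [measurable] = X2_measurable[OF a]
  have le: "AE \<xi> in lborel. norm (wt jb a \<xi>) \<le> 1 * norm (wt (\<lambda>\<xi>. (jb \<xi>)\<^sup>2) a \<xi>)"
    using jb_le_sq by (intro AE_I2) (simp add: norm_wt mult_right_mono)
  show "wt jb a \<in> L2_space" "L2_norm (wt jb a) \<le> X2_norm a"
    using L2_dominated[OF _ X2_wt_L2[OF a] le] by (auto simp: X2_norm_def)
  have eq: "wt jb a = (\<lambda>\<xi>. complex_of_real (1 / jb \<xi>) * wt (\<lambda>\<xi>. (jb \<xi>)\<^sup>2) a \<xi>)"
    using jb_pos(1) by (auto simp: wt_def fun_eq_iff power2_eq_square field_simps less_imp_neq[THEN not_sym])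
  show "integrable lborel (wt jb a)"
    unfolding eq by (rule L2_mult_integrable[OF jb_inverse_L2 X2_wt_L2[OF a]])
  show "(LINT \<xi>|lborel. norm (wt jb a \<xi>)) \<le> inv_jb_norm * X2_norm a"
    unfolding eq inv_jb_norm_def X2_norm_def by (rule L2_CS_abs[OF jb_inverse_L2 X2_wt_L2[OF a]])
qed

lemma X2_dominated:
  assumes a: "a \<in> X2" and [measurable]: "b \<in> borel_measurable borel"
    and le: "\<And>\<xi>. norm (b \<xi>) \<le> jb \<xi> * norm (a \<xi>)"
  shows "b \<in> L2_space" "L2_norm b \<le> X2_norm a"
    and "integrable lborel b" "(LINT \<xi>|lborel. norm (b \<xi>)) \<le> inv_jb_norm * X2_norm a"
proof -
  have ae: "AE \<xi> in lborel. norm (b \<xi>) \<le> 1 * norm (wt jb a \<xi>)" using le by (simp add: norm_wt)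
  show "b \<in> L2_space" "L2_norm b \<le> X2_norm a"
    using L2_dominated[OF _ X2_j(1)[OF a] ae] X2_j(2)[OF a] by auto
  show i: "integrable lborel b"
    by (rule Bochner_Integration.integrable_bound[OF X2_j(3)[OF a]]) (use ae in auto)
  have "(LINT \<xi>|lborel. norm (b \<xi>)) \<le> (LINT \<xi>|lborel. norm (wt jb a \<xi>))"
    by (rule integral_mono[OF integrable_norm[OF i] integrable_norm[OF X2_j(3)[OF a]]]) (use le in \<open>simp add: norm_wt\<close>)
  then show "(LINT \<xi>|lborel. norm (b \<xi>)) \<le> inv_jb_norm * X2_norm a" using X2_j(4)[OF a] by linarith
qed

lemma le_jb_mult: "0 \<le> c \<Longrightarrow> c \<le> jb \<xi> * c"
  using mult_right_mono[OF jb_ge_1[of \<xi>], of c] by simp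

lemmas X2_self = X2_dominated[OF _ X2_measurable, OF _ _ le_jb_mult[OF norm_ge_zero]]

lemma X2_mult_id:
  assumes a: "a \<in> X2"
  shows "wt (\<lambda>\<xi>. \<xi>) a \<in> L2_space" "L2_norm (wt (\<lambda>\<xi>. \<xi>) a) \<le> X2_norm a"
    and "integrable lborel (wt (\<lambda>\<xi>. \<xi>) a)" "(LINT \<xi>|lborel. norm (wt (\<lambda>\<xi>. \<xi>) a \<xi>)) \<le> inv_jb_norm * X2_norm a"
proof -
  note [measurable] = X2_measurable[OF a]
  have le: "norm (wt (\<lambda>\<xi>. \<xi>) a \<xi>) \<le> jb \<xi> * norm (a \<xi>)" for \<xi>
    by (simp add: wt_def norm_mult mult_right_mono jb_abs)
  have m: "wt (\<lambda>\<xi>. \<xi>) a \<in> borel_measurable borel" by measurable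
  show "wt (\<lambda>\<xi>. \<xi>) a \<in> L2_space" "L2_norm (wt (\<lambda>\<xi>. \<xi>) a) \<le> X2_norm a"
    "integrable lborel (wt (\<lambda>\<xi>. \<xi>) a)" "(LINT \<xi>|lborel. norm (wt (\<lambda>\<xi>. \<xi>) a \<xi>)) \<le> inv_jb_norm * X2_norm a"
    by (rule X2_dominated[OF a m le])+
qed

text \<open>A weighted Young inequality: the last hypothesis lets the weight fall on the left or the
  right factor, and each alternative is a convolution of L1 with L2. The leading 2 covers the loss
  in (A + B)^2 \<le> 2 A^2 + 2 B^2.\<close>

lemma conv_weight:
  assumes [measurable]: "p \<in> borel_measurable borel" "q \<in> borel_measurable borel" "w \<in> borel_measurable borel"
    and w0: "\<And>\<xi>. 0 \<le> w \<xi>"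
    and P1: "integrable lborel P1" and Q1: "Q1 \<in> L2_space"
    and P2: "integrable lborel P2" and Q2: "Q2 \<in> L2_space"
    and le: "\<And>\<xi> \<eta>. w \<xi> * norm (p \<eta> * q (\<xi> - \<eta>)) \<le> norm (P1 \<eta> * Q1 (\<xi> - \<eta>)) + norm (Q2 \<eta> * P2 (\<xi> - \<eta>))"
  shows "wt w (conv p q) \<in> L2_space"
    and "L2_norm (wt w (conv p q)) \<le> 2 * ((LINT x|lborel. norm (P1 x)) * L2_norm Q1 + (LINT x|lborel. norm (P2 x)) * L2_norm Q2)"
proof -
  note [measurable] = borel_measurable_integrable[OF P1] borel_measurable_integrable[OF P2] L2_measurable[OF Q1] L2_measurable[OF Q2]
  define s where "s = (LINT x|lborel. norm (P1 x)) * L2_norm Q1"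
  define t where "t = (LINT x|lborel. norm (P2 x)) * L2_norm Q2"
  have st: "0 \<le> s" "0 \<le> t" by (auto simp: s_def t_def integral_nonneg_AE)
  define A where "A \<xi> = (\<integral>\<^sup>+\<eta>. ennreal (norm (P1 \<eta> * Q1 (\<xi> - \<eta>))) \<partial>lborel)" for \<xi>
  define B where "B \<xi> = (\<integral>\<^sup>+\<eta>. ennreal (norm (P2 \<eta> * Q2 (\<xi> - \<eta>))) \<partial>lborel)" for \<xi>
  have [measurable]: "A \<in> borel_measurable borel" "B \<in> borel_measurable borel"
    unfolding A_def[abs_def] B_def[abs_def] by measurable
  \<comment> \<open>In the second alternative the square integrable factor stands on the left; a
    reflection of the variable restores the order that \<open>young_nn\<close> expects.\<close>
  have B': "(\<integral>\<^sup>+\<eta>. ennreal (norm (Q2 \<eta> * P2 (\<xi> - \<eta>))) \<partial>lborel) = B \<xi>" for \<xi>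
    unfolding B_def
    by (subst nn_integral_reflect_shift[of "\<lambda>\<eta>. ennreal (norm (Q2 \<eta> * P2 (\<xi> - \<eta>)))" \<xi>, symmetric])
       (auto simp: mult.commute)
  have pt: "ennreal (norm (wt w (conv p q) \<xi>)) \<le> A \<xi> + B \<xi>" for \<xi>
  proof -
    have "ennreal (norm (wt w (conv p q) \<xi>)) = ennreal (w \<xi>) * ennreal (norm (conv p q \<xi>))"
      using w0 by (simp add: norm_wt ennreal_mult)
    also have "\<dots> \<le> ennreal (w \<xi>) * (\<integral>\<^sup>+\<eta>. ennreal (norm (p \<eta> * q (\<xi> - \<eta>))) \<partial>lborel)"
      unfolding conv_def by (intro mult_left_mono norm_integral_le_nn_integral) auto
    also have "\<dots> = (\<integral>\<^sup>+\<eta>. ennreal (w \<xi> * norm (p \<eta> * q (\<xi> - \<eta>))) \<partial>lborel)"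
      using w0 by (subst nn_integral_cmult[symmetric]) (auto simp: ennreal_mult)
    also have "\<dots> \<le> (\<integral>\<^sup>+\<eta>. ennreal (norm (P1 \<eta> * Q1 (\<xi> - \<eta>))) + ennreal (norm (Q2 \<eta> * P2 (\<xi> - \<eta>))) \<partial>lborel)"
      using le by (intro nn_integral_mono) (simp add: ennreal_leI flip: ennreal_plus)
    also have "\<dots> = A \<xi> + B \<xi>"
      unfolding B'[symmetric] A_def by (rule nn_integral_add) auto
    finally show ?thesis .
  qed
  have "(\<integral>\<^sup>+\<xi>. ennreal ((norm (wt w (conv p q) \<xi>))\<^sup>2) \<partial>lborel) \<le> (\<integral>\<^sup>+\<xi>. 2 * (A \<xi>)\<^sup>2 + 2 * (B \<xi>)\<^sup>2 \<partial>lborel)"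
  proof (rule nn_integral_mono)
    fix \<xi>
    have "ennreal ((norm (wt w (conv p q) \<xi>))\<^sup>2) = (ennreal (norm (wt w (conv p q) \<xi>)))\<^sup>2"
      by (simp add: ennreal_power)
    also have "\<dots> \<le> (A \<xi> + B \<xi>)\<^sup>2" by (intro power_mono_ennreal pt)
    also have "\<dots> = (A \<xi>)\<^sup>2 + (B \<xi>)\<^sup>2 + 2 * A \<xi> * B \<xi>" by (rule power2_sum)
    also have "\<dots> \<le> (A \<xi>)\<^sup>2 + (B \<xi>)\<^sup>2 + ((A \<xi>)\<^sup>2 + (B \<xi>)\<^sup>2)"
      by (intro add_left_mono sum_of_squares_ge_ennreal)
    finally show "ennreal ((norm (wt w (conv p q) \<xi>))\<^sup>2) \<le> 2 * (A \<xi>)\<^sup>2 + 2 * (B \<xi>)\<^sup>2"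
      by (simp add: mult_2 add_ac)
  qed
  also have "\<dots> = 2 * (\<integral>\<^sup>+\<xi>. (A \<xi>)\<^sup>2 \<partial>lborel) + 2 * (\<integral>\<^sup>+\<xi>. (B \<xi>)\<^sup>2 \<partial>lborel)"
    by (simp add: nn_integral_add nn_integral_cmult)
  also have "\<dots> \<le> 2 * ennreal (s\<^sup>2) + 2 * ennreal (t\<^sup>2)"
    unfolding A_def B_def s_def t_def by (intro add_mono mult_left_mono young_nn P1 Q1 P2 Q2) auto
  also have "\<dots> = ennreal (2 * s\<^sup>2 + 2 * t\<^sup>2)" by (simp add: ennreal_mult ennreal_plus)
  also have "\<dots> \<le> ennreal ((2 * (s + t))\<^sup>2)"
    using st by (intro ennreal_leI) (simp add: power2_sum power_mult_distrib)
  finally have *: "(\<integral>\<^sup>+\<xi>. ennreal ((norm (wt w (conv p q) \<xi>))\<^sup>2) \<partial>lborel) \<le> ennreal ((2 * (s + t))\<^sup>2)" .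
  show "wt w (conv p q) \<in> L2_space"
    and "L2_norm (wt w (conv p q)) \<le> 2 * ((LINT x|lborel. norm (P1 x)) * L2_norm Q1 + (LINT x|lborel. norm (P2 x)) * L2_norm Q2)"
    using L2_by_nn_integral[OF _ *] st unfolding s_def[symmetric] t_def[symmetric] by auto
qed

lemma jb_add: "jb \<xi> \<le> jb \<eta> + jb (\<xi> - \<eta>)" and jb_mult: "jb \<xi> \<le> jb \<eta> * jb (\<xi> - \<eta>)"
proof -
  have *: "\<bar>\<xi>\<bar> \<le> \<bar>\<eta>\<bar> + \<bar>\<xi> - \<eta>\<bar>" by linarith
  then show "jb \<xi> \<le> jb \<eta> + jb (\<xi> - \<eta>)" by (simp add: jb_def)
  have "0 \<le> \<bar>\<eta>\<bar> * \<bar>\<xi> - \<eta>\<bar>" by simp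
  moreover have "jb \<eta> * jb (\<xi> - \<eta>) = 1 + \<bar>\<eta>\<bar> + \<bar>\<xi> - \<eta>\<bar> + \<bar>\<eta>\<bar> * \<bar>\<xi> - \<eta>\<bar>" by (simp add: jb_def algebra_simps)
  ultimately show "jb \<xi> \<le> jb \<eta> * jb (\<xi> - \<eta>)" using * unfolding jb_def[of \<xi>] by linarith
qed

text \<open>H^2 is an algebra: up to a factor 2 the weight falls on one of the two functions, and
  the other one is integrable. The constant is 8 = 2 * (2 + 2).\<close>

lemma X2_conv:
  assumes p: "p \<in> X2" and q: "q \<in> X2"
  shows "conv p q \<in> X2" and "X2_norm (conv p q) \<le> 8 * inv_jb_norm * (X2_norm p * X2_norm q)"
proof -
  note [measurable] = X2_measurable[OF p] X2_measurable[OF q]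
  let ?J = "\<lambda>\<xi>. (jb \<xi>)\<^sup>2"
  have le: "(jb \<xi>)\<^sup>2 * norm (p \<eta> * q (\<xi> - \<eta>))
     \<le> norm ((2 * p \<eta>) * wt ?J q (\<xi> - \<eta>)) + norm (wt ?J p \<eta> * (2 * q (\<xi> - \<eta>)))" for \<xi> \<eta>
  proof -
    have "(jb \<xi>)\<^sup>2 \<le> (jb \<eta> + jb (\<xi> - \<eta>))\<^sup>2" by (intro power_mono jb_add) simp
    also have "\<dots> \<le> 2 * (jb \<eta>)\<^sup>2 + 2 * (jb (\<xi> - \<eta>))\<^sup>2"
      using sum_squares_bound[of "jb \<eta>" "jb (\<xi> - \<eta>)"] by (simp add: power2_sum)
    finally have "(jb \<xi>)\<^sup>2 * norm (p \<eta> * q (\<xi> - \<eta>)) \<le> (2 * (jb \<eta>)\<^sup>2 + 2 * (jb (\<xi> - \<eta>))\<^sup>2) * norm (p \<eta> * q (\<xi> - \<eta>))"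
      by (intro mult_right_mono) auto
    then show ?thesis by (simp add: norm_mult norm_wt algebra_simps)
  qed
  have i: "integrable lborel (\<lambda>\<eta>. 2 * p \<eta>)" "integrable lborel (\<lambda>\<eta>. 2 * q \<eta>)" using X2_self(3) p q by auto
  note * = conv_weight[of p q ?J, OF _ _ _ _ i(1) X2_wt_L2[OF q] i(2) X2_wt_L2[OF p] le]
  show "conv p q \<in> X2" using * by (auto simp: X2_def)
  have "X2_norm (conv p q) \<le> 2 * ((2 * (LINT x|lborel. norm (p x))) * X2_norm q + (2 * (LINT x|lborel. norm (q x))) * X2_norm p)"
    using * by (simp add: X2_norm_def norm_mult)
  also have "\<dots> \<le> 2 * ((2 * (inv_jb_norm * X2_norm p)) * X2_norm q + (2 * (inv_jb_norm * X2_norm q)) * X2_norm p)"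
    by (intro mult_left_mono add_mono mult_right_mono X2_self(4) p q) auto
  finally show "X2_norm (conv p q) \<le> 8 * inv_jb_norm * (X2_norm p * X2_norm q)" by (simp add: algebra_simps)
qed

section \<open>Trilinear integrals over frequencies with sum zero\<close>

lemma nn_pair_swap:
  assumes [measurable]: "(\<lambda>(x, y). f x y) \<in> borel_measurable (borel \<Otimes>\<^sub>M borel)"
  shows "(\<integral>\<^sup>+p. \<integral>\<^sup>+q. f p q \<partial>lborel \<partial>lborel) = (\<integral>\<^sup>+p. \<integral>\<^sup>+q. f q p \<partial>lborel \<partial>lborel)"
  by (rule lborel_pair.Fubini'[symmetric]) (use assms in measurable)

lemma nn_pair_third:
  fixes f :: "real \<Rightarrow> real \<Rightarrow> ennreal"
  assumes [measurable]: "(\<lambda>(x, y). f x y) \<in> borel_measurable (borel \<Otimes>\<^sub>M borel)"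
  shows "(\<integral>\<^sup>+p. \<integral>\<^sup>+q. f p (- p - q) \<partial>lborel \<partial>lborel) = (\<integral>\<^sup>+p. \<integral>\<^sup>+q. f p q \<partial>lborel \<partial>lborel)"
  by (intro nn_integral_cong nn_integral_reflect_shift) measurable

lemma L2_third: "F \<in> L2_space \<Longrightarrow> (\<lambda>q. F (- p - q)) \<in> L2_space"
  using L2_shift[OF L2_reflect, of F p] by simp

lemma L2_norm_third: "L2_norm (\<lambda>q. F (- p - q)) = L2_norm F"
  using L2_norm_shift[of "\<lambda>x. F (- x)" p] L2_norm_reflect[of F] by simp

text \<open>Cauchy-Schwarz in q, uniformly in p, followed by the L1 norm in p. The two variants
  below put the integrable factor in the other positions by a change of variables.\<close>

lemma triple_nn:
  fixes K :: "real \<Rightarrow> complex"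
  assumes K: "integrable lborel K" and F: "F \<in> L2_space" and H: "H \<in> L2_space"
  shows "(\<integral>\<^sup>+p. \<integral>\<^sup>+q. ennreal (norm (K p) * norm (F q) * norm (H (- p - q))) \<partial>lborel \<partial>lborel)
    \<le> ennreal ((LINT x|lborel. norm (K x)) * L2_norm F * L2_norm H)" (is "?L \<le> _")
proof -
  note [measurable] = borel_measurable_integrable[OF K] L2_measurable[OF F] L2_measurable[OF H]
  have "?L = (\<integral>\<^sup>+p. ennreal (norm (K p)) * (\<integral>\<^sup>+q. ennreal (norm (F q * H (- p - q))) \<partial>lborel) \<partial>lborel)"
    by (subst nn_integral_cmult[symmetric]) (auto simp: norm_mult ennreal_mult mult.assoc)
  also have "\<dots> \<le> (\<integral>\<^sup>+p. ennreal (norm (K p)) * ennreal (L2_norm F * L2_norm H) \<partial>lborel)"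
    using L2_CS_nn[OF F L2_third[OF H]] unfolding L2_norm_third by (intro nn_integral_mono mult_left_mono) auto
  also have "\<dots> = ennreal (LINT x|lborel. norm (K x)) * ennreal (L2_norm F * L2_norm H)"
    using nn_integral_eq_integral[OF integrable_norm[OF K]] by (subst nn_integral_multc) auto
  finally show ?thesis by (simp add: mult.assoc integral_nonneg_AE flip: ennreal_mult)
qed

lemma triple_nn_3:
  fixes K :: "real \<Rightarrow> complex"
  assumes K: "integrable lborel K" and F: "F \<in> L2_space" and H: "H \<in> L2_space"
  shows "(\<integral>\<^sup>+p. \<integral>\<^sup>+q. ennreal (norm (F p) * norm (H q) * norm (K (- p - q))) \<partial>lborel \<partial>lborel)
    \<le> ennreal ((LINT x|lborel. norm (K x)) * L2_norm F * L2_norm H)" (is "?L \<le> _")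
proof -
  note [measurable] = borel_measurable_integrable[OF K] L2_measurable[OF F] L2_measurable[OF H]
  have "?L = (\<integral>\<^sup>+p. \<integral>\<^sup>+q. ennreal (norm (F p) * norm (H (- p - q)) * norm (K q)) \<partial>lborel \<partial>lborel)"
    using nn_pair_third[of "\<lambda>p q. ennreal (norm (F p) * norm (H q) * norm (K (- p - q)))"] by simp
  also have "\<dots> = (\<integral>\<^sup>+p. \<integral>\<^sup>+q. ennreal (norm (F q) * norm (H (- q - p)) * norm (K p)) \<partial>lborel \<partial>lborel)"
    by (rule nn_pair_swap) measurable
  also have "\<dots> = (\<integral>\<^sup>+p. \<integral>\<^sup>+q. ennreal (norm (K p) * norm (F q) * norm (H (- p - q))) \<partial>lborel \<partial>lborel)"
    by (intro nn_integral_cong) (simp add: mult_ac minus_diff_commute)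
  also note triple_nn[OF K F H]
  finally show ?thesis .
qed

lemma triple_nn_2:
  fixes K :: "real \<Rightarrow> complex"
  assumes K: "integrable lborel K" and F: "F \<in> L2_space" and H: "H \<in> L2_space"
  shows "(\<integral>\<^sup>+p. \<integral>\<^sup>+q. ennreal (norm (F p) * norm (K q) * norm (H (- p - q))) \<partial>lborel \<partial>lborel)
    \<le> ennreal ((LINT x|lborel. norm (K x)) * L2_norm F * L2_norm H)" (is "?L \<le> _")
proof -
  note [measurable] = borel_measurable_integrable[OF K] L2_measurable[OF F] L2_measurable[OF H]
  have "?L = (\<integral>\<^sup>+p. \<integral>\<^sup>+q. ennreal (norm (F q) * norm (K p) * norm (H (- q - p))) \<partial>lborel \<partial>lborel)"
    by (rule nn_pair_swap) measurable
  also have "\<dots> = (\<integral>\<^sup>+p. \<integral>\<^sup>+q. ennreal (norm (K p) * norm (F q) * norm (H (- p - q))) \<partial>lborel \<partial>lborel)"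
    by (intro nn_integral_cong) (simp add: mult_ac minus_diff_commute)
  also note triple_nn[OF K F H]
  finally show ?thesis .
qed

text \<open>Each monomial of \<open>Jj\<close> has one slot with a single \<open>jb\<close>, filled
  by the integrable function K, and two slots with \<open>jb\<close> squared, filled by F in L2; the
  three monomials match the three positions of the integrable factor.\<close>

lemma triple_Jj:
  assumes A: "A \<in> X2"
  shows "(\<integral>\<^sup>+p. \<integral>\<^sup>+q. ennreal (Jj p q (- p - q) * norm (A p * A q * A (- p - q))) \<partial>lborel \<partial>lborel)
    \<le> ennreal (3 * inv_jb_norm * (X2_norm A)^3)" (is "?L \<le> _")
proof -
  note [measurable] = X2_measurable[OF A]
  define F where "F = wt (\<lambda>\<xi>. (jb \<xi>)\<^sup>2) A"
  define K where "K = wt jb A"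
  have F: "F \<in> L2_space" "L2_norm F = X2_norm A" and K: "integrable lborel K" "(LINT x|lborel. norm (K x)) \<le> inv_jb_norm * X2_norm A"
    using X2_wt_L2[OF A] X2_j[OF A] by (auto simp: F_def K_def X2_norm_def)
  note [measurable] = L2_measurable[OF F(1)] borel_measurable_integrable[OF K(1)]
  have split: "ennreal (Jj p q r * norm (A p * A q * A r)) = ennreal (norm (K p) * norm (F q) * norm (F r))
     + ennreal (norm (F p) * norm (K q) * norm (F r)) + ennreal (norm (F p) * norm (F q) * norm (K r))" for p q r
    by (simp add: F_def K_def norm_wt Jj_def norm_mult algebra_simps flip: ennreal_plus)
  have "?L = (\<integral>\<^sup>+p. \<integral>\<^sup>+q. ennreal (norm (K p) * norm (F q) * norm (F (- p - q))) \<partial>lborel \<partial>lborel)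
    + (\<integral>\<^sup>+p. \<integral>\<^sup>+q. ennreal (norm (F p) * norm (K q) * norm (F (- p - q))) \<partial>lborel \<partial>lborel)
    + (\<integral>\<^sup>+p. \<integral>\<^sup>+q. ennreal (norm (F p) * norm (F q) * norm (K (- p - q))) \<partial>lborel \<partial>lborel)"
    unfolding split by (simp add: nn_integral_add)
  also have "\<dots> \<le> ennreal ((LINT x|lborel. norm (K x)) * L2_norm F * L2_norm F)
     + ennreal ((LINT x|lborel. norm (K x)) * L2_norm F * L2_norm F) + ennreal ((LINT x|lborel. norm (K x)) * L2_norm F * L2_norm F)"
    by (intro add_mono triple_nn triple_nn_2 triple_nn_3 K F)
  also have "\<dots> = ennreal (3 * ((LINT x|lborel. norm (K x)) * L2_norm F * L2_norm F))"
    by (simp add: integral_nonneg_AE flip: ennreal_plus)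
  also have "\<dots> \<le> ennreal (3 * ((inv_jb_norm * X2_norm A) * X2_norm A * X2_norm A))"
    unfolding F(2) by (intro ennreal_leI mult_left_mono mult_right_mono K) auto
  finally show ?thesis by (simp add: power3_eq_cube mult_ac)
qed

lemma pair_integrableI:
  fixes f :: "real \<Rightarrow> real \<Rightarrow> complex"
  assumes [measurable]: "(\<lambda>(x, y). f x y) \<in> borel_measurable (borel \<Otimes>\<^sub>M borel)"
    and le: "(\<integral>\<^sup>+p. \<integral>\<^sup>+q. ennreal (norm (f p q)) \<partial>lborel \<partial>lborel) \<le> ennreal B" and B: "0 \<le> B"
  shows "integrable (lborel \<Otimes>\<^sub>M lborel) (\<lambda>(p, q). f p q)"
    and "norm (LINT p|lborel. LINT q|lborel. f p q) \<le> B"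
proof -
  have [measurable]: "(\<lambda>(x, y). f x y) \<in> borel_measurable (lborel \<Otimes>\<^sub>M lborel)"
    using assms(1) by measurable
  have eq: "(\<integral>\<^sup>+z. ennreal (norm (case z of (p, q) \<Rightarrow> f p q)) \<partial>(lborel \<Otimes>\<^sub>M lborel))
     = (\<integral>\<^sup>+p. \<integral>\<^sup>+q. ennreal (norm (f p q)) \<partial>lborel \<partial>lborel)"
    by (subst lborel.nn_integral_fst[symmetric]) auto
  show i: "integrable (lborel \<Otimes>\<^sub>M lborel) (\<lambda>(p, q). f p q)"
  proof (rule integrableI_bounded)
    show "(\<integral>\<^sup>+z. ennreal (norm (case z of (p, q) \<Rightarrow> f p q)) \<partial>(lborel \<Otimes>\<^sub>M lborel)) < \<infinity>"
      unfolding eq using le_less_trans[OF le ennreal_less_top] by simp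
  qed measurable
  have "ennreal (norm (integral\<^sup>L (lborel \<Otimes>\<^sub>M lborel) (\<lambda>(p, q). f p q))) \<le> ennreal B"
    using order_trans[OF integral_norm_bound_ennreal[OF i]] le unfolding eq by blast
  then show "norm (LINT p|lborel. LINT q|lborel. f p q) \<le> B"
    using lborel_pair.integral_fst'[OF i] B by (simp add: ennreal_le_iff)
qed

lemma pair_integral_third:
  fixes f :: "real \<Rightarrow> real \<Rightarrow> complex"
  shows "(LINT p|lborel. LINT q|lborel. f p (- p - q)) = (LINT p|lborel. LINT q|lborel. f p q)"
proof (rule Bochner_Integration.integral_cong[OF refl])
  fix p show "(LINT q|lborel. f p (- p - q)) = (LINT q|lborel. f p q)"
    using lborel_integral_real_affine[of "-1" "f p" "- p"] by simp
qed

section \<open>The cubic and quartic terms of the energy identity\<close>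

lemma norm_gw_product:
  "norm (wt (gw \<sigma> N) a x * wt (gw \<sigma> N) a y * wt (gw \<sigma> N) a z)
     = (gw \<sigma> N x * gw \<sigma> N y * gw \<sigma> N z) * norm (a x * a y * a z)"
  by (simp add: norm_mult norm_wt)

text \<open>The bound cosh (\<sigma> * N) blows up with N; it provides finiteness, while the
  quantitative estimates are uniform in N.\<close>

lemma X2_gw:
  assumes s: "0 \<le> \<sigma>" "0 \<le> N" and a: "a \<in> X2"
  shows "wt (gw \<sigma> N) a \<in> X2"
proof -
  note [measurable] = X2_measurable[OF a]
  have "wt (\<lambda>\<xi>. (jb \<xi>)\<^sup>2) (wt (gw \<sigma> N) a) \<in> L2_space"
  proof (rule L2_dominated(1)[OF _ X2_wt_L2[OF a]])
    show "AE \<xi> in lborel. norm (wt (\<lambda>\<xi>. (jb \<xi>)\<^sup>2) (wt (gw \<sigma> N) a) \<xi>) \<le> cosh (\<sigma> * N) * norm (wt (\<lambda>\<xi>. (jb \<xi>)\<^sup>2) a \<xi>)"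
      using gw_bounded[OF s] by (intro AE_I2) (simp add: norm_wt mult_left_mono mult_right_mono mult.left_commute)
  qed auto
  then show ?thesis by (simp add: X2_def)
qed

definition ixi_mult :: "(real \<Rightarrow> complex) \<Rightarrow> real \<Rightarrow> complex" where
  "ixi_mult a = (\<lambda>\<xi>. \<i> * of_real \<xi> * a \<xi>)"

text \<open>The quadratic part of the nonlinearity multiplied by \<open>Dn\<close>, up to the factor
  1 / (2 pi); see \<open>Dn_Fhat\<close>.\<close>

definition quad_part :: "(real \<Rightarrow> complex) \<Rightarrow> real \<Rightarrow> complex" where
  "quad_part a \<xi> = of_real (\<xi> * (3/4 - 7/48 * \<xi>\<^sup>2)) * conv a a \<xi> - 7/48 * of_real \<xi> * conv (ixi_mult a) (ixi_mult a) \<xi>"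

lemma conv_ixi_mult: "conv (ixi_mult p) (ixi_mult q) \<xi> = - conv (wt (\<lambda>\<xi>. \<xi>) p) (wt (\<lambda>\<xi>. \<xi>) q) \<xi>"
proof -
  have "(\<i> * of_real \<eta> * p \<eta>) * (\<i> * of_real (\<xi> - \<eta>) * q (\<xi> - \<eta>))
     = - ((of_real \<eta> * p \<eta>) * (of_real (\<xi> - \<eta>) * q (\<xi> - \<eta>)))" for \<eta>
  proof -
    have "(\<i> * of_real \<eta> * p \<eta>) * (\<i> * of_real (\<xi> - \<eta>) * q (\<xi> - \<eta>))
       = (\<i> * \<i>) * ((of_real \<eta> * p \<eta>) * (of_real (\<xi> - \<eta>) * q (\<xi> - \<eta>)))" by (simp only: ac_simps)
    then show ?thesis by simp
  qed
  then show ?thesis unfolding conv_def ixi_mult_def wt_def by (simp only: integral_minus)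
qed

text \<open>With r = - p - q, the integral I of U p q does not change when the weighted frequency p
  is replaced by q or by r. Hence 3 I is the integral of the symmetrised symbol, to which
  \<open>symmetrized_symbol_le\<close> and \<open>triple_Jj\<close> apply; the factor 3 cancels at
  the end. Fubini's theorem needs absolute convergence before symmetrisation, which the boundedness
  of the truncated weight provides.\<close>

lemma cubic_form_bound:
  assumes s: "0 \<le> \<sigma>" "0 \<le> N" and a: "a \<in> X2"
  shows "norm (LINT \<xi>|lborel. of_real ((gw \<sigma> N \<xi>)\<^sup>2) * a (- \<xi>) * quad_part a \<xi>)
     \<le> 12 * \<sigma>\<^sup>2 * inv_jb_norm * (X2_norm (wt (gw \<sigma> N) a))^3"
proof -
  note [measurable] = X2_measurable[OF a]
  define A where "A = wt (gw \<sigma> N) a"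
  have A: "A \<in> X2" unfolding A_def by (rule X2_gw[OF s a])
  define m where "m = (\<lambda>t. (gw \<sigma> N t)\<^sup>2)"
  have [measurable]: "m \<in> borel_measurable borel" unfolding m_def by measurable
  have m0: "0 \<le> m t" "m t \<le> (cosh (\<sigma> * N))\<^sup>2" for t
    unfolding m_def by (auto intro!: power_mono gw_bounded[OF s])
  \<comment> \<open>The frequency t carries the weight and q stands for the product of all three.
    The minus sign comes from the reflection \<xi> = - p.\<close>
  define \<kappa> where "\<kappa> t q = - m t * (3/4 * t - 7/48 * t^3 + 7/48 * q)" for t q
  define aaa where "aaa p q r = a p * a q * a r" for p q r
  define U where "U p q = of_real (\<kappa> p (p * q * (- p - q))) * aaa p q (- p - q)" for p q
  have U_def': "U = (\<lambda>p q. of_real (- m p * (3/4 * p - 7/48 * p^3 + 7/48 * (p * q * (- p - q)))) * (a p * a q * a (- p - q)))"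
    by (simp add: U_def \<kappa>_def aaa_def fun_eq_iff)
  have mU: "(\<lambda>(x, y). U x y) \<in> borel_measurable (borel \<Otimes>\<^sub>M borel)"
    "(\<lambda>(x, y). U y x) \<in> borel_measurable (borel \<Otimes>\<^sub>M borel)"
    "(\<lambda>(x, y). U (- x - y) x) \<in> borel_measurable (borel \<Otimes>\<^sub>M borel)"
    unfolding U_def' by measurable
  have swap: "U q p = of_real (\<kappa> q (p * q * (- p - q))) * aaa p q (- p - q)"
    and third: "U (- p - q) p = of_real (\<kappa> (- p - q) (p * q * (- p - q))) * aaa p q (- p - q)" for p q
  proof -
    have e: "- q - p = - p - q" "- (- p - q) - p = q" by simp_all
    show "U q p = of_real (\<kappa> q (p * q * (- p - q))) * aaa p q (- p - q)"
      "U (- p - q) p = of_real (\<kappa> (- p - q) (p * q * (- p - q))) * aaa p q (- p - q)"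
      unfolding U_def aaa_def e by (simp_all add: ac_simps)
  qed
  \<comment> \<open>A crude bound that depends on N, for absolute convergence only; the 2 dominates
    3/4 + 7/48 + 7/48.\<close>
  define C where "C = 2 * (cosh (\<sigma> * N))\<^sup>2"
  have \<kappa>_le: "\<bar>\<kappa> t (p * q * r)\<bar> \<le> C * Jj p q r" if r: "p + q + r = 0" and t: "\<bar>t\<bar>^3 \<le> Jj p q r" "\<bar>t\<bar> \<le> Jj p q r" for p q r t
  proof -
    have "\<bar>3/4 * t - 7/48 * t^3 + 7/48 * (p * q * r)\<bar> \<le> 3/4 * \<bar>t\<bar> + 7/48 * \<bar>t\<bar>^3 + 7/48 * \<bar>p * q * r\<bar>"
    proof -
      have "\<bar>x - y + z\<bar> \<le> \<bar>x\<bar> + \<bar>y\<bar> + \<bar>z\<bar>" for x y z :: real by linarith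
      from this[of "3/4 * t" "7/48 * t^3" "7/48 * (p * q * r)"] show ?thesis
        by (simp only: abs_mult power_abs abs_divide abs_numeral)
    qed
    also have "\<dots> \<le> 3/4 * Jj p q r + 7/48 * Jj p q r + 7/48 * Jj p q r"
      by (intro add_mono mult_left_mono t abs_triple_le_Jj) auto
    also have "\<dots> \<le> 2 * Jj p q r" using Jj_nonneg[of p q r] by simp
    finally have "m t * \<bar>3/4 * t - 7/48 * t^3 + 7/48 * (p * q * r)\<bar> \<le> (cosh (\<sigma> * N))\<^sup>2 * (2 * Jj p q r)"
      by (intro mult_mono m0) auto
    then show ?thesis using m0(1)[of t] by (simp add: \<kappa>_def abs_mult C_def)
  qed
  have C0: "0 \<le> C" by (simp add: C_def)
  have abs_le: "\<bar>z\<bar> \<le> Jj x y z" for x y z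
  proof -
    have "\<bar>z\<bar> \<le> jb z" by (rule jb_abs)
    also have "1 * 1 * jb z \<le> (jb x)\<^sup>2 * (jb y)\<^sup>2 * jb z"
      by (intro mult_mono mult_nonneg_nonneg order_trans[OF jb_ge_1 jb_le_sq]) auto
    also have "\<dots> \<le> Jj x y z" by (simp add: Jj_def)
    finally show ?thesis by simp
  qed
  have bound: "(\<integral>\<^sup>+p. \<integral>\<^sup>+q. ennreal (norm (V p q)) \<partial>lborel \<partial>lborel) \<le> ennreal (C * (3 * inv_jb_norm * (X2_norm a)^3))"
    if V: "\<And>p q. norm (V p q) \<le> C * (Jj p q (- p - q) * norm (aaa p q (- p - q)))" for V :: "real \<Rightarrow> real \<Rightarrow> complex"
  proof -
    have "(\<integral>\<^sup>+p. \<integral>\<^sup>+q. ennreal (norm (V p q)) \<partial>lborel \<partial>lborel)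
      \<le> (\<integral>\<^sup>+p. \<integral>\<^sup>+q. ennreal C * ennreal (Jj p q (- p - q) * norm (a p * a q * a (- p - q))) \<partial>lborel \<partial>lborel)"
      using V C0 Jj_nonneg by (intro nn_integral_mono) (simp add: aaa_def ennreal_leI flip: ennreal_mult)
    also have "\<dots> = ennreal C * (\<integral>\<^sup>+p. \<integral>\<^sup>+q. ennreal (Jj p q (- p - q) * norm (a p * a q * a (- p - q))) \<partial>lborel \<partial>lborel)"
      unfolding Jj_def by (simp add: nn_integral_cmult)
    also have "\<dots> \<le> ennreal C * ennreal (3 * inv_jb_norm * (X2_norm a)^3)"
      by (intro mult_left_mono triple_Jj a) auto
    finally show ?thesis using C0 by (simp add: ennreal_mult)
  qed
  have B0: "0 \<le> C * (3 * inv_jb_norm * (X2_norm a)^3)" using C0 by simp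
  have Jc: "Jj p q r = Jj q r p" "Jj p q r = Jj p r q" for p q r by (auto simp: Jj_def)
  have iU: "integrable (lborel \<Otimes>\<^sub>M lborel) (\<lambda>(p, q). U p q)"
  proof (rule pair_integrableI(1)[OF mU(1) bound B0])
    fix p q
    have "\<bar>\<kappa> p (p * q * (- p - q))\<bar> \<le> C * Jj p q (- p - q)"
      using cube_le_Jj[of q "- p - q" p] abs_le[of p q "- p - q"] Jc(1)[of p q "- p - q"]
      by (intro \<kappa>_le) auto
    then show "norm (U p q) \<le> C * (Jj p q (- p - q) * norm (aaa p q (- p - q)))"
      unfolding U_def norm_mult norm_of_real by (simp add: mult_right_mono flip: mult.assoc)
  qed
  have iV: "integrable (lborel \<Otimes>\<^sub>M lborel) (\<lambda>(p, q). U q p)"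
  proof (rule pair_integrableI(1)[OF mU(2) bound B0])
    fix p q
    have "\<bar>\<kappa> q (p * q * (- p - q))\<bar> \<le> C * Jj p q (- p - q)"
      using cube_le_Jj[of p "- p - q" q] abs_le[of q p "- p - q"] Jc(2)[of p q "- p - q"]
      by (intro \<kappa>_le) auto
    then show "norm (U q p) \<le> C * (Jj p q (- p - q) * norm (aaa p q (- p - q)))"
      unfolding swap norm_mult norm_of_real by (simp add: mult_right_mono flip: mult.assoc)
  qed
  have iW: "integrable (lborel \<Otimes>\<^sub>M lborel) (\<lambda>(p, q). U (- p - q) p)"
  proof (rule pair_integrableI(1)[OF mU(3) bound B0])
    fix p q
    have "\<bar>\<kappa> (- p - q) (p * q * (- p - q))\<bar> \<le> C * Jj p q (- p - q)"
      using cube_le_Jj[of p q "- p - q"] abs_le[of "- p - q" p q] by (intro \<kappa>_le) auto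
    then show "norm (U (- p - q) p) \<le> C * (Jj p q (- p - q) * norm (aaa p q (- p - q)))"
      unfolding third norm_mult norm_of_real by (simp add: mult_right_mono flip: mult.assoc)
  qed
  define I where "I = (LINT p|lborel. LINT q|lborel. U p q)"
  \<comment> \<open>Exchanging the variables and substituting - p - q for q suffice to bring each of
    the three frequencies to the place that carries the weight.\<close>
  have eV: "(LINT p|lborel. LINT q|lborel. U q p) = I"
    unfolding I_def by (rule lborel_pair.Fubini_integral[OF iU])
  have eW: "(LINT p|lborel. LINT q|lborel. U (- p - q) p) = I"
    unfolding eV[symmetric] by (rule pair_integral_third[of "\<lambda>p q. U q p"])
  have "(LINT p|lborel. LINT q|lborel. U p q + U q p + U (- p - q) p) = 3 * I"
  proof -
    have "(LINT p|lborel. LINT q|lborel. U p q + U q p + U (- p - q) p)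
      = integral\<^sup>L (lborel \<Otimes>\<^sub>M lborel) (\<lambda>z. (case z of (p, q) \<Rightarrow> U p q) + (case z of (p, q) \<Rightarrow> U q p) + (case z of (p, q) \<Rightarrow> U (- p - q) p))"
      using iU iV iW by (subst lborel_pair.integral_fst'[symmetric]) (auto intro!: Bochner_Integration.integrable_add)
    also have "\<dots> = integral\<^sup>L (lborel \<Otimes>\<^sub>M lborel) (\<lambda>(p, q). U p q)
       + integral\<^sup>L (lborel \<Otimes>\<^sub>M lborel) (\<lambda>(p, q). U q p) + integral\<^sup>L (lborel \<Otimes>\<^sub>M lborel) (\<lambda>(p, q). U (- p - q) p)"
      using iU iV iW by (simp add: Bochner_Integration.integral_add)
    also have "\<dots> = I + I + I"
      using lborel_pair.integral_fst'[OF iU] lborel_pair.integral_fst'[OF iV] lborel_pair.integral_fst'[OF iW] eV eW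
      by (simp add: I_def)
    finally show ?thesis by simp
  qed
  moreover have "norm (LINT p|lborel. LINT q|lborel. U p q + U q p + U (- p - q) p) \<le> 12 * \<sigma>\<^sup>2 * (3 * inv_jb_norm * (X2_norm A)^3)"
  proof (rule pair_integrableI(2))
    have [measurable]: "A \<in> borel_measurable borel" using A by (rule X2_measurable)
    have pt: "norm (U p q + U q p + U (- p - q) p) \<le> 12 * \<sigma>\<^sup>2 * (Jj p q (- p - q) * norm (A p * A q * A (- p - q)))" for p q
    proof -
      define r where "r = - p - q"
      have r: "p + q + r = 0" by (simp add: r_def)
      have "U p q + U q p + U (- p - q) p = of_real (\<kappa> p (p * q * r) + \<kappa> q (p * q * r) + \<kappa> r (p * q * r)) * aaa p q r"
        unfolding swap[where p=p and q=q] third[where p=p and q=q] unfolding U_def r_def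
        by (simp only: of_real_add distrib_right)
      also have "\<kappa> p (p * q * r) + \<kappa> q (p * q * r) + \<kappa> r (p * q * r)
        = - (\<Sum>t\<leftarrow>[p, q, r]. (gw \<sigma> N t)\<^sup>2 * (3/4 * t - 7/48 * t^3 + 7/48 * (p * q * r)))"
        by (simp add: \<kappa>_def m_def)
      finally have "norm (U p q + U q p + U (- p - q) p)
        = \<bar>\<Sum>t\<leftarrow>[p, q, r]. (gw \<sigma> N t)\<^sup>2 * (3/4 * t - 7/48 * t^3 + 7/48 * (p * q * r))\<bar> * norm (aaa p q r)"
        by (simp only: norm_mult norm_of_real abs_minus_cancel)
      also have "\<dots> \<le> 12 * \<sigma>\<^sup>2 * (Jj p q r * (gw \<sigma> N p * gw \<sigma> N q * gw \<sigma> N r)) * norm (aaa p q r)"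
        by (intro mult_right_mono symmetrized_symbol_le s r) auto
      also have "\<dots> = 12 * \<sigma>\<^sup>2 * (Jj p q r * norm (A p * A q * A r))"
        unfolding A_def norm_gw_product aaa_def by simp
      finally show ?thesis by (simp only: r_def)
    qed
    have "(\<integral>\<^sup>+p. \<integral>\<^sup>+q. ennreal (norm (U p q + U q p + U (- p - q) p)) \<partial>lborel \<partial>lborel)
       \<le> (\<integral>\<^sup>+p. \<integral>\<^sup>+q. ennreal (12 * \<sigma>\<^sup>2) * ennreal (Jj p q (- p - q) * norm (A p * A q * A (- p - q))) \<partial>lborel \<partial>lborel)"
      using pt Jj_nonneg by (intro nn_integral_mono) (simp add: ennreal_leI flip: ennreal_mult)
    also have "\<dots> = ennreal (12 * \<sigma>\<^sup>2) * (\<integral>\<^sup>+p. \<integral>\<^sup>+q. ennreal (Jj p q (- p - q) * norm (A p * A q * A (- p - q))) \<partial>lborel \<partial>lborel)"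
      unfolding Jj_def by (simp add: nn_integral_cmult)
    also have "\<dots> \<le> ennreal (12 * \<sigma>\<^sup>2) * ennreal (3 * inv_jb_norm * (X2_norm A)^3)"
      by (intro mult_left_mono triple_Jj A) auto
    finally show "(\<integral>\<^sup>+p. \<integral>\<^sup>+q. ennreal (norm (U p q + U q p + U (- p - q) p)) \<partial>lborel \<partial>lborel)
       \<le> ennreal (12 * \<sigma>\<^sup>2 * (3 * inv_jb_norm * (X2_norm A)^3))"
      by (subst ennreal_mult) simp_all
    show "(\<lambda>(x, y). U x y + U y x + U (- x - y) x) \<in> borel_measurable (borel \<Otimes>\<^sub>M borel)"
      unfolding U_def' by measurable
  qed simp
  ultimately have "norm (3 * I) \<le> 12 * \<sigma>\<^sup>2 * (3 * inv_jb_norm * (X2_norm A)^3)" by simp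
  then have nI: "norm I \<le> 12 * \<sigma>\<^sup>2 * inv_jb_norm * (X2_norm A)^3" by (simp add: norm_mult mult_ac)
  \<comment> \<open>After the reflection \<xi> = - p the convolution is an integral of a(q) a(-p-q),
    so the three frequencies add up to zero.\<close>
  have "(LINT \<xi>|lborel. of_real ((gw \<sigma> N \<xi>)\<^sup>2) * a (- \<xi>) * quad_part a \<xi>)
     = (LINT p|lborel. of_real (m p) * a p * quad_part a (- p))"
    by (subst lborel_integral_reflect[symmetric]) (simp add: m_def)
  also have "\<dots> = I"
    unfolding I_def
  proof (rule Bochner_Integration.integral_cong[OF refl])
    fix p
    have i1: "integrable lborel (\<lambda>q. a q * a (- p - q))"
      by (intro L2_mult_integrable L2_third X2_self a)
    have i2: "integrable lborel (\<lambda>q. wt (\<lambda>\<xi>. \<xi>) a q * wt (\<lambda>\<xi>. \<xi>) a (- p - q))"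
      by (intro L2_mult_integrable L2_third X2_mult_id a)
    have "U p q = of_real (m p) * a p * (of_real (- p * (3/4 - 7/48 * p\<^sup>2)) * (a q * a (- p - q))
        + of_real (- (7/48) * p) * (wt (\<lambda>\<xi>. \<xi>) a q * wt (\<lambda>\<xi>. \<xi>) a (- p - q)))" for q
    proof -
      define r where "r = - p - q"
      have k: "of_real (\<kappa> p (p * q * r)) = (of_real (m p) * (of_real (- p * (3/4 - 7/48 * p\<^sup>2)) + of_real (- (7/48) * p) * (of_real q * of_real r)) :: complex)"
        unfolding of_real_mult[symmetric] of_real_add[symmetric] \<kappa>_def
        by (rule arg_cong[where f=of_real]) (simp add: algebra_simps power2_eq_square power3_eq_cube)
      show ?thesis unfolding U_def r_def[symmetric] aaa_def wt_def k
        by (simp only: distrib_left distrib_right ac_simps)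
    qed
    then have "(LINT q|lborel. U p q) = of_real (m p) * a p * (of_real (- p * (3/4 - 7/48 * p\<^sup>2)) * conv a a (- p)
        + of_real (- (7/48) * p) * conv (wt (\<lambda>\<xi>. \<xi>) a) (wt (\<lambda>\<xi>. \<xi>) a) (- p))"
      unfolding conv_def using i1 i2 by (simp only: integral_mult_right_zero Bochner_Integration.integral_add integrable_mult_right)
    then show "of_real (m p) * a p * quad_part a (- p) = (LINT q|lborel. U p q)"
      unfolding quad_part_def conv_ixi_mult by simp
  qed
  finally show ?thesis using nI by (simp only: A_def)
qed

text \<open>Pairing two of the four factors as b = conv a a gives a trilinear form in a, b, a whose
  symbol is the frequency of one \<open>a\<close>. For weight 1, exchanging the two outer factors
  averages this symbol to half of - q, and an odd integral in q remains. What is left carries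
  \<open>gexc\<close> and is estimated with b in a space weighted by \<open>jb\<close> and
  \<open>gw\<close>.\<close>

lemma quartic_form_bound:
  assumes s: "0 \<le> \<sigma>" "0 \<le> N" and a: "a \<in> X2"
  shows "norm (LINT \<xi>|lborel. of_real ((gw \<sigma> N \<xi>)\<^sup>2) * a (- \<xi>) * (of_real \<xi> * conv (conv a a) a \<xi>))
     \<le> 16 * \<sigma>\<^sup>2 * inv_jb_norm\<^sup>2 * (X2_norm (wt (gw \<sigma> N) a))^4"
proof -
  note [measurable] = X2_measurable[OF a]
  define A where "A = wt (gw \<sigma> N) a"
  have A: "A \<in> X2" unfolding A_def by (rule X2_gw[OF s a])
  note [measurable] = X2_measurable[OF A]
  define b where "b = conv a a"
  have b: "b \<in> X2" unfolding b_def by (rule X2_conv[OF a a])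
  note [measurable] = X2_measurable[OF b]
  define aba where "aba p q = a p * b q * a (- p - q)" for p q
  have [measurable]: "(\<lambda>(x, y). aba x y) \<in> borel_measurable (borel \<Otimes>\<^sub>M borel)"
    unfolding aba_def by measurable
  define U where "U p q = of_real p * aba p q" for p q
  define G where "G p q = of_real (gexc \<sigma> N p * p) * aba p q" for p q
  have [measurable]: "gexc \<sigma> N \<in> borel_measurable borel"
  proof -
    have "gexc \<sigma> N = (\<lambda>t. (gw \<sigma> N t)\<^sup>2 - 1)" by (simp add: gw_square)
    then show ?thesis by simp
  qed
  have mU: "(\<lambda>(x, y). U x y) \<in> borel_measurable (borel \<Otimes>\<^sub>M borel)"
    and mG: "(\<lambda>(x, y). G x y) \<in> borel_measurable (borel \<Otimes>\<^sub>M borel)"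
    unfolding U_def G_def by measurable
  have iU: "integrable (lborel \<Otimes>\<^sub>M lborel) (\<lambda>(p, q). U p q)"
  proof (rule pair_integrableI(1)[OF mU])
    show "(\<integral>\<^sup>+p. \<integral>\<^sup>+q. ennreal (norm (U p q)) \<partial>lborel \<partial>lborel)
       \<le> ennreal ((LINT x|lborel. norm (a x)) * L2_norm (wt (\<lambda>\<xi>. \<xi>) a) * L2_norm b)"
      using triple_nn_3[OF X2_self(3)[OF a a] X2_mult_id(1)[OF a] X2_self(1)[OF b b]]
      by (simp add: U_def aba_def norm_mult wt_def mult_ac)
  qed (simp add: integral_nonneg_AE)
  have Ub: "(LINT p|lborel. LINT q|lborel. U p q) = 0"
  proof -
    let ?Z = "LINT q|lborel. LINT p|lborel. U p q"
    have "(LINT p|lborel. LINT q|lborel. U p q) = ?Z"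
      by (rule lborel_pair.Fubini_integral[OF iU, symmetric])
    moreover have Z2: "(LINT q|lborel. LINT p|lborel. U (- q - p) q) = ?Z"
      by (rule pair_integral_third[of "\<lambda>q p. U p q"])
    moreover have "(LINT q|lborel. LINT p|lborel. U p q) + (LINT q|lborel. LINT p|lborel. U (- q - p) q) = 0"
    proof -
      have eq: "- p - q = - q - p" for p q :: real by simp
      have i: "integrable lborel (\<lambda>p. U p q)" for q
      proof -
        have "integrable lborel (\<lambda>p. b q * (wt (\<lambda>\<xi>. \<xi>) a p * a (- q - p)))"
          by (intro integrable_mult_right L2_mult_integrable L2_third X2_mult_id X2_self(1)[OF a a] a)
        then show ?thesis unfolding U_def aba_def wt_def eq[of _ q] by (simp add: mult_ac)
      qed
      have i': "integrable lborel (\<lambda>p. U (- q - p) q)" for q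
        using lborel_integrable_real_affine[OF i[of q], of "-1" "- q"] by simp
      \<comment> \<open>For fixed q the symbol is p in one integral and - q - p in the other. Their
        sum - q does not depend on p, and the remaining integral over p is the convolution b (-
        q).\<close>
      have inner: "(LINT p|lborel. U p q) + (LINT p|lborel. U (- q - p) q) = - (of_real q * b q * b (- q))" for q
      proof -
        have "(LINT p|lborel. U p q) + (LINT p|lborel. U (- q - p) q) = (LINT p|lborel. U p q + U (- q - p) q)"
          by (rule Bochner_Integration.integral_add[OF i i', symmetric])
        also have "\<dots> = (LINT p|lborel. (- of_real q * b q) * (a p * a (- q - p)))"
        proof (rule Bochner_Integration.integral_cong[OF refl])
          fix p
          have e: "- (- q - p) - q = p" by simp
          have "U p q + U (- q - p) q = (of_real p + of_real (- q - p)) * (a p * b q * a (- q - p))"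
            unfolding U_def aba_def e eq[of p q] by (simp add: algebra_simps)
          then show "U p q + U (- q - p) q = (- of_real q * b q) * (a p * a (- q - p))" by simp
        qed
        also have "\<dots> = (- of_real q * b q) * b (- q)"
          unfolding b_def[symmetric] by (subst integral_mult_right_zero) (simp add: b_def conv_def)
        finally show ?thesis by simp
      qed
      have i1: "integrable lborel (\<lambda>q. LINT p|lborel. U p q)"
        using lborel_pair.integrable_snd[OF iU] .
      have e2: "(LINT p|lborel. U (- q - p) q) = (LINT p|lborel. U p q)" for q
        using lborel_integral_real_affine[of "-1" "\<lambda>p. U p q" "- q"] by simp
      have "(LINT q|lborel. LINT p|lborel. U p q) + (LINT q|lborel. LINT p|lborel. U (- q - p) q)
        = (LINT q|lborel. - (of_real q * b q * b (- q)))"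
        unfolding inner[symmetric] by (rule Bochner_Integration.integral_add[symmetric]) (simp_all only: e2 i1)
      also have "\<dots> = - (LINT q|lborel. of_real q * b q * b (- q))" by simp
      \<comment> \<open>The integrand is odd.\<close>
      also have "(LINT q|lborel. of_real q * b q * b (- q)) = 0"
      proof -
        have "(LINT q|lborel. of_real q * b q * b (- q)) = (LINT q|lborel. - (of_real q * b q * b (- q)))"
          by (subst lborel_integral_reflect[symmetric]) (simp add: mult_ac)
        then show ?thesis by simp
      qed
      finally show ?thesis by simp
    qed
    ultimately show ?thesis by simp
  qed
  let ?w = "\<lambda>\<xi>. jb \<xi> * gw \<sigma> N \<xi>"
  have jA: "integrable lborel (wt jb A)" "wt jb A \<in> L2_space" using X2_j[OF A] by auto
  \<comment> \<open>The weight \<open>jb * gw\<close> is submultiplicative up to the factor 2, so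
    the first alternative of \<open>conv_weight\<close> suffices and the second is filled with zero
    functions.\<close>
  have wle: "?w \<xi> * norm (a \<eta> * a (\<xi> - \<eta>)) \<le> norm (2 * wt jb A \<eta> * wt jb A (\<xi> - \<eta>)) + norm (0 * (0::complex))" for \<xi> \<eta>
  proof -
    have "gw \<sigma> N \<xi> \<le> 2 * gw \<sigma> N \<eta> * gw \<sigma> N (\<xi> - \<eta>)" by (rule gw_le_mult[OF s]) simp
    then have "?w \<xi> \<le> (jb \<eta> * jb (\<xi> - \<eta>)) * (2 * gw \<sigma> N \<eta> * gw \<sigma> N (\<xi> - \<eta>))"
      by (intro mult_mono jb_mult) auto
    then have "?w \<xi> * norm (a \<eta> * a (\<xi> - \<eta>)) \<le> (jb \<eta> * jb (\<xi> - \<eta>)) * (2 * gw \<sigma> N \<eta> * gw \<sigma> N (\<xi> - \<eta>)) * norm (a \<eta> * a (\<xi> - \<eta>))"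
      by (rule mult_right_mono) simp
    also have "\<dots> = norm (2 * wt jb A \<eta> * wt jb A (\<xi> - \<eta>))" by (simp add: A_def norm_mult norm_wt)
    finally show ?thesis by simp
  qed
  have i2: "integrable lborel (\<lambda>x. 2 * wt jb A x)" using jA by simp
  have H: "wt ?w b \<in> L2_space" "L2_norm (wt ?w b) \<le> 4 * inv_jb_norm * (X2_norm A)\<^sup>2"
  proof -
    note * = conv_weight[of a a ?w, OF _ _ _ _ i2 jA(2) _ _ wle]
    show "wt ?w b \<in> L2_space" unfolding b_def by (rule *(1)) auto
    have "L2_norm (wt ?w b) \<le> 2 * ((LINT x|lborel. norm (2 * wt jb A x)) * L2_norm (wt jb A) + (LINT x::real|lborel. norm (0::complex)) * L2_norm (\<lambda>x. 0))"
      unfolding b_def by (rule *(2)) auto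
    also have "\<dots> = 2 * (2 * ((LINT x|lborel. norm (wt jb A x)) * L2_norm (wt jb A)))" by (simp add: norm_mult)
    also have "\<dots> \<le> 2 * (2 * ((inv_jb_norm * X2_norm A) * X2_norm A))"
      by (intro mult_left_mono mult_mono X2_j[OF A]) auto
    finally show "L2_norm (wt ?w b) \<le> 4 * inv_jb_norm * (X2_norm A)\<^sup>2" by (simp add: power2_eq_square)
  qed
  \<comment> \<open>The 4 collects a 2 from \<open>gexc_triple\<close> and a 2 from the estimate of
    |p| by \<open>jb q * jb r\<close>; the norm of the weighted b contributes another 4, which makes
    16 in the end.\<close>
  define B where "B = 4 * \<sigma>\<^sup>2 * ((LINT x|lborel. norm (wt jb A x)) * L2_norm (wt (\<lambda>\<xi>. (jb \<xi>)\<^sup>2) A) * L2_norm (wt ?w b))"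
  have B0: "0 \<le> B" by (simp add: B_def integral_nonneg_AE)
  have "B \<le> 4 * \<sigma>\<^sup>2 * ((inv_jb_norm * X2_norm A) * X2_norm A * (4 * inv_jb_norm * (X2_norm A)\<^sup>2))"
    unfolding B_def X2_norm_def[symmetric] by (intro mult_left_mono mult_mono X2_j[OF A] H) auto
  then have B: "B \<le> 16 * \<sigma>\<^sup>2 * inv_jb_norm\<^sup>2 * (X2_norm A)^4" by (simp add: power2_eq_square power4_eq_xxxx mult_ac)
  have pt: "norm (G p q) \<le> 4 * \<sigma>\<^sup>2 * (norm (wt (\<lambda>\<xi>. (jb \<xi>)\<^sup>2) A p) * norm (wt ?w b q) * norm (wt jb A (- p - q)))" for p q
  proof -
    define r where "r = - p - q"
    have r: "q + r + p = 0" by (simp add: r_def)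
    define W where "W = gw \<sigma> N q * gw \<sigma> N r * gw \<sigma> N p"
    have W0: "0 \<le> W" by (simp add: W_def)
    \<comment> \<open>\<open>gexc\<close> already uses the two derivatives that the factor with
      frequency p can bear, so the third one is passed on to q and r.\<close>
    have "\<bar>p\<bar> \<le> jb q + jb r" using r by (auto simp: jb_def)
    also have "\<dots> = jb q * 1 + 1 * jb r" by simp
    also have "\<dots> \<le> jb q * jb r + jb q * jb r" by (intro add_mono mult_mono jb_ge_1) auto
    finally have pj: "\<bar>p\<bar> \<le> 2 * (jb q * jb r)" by simp
    have "gexc \<sigma> N p * \<bar>p\<bar> \<le> (2 * \<sigma>\<^sup>2 * p\<^sup>2 * W) * \<bar>p\<bar>"
      unfolding W_def by (intro mult_right_mono gexc_triple s r) auto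
    also have "\<dots> \<le> (2 * \<sigma>\<^sup>2 * (jb p)\<^sup>2 * W) * (2 * (jb q * jb r))"
      using W0 by (intro mult_mono mult_left_mono mult_right_mono jb_sq pj) auto
    finally have "gexc \<sigma> N p * \<bar>p\<bar> * norm (aba p q) \<le> (2 * \<sigma>\<^sup>2 * (jb p)\<^sup>2 * W) * (2 * (jb q * jb r)) * norm (aba p q)"
      by (rule mult_right_mono) simp
    then show ?thesis
      unfolding r_def[symmetric] by (simp add: G_def aba_def norm_mult abs_mult norm_wt A_def W_def r_def[symmetric] mult_ac)
  qed
  have Gnn: "(\<integral>\<^sup>+p. \<integral>\<^sup>+q. ennreal (norm (G p q)) \<partial>lborel \<partial>lborel) \<le> ennreal B"
  proof -
    have "(\<integral>\<^sup>+p. \<integral>\<^sup>+q. ennreal (norm (G p q)) \<partial>lborel \<partial>lborel)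
      \<le> (\<integral>\<^sup>+p. \<integral>\<^sup>+q. ennreal (4 * \<sigma>\<^sup>2) * ennreal (norm (wt (\<lambda>\<xi>. (jb \<xi>)\<^sup>2) A p) * norm (wt ?w b q) * norm (wt jb A (- p - q))) \<partial>lborel \<partial>lborel)"
      using pt by (intro nn_integral_mono) (simp add: ennreal_leI flip: ennreal_mult)
    also have "\<dots> = ennreal (4 * \<sigma>\<^sup>2) * (\<integral>\<^sup>+p. \<integral>\<^sup>+q. ennreal (norm (wt (\<lambda>\<xi>. (jb \<xi>)\<^sup>2) A p) * norm (wt ?w b q) * norm (wt jb A (- p - q))) \<partial>lborel \<partial>lborel)"
      by (simp add: nn_integral_cmult)
    also have "\<dots> \<le> ennreal (4 * \<sigma>\<^sup>2) * ennreal ((LINT x|lborel. norm (wt jb A x)) * L2_norm (wt (\<lambda>\<xi>. (jb \<xi>)\<^sup>2) A) * L2_norm (wt ?w b))"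
      by (intro mult_left_mono triple_nn_3 jA X2_wt_L2 A H) auto
    finally show ?thesis by (simp add: B_def ennreal_mult integral_nonneg_AE)
  qed
  note iG = pair_integrableI[OF mG Gnn B0]
  have "(LINT \<xi>|lborel. of_real ((gw \<sigma> N \<xi>)\<^sup>2) * a (- \<xi>) * (of_real \<xi> * conv b a \<xi>))
     = (LINT p|lborel. of_real ((gw \<sigma> N p)\<^sup>2) * a p * (of_real (- p) * conv b a (- p)))"
    by (subst lborel_integral_reflect[symmetric]) simp
  also have "\<dots> = (LINT p|lborel. LINT q|lborel. - U p q - G p q)"
  proof (rule Bochner_Integration.integral_cong[OF refl])
    fix p
    have "- U p q - G p q = (of_real ((gw \<sigma> N p)\<^sup>2) * a p * of_real (- p)) * (b q * a (- p - q))" for q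
      unfolding U_def G_def aba_def gw_square by (simp add: algebra_simps)
    then show "of_real ((gw \<sigma> N p)\<^sup>2) * a p * (of_real (- p) * conv b a (- p)) = (LINT q|lborel. - U p q - G p q)"
      unfolding conv_def by (simp add: mult.assoc)
  qed
  also have "\<dots> = - (LINT p|lborel. LINT q|lborel. U p q) - (LINT p|lborel. LINT q|lborel. G p q)"
  proof -
    have "(LINT p|lborel. LINT q|lborel. - U p q - G p q)
      = integral\<^sup>L (lborel \<Otimes>\<^sub>M lborel) (\<lambda>z. - (case z of (p, q) \<Rightarrow> U p q) - (case z of (p, q) \<Rightarrow> G p q))"
      using iU iG(1) by (subst lborel_pair.integral_fst'[symmetric]) (auto intro!: Bochner_Integration.integrable_diff Bochner_Integration.integrable_minus)
    also have "\<dots> = - integral\<^sup>L (lborel \<Otimes>\<^sub>M lborel) (\<lambda>(p, q). U p q) - integral\<^sup>L (lborel \<Otimes>\<^sub>M lborel) (\<lambda>(p, q). G p q)"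
      using iU iG(1) by (subst Bochner_Integration.integral_diff) auto
    finally show ?thesis
      using lborel_pair.integral_fst'[OF iU] lborel_pair.integral_fst'[OF iG(1)] by simp
  qed
  finally have "norm (LINT \<xi>|lborel. of_real ((gw \<sigma> N \<xi>)\<^sup>2) * a (- \<xi>) * (of_real \<xi> * conv b a \<xi>)) \<le> B"
    using iG(2) Ub by simp
  then show ?thesis using B by (simp add: b_def A_def)
qed

section \<open>The nonlinearity on the Fourier side\<close>

lemma wt_diff: "wt w (\<lambda>\<xi>. f \<xi> - g \<xi>) = (\<lambda>\<xi>. wt w f \<xi> - wt w g \<xi>)"
  and wt_add: "wt w (\<lambda>\<xi>. f \<xi> + g \<xi>) = (\<lambda>\<xi>. wt w f \<xi> + wt w g \<xi>)"
  and wt_scale: "wt w (\<lambda>\<xi>. c * f \<xi>) = (\<lambda>\<xi>. c * wt w f \<xi>)"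
  by (auto simp: wt_def fun_eq_iff algebra_simps)

lemma X2_diff: "f \<in> X2 \<Longrightarrow> g \<in> X2 \<Longrightarrow> (\<lambda>\<xi>. f \<xi> - g \<xi>) \<in> X2"
  and X2_add: "f \<in> X2 \<Longrightarrow> g \<in> X2 \<Longrightarrow> (\<lambda>\<xi>. f \<xi> + g \<xi>) \<in> X2"
  and X2_scale: "f \<in> X2 \<Longrightarrow> (\<lambda>\<xi>. c * f \<xi>) \<in> X2"
  unfolding X2_def by (auto simp: wt_diff wt_add wt_scale intro!: L2_diff L2_add L2_scale)

lemma X2_norm_scale: "X2_norm (\<lambda>\<xi>. c * f \<xi>) = norm c * X2_norm f"
  by (simp add: X2_norm_def wt_scale L2_norm_scale)

lemma X2_norm_triangle:
  "f \<in> X2 \<Longrightarrow> g \<in> X2 \<Longrightarrow> X2_norm (\<lambda>\<xi>. f \<xi> + g \<xi>) \<le> X2_norm f + X2_norm g"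
  unfolding X2_norm_def wt_add by (intro L2_triangle X2_wt_L2)

lemma X2_norm_triangle_diff:
  "f \<in> X2 \<Longrightarrow> g \<in> X2 \<Longrightarrow> X2_norm (\<lambda>\<xi>. f \<xi> - g \<xi>) \<le> X2_norm f + X2_norm g"
  unfolding X2_norm_def wt_diff by (intro L2_triangle_minus X2_wt_L2)

lemma conv_diff_left:
  assumes "p \<in> L2_space" "p' \<in> L2_space" "q \<in> L2_space"
  shows "conv (\<lambda>\<xi>. p \<xi> - p' \<xi>) q \<xi> = conv p q \<xi> - conv p' q \<xi>"
proof -
  have q: "(\<lambda>\<eta>. q (\<xi> - \<eta>)) \<in> L2_space" using L2_third[OF assms(3), of "- \<xi>"] by simp
  show ?thesis unfolding conv_def
    using L2_mult_integrable[OF assms(1) q] L2_mult_integrable[OF assms(2) q] by (simp add: left_diff_distrib)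
qed

lemma conv_diff_right:
  assumes "p \<in> L2_space" "q \<in> L2_space" "q' \<in> L2_space"
  shows "conv p (\<lambda>\<xi>. q \<xi> - q' \<xi>) \<xi> = conv p q \<xi> - conv p q' \<xi>"
proof -
  have q: "(\<lambda>\<eta>. q (\<xi> - \<eta>)) \<in> L2_space" "(\<lambda>\<eta>. q' (\<xi> - \<eta>)) \<in> L2_space"
    using L2_third[OF assms(2), of "- \<xi>"] L2_third[OF assms(3), of "- \<xi>"] by simp_all
  show ?thesis unfolding conv_def
    using L2_mult_integrable[OF assms(1) q(1)] L2_mult_integrable[OF assms(1) q(2)] by (simp add: right_diff_distrib)
qed

lemma ixi_mult_eq: "ixi_mult a = (\<lambda>\<xi>. \<i> * wt (\<lambda>\<xi>. \<xi>) a \<xi>)"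
  by (simp add: ixi_mult_def wt_def mult.assoc)

lemma X2_ixi_mult:
  assumes "a \<in> X2"
  shows "ixi_mult a \<in> L2_space" "L2_norm (ixi_mult a) \<le> X2_norm a"
    and "integrable lborel (ixi_mult a)" "(LINT \<xi>|lborel. norm (ixi_mult a \<xi>)) \<le> inv_jb_norm * X2_norm a"
  using X2_mult_id[OF assms] unfolding ixi_mult_eq by (auto simp: L2_scale L2_norm_scale norm_mult)

lemma ixi_mult_diff: "ixi_mult (\<lambda>\<xi>. f \<xi> - g \<xi>) = (\<lambda>\<xi>. ixi_mult f \<xi> - ixi_mult g \<xi>)"
  by (simp add: ixi_mult_def right_diff_distrib)

lemma conv_ixi_mult_L2:
  assumes "p \<in> X2" "q \<in> X2"
  shows "conv (ixi_mult p) (ixi_mult q) \<in> L2_space" "L2_norm (conv (ixi_mult p) (ixi_mult q)) \<le> inv_jb_norm * (X2_norm p * X2_norm q)"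
proof -
  show "conv (ixi_mult p) (ixi_mult q) \<in> L2_space" by (intro young X2_ixi_mult assms)
  have "L2_norm (conv (ixi_mult p) (ixi_mult q)) \<le> (LINT x|lborel. norm (ixi_mult p x)) * L2_norm (ixi_mult q)"
    by (intro young X2_ixi_mult assms)
  also have "\<dots> \<le> (inv_jb_norm * X2_norm p) * X2_norm q" by (intro mult_mono X2_ixi_mult assms) auto
  finally show "L2_norm (conv (ixi_mult p) (ixi_mult q)) \<le> inv_jb_norm * (X2_norm p * X2_norm q)" by simp
qed

text \<open>Continuity of bounded bilinear maps, from \<beta>(p, q) - \<beta>(p', q') = \<beta>(p -
  p', q) + \<beta>(p', q - q'). The target norm is left open: it is weighted for products, plain L2
  for products of derivatives.\<close>

lemma bilinear_tendsto:
  fixes \<beta> :: "(real \<Rightarrow> complex) \<Rightarrow> (real \<Rightarrow> complex) \<Rightarrow> real \<Rightarrow> complex"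
  assumes left: "\<And>p p' q \<xi>. p \<in> X2 \<Longrightarrow> p' \<in> X2 \<Longrightarrow> q \<in> X2 \<Longrightarrow> \<beta> (\<lambda>\<xi>. p \<xi> - p' \<xi>) q \<xi> = \<beta> p q \<xi> - \<beta> p' q \<xi>"
    and right: "\<And>p q q' \<xi>. p \<in> X2 \<Longrightarrow> q \<in> X2 \<Longrightarrow> q' \<in> X2 \<Longrightarrow> \<beta> p (\<lambda>\<xi>. q \<xi> - q' \<xi>) \<xi> = \<beta> p q \<xi> - \<beta> p q' \<xi>"
    and L2: "\<And>p q. p \<in> X2 \<Longrightarrow> q \<in> X2 \<Longrightarrow> \<beta> p q \<in> L2_space"
    and bd: "\<And>p q. p \<in> X2 \<Longrightarrow> q \<in> X2 \<Longrightarrow> L2_norm (\<beta> p q) \<le> K * (X2_norm p * X2_norm q)"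
    and p: "\<And>s. s \<in> S \<Longrightarrow> p s \<in> X2" "p' \<in> X2" and q: "\<And>s. s \<in> S \<Longrightarrow> q s \<in> X2" "q' \<in> X2"
    and pl: "((\<lambda>s. X2_norm (\<lambda>\<xi>. p s \<xi> - p' \<xi>)) \<longlongrightarrow> 0) (at t within S)"
    and ql: "((\<lambda>s. X2_norm (\<lambda>\<xi>. q s \<xi> - q' \<xi>)) \<longlongrightarrow> 0) (at t within S)"
    and K: "0 \<le> K"
  shows "((\<lambda>s. L2_norm (\<lambda>\<xi>. \<beta> (p s) (q s) \<xi> - \<beta> p' q' \<xi>)) \<longlongrightarrow> 0) (at t within S)"
proof -
  let ?b = "\<lambda>s. K * (X2_norm (\<lambda>\<xi>. p s \<xi> - p' \<xi>) * (X2_norm (\<lambda>\<xi>. q s \<xi> - q' \<xi>) + X2_norm q'))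
      + K * (X2_norm p' * X2_norm (\<lambda>\<xi>. q s \<xi> - q' \<xi>))"
  have le: "L2_norm (\<lambda>\<xi>. \<beta> (p s) (q s) \<xi> - \<beta> p' q' \<xi>) \<le> ?b s" if s: "s \<in> S" for s
  proof -
    note pq = p(1)[OF s] p(2) q(1)[OF s] q(2)
    note d = X2_diff[OF pq(1,2)] X2_diff[OF pq(3,4)]
    have "L2_norm (\<lambda>\<xi>. \<beta> (p s) (q s) \<xi> - \<beta> p' q' \<xi>)
      = L2_norm (\<lambda>\<xi>. \<beta> (\<lambda>\<xi>. p s \<xi> - p' \<xi>) (q s) \<xi> + \<beta> p' (\<lambda>\<xi>. q s \<xi> - q' \<xi>) \<xi>)"
      using left[OF pq(1,2,3)] right[OF pq(2,3,4)] by simp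
    also have "\<dots> \<le> L2_norm (\<beta> (\<lambda>\<xi>. p s \<xi> - p' \<xi>) (q s)) + L2_norm (\<beta> p' (\<lambda>\<xi>. q s \<xi> - q' \<xi>))"
      by (intro L2_triangle L2 d pq)
    also have "\<dots> \<le> K * (X2_norm (\<lambda>\<xi>. p s \<xi> - p' \<xi>) * X2_norm (q s)) + K * (X2_norm p' * X2_norm (\<lambda>\<xi>. q s \<xi> - q' \<xi>))"
      by (intro add_mono bd d pq)
    also have "X2_norm (q s) \<le> X2_norm (\<lambda>\<xi>. q s \<xi> - q' \<xi>) + X2_norm q'"
      using X2_norm_triangle[OF d(2) pq(4)] by simp
    finally show ?thesis using K by (simp add: mult_left_mono)
  qed
  have "(?b \<longlongrightarrow> K * (0 * (0 + X2_norm q')) + K * (X2_norm p' * 0)) (at t within S)"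
    by (intro tendsto_intros pl ql)
  then have b0: "(?b \<longlongrightarrow> 0) (at t within S)" by simp
  show ?thesis
  proof (rule tendsto_sandwich[OF _ _ tendsto_const b0])
    show "\<forall>\<^sub>F s in at t within S. 0 \<le> L2_norm (\<lambda>\<xi>. \<beta> (p s) (q s) \<xi> - \<beta> p' q' \<xi>)" by simp
    show "\<forall>\<^sub>F s in at t within S. L2_norm (\<lambda>\<xi>. \<beta> (p s) (q s) \<xi> - \<beta> p' q' \<xi>) \<le> ?b s"
      using le by (auto simp: eventually_at_filter)
  qed
qed

lemma X2_conv_tendsto:
  assumes p: "\<And>s. s \<in> S \<Longrightarrow> p s \<in> X2" "p' \<in> X2" and q: "\<And>s. s \<in> S \<Longrightarrow> q s \<in> X2" "q' \<in> X2"
    and pl: "((\<lambda>s. X2_norm (\<lambda>\<xi>. p s \<xi> - p' \<xi>)) \<longlongrightarrow> 0) (at t within S)"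
    and ql: "((\<lambda>s. X2_norm (\<lambda>\<xi>. q s \<xi> - q' \<xi>)) \<longlongrightarrow> 0) (at t within S)"
  shows "((\<lambda>s. X2_norm (\<lambda>\<xi>. conv (p s) (q s) \<xi> - conv p' q' \<xi>)) \<longlongrightarrow> 0) (at t within S)"
proof -
  have "((\<lambda>s. L2_norm (\<lambda>\<xi>. wt (\<lambda>\<xi>. (jb \<xi>)\<^sup>2) (conv (p s) (q s)) \<xi> - wt (\<lambda>\<xi>. (jb \<xi>)\<^sup>2) (conv p' q') \<xi>)) \<longlongrightarrow> 0) (at t within S)"
  proof (rule bilinear_tendsto[where K="8 * inv_jb_norm", OF _ _ _ _ p q pl ql])
    fix p q assume "p \<in> X2" "q \<in> X2"
    from X2_conv[OF this] show "wt (\<lambda>\<xi>. (jb \<xi>)\<^sup>2) (conv p q) \<in> L2_space"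
      "L2_norm (wt (\<lambda>\<xi>. (jb \<xi>)\<^sup>2) (conv p q)) \<le> 8 * inv_jb_norm * (X2_norm p * X2_norm q)"
      by (auto simp: X2_def X2_norm_def[of "conv p q"])
  qed (auto simp: wt_def conv_diff_left conv_diff_right X2_self(1) right_diff_distrib)
  then show ?thesis by (simp add: X2_norm_def wt_diff)
qed

lemma conv_ixi_mult_tendsto:
  assumes p: "\<And>s. s \<in> S \<Longrightarrow> p s \<in> X2" "p' \<in> X2"
    and pl: "((\<lambda>s. X2_norm (\<lambda>\<xi>. p s \<xi> - p' \<xi>)) \<longlongrightarrow> 0) (at t within S)"
  shows "((\<lambda>s. L2_norm (\<lambda>\<xi>. conv (ixi_mult (p s)) (ixi_mult (p s)) \<xi> - conv (ixi_mult p') (ixi_mult p') \<xi>)) \<longlongrightarrow> 0) (at t within S)"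
  by (rule bilinear_tendsto[where K=inv_jb_norm, OF _ _ _ _ p p pl pl])
     (auto simp: ixi_mult_diff conv_diff_left conv_diff_right X2_ixi_mult(1) conv_ixi_mult_L2)

section \<open>The symbols of the equation and the transformed nonlinearity\<close>

locale kdvbbm =
  fixes \<gamma>1 \<gamma>2 \<delta>1 \<delta>2 :: real
  assumes g1: "\<gamma>1 > 0" and d1: "\<delta>1 > 0"
begin

abbreviation "Dn \<equiv> kdvbbm_denom \<gamma>1 \<delta>1"
abbreviation "\<tau> \<equiv> kdvbbm_tau (7/48) \<gamma>1 \<delta>1"
abbreviation "\<psi> \<equiv> kdvbbm_psi \<gamma>1 \<delta>1"
abbreviation "\<phi> \<equiv> kdvbbm_phi \<gamma>1 \<gamma>2 \<delta>1 \<delta>2"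

text \<open>The 8 is the constant in (jb \<xi>)^4 \<le> 8 (1 + \<xi>^4).\<close>

definition dl :: real where "dl = min 1 \<delta>1 / 8"
definition du :: real where "du = 1 + \<gamma>1 + \<delta>1"

lemma dl_pos: "0 < dl" using d1 by (simp add: dl_def)

lemma du_pos: "0 < du" using g1 d1 by (simp add: du_def)

lemma Dn_ge: "dl * (jb \<xi>)^4 \<le> Dn \<xi>"
proof -
  have "(jb \<xi>)\<^sup>2 \<le> 2 * (1 + \<xi>\<^sup>2)"
    using sum_squares_bound[of 1 "\<bar>\<xi>\<bar>"] by (simp add: jb_def power2_sum)
  then have "((jb \<xi>)\<^sup>2)\<^sup>2 \<le> (2 * (1 + \<xi>\<^sup>2))\<^sup>2" by (intro power_mono) auto
  also have "\<dots> \<le> 8 * (1 + \<xi>^4)"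
    using sum_squares_bound[of 1 "\<xi>\<^sup>2"] by (simp add: power2_sum power_mult_distrib)
  finally have "(jb \<xi>)^4 \<le> 8 * (1 + \<xi>^4)" by simp
  then have "dl * (jb \<xi>)^4 \<le> dl * (8 * (1 + \<xi>^4))" using dl_pos by (intro mult_left_mono) auto
  also have "\<dots> = min 1 \<delta>1 * 1 + min 1 \<delta>1 * \<xi>^4" by (simp add: dl_def distrib_left)
  also have "\<dots> \<le> 1 * 1 + \<delta>1 * \<xi>^4" by (intro add_mono mult_right_mono) auto
  also have "\<dots> \<le> Dn \<xi>" using g1 by (simp add: kdvbbm_denom_def)
  finally show ?thesis .
qed

lemma Dn_le: "Dn \<xi> \<le> du * (jb \<xi>)^4"
proof -
  have j: "1 \<le> (jb \<xi>)^4" "\<xi>\<^sup>2 \<le> (jb \<xi>)^4" "\<xi>^4 \<le> (jb \<xi>)^4"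
  proof -
    show "1 \<le> (jb \<xi>)^4" using jb_ge_1 by (rule one_le_power)
    have "(jb \<xi>)\<^sup>2 \<le> (jb \<xi>)^4" by (intro power_increasing jb_ge_1) auto
    then show "\<xi>\<^sup>2 \<le> (jb \<xi>)^4" using jb_sq[of \<xi>] by linarith
    show "\<xi>^4 \<le> (jb \<xi>)^4" using power_mono[OF jb_abs[of \<xi>], of 4] by simp
  qed
  have "Dn \<xi> \<le> (jb \<xi>)^4 + \<gamma>1 * (jb \<xi>)^4 + \<delta>1 * (jb \<xi>)^4"
    unfolding kdvbbm_denom_def using g1 d1 by (intro add_mono mult_left_mono j) auto
  then show ?thesis by (simp add: du_def algebra_simps)
qed

lemma Dn_pos: "0 < Dn \<xi>"
  by (rule less_le_trans[OF _ Dn_ge]) (intro mult_pos_pos dl_pos zero_less_power jb_pos)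

lemma symbols_measurable [measurable]:
  "Dn \<in> borel_measurable borel" "\<tau> \<in> borel_measurable borel" "\<psi> \<in> borel_measurable borel" "\<phi> \<in> borel_measurable borel"
  unfolding kdvbbm_denom_def[abs_def] kdvbbm_tau_def[abs_def] kdvbbm_psi_def[abs_def] kdvbbm_phi_def[abs_def]
  by measurable

lemma symbol_quotient:
  assumes "\<bar>x\<bar> \<le> C * (jb \<xi>)^n" "0 \<le> C"
  shows "\<bar>x / Dn \<xi>\<bar> * (jb \<xi>)^4 \<le> C / dl * (jb \<xi>)^n"
proof -
  have "\<bar>x / Dn \<xi>\<bar> * (jb \<xi>)^4 = \<bar>x\<bar> * ((jb \<xi>)^4 / Dn \<xi>)" using Dn_pos[of \<xi>] by (simp add: abs_divide)
  also have "\<dots> \<le> (C * (jb \<xi>)^n) * (1 / dl)"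
    using Dn_ge[of \<xi>] Dn_pos[of \<xi>] dl_pos assms by (intro mult_mono) (auto simp: field_simps)
  finally show ?thesis by simp
qed

definition Cs :: real where "Cs = (1 + \<bar>\<gamma>2\<bar> + \<bar>\<delta>2\<bar>) / dl"

lemma Cs_nonneg: "0 \<le> Cs" using dl_pos by (simp add: Cs_def)

text \<open>The symbols have orders at most -1, -3 and 1. So \<open>\<tau>\<close> takes H^2 to H^3
  and \<open>\<psi>\<close> takes L2 to H^3: the nonlinearity gains one derivative over H^2, exactly
  what multiplication by \<open>\<phi>\<close> can cost.\<close>

lemma tau_le: "(jb \<xi>)^3 * \<bar>\<tau> \<xi>\<bar> \<le> Cs * (jb \<xi>)\<^sup>2"
  and psi_le: "(jb \<xi>)^3 * \<bar>\<psi> \<xi>\<bar> \<le> Cs"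
  and phi_le: "\<bar>\<phi> \<xi>\<bar> \<le> Cs * jb \<xi>"
proof -
  let ?j = "jb \<xi>"
  have p: "\<bar>\<xi>^n\<bar> \<le> ?j^n" for n using power_mono[OF jb_abs, of \<xi> n] by (simp add: power_abs)
  have mono: "?j^m \<le> ?j^n" if "m \<le> n" for m n using that by (intro power_increasing jb_ge_1)
  have dl1: "1 / dl \<le> Cs" unfolding Cs_def using dl_pos by (intro divide_right_mono) auto
  have "\<bar>\<xi> * (3 - 4 * (7/48) * \<xi>\<^sup>2) / 4\<bar> = \<bar>3/4 * \<xi> - 7/48 * \<xi>^3\<bar>"
    by (rule arg_cong[where f=abs]) (simp add: power3_eq_cube power2_eq_square field_simps)
  also have "\<dots> \<le> 3/4 * \<bar>\<xi>\<bar> + 7/48 * \<bar>\<xi>^3\<bar>" using abs_triangle_ineq4[of "3/4 * \<xi>" "7/48 * \<xi>^3"] by (simp add: abs_mult)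
  also have "\<dots> \<le> 3/4 * ?j^3 + 7/48 * ?j^3" using p[of 1] p[of 3] mono[of 1 3] by (intro add_mono mult_left_mono) auto
  also have "\<dots> \<le> 1 * ?j^3" using zero_le_power[of ?j 3] by simp
  finally have "\<bar>\<xi> * (3 - 4 * (7/48) * \<xi>\<^sup>2) / 4 / Dn \<xi>\<bar> * ?j^4 \<le> 1 / dl * ?j^3" by (rule symbol_quotient) simp
  then have "\<bar>\<tau> \<xi>\<bar> * ?j^4 \<le> 1 / dl * ?j^3" by (simp add: kdvbbm_tau_def)
  also have "\<dots> \<le> Cs * ?j^3" using dl1 by (intro mult_right_mono) auto
  finally have "?j * (?j^3 * \<bar>\<tau> \<xi>\<bar>) \<le> ?j * (Cs * ?j\<^sup>2)"
    by (simp add: power2_eq_square power3_eq_cube power4_eq_xxxx mult_ac)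
  then show "?j^3 * \<bar>\<tau> \<xi>\<bar> \<le> Cs * ?j\<^sup>2" using jb_pos(1) by (simp add: mult_le_cancel_left_pos)
  have "\<bar>\<xi> / Dn \<xi>\<bar> * ?j^4 \<le> 1 / dl * ?j^1" by (rule symbol_quotient) (use p[of 1] in auto)
  also have "\<dots> \<le> Cs * ?j^1" using dl1 by (intro mult_right_mono) auto
  finally have "?j * (?j^3 * \<bar>\<psi> \<xi>\<bar>) \<le> ?j * Cs"
    unfolding kdvbbm_psi_def by (simp add: power2_eq_square power3_eq_cube power4_eq_xxxx mult_ac)
  then show "?j^3 * \<bar>\<psi> \<xi>\<bar> \<le> Cs" using jb_pos(1) by (simp add: mult_le_cancel_left_pos)
  have "\<bar>\<xi> * (1 - \<gamma>2 * \<xi>^2 + \<delta>2 * \<xi>^4)\<bar> = \<bar>\<xi> - \<gamma>2 * \<xi>^3 + \<delta>2 * \<xi>^5\<bar>"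
    by (simp add: power2_eq_square eval_nat_numeral algebra_simps)
  also have "\<dots> \<le> \<bar>\<xi>\<bar> + \<bar>\<gamma>2 * \<xi>^3\<bar> + \<bar>\<delta>2 * \<xi>^5\<bar>" by linarith
  also have "\<dots> \<le> ?j^5 + \<bar>\<gamma>2\<bar> * ?j^5 + \<bar>\<delta>2\<bar> * ?j^5"
    unfolding abs_mult
    using p[of 1] order_trans[OF p[of 3] mono[of 3 5]] p[of 5] mono[of 1 5] by (intro add_mono mult_left_mono) auto
  finally have "\<bar>\<xi> * (1 - \<gamma>2 * \<xi>^2 + \<delta>2 * \<xi>^4)\<bar> \<le> (1 + \<bar>\<gamma>2\<bar> + \<bar>\<delta>2\<bar>) * ?j^5" by (simp add: algebra_simps)
  then have "\<bar>\<xi> * (1 - \<gamma>2 * \<xi>^2 + \<delta>2 * \<xi>^4) / Dn \<xi>\<bar> * ?j^4 \<le> (1 + \<bar>\<gamma>2\<bar> + \<bar>\<delta>2\<bar>) / dl * ?j^5"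
    by (rule symbol_quotient) simp
  then have "?j^4 * \<bar>\<phi> \<xi>\<bar> \<le> ?j^4 * (Cs * ?j)"
    by (simp add: kdvbbm_phi_def Cs_def eval_nat_numeral mult_ac)
  then show "\<bar>\<phi> \<xi>\<bar> \<le> Cs * ?j"
    unfolding mult_le_cancel_left_pos[OF zero_less_power[OF jb_pos(1)]] .
qed

text \<open>The nonlinearity as a map on transforms; each product contributes a factor 1 / (2 pi),
  hence two of them in the cubic term.\<close>

definition Fhat :: "(real \<Rightarrow> complex) \<Rightarrow> real \<Rightarrow> complex" where
  "Fhat a \<xi> = of_real (\<tau> \<xi>) * (of_real (1 / (2 * pi)) * conv a a \<xi>)
     - 7/48 * (of_real (\<psi> \<xi>) * (of_real (1 / (2 * pi)) * conv (ixi_mult a) (ixi_mult a) \<xi>))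
     - 1/8 * (of_real (\<psi> \<xi>) * (of_real (1 / (2 * pi)) * (of_real (1 / (2 * pi)) * conv (conv a a) a \<xi>)))"

lemma Fhat_measurable [measurable]: "a \<in> borel_measurable borel \<Longrightarrow> Fhat a \<in> borel_measurable borel"
  unfolding Fhat_def[abs_def]
  by (intro borel_measurable_diff borel_measurable_times borel_measurable_const conv_measurable
      borel_measurable_of_real symbols_measurable) (auto simp: ixi_mult_def)

text \<open>The denominator cancels and polynomial symbols remain, as symmetrisation requires. The
  second constant is 1/8 * (1 / (2 pi))^2.\<close>

lemma Dn_Fhat:
  "of_real (Dn \<xi>) * Fhat a \<xi> = of_real (1 / (2 * pi)) * quad_part a \<xi>
     - of_real (1 / (32 * pi\<^sup>2)) * (of_real \<xi> * conv (conv a a) a \<xi>)"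
proof -
  have t: "Dn \<xi> * \<tau> \<xi> = \<xi> * (3/4 - 7/48 * \<xi>\<^sup>2)" and p: "Dn \<xi> * \<psi> \<xi> = \<xi>"
    using Dn_pos[of \<xi>] by (simp_all add: kdvbbm_tau_def kdvbbm_psi_def field_simps)
  have "of_real (Dn \<xi>) * Fhat a \<xi> = of_real (Dn \<xi> * \<tau> \<xi>) * (of_real (1 / (2 * pi)) * conv a a \<xi>)
     - 7/48 * (of_real (Dn \<xi> * \<psi> \<xi>) * (of_real (1 / (2 * pi)) * conv (ixi_mult a) (ixi_mult a) \<xi>))
     - 1/8 * (of_real (Dn \<xi> * \<psi> \<xi>) * (of_real (1 / (2 * pi)) * (of_real (1 / (2 * pi)) * conv (conv a a) a \<xi>)))"
    by (simp add: Fhat_def algebra_simps)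
  also have "\<dots> = of_real (1 / (2 * pi)) * quad_part a \<xi>
     - of_real (1 / (32 * pi\<^sup>2)) * (of_real \<xi> * conv (conv a a) a \<xi>)"
    unfolding t p quad_part_def by (simp add: field_simps power2_eq_square)
  finally show ?thesis .
qed

lemma wt_dominated:
  assumes "\<And>\<xi>. w \<xi> * \<bar>s \<xi>\<bar> \<le> C * v \<xi>" "0 \<le> C" and w: "\<And>\<xi>. 0 \<le> w \<xi>" and v: "\<And>\<xi>. 0 \<le> v \<xi>"
    and [measurable]: "f \<in> borel_measurable borel" "s \<in> borel_measurable borel" "w \<in> borel_measurable borel"
    and f: "wt v f \<in> L2_space"
  shows "wt w (\<lambda>\<xi>. of_real (s \<xi>) * f \<xi>) \<in> L2_space"
    and "L2_norm (wt w (\<lambda>\<xi>. of_real (s \<xi>) * f \<xi>)) \<le> C * L2_norm (wt v f)"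
proof -
  have ae: "AE \<xi> in lborel. norm (wt w (\<lambda>\<xi>. of_real (s \<xi>) * f \<xi>) \<xi>) \<le> C * norm (wt v f \<xi>)"
  proof (rule AE_I2)
    fix \<xi>
    have "norm (wt w (\<lambda>\<xi>. of_real (s \<xi>) * f \<xi>) \<xi>) = (w \<xi> * \<bar>s \<xi>\<bar>) * norm (f \<xi>)"
      using w by (simp add: norm_wt norm_mult)
    also have "\<dots> \<le> (C * v \<xi>) * norm (f \<xi>)" by (intro mult_right_mono assms) auto
    finally show "norm (wt w (\<lambda>\<xi>. of_real (s \<xi>) * f \<xi>) \<xi>) \<le> C * norm (wt v f \<xi>)"
      using v by (simp add: norm_wt)
  qed
  have m: "wt w (\<lambda>\<xi>. of_real (s \<xi>) * f \<xi>) \<in> borel_measurable borel" by measurable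
  show "wt w (\<lambda>\<xi>. of_real (s \<xi>) * f \<xi>) \<in> L2_space"
    and "L2_norm (wt w (\<lambda>\<xi>. of_real (s \<xi>) * f \<xi>)) \<le> C * L2_norm (wt v f)"
    using L2_dominated[OF m f ae \<open>0 \<le> C\<close>] by auto
qed

abbreviation "j3 \<equiv> \<lambda>\<xi>. (jb \<xi>)^3"

lemma wt_one [simp]: "wt (\<lambda>_. 1) f = f"
  by (simp add: wt_def)

lemma tau_L2:
  assumes "f \<in> X2"
  shows "wt j3 (\<lambda>\<xi>. of_real (\<tau> \<xi>) * f \<xi>) \<in> L2_space"
    and "L2_norm (wt j3 (\<lambda>\<xi>. of_real (\<tau> \<xi>) * f \<xi>)) \<le> Cs * X2_norm f"
  using wt_dominated[of j3 \<tau> Cs "\<lambda>\<xi>. (jb \<xi>)\<^sup>2" f, OF tau_le Cs_nonneg] X2_wt_L2[OF assms] X2_measurable[OF assms]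
  by (auto simp: X2_norm_def)

lemma psi_L2:
  assumes "f \<in> L2_space"
  shows "wt j3 (\<lambda>\<xi>. of_real (\<psi> \<xi>) * f \<xi>) \<in> L2_space"
    and "L2_norm (wt j3 (\<lambda>\<xi>. of_real (\<psi> \<xi>) * f \<xi>)) \<le> Cs * L2_norm f"
  using wt_dominated[of j3 \<psi> Cs "\<lambda>_. 1" f] psi_le Cs_nonneg L2_measurable[OF assms] assms
  by auto

text \<open>One derivative more than membership in \<open>X2\<close>; continuity in time of the
  profile's derivative relies on it.\<close>

lemma Fhat_L2:
  assumes a: "a \<in> X2" shows "wt j3 (Fhat a) \<in> L2_space"
proof -
  have eq: "wt j3 (Fhat a) = (\<lambda>\<xi>. of_real (1 / (2 * pi)) * wt j3 (\<lambda>\<xi>. of_real (\<tau> \<xi>) * conv a a \<xi>) \<xi>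
     - of_real (7/48 / (2 * pi)) * wt j3 (\<lambda>\<xi>. of_real (\<psi> \<xi>) * conv (ixi_mult a) (ixi_mult a) \<xi>) \<xi>
     - of_real (1/8 * (1 / (2 * pi) * (1 / (2 * pi)))) * wt j3 (\<lambda>\<xi>. of_real (\<psi> \<xi>) * conv (conv a a) a \<xi>) \<xi>)"
    by (simp add: wt_def Fhat_def fun_eq_iff algebra_simps)
  show ?thesis unfolding eq
    by (intro L2_diff L2_scale tau_L2 psi_L2 X2_conv conv_ixi_mult_L2 X2_self a)
qed

lemma Fhat_X2:
  assumes a: "a \<in> X2" shows "Fhat a \<in> X2"
proof -
  note [measurable] = X2_measurable[OF a]
  have "wt (\<lambda>\<xi>. (jb \<xi>)\<^sup>2) (Fhat a) \<in> L2_space"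
  proof (rule L2_dominated(1)[OF _ Fhat_L2[OF a], of _ 1])
    show "AE \<xi> in lborel. norm (wt (\<lambda>\<xi>. (jb \<xi>)\<^sup>2) (Fhat a) \<xi>) \<le> 1 * norm (wt j3 (Fhat a) \<xi>)"
    proof (rule AE_I2)
      fix \<xi>
      have "(jb \<xi>)\<^sup>2 \<le> (jb \<xi>)^3" by (intro power_increasing jb_ge_1) simp
      then show "norm (wt (\<lambda>\<xi>. (jb \<xi>)\<^sup>2) (Fhat a) \<xi>) \<le> 1 * norm (wt j3 (Fhat a) \<xi>)"
        by (simp add: norm_wt mult_right_mono)
    qed
  qed auto
  then show ?thesis by (simp add: X2_def)
qed

lemma Fhat_tendsto:
  assumes a: "\<And>s. s \<in> S \<Longrightarrow> a s \<in> X2" "a' \<in> X2"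
    and al: "((\<lambda>s. X2_norm (\<lambda>\<xi>. a s \<xi> - a' \<xi>)) \<longlongrightarrow> 0) (at t within S)"
  shows "((\<lambda>s. X2_norm (\<lambda>\<xi>. Fhat (a s) \<xi> - Fhat a' \<xi>)) \<longlongrightarrow> 0) (at t within S)"
proof -
  let ?d1 = "\<lambda>s \<xi>. conv (a s) (a s) \<xi> - conv a' a' \<xi>"
  let ?d2 = "\<lambda>s \<xi>. conv (ixi_mult (a s)) (ixi_mult (a s)) \<xi> - conv (ixi_mult a') (ixi_mult a') \<xi>"
  let ?d3 = "\<lambda>s \<xi>. conv (conv (a s) (a s)) (a s) \<xi> - conv (conv a' a') a' \<xi>"
  have l1: "((\<lambda>s. X2_norm (?d1 s)) \<longlongrightarrow> 0) (at t within S)" by (rule X2_conv_tendsto[OF a a al al])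
  have l2: "((\<lambda>s. L2_norm (?d2 s)) \<longlongrightarrow> 0) (at t within S)" by (rule conv_ixi_mult_tendsto[OF a al])
  have l3: "((\<lambda>s. X2_norm (?d3 s)) \<longlongrightarrow> 0) (at t within S)"
    by (rule X2_conv_tendsto[OF _ _ a l1 al]) (auto intro!: X2_conv a)
  let ?b = "\<lambda>s. Cs * X2_norm (?d1 s) + Cs * L2_norm (?d2 s) + Cs * X2_norm (?d3 s)"
  have "(?b \<longlongrightarrow> Cs * 0 + Cs * 0 + Cs * 0) (at t within S)" by (intro tendsto_intros l1 l2 l3)
  then have b0: "(?b \<longlongrightarrow> 0) (at t within S)" by simp
  have le: "X2_norm (\<lambda>\<xi>. Fhat (a s) \<xi> - Fhat a' \<xi>) \<le> ?b s" if s: "s \<in> S" for s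
  proof -
    note as = a(1)[OF s]
    have x1: "?d1 s \<in> X2" and x3: "?d3 s \<in> X2" by (intro X2_diff X2_conv as a(2))+
    have x2: "?d2 s \<in> L2_space" by (intro L2_diff conv_ixi_mult_L2 as a(2))
    let ?w1 = "wt j3 (\<lambda>\<xi>. of_real (\<tau> \<xi>) * ?d1 s \<xi>)"
    let ?w2 = "wt j3 (\<lambda>\<xi>. of_real (\<psi> \<xi>) * ?d2 s \<xi>)"
    let ?w3 = "wt j3 (\<lambda>\<xi>. of_real (\<psi> \<xi>) * ?d3 s \<xi>)"
    let ?c1 = "1 / (2 * pi)" let ?c2 = "7/48 / (2 * pi)" let ?c3 = "1/8 * (1 / (2 * pi) * (1 / (2 * pi)))"
    have pi: "2 * pi \<ge> 1" using pi_gt3 by simp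
    have c: "0 \<le> ?c1" "0 \<le> ?c2" "0 \<le> ?c3" "?c1 \<le> 1" "?c2 \<le> 1" "?c3 \<le> 1"
    proof -
      show c1: "?c1 \<le> 1" "0 \<le> ?c1" using pi by auto
      show "0 \<le> ?c2" "?c2 \<le> 1" using pi by auto
      have "?c1 * ?c1 \<le> 1 * 1" using c1 by (intro mult_mono) auto
      then show "?c3 \<le> 1" by linarith
      show "0 \<le> ?c3" by simp
    qed
    have eq: "wt j3 (\<lambda>\<xi>. Fhat (a s) \<xi> - Fhat a' \<xi>) = (\<lambda>\<xi>. of_real ?c1 * ?w1 \<xi> - of_real ?c2 * ?w2 \<xi> - of_real ?c3 * ?w3 \<xi>)"
      by (simp add: wt_def Fhat_def fun_eq_iff algebra_simps)
    have w: "?w1 \<in> L2_space" "?w2 \<in> L2_space" "?w3 \<in> L2_space"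
      by (intro tau_L2 psi_L2 x1 x2 X2_self(1)[OF x3 x3])+
    have "X2_norm (\<lambda>\<xi>. Fhat (a s) \<xi> - Fhat a' \<xi>) \<le> 1 * L2_norm (wt j3 (\<lambda>\<xi>. Fhat (a s) \<xi> - Fhat a' \<xi>))"
      unfolding X2_norm_def
    proof (rule L2_dominated(2))
      note [measurable] = X2_measurable[OF as] X2_measurable[OF a(2)]
      show "wt (\<lambda>\<xi>. (jb \<xi>)\<^sup>2) (\<lambda>\<xi>. Fhat (a s) \<xi> - Fhat a' \<xi>) \<in> borel_measurable borel" by measurable
      show "wt j3 (\<lambda>\<xi>. Fhat (a s) \<xi> - Fhat a' \<xi>) \<in> L2_space" unfolding wt_diff by (intro L2_diff Fhat_L2 as a)
      show "AE \<xi> in lborel. norm (wt (\<lambda>\<xi>. (jb \<xi>)\<^sup>2) (\<lambda>\<xi>. Fhat (a s) \<xi> - Fhat a' \<xi>) \<xi>) \<le> 1 * norm (wt j3 (\<lambda>\<xi>. Fhat (a s) \<xi> - Fhat a' \<xi>) \<xi>)"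
      proof (rule AE_I2)
        fix \<xi>
        have "(jb \<xi>)\<^sup>2 \<le> (jb \<xi>)^3" by (intro power_increasing jb_ge_1) simp
        then show "norm (wt (\<lambda>\<xi>. (jb \<xi>)\<^sup>2) (\<lambda>\<xi>. Fhat (a s) \<xi> - Fhat a' \<xi>) \<xi>) \<le> 1 * norm (wt j3 (\<lambda>\<xi>. Fhat (a s) \<xi> - Fhat a' \<xi>) \<xi>)"
          by (simp add: norm_wt mult_right_mono)
      qed
    qed simp
    also have "1 * L2_norm (wt j3 (\<lambda>\<xi>. Fhat (a s) \<xi> - Fhat a' \<xi>)) \<le> (?c1 * L2_norm ?w1 + ?c2 * L2_norm ?w2) + ?c3 * L2_norm ?w3"
    proof -
      have "L2_norm (\<lambda>\<xi>. (of_real ?c1 * ?w1 \<xi> - of_real ?c2 * ?w2 \<xi>) - of_real ?c3 * ?w3 \<xi>)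
         \<le> L2_norm (\<lambda>\<xi>. of_real ?c1 * ?w1 \<xi> - of_real ?c2 * ?w2 \<xi>) + L2_norm (\<lambda>\<xi>. of_real ?c3 * ?w3 \<xi>)"
        by (intro L2_triangle_minus L2_diff L2_scale w)
      also have "L2_norm (\<lambda>\<xi>. of_real ?c1 * ?w1 \<xi> - of_real ?c2 * ?w2 \<xi>) \<le> L2_norm (\<lambda>\<xi>. of_real ?c1 * ?w1 \<xi>) + L2_norm (\<lambda>\<xi>. of_real ?c2 * ?w2 \<xi>)"
        by (intro L2_triangle_minus L2_scale w)
      finally show ?thesis unfolding eq using c by (simp only: L2_norm_scale norm_of_real abs_of_nonneg mult_1)
    qed
    also have "\<dots> \<le> (1 * L2_norm ?w1 + 1 * L2_norm ?w2) + 1 * L2_norm ?w3"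
      by (intro add_mono mult_right_mono c) auto
    also have "\<dots> \<le> (Cs * X2_norm (?d1 s) + Cs * L2_norm (?d2 s)) + Cs * X2_norm (?d3 s)"
    proof -
      have "L2_norm ?w3 \<le> Cs * L2_norm (?d3 s)" by (intro psi_L2 X2_self(1)[OF x3 x3])
      also have "\<dots> \<le> Cs * X2_norm (?d3 s)" by (intro mult_left_mono X2_self(2)[OF x3 x3] Cs_nonneg)
      finally show ?thesis using tau_L2(2)[OF x1] psi_L2(2)[OF x2] by simp
    qed
    finally show ?thesis .
  qed
  show ?thesis
  proof (rule tendsto_sandwich[OF _ _ tendsto_const b0])
    show "\<forall>\<^sub>F s in at t within S. 0 \<le> X2_norm (\<lambda>\<xi>. Fhat (a s) \<xi> - Fhat a' \<xi>)" by simp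
    show "\<forall>\<^sub>F s in at t within S. X2_norm (\<lambda>\<xi>. Fhat (a s) \<xi> - Fhat a' \<xi>) \<le> ?b s"
      using le by (auto simp: eventually_at_filter)
  qed
qed

definition Ke :: real where "Ke = 12 * inv_jb_norm + 16 * inv_jb_norm\<^sup>2"

lemma Ke_nonneg: "0 \<le> Ke" by (simp add: Ke_def)

text \<open>Reality turns cnj (a \<xi>) into a(-\<xi>), which produces the cubic and quartic forms
  bounded above; their prefactors are at most 1.\<close>

lemma energy_form_bound:
  assumes s: "0 \<le> \<sigma>" "0 \<le> N" and a: "a \<in> X2" and real: "AE \<xi> in lborel. a (- \<xi>) = cnj (a \<xi>)"
  shows "norm (LINT \<xi>|lborel. of_real ((gw \<sigma> N \<xi>)\<^sup>2 * Dn \<xi>) * (cnj (a \<xi>) * Fhat a \<xi>))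
    \<le> Ke * \<sigma>\<^sup>2 * ((X2_norm (wt (gw \<sigma> N) a))^3 + (X2_norm (wt (gw \<sigma> N) a))^4)"
proof -
  note [measurable] = X2_measurable[OF a]
  define Y where "Y = X2_norm (wt (gw \<sigma> N) a)"
  have Y0: "0 \<le> Y" by (simp add: Y_def)
  let ?m = "\<lambda>\<xi>. complex_of_real ((gw \<sigma> N \<xi>)\<^sup>2)"
  have [measurable]: "quad_part a \<in> borel_measurable borel" unfolding quad_part_def[abs_def] ixi_mult_def by measurable
  have ar: "(\<lambda>\<xi>. wt jb a (- \<xi>)) \<in> L2_space" by (intro L2_reflect X2_j a)
  have m_le: "norm (?m \<xi>) \<le> (cosh (\<sigma> * N))\<^sup>2" for \<xi>
    using power_mono[OF gw_bounded[OF s], of \<xi> 2] by (simp add: norm_power)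
  \<comment> \<open>The function \<open>a\<close> can bear one power of \<open>jb\<close> and stay
    in L2, so q needs to be bounded by \<open>jb\<close> times an L2 function only. The dependence
    on N is harmless, as mere integrability is claimed.\<close>
  have int: "integrable lborel (\<lambda>\<xi>. ?m \<xi> * a (- \<xi>) * q \<xi>)"
    if q: "r \<in> L2_space" and le: "\<And>\<xi>. norm (q \<xi>) \<le> jb \<xi> * norm (r \<xi>)" and [measurable]: "q \<in> borel_measurable borel" for q r
  proof (rule Bochner_Integration.integrable_bound)
    show "integrable lborel (\<lambda>\<xi>. of_real ((cosh (\<sigma> * N))\<^sup>2) * (wt jb a (- \<xi>) * r \<xi>))"
      by (intro integrable_mult_right L2_mult_integrable ar q)
    show "AE \<xi> in lborel. norm (?m \<xi> * a (- \<xi>) * q \<xi>) \<le> norm (of_real ((cosh (\<sigma> * N))\<^sup>2) * (wt jb a (- \<xi>) * r \<xi>))"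
    proof (rule AE_I2)
      fix \<xi>
      have "norm (?m \<xi> * a (- \<xi>) * q \<xi>) = norm (?m \<xi>) * norm (a (- \<xi>)) * norm (q \<xi>)" by (simp only: norm_mult)
      also have "\<dots> \<le> (cosh (\<sigma> * N))\<^sup>2 * norm (a (- \<xi>)) * (jb \<xi> * norm (r \<xi>))"
        by (intro mult_mono m_le le) auto
      finally show "norm (?m \<xi> * a (- \<xi>) * q \<xi>) \<le> norm (of_real ((cosh (\<sigma> * N))\<^sup>2) * (wt jb a (- \<xi>) * r \<xi>))"
        by (simp add: norm_mult norm_wt norm_power mult_ac)
    qed
  qed measurable
  have c: "conv a a \<in> X2" by (rule X2_conv[OF a a])
  have i1: "integrable lborel (\<lambda>\<xi>. ?m \<xi> * a (- \<xi>) * quad_part a \<xi>)"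
  proof (rule int)
    \<comment> \<open>The L2 function whose product with \<open>jb\<close> dominates
      \<open>quad_part\<close>: the polynomial of degree three splits into one \<open>jb\<close> and
      two powers for the convolution.\<close>
    show "(\<lambda>\<xi>. of_real (norm (wt (\<lambda>\<xi>. (jb \<xi>)\<^sup>2) (conv a a) \<xi>)) + of_real (norm (conv (ixi_mult a) (ixi_mult a) \<xi>))) \<in> L2_space"
    proof (rule L2_add)
      show "(\<lambda>\<xi>. complex_of_real (norm (wt (\<lambda>\<xi>. (jb \<xi>)\<^sup>2) (conv a a) \<xi>))) \<in> L2_space"
        by (rule L2_dominated(1)[OF _ X2_wt_L2[OF c], of _ 1]) auto
      show "(\<lambda>\<xi>. complex_of_real (norm (conv (ixi_mult a) (ixi_mult a) \<xi>))) \<in> L2_space"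
        by (rule L2_dominated(1)[OF _ conv_ixi_mult_L2(1)[OF a a], of _ 1]) (auto simp: ixi_mult_def)
    qed
    fix \<xi> :: real
    have "\<bar>\<xi> * (3/4 - 7/48 * \<xi>\<^sup>2)\<bar> = \<bar>\<xi>\<bar> * \<bar>3/4 - 7/48 * \<xi>\<^sup>2\<bar>" by (rule abs_mult)
    also have "\<dots> \<le> jb \<xi> * (jb \<xi>)\<^sup>2"
    proof (intro mult_mono jb_abs)
      have "\<bar>3/4 - 7/48 * \<xi>\<^sup>2\<bar> \<le> 3/4 + 7/48 * \<xi>\<^sup>2" using zero_le_power2[of \<xi>] by (simp add: abs_le_iff)
      also have "\<dots> \<le> (jb \<xi>)\<^sup>2" by (simp add: jb_def power2_sum) (use zero_le_power2[of \<xi>] in linarith)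
      finally show "\<bar>3/4 - 7/48 * \<xi>\<^sup>2\<bar> \<le> (jb \<xi>)\<^sup>2" .
    qed auto
    finally have k1: "\<bar>\<xi> * (3/4 - 7/48 * \<xi>\<^sup>2)\<bar> \<le> jb \<xi> * (jb \<xi>)\<^sup>2" .
    have k2: "norm (7/48 * complex_of_real \<xi>) \<le> jb \<xi>" using jb_abs[of \<xi>] by (simp add: norm_mult norm_divide)
    have "norm (quad_part a \<xi>) \<le> norm (complex_of_real (\<xi> * (3/4 - 7/48 * \<xi>\<^sup>2)) * conv a a \<xi>) + norm (7/48 * complex_of_real \<xi> * conv (ixi_mult a) (ixi_mult a) \<xi>)"
      unfolding quad_part_def by (rule norm_triangle_ineq4)
    also have "\<dots> = \<bar>\<xi> * (3/4 - 7/48 * \<xi>\<^sup>2)\<bar> * norm (conv a a \<xi>) + norm (7/48 * complex_of_real \<xi>) * norm (conv (ixi_mult a) (ixi_mult a) \<xi>)"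
      by (simp only: norm_mult norm_of_real)
    also have "\<dots> \<le> (jb \<xi> * (jb \<xi>)\<^sup>2) * norm (conv a a \<xi>) + jb \<xi> * norm (conv (ixi_mult a) (ixi_mult a) \<xi>)"
      by (intro add_mono mult_right_mono k1 k2) auto
    finally show "norm (quad_part a \<xi>) \<le> jb \<xi> * norm (complex_of_real (norm (wt (\<lambda>\<xi>. (jb \<xi>)\<^sup>2) (conv a a) \<xi>)) + complex_of_real (norm (conv (ixi_mult a) (ixi_mult a) \<xi>)))"
      unfolding of_real_add[symmetric] norm_of_real by (simp add: norm_wt distrib_left mult.assoc)
  qed measurable
  have i2: "integrable lborel (\<lambda>\<xi>. ?m \<xi> * a (- \<xi>) * (of_real \<xi> * conv (conv a a) a \<xi>))"
  proof (rule int)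
    show "conv (conv a a) a \<in> L2_space" using X2_self(1) X2_conv(1)[OF c a] by blast
    show "norm (of_real \<xi> * conv (conv a a) a \<xi>) \<le> jb \<xi> * norm (conv (conv a a) a \<xi>)" for \<xi>
      by (simp add: norm_mult mult_right_mono jb_abs)
  qed measurable
  have "(LINT \<xi>|lborel. of_real ((gw \<sigma> N \<xi>)\<^sup>2 * Dn \<xi>) * (cnj (a \<xi>) * Fhat a \<xi>))
    = (LINT \<xi>|lborel. of_real (1 / (2 * pi)) * (?m \<xi> * a (- \<xi>) * quad_part a \<xi>)
         - of_real (1 / (32 * pi\<^sup>2)) * (?m \<xi> * a (- \<xi>) * (of_real \<xi> * conv (conv a a) a \<xi>)))"
  proof (rule integral_cong_AE)
    show "AE \<xi> in lborel. of_real ((gw \<sigma> N \<xi>)\<^sup>2 * Dn \<xi>) * (cnj (a \<xi>) * Fhat a \<xi>) = of_real (1 / (2 * pi)) * (?m \<xi> * a (- \<xi>) * quad_part a \<xi>)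
         - of_real (1 / (32 * pi\<^sup>2)) * (?m \<xi> * a (- \<xi>) * (of_real \<xi> * conv (conv a a) a \<xi>))"
      using real
    proof eventually_elim
      case (elim \<xi>)
      have "of_real ((gw \<sigma> N \<xi>)\<^sup>2 * Dn \<xi>) * (cnj (a \<xi>) * Fhat a \<xi>) = ?m \<xi> * a (- \<xi>) * (of_real (Dn \<xi>) * Fhat a \<xi>)"
        unfolding elim by simp
      then show ?case unfolding Dn_Fhat by (simp add: right_diff_distrib mult_ac)
    qed
  qed measurable
  also have "\<dots> = of_real (1 / (2 * pi)) * (LINT \<xi>|lborel. ?m \<xi> * a (- \<xi>) * quad_part a \<xi>)
         - of_real (1 / (32 * pi\<^sup>2)) * (LINT \<xi>|lborel. ?m \<xi> * a (- \<xi>) * (of_real \<xi> * conv (conv a a) a \<xi>))"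
    using i1 i2 by (simp only: Bochner_Integration.integral_diff integrable_mult_right integral_mult_right_zero)
  finally have "norm (LINT \<xi>|lborel. of_real ((gw \<sigma> N \<xi>)\<^sup>2 * Dn \<xi>) * (cnj (a \<xi>) * Fhat a \<xi>))
     \<le> norm (complex_of_real (1 / (2 * pi))) * norm (LINT \<xi>|lborel. ?m \<xi> * a (- \<xi>) * quad_part a \<xi>)
       + norm (complex_of_real (1 / (32 * pi\<^sup>2))) * norm (LINT \<xi>|lborel. ?m \<xi> * a (- \<xi>) * (of_real \<xi> * conv (conv a a) a \<xi>))"
    by (simp only: norm_mult[symmetric] norm_triangle_ineq4)
  also have "\<dots> \<le> 1 * (12 * \<sigma>\<^sup>2 * inv_jb_norm * Y^3) + 1 * (16 * \<sigma>\<^sup>2 * inv_jb_norm\<^sup>2 * Y^4)"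
  proof (intro add_mono mult_mono)
    have "1 \<le> pi\<^sup>2" using pi_gt3 by (intro one_le_power) simp
    then show "norm (complex_of_real (1 / (32 * pi\<^sup>2))) \<le> 1" by (simp add: norm_divide norm_power)
    show "norm (complex_of_real (1 / (2 * pi))) \<le> 1" using pi_gt3 by (simp add: norm_divide)
  qed (use cubic_form_bound[OF s a] quartic_form_bound[OF s a] in \<open>auto simp: Y_def\<close>)
  also have "\<dots> \<le> Ke * \<sigma>\<^sup>2 * (Y^3 + Y^4)"
  proof -
    have "0 \<le> 12 * inv_jb_norm * \<sigma>\<^sup>2 * Y^4 + 16 * inv_jb_norm\<^sup>2 * \<sigma>\<^sup>2 * Y^3" using Y0 by simp
    then show ?thesis by (simp add: Ke_def algebra_simps)
  qed
  finally show ?thesis unfolding Y_def .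
qed

end

section \<open>Differentiation in time\<close>

lemma L2_norm_add_sq:
  assumes f: "f \<in> L2_space" and g: "g \<in> L2_space"
  shows "(L2_norm (\<lambda>x. f x + g x))\<^sup>2 = (L2_norm f)\<^sup>2 + 2 * Re (LINT x|lborel. f x * cnj (g x)) + (L2_norm g)\<^sup>2"
proof -
  have i: "integrable lborel (\<lambda>x. f x * cnj (g x))" by (intro L2_mult_integrable L2_cnj f g)
  have "(norm (f x + g x))\<^sup>2 = (norm (f x))\<^sup>2 + 2 * Re (f x * cnj (g x)) + (norm (g x))\<^sup>2" for x
    unfolding cmod_power2 by (simp add: power2_eq_square algebra_simps)
  then have "(L2_norm (\<lambda>x. f x + g x))\<^sup>2 = (LINT x|lborel. (norm (f x))\<^sup>2 + 2 * Re (f x * cnj (g x)) + (norm (g x))\<^sup>2)"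
    by (simp add: L2_norm_sq)
  also have "\<dots> = (L2_norm f)\<^sup>2 + 2 * (LINT x|lborel. Re (f x * cnj (g x))) + (L2_norm g)\<^sup>2"
    using i L2_integrable[OF f] L2_integrable[OF g] integrable_Re[OF i] by (simp add: L2_norm_sq del: times_complex.sel)
  finally show ?thesis using integral_Re[OF i] by simp
qed

text \<open>The chain rule for the squared norm, with differentiability of u at t as an L2-valued
  curve spelled out in the last hypothesis.\<close>

lemma L2_norm_sq_has_derivative:
  assumes u: "\<And>s. s \<in> S \<Longrightarrow> u s \<in> L2_space" and v: "v \<in> L2_space" and t: "t \<in> S"
    and lim: "\<And>e. e > 0 \<Longrightarrow> \<exists>d>0. \<forall>s\<in>S. \<bar>s - t\<bar> < d \<longrightarrow>
       L2_norm (\<lambda>\<xi>. u s \<xi> - u t \<xi> - of_real (s - t) * v \<xi>) \<le> e * \<bar>s - t\<bar>"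
  shows "((\<lambda>s. (L2_norm (u s))\<^sup>2) has_real_derivative 2 * Re (LINT \<xi>|lborel. u t \<xi> * cnj (v \<xi>))) (at t within S)"
  unfolding has_field_derivative_iff Lim_within
proof (intro allI impI)
  fix e :: real assume e: "e > 0"
  define U where "U = L2_norm (u t)"
  define V where "V = L2_norm v"
  define D where "D = 2 * Re (LINT \<xi>|lborel. u t \<xi> * cnj (v \<xi>))"
  have UV: "0 \<le> U" "0 \<le> V" by (auto simp: U_def V_def)
  \<comment> \<open>The quotient differs from D by at most 2 U e' + |h| (1 + V)^2; e' and d' make
    each summand at most e / 2. The minimum with 1 serves the bound |h| (1 + V) for the increment
    w.\<close>
  define e' where "e' = min 1 (e / (4 * (U + 1)))"
  have e': "0 < e'" "e' \<le> 1" using e UV by (auto simp: e'_def)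
  have Ue: "2 * U * e' \<le> e / 2"
  proof -
    have "2 * U * e' \<le> 2 * (U + 1) * (e / (4 * (U + 1)))" using UV e' e by (intro mult_mono) (auto simp: e'_def)
    also have "\<dots> = e / 2" using UV by (simp add: field_simps)
    finally show ?thesis .
  qed
  obtain d where d: "d > 0" and le: "\<And>s. s \<in> S \<Longrightarrow> \<bar>s - t\<bar> < d \<Longrightarrow>
     L2_norm (\<lambda>\<xi>. u s \<xi> - u t \<xi> - of_real (s - t) * v \<xi>) \<le> e' * \<bar>s - t\<bar>"
    using lim[OF e'(1)] by blast
  define d' where "d' = min d (e / (2 * (1 + V)\<^sup>2))"
  have d': "0 < d'" using d e UV by (auto simp: d'_def intro!: divide_pos_pos)
  have "dist (((L2_norm (u s))\<^sup>2 - (L2_norm (u t))\<^sup>2) / (s - t)) D < e" if s: "s \<in> S" "0 < dist s t" "dist s t < d'" for s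
  proof -
    define h where "h = s - t"
    have h: "h \<noteq> 0" "\<bar>h\<bar> < d" "\<bar>h\<bar> < e / (2 * (1 + V)\<^sup>2)" using s by (auto simp: h_def dist_real_def d'_def)
    define \<rho> where "\<rho> \<xi> = u s \<xi> - u t \<xi> - of_real h * v \<xi>" for \<xi>
    have \<rho>: "\<rho> \<in> L2_space" "L2_norm \<rho> \<le> e' * \<bar>h\<bar>"
      using le[OF s(1)] h unfolding \<rho>_def[abs_def] h_def by (auto intro!: L2_diff L2_scale u s t v)
    define w where "w \<xi> = \<rho> \<xi> + of_real h * v \<xi>" for \<xi>
    have w: "w \<in> L2_space" unfolding w_def[abs_def] by (intro L2_add L2_scale \<rho> v)
    have "L2_norm w \<le> L2_norm \<rho> + \<bar>h\<bar> * V"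
      unfolding w_def[abs_def] using L2_triangle[OF \<rho>(1) L2_scale[OF v, of "of_real h"]] by (simp add: L2_norm_scale V_def)
    also have "\<dots> \<le> e' * \<bar>h\<bar> + \<bar>h\<bar> * V" using \<rho> by simp
    also have "\<dots> \<le> 1 * \<bar>h\<bar> + \<bar>h\<bar> * V" using e' UV by (intro add_mono mult_right_mono) auto
    finally have wn: "L2_norm w \<le> \<bar>h\<bar> * (1 + V)" by (simp add: algebra_simps)
    have us: "u s = (\<lambda>\<xi>. u t \<xi> + w \<xi>)" by (simp add: w_def \<rho>_def fun_eq_iff)
    have iw: "(LINT \<xi>|lborel. u t \<xi> * cnj (w \<xi>)) = (LINT \<xi>|lborel. u t \<xi> * cnj (\<rho> \<xi>)) + of_real h * (LINT \<xi>|lborel. u t \<xi> * cnj (v \<xi>))"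
    proof -
      have "(LINT \<xi>|lborel. u t \<xi> * cnj (w \<xi>)) = (LINT \<xi>|lborel. u t \<xi> * cnj (\<rho> \<xi>) + of_real h * (u t \<xi> * cnj (v \<xi>)))"
        by (simp add: w_def algebra_simps)
      also have "\<dots> = (LINT \<xi>|lborel. u t \<xi> * cnj (\<rho> \<xi>)) + of_real h * (LINT \<xi>|lborel. u t \<xi> * cnj (v \<xi>))"
        using L2_mult_integrable[OF u[OF t] L2_cnj[OF \<rho>(1)]] L2_mult_integrable[OF u[OF t] L2_cnj[OF v]]
        by (simp add: integral_mult_right_zero)
      finally show ?thesis .
    qed
    have "(L2_norm (u s))\<^sup>2 = U\<^sup>2 + 2 * Re (LINT \<xi>|lborel. u t \<xi> * cnj (w \<xi>)) + (L2_norm w)\<^sup>2"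
      using L2_norm_add_sq[OF u[OF t] w] by (simp only: us U_def[symmetric])
    then have eq: "(L2_norm (u s))\<^sup>2 - (L2_norm (u t))\<^sup>2 - h * D = 2 * Re (LINT \<xi>|lborel. u t \<xi> * cnj (\<rho> \<xi>)) + (L2_norm w)\<^sup>2"
      unfolding iw D_def U_def by (simp add: algebra_simps)
    have "\<bar>Re (LINT \<xi>|lborel. u t \<xi> * cnj (\<rho> \<xi>))\<bar> \<le> U * L2_norm \<rho>"
      using order_trans[OF abs_Re_le_cmod L2_CS[OF u[OF t] L2_cnj[OF \<rho>(1)]]] by (simp add: U_def)
    also have "\<dots> \<le> U * (e' * \<bar>h\<bar>)" using \<rho> UV by (intro mult_left_mono) auto
    finally have "\<bar>(L2_norm (u s))\<^sup>2 - (L2_norm (u t))\<^sup>2 - h * D\<bar> \<le> 2 * (U * (e' * \<bar>h\<bar>)) + (L2_norm w)\<^sup>2"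
      unfolding eq using zero_le_power2[of "L2_norm w"] by linarith
    also have "\<dots> \<le> 2 * (U * (e' * \<bar>h\<bar>)) + (\<bar>h\<bar> * (1 + V))\<^sup>2" using wn by (intro add_left_mono power_mono) auto
    also have "2 * (U * (e' * \<bar>h\<bar>)) + (\<bar>h\<bar> * (1 + V))\<^sup>2 = \<bar>h\<bar> * (2 * U * e' + \<bar>h\<bar> * (1 + V)\<^sup>2)"
      by (simp only: power_mult_distrib power2_eq_square distrib_left distrib_right ac_simps)
    also have "\<dots> < \<bar>h\<bar> * e"
    proof -
      have "\<bar>h\<bar> * (1 + V)\<^sup>2 < e / 2"
        using h(3) UV by (simp add: pos_less_divide_eq)
      then show ?thesis using h(1) Ue by (intro mult_strict_left_mono) auto
    qed
    finally have "\<bar>(L2_norm (u s))\<^sup>2 - (L2_norm (u t))\<^sup>2 - h * D\<bar> < \<bar>h\<bar> * e" .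
    moreover have "((L2_norm (u s))\<^sup>2 - (L2_norm (u t))\<^sup>2) / h - D = ((L2_norm (u s))\<^sup>2 - (L2_norm (u t))\<^sup>2 - h * D) / h"
      using h(1) by (simp add: field_simps)
    ultimately show ?thesis using h(1)
      by (simp add: h_def[symmetric] dist_real_def abs_divide pos_divide_less_eq mult.commute)
  qed
  then show "\<exists>d>0. \<forall>x\<in>S. 0 < dist x t \<and> dist x t < d \<longrightarrow>
       dist (((L2_norm (u x))\<^sup>2 - (L2_norm (u t))\<^sup>2) / (x - t)) (2 * Re (LINT \<xi>|lborel. u t \<xi> * cnj (v \<xi>))) < e"
    unfolding D_def using d' by blast
qed

text \<open>If E exceeded 2 M at time T, let s be the first time at which E reaches 2 M. Before s
  the derivative bound is in force, so the mean value theorem limits the growth up to s to T * K <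
  M, whereas E has grown by at least M.\<close>

lemma continuity_bootstrap:
  fixes E E' :: "real \<Rightarrow> real"
  assumes der: "\<And>t. 0 \<le> t \<Longrightarrow> (E has_real_derivative E' t) (at t within {0..})"
    and bound: "\<And>t. 0 \<le> t \<Longrightarrow> E t \<le> 2 * M \<Longrightarrow> \<bar>E' t\<bar> \<le> K"
    and init: "E 0 \<le> M" and T: "0 \<le> T" and small: "T * K < M" and M: "0 < M"
  shows "E T \<le> 2 * M"
proof (rule ccontr)
  assume "\<not> E T \<le> 2 * M"
  define A where "A = {t \<in> {0..T}. 2 * M \<le> E t}"
  have cont: "continuous_on {0..T} E"
    by (rule continuous_on_subset[of "{0..}"]) (use der in \<open>auto intro!: DERIV_continuous_on\<close>)
  have "closed A"
    unfolding A_def by (rule continuous_on_closed_Collect_le[OF continuous_on_const cont closed_atLeastAtMost])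
  moreover have "T \<in> A" using \<open>\<not> E T \<le> 2 * M\<close> T by (simp add: A_def)
  moreover have bdd: "bdd_below A" by (rule bdd_belowI[of _ 0]) (simp add: A_def)
  ultimately have "Inf A \<in> A" by (intro closed_contains_Inf) auto
  define s where "s = Inf A"
  have s: "0 \<le> s" "s \<le> T" "2 * M \<le> E s" using \<open>Inf A \<in> A\<close> by (auto simp: s_def A_def)
  have below: "E t < 2 * M" if "0 \<le> t" "t < s" for t
  proof (rule ccontr)
    assume "\<not> E t < 2 * M"
    then have "t \<in> A" using that s by (simp add: A_def)
    then have "s \<le> t" unfolding s_def by (rule cInf_lower[OF _ bdd])
    then show False using that by simp
  qed
  have "s \<noteq> 0" using init s M by auto
  then have "0 < s" using s by simp
  have der': "(E has_real_derivative E' x) (at x)" if "0 < x" for x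
  proof -
    have "{0<..} \<subseteq> {0::real..}" by auto
    from at_within_open_subset[OF _ open_greaterThan this, of x] show ?thesis using der[of x] that by simp
  qed
  have "\<exists>l z. 0 < z \<and> z < s \<and> DERIV E z :> l \<and> E s - E 0 = (s - 0) * l"
  proof (rule MVT[OF \<open>0 < s\<close>])
    show "continuous_on {0..s} E" using continuous_on_subset[OF cont] s by auto
    show "E differentiable (at x)" if "0 < x" "x < s" for x
      using der'[OF that(1)] real_differentiable_def by blast
  qed
  then obtain l z where z: "0 < z" "z < s" "DERIV E z :> l" "E s - E 0 = s * l" by auto
  have "l = E' z" using DERIV_unique[OF z(3) der'[OF z(1)]] .
  then have l: "\<bar>l\<bar> \<le> K" using bound[of z] below[of z] z by simp
  have "s * l \<le> s * \<bar>l\<bar>" using s by (intro mult_left_mono) auto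
  also have "\<dots> \<le> T * K" using l s T by (intro mult_mono) auto
  finally have "s * l \<le> T * K" .
  then show False using z(4) s init small by simp
qed

section \<open>Increments of limits of Riemann sums\<close>

lemma X2_sum: "(\<And>i. i \<in> A \<Longrightarrow> f i \<in> X2) \<Longrightarrow> (\<lambda>x. \<Sum>i\<in>A. f i x) \<in> X2"
proof (induction A rule: infinite_finite_induct)
  case (insert x F)
  then show ?case using X2_add[of "f x" "\<lambda>y. \<Sum>i\<in>F. f i y"] by simp
qed (auto simp: X2_def wt_def)

lemma X2_norm_zero [simp]: "X2_norm (\<lambda>x. 0) = 0"
  by (simp add: X2_norm_def wt_def)

lemma X2_norm_sum:
  "finite A \<Longrightarrow> (\<And>i. i \<in> A \<Longrightarrow> f i \<in> X2) \<Longrightarrow> X2_norm (\<lambda>x. \<Sum>i\<in>A. f i x) \<le> (\<Sum>i\<in>A. X2_norm (f i))"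
proof (induction A rule: finite_induct)
  case (insert x F)
  have "X2_norm (\<lambda>y. f x y + (\<Sum>i\<in>F. f i y)) \<le> X2_norm (f x) + X2_norm (\<lambda>y. \<Sum>i\<in>F. f i y)"
    using insert by (intro X2_norm_triangle X2_sum) auto
  with insert show ?case by auto
qed simp

text \<open>Join a fine tagged division of {0..s} to one of {s..t}: the Riemann sums over the first
  interval cancel and those over the second differ from (t - s) * G c by at most e (t - s). The
  reference time c is free so that it can be either endpoint.\<close>

lemma riemann_increment:
  assumes R: "\<And>t e. 0 \<le> t \<Longrightarrow> 0 < e \<Longrightarrow> \<exists>d>0. \<forall>p. p tagged_division_of {0..t} \<and> (\<lambda>r. ball r d) fine p \<longrightarrow>
      X2_norm (\<lambda>\<xi>. (\<Sum>(r, K)\<in>p. of_real (measure lborel K) * G r \<xi>) - J t \<xi>) < e"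
    and J: "\<And>t. 0 \<le> t \<Longrightarrow> J t \<in> X2" and G: "\<And>t. 0 \<le> t \<Longrightarrow> G t \<in> X2"
    and st: "0 \<le> s" "s \<le> t" and c: "0 \<le> c"
    and near: "\<And>r. s \<le> r \<Longrightarrow> r \<le> t \<Longrightarrow> X2_norm (\<lambda>\<xi>. G r \<xi> - G c \<xi>) \<le> e"
  shows "X2_norm (\<lambda>\<xi>. J t \<xi> - J s \<xi> - of_real (t - s) * G c \<xi>) \<le> e * (t - s)"
proof (rule field_le_epsilon)
  fix e' :: real assume e': "0 < e'"
  obtain d1 where d1: "d1 > 0" "\<And>p. p tagged_division_of {0..s} \<Longrightarrow> (\<lambda>r. ball r d1) fine p \<Longrightarrow>
      X2_norm (\<lambda>\<xi>. (\<Sum>(r, K)\<in>p. of_real (measure lborel K) * G r \<xi>) - J s \<xi>) < e' / 2"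
    using R[OF st(1), of "e' / 2"] e' by auto
  obtain d2 where d2: "d2 > 0" "\<And>p. p tagged_division_of {0..t} \<Longrightarrow> (\<lambda>r. ball r d2) fine p \<Longrightarrow>
      X2_norm (\<lambda>\<xi>. (\<Sum>(r, K)\<in>p. of_real (measure lborel K) * G r \<xi>) - J t \<xi>) < e' / 2"
    using R[of t "e' / 2"] e' st by auto
  define d where "d = min d1 d2"
  have d: "0 < d" using d1 d2 by (simp add: d_def)
  obtain p where p: "p tagged_division_of {0..s}" "(\<lambda>r. ball r d) fine p"
    using fine_division_exists_real[OF gauge_ball[OF d]] by blast
  obtain q where q: "q tagged_division_of {s..t}" "(\<lambda>r. ball r d) fine q"
    using fine_division_exists_real[OF gauge_ball[OF d]] by blast
  have fine_mono: "(\<lambda>r. ball r d') fine x" if "(\<lambda>r. ball r d) fine x" "d \<le> d'" for d' and x :: "(real \<times> real set) set"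
    using that(1) subset_ball[OF that(2)] unfolding fine_def by fastforce
  have "{0..s} \<union> {s..t} = {0..t}" using st by auto
  moreover have "interior {0..s} \<inter> interior {s..t} = {}" by (auto simp: interior_atLeastAtMost_real)
  ultimately have pq: "(p \<union> q) tagged_division_of {0..t}" using tagged_division_Un[OF p(1) q(1)] by simp
  have pqf: "(\<lambda>r. ball r d) fine (p \<union> q)" using p q by (intro fine_Un)
  have fin: "finite p" "finite q" using p q by (auto intro: tagged_division_of_finite)
  have tags: "fst z \<in> {s..t}" if "z \<in> q" for z using tag_in_interval[OF q(1), of "fst z" "snd z"] that by simp
  have tagsp: "fst z \<in> {0..s}" if "z \<in> p" for z using tag_in_interval[OF p(1), of "fst z" "snd z"] that by simp
  \<comment> \<open>Both divisions may contain the degenerate interval {s} with tag s, which the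
    union counts once; having measure zero, it contributes nothing.\<close>
  have overlap: "measure lborel (snd z) = 0" if "z \<in> p \<inter> q" for z
  proof -
    have "snd z \<subseteq> {0..s}" "snd z \<subseteq> {s..t}"
      using that tagged_division_ofD(3)[OF p(1), of "fst z" "snd z"] tagged_division_ofD(3)[OF q(1), of "fst z" "snd z"] by auto
    then have "snd z \<subseteq> {s}" by fastforce
    then have "snd z = {} \<or> snd z = {s}" by (rule subset_singletonD)
    then show ?thesis by (auto simp: measure_def)
  qed
  let ?\<Sigma> = "\<lambda>x \<xi>. (\<Sum>(r, K)\<in>x. of_real (measure lborel K) * G r \<xi>)"
  have sumU: "?\<Sigma> (p \<union> q) \<xi> = ?\<Sigma> p \<xi> + ?\<Sigma> q \<xi>" for \<xi>
  proof (rule sum.union_inter_neutral[OF fin], rule ballI)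
    fix z assume "z \<in> p \<inter> q"
    from overlap[OF this] show "(case z of (r, K) \<Rightarrow> of_real (measure lborel K) * G r \<xi>) = 0"
      by (simp only: split_beta of_real_0 mult_zero_left)
  qed
  have sumK: "(\<Sum>z\<in>q. measure lborel (snd z)) = t - s"
  proof -
    have "(\<Sum>(x, K)\<in>q. measure lborel K) = measure lborel (cbox s t)"
      by (rule additive_content_tagged_division) (use q(1) in simp)
    then show ?thesis using st by (simp add: split_beta)
  qed
  have GX: "G (fst z) \<in> X2" if "z \<in> q" for z using tags[OF that] st by (intro G) auto
  have GXp: "G (fst z) \<in> X2" if "z \<in> p" for z using tagsp[OF that] st by (intro G) auto
  have sX: "?\<Sigma> p \<in> X2" "?\<Sigma> q \<in> X2" "?\<Sigma> (p \<union> q) \<in> X2"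
    unfolding split_beta using GX GXp by (auto intro!: X2_sum X2_scale)
  let ?Q = "\<lambda>\<xi>. \<Sum>z\<in>q. of_real (measure lborel (snd z)) * (G (fst z) \<xi> - G c \<xi>)"
  have QX: "?Q \<in> X2" using GX by (intro X2_sum X2_scale X2_diff G[OF c]) auto
  have Q: "?Q \<xi> = ?\<Sigma> q \<xi> - of_real (t - s) * G c \<xi>" for \<xi>
    unfolding sumK[symmetric] of_real_sum by (simp add: split_beta right_diff_distrib sum_subtractf sum_distrib_right)
  have "X2_norm ?Q \<le> (\<Sum>z\<in>q. X2_norm (\<lambda>\<xi>. of_real (measure lborel (snd z)) * (G (fst z) \<xi> - G c \<xi>)))"
    using GX by (intro X2_norm_sum fin X2_scale X2_diff G[OF c]) auto
  also have "\<dots> = (\<Sum>z\<in>q. measure lborel (snd z) * X2_norm (\<lambda>\<xi>. G (fst z) \<xi> - G c \<xi>))"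
    by (simp add: X2_norm_scale)
  also have "\<dots> \<le> (\<Sum>z\<in>q. measure lborel (snd z) * e)"
    using tags near by (intro sum_mono mult_left_mono) auto
  also have "\<dots> = e * (t - s)" unfolding sum_distrib_right[symmetric] sumK by (rule mult.commute)
  finally have nQ: "X2_norm ?Q \<le> e * (t - s)" .
  have "X2_norm (\<lambda>\<xi>. J t \<xi> - J s \<xi> - of_real (t - s) * G c \<xi>)
    = X2_norm (\<lambda>\<xi>. (?Q \<xi> + (?\<Sigma> p \<xi> - J s \<xi>)) - (?\<Sigma> (p \<union> q) \<xi> - J t \<xi>))"
    unfolding Q sumU by (rule arg_cong[where f=X2_norm]) (auto simp: fun_eq_iff)
  also have "\<dots> \<le> X2_norm (\<lambda>\<xi>. ?Q \<xi> + (?\<Sigma> p \<xi> - J s \<xi>)) + X2_norm (\<lambda>\<xi>. ?\<Sigma> (p \<union> q) \<xi> - J t \<xi>)"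
    by (intro X2_norm_triangle_diff X2_add X2_diff QX sX J) (use st in auto)
  also have "\<dots> \<le> (X2_norm ?Q + X2_norm (\<lambda>\<xi>. ?\<Sigma> p \<xi> - J s \<xi>)) + X2_norm (\<lambda>\<xi>. ?\<Sigma> (p \<union> q) \<xi> - J t \<xi>)"
    by (intro add_right_mono X2_norm_triangle X2_diff QX sX J) (use st in auto)
  also have "\<dots> \<le> (e * (t - s) + e' / 2) + e' / 2"
    using d1(2)[OF p(1) fine_mono[OF p(2)]] d2(2)[OF pq fine_mono[OF pqf]] nQ by (intro add_mono) (auto simp: d_def)
  finally show "X2_norm (\<lambda>\<xi>. J t \<xi> - J s \<xi> - of_real (t - s) * G c \<xi>) \<le> e * (t - s) + e'" by simp
qed

section \<open>Passage between H^2 and its Fourier image\<close>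

lemma X2_cong_AE:
  assumes [measurable]: "b \<in> borel_measurable borel" and a: "a \<in> X2" and ae: "AE \<xi> in lborel. b \<xi> = a \<xi>"
  shows "b \<in> X2" "X2_norm b = X2_norm a"
proof -
  note [measurable] = X2_measurable[OF a]
  have "AE \<xi> in lborel. wt (\<lambda>\<xi>. (jb \<xi>)\<^sup>2) b \<xi> = wt (\<lambda>\<xi>. (jb \<xi>)\<^sup>2) a \<xi>"
    using ae by eventually_elim (simp add: wt_def)
  from L2_cong_AE[OF _ X2_wt_L2[OF a] this] show "b \<in> X2" "X2_norm b = X2_norm a"
    by (auto simp: X2_def X2_norm_def)
qed

lemma X2_unimodular:
  assumes a: "a \<in> X2" and [measurable]: "e \<in> borel_measurable borel" and e: "\<And>\<xi>. norm (e \<xi>) = 1"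
  shows "(\<lambda>\<xi>. e \<xi> * a \<xi>) \<in> X2" "X2_norm (\<lambda>\<xi>. e \<xi> * a \<xi>) = X2_norm a"
proof -
  note [measurable] = X2_measurable[OF a]
  have n: "norm (wt (\<lambda>\<xi>. (jb \<xi>)\<^sup>2) (\<lambda>\<xi>. e \<xi> * a \<xi>) \<xi>) = norm (wt (\<lambda>\<xi>. (jb \<xi>)\<^sup>2) a \<xi>)" for \<xi>
    by (simp add: norm_wt norm_mult e)
  have "wt (\<lambda>\<xi>. (jb \<xi>)\<^sup>2) (\<lambda>\<xi>. e \<xi> * a \<xi>) \<in> L2_space"
    by (rule L2_dominated(1)[OF _ X2_wt_L2[OF a], of _ 1]) (auto simp: n)
  then show "(\<lambda>\<xi>. e \<xi> * a \<xi>) \<in> X2" by (simp add: X2_def)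
  show "X2_norm (\<lambda>\<xi>. e \<xi> * a \<xi>) = X2_norm a"
    unfolding X2_norm_def by (rule L2_norm_eq[OF n])
qed

lemma gevrey_weight_2: "gevrey_weight \<sigma> 2 \<xi> = cosh (\<sigma> * \<bar>\<xi>\<bar>) * (1 + \<xi>\<^sup>2)"
  by (simp add: gevrey_weight_def add_pos_nonneg)

lemma abs_gevrey_weight_0: "\<bar>gevrey_weight 0 2 \<xi>\<bar> = 1 + \<xi>\<^sup>2"
  by (simp add: gevrey_weight_2)

lemma jb_sq_le: "(jb \<xi>)\<^sup>2 \<le> 2 * (1 + \<xi>\<^sup>2)"
  using sum_squares_bound[of 1 "\<bar>\<xi>\<bar>"] by (simp add: jb_def power2_sum)

lemma jb_sq_ge: "1 + \<xi>\<^sup>2 \<le> (jb \<xi>)\<^sup>2"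
  by (simp add: jb_def power2_sum)

lemma sobolev_L2: "u \<in> sobolev_space s \<Longrightarrow> u \<in> L2_space"
  by (simp add: gevrey_space_def)

lemma sobolev_X2:
  assumes u: "u \<in> sobolev_space 2"
  shows "fourier u \<in> X2" and "X2_norm (fourier u) \<le> 2 * sobolev_norm 2 u"
proof -
  note [measurable] = fourier_measurable[OF sobolev_L2[OF u]]
  have w: "(\<lambda>\<xi>. of_real (gevrey_weight 0 2 \<xi>) * fourier u \<xi>) \<in> L2_space" using u by (simp add: gevrey_space_def)
  have ae: "AE \<xi> in lborel. norm (wt (\<lambda>\<xi>. (jb \<xi>)\<^sup>2) (fourier u) \<xi>) \<le> 2 * norm (of_real (gevrey_weight 0 2 \<xi>) * fourier u \<xi>)"
  proof (rule AE_I2)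
    fix \<xi>
    have "norm (wt (\<lambda>\<xi>. (jb \<xi>)\<^sup>2) (fourier u) \<xi>) \<le> 2 * (1 + \<xi>\<^sup>2) * norm (fourier u \<xi>)"
      using jb_sq_le[of \<xi>] by (simp add: norm_wt mult_right_mono)
    also have "\<dots> = 2 * norm (of_real (gevrey_weight 0 2 \<xi>) * fourier u \<xi>)"
      by (simp only: norm_mult norm_of_real abs_gevrey_weight_0 mult.assoc)
    finally show "norm (wt (\<lambda>\<xi>. (jb \<xi>)\<^sup>2) (fourier u) \<xi>) \<le> 2 * norm (of_real (gevrey_weight 0 2 \<xi>) * fourier u \<xi>)" .
  qed
  have m: "wt (\<lambda>\<xi>. (jb \<xi>)\<^sup>2) (fourier u) \<in> borel_measurable borel" by measurable
  from L2_dominated[OF m w ae] show "fourier u \<in> X2" "X2_norm (fourier u) \<le> 2 * sobolev_norm 2 u"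
    by (simp_all add: X2_def X2_norm_def gevrey_norm_def)
qed

lemma X2_sobolev:
  assumes u: "u \<in> L2_space" and f: "fourier u \<in> X2"
  shows "u \<in> sobolev_space 2"
proof -
  note [measurable] = fourier_measurable[OF u]
  have "(\<lambda>\<xi>. of_real (gevrey_weight 0 2 \<xi>) * fourier u \<xi>) \<in> L2_space"
  proof (rule L2_dominated(1)[OF _ X2_wt_L2[OF f], of _ 1])
    show "AE \<xi> in lborel. norm (of_real (gevrey_weight 0 2 \<xi>) * fourier u \<xi>) \<le> 1 * norm (wt (\<lambda>\<xi>. (jb \<xi>)\<^sup>2) (fourier u) \<xi>)"
    proof (rule AE_I2)
      fix \<xi>
      have "norm (of_real (gevrey_weight 0 2 \<xi>) * fourier u \<xi>) = (1 + \<xi>\<^sup>2) * norm (fourier u \<xi>)"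
        by (simp only: norm_mult norm_of_real abs_gevrey_weight_0 mult.assoc)
      also have "\<dots> \<le> (jb \<xi>)\<^sup>2 * norm (fourier u \<xi>)" using jb_sq_ge by (rule mult_right_mono) simp
      finally show "norm (of_real (gevrey_weight 0 2 \<xi>) * fourier u \<xi>) \<le> 1 * norm (wt (\<lambda>\<xi>. (jb \<xi>)\<^sup>2) (fourier u) \<xi>)"
        by (simp add: norm_wt)
    qed
  qed (simp_all add: gevrey_weight_2)
  then show ?thesis using u by (simp add: gevrey_space_def)
qed

text \<open>Multipliers are applied to functions whose transform is known only up to null sets, so
  the transform is replaced by a representative A.\<close>

lemma multiplier_AE:
  assumes f: "f \<in> L2_space" and ae: "AE \<xi> in lborel. fourier f \<xi> = A \<xi>"
    and [measurable]: "m \<in> borel_measurable borel" and mA: "(\<lambda>\<xi>. m \<xi> * A \<xi>) \<in> L2_space"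
  shows "fourier_multiplier m f \<in> L2_space"
    and "AE \<xi> in lborel. fourier (fourier_multiplier m f) \<xi> = m \<xi> * A \<xi>"
proof -
  note [measurable] = fourier_measurable[OF f]
  have eq: "AE \<xi> in lborel. m \<xi> * fourier f \<xi> = m \<xi> * A \<xi>" using ae by eventually_elim simp
  have L: "(\<lambda>\<xi>. m \<xi> * fourier f \<xi>) \<in> L2_space" by (rule L2_cong_AE(1)[OF _ mA eq]) measurable
  show "fourier_multiplier m f \<in> L2_space" by (rule fourier_multiplier(1)[OF L])
  show "AE \<xi> in lborel. fourier (fourier_multiplier m f) \<xi> = m \<xi> * A \<xi>"
    using fourier_multiplier(2)[OF L] eq by eventually_elim simp
qed

lemma integrable_AE_eq:
  assumes "integrable lborel g" "f \<in> borel_measurable borel" "AE x in lborel. f x = g x"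
  shows "integrable lborel (f :: real \<Rightarrow> complex)"
  using assms by (intro Bochner_Integration.integrable_bound[OF assms(1)]) (auto elim: AE_mp)

section \<open>Duhamel's formula on the Fourier side\<close>

locale kdvbbm_solution = kdvbbm +
  fixes \<eta>0 :: "real \<Rightarrow> real" and \<eta> :: "real \<Rightarrow> real \<Rightarrow> real"
  assumes sol: "kdvbbm_global_solution (7/48) \<gamma>1 \<gamma>2 \<delta>1 \<delta>2 \<eta>0 \<eta>"
    and \<eta>0: "complexify \<eta>0 \<in> sobolev_space 2"
begin

abbreviation "prop \<equiv> kdvbbm_propagator \<gamma>1 \<gamma>2 \<delta>1 \<delta>2"
abbreviation "nonlin \<equiv> kdvbbm_nonlinearity (7/48) \<gamma>1 \<delta>1"

text \<open>The symbol of the inverse propagator: multiplication by it undoes the linear flow, which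
  is why the propagator appears as \<open>E1 (- t)\<close>.\<close>

definition E1 :: "real \<Rightarrow> real \<Rightarrow> complex" where "E1 t \<xi> = exp (\<i> * of_real t * of_real (\<phi> \<xi>))"

lemma E1_measurable [measurable]: "E1 t \<in> borel_measurable borel"
  unfolding E1_def[abs_def] by measurable

lemma norm_E1 [simp]: "norm (E1 t \<xi>) = 1"
  using norm_exp_i_times[of "t * \<phi> \<xi>"] by (simp add: E1_def mult.assoc)

lemma E1_add: "E1 s \<xi> * E1 t \<xi> = E1 (s + t) \<xi>"
  unfolding E1_def exp_add[symmetric] by (simp add: algebra_simps)

lemma E1_0 [simp]: "E1 0 \<xi> = 1" by (simp add: E1_def)

lemma cnj_E1: "cnj (E1 t \<xi>) = E1 (- t) \<xi>" by (simp add: E1_def exp_cnj)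

lemma prop_symbol: "exp (- (\<i> * of_real t * of_real (\<phi> \<xi>))) = E1 (- t) \<xi>" by (simp add: E1_def)

lemma E1_X2: "a \<in> X2 \<Longrightarrow> (\<lambda>\<xi>. E1 t \<xi> * a \<xi>) \<in> X2"
  and E1_X2_norm: "a \<in> X2 \<Longrightarrow> X2_norm (\<lambda>\<xi>. E1 t \<xi> * a \<xi>) = X2_norm a"
  by (rule X2_unimodular; simp)+

lemma prop_fourier:
  assumes f: "f \<in> L2_space" and A: "A \<in> X2" and ae: "AE \<xi> in lborel. fourier f \<xi> = A \<xi>"
  shows "prop t f \<in> L2_space" and "AE \<xi> in lborel. fourier (prop t f) \<xi> = E1 (- t) \<xi> * A \<xi>"
proof -
  have "(\<lambda>\<xi>. E1 (- t) \<xi> * A \<xi>) \<in> L2_space" using X2_self(1) E1_X2[OF A] by blast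
  from multiplier_AE[OF f ae _ this]
  show "prop t f \<in> L2_space" and "AE \<xi> in lborel. fourier (prop t f) \<xi> = E1 (- t) \<xi> * A \<xi>"
    unfolding kdvbbm_propagator_def prop_symbol by simp_all
qed

lemma j3_L2:
  assumes "wt j3 f \<in> L2_space" and m: "f \<in> borel_measurable borel"
  shows "f \<in> L2_space"
proof (rule L2_dominated(1)[OF m assms(1), of 1])
  show "AE \<xi> in lborel. norm (f \<xi>) \<le> 1 * norm (wt j3 f \<xi>)"
  proof (rule AE_I2)
    fix \<xi>
    have "1 * norm (f \<xi>) \<le> (jb \<xi>)^3 * norm (f \<xi>)" by (intro mult_right_mono one_le_power jb_ge_1) simp
    then show "norm (f \<xi>) \<le> 1 * norm (wt j3 f \<xi>)" by (simp add: norm_wt)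
  qed
qed simp

text \<open>Membership of the transform in \<open>X2\<close> makes the transforms of u, of its
  square and of its derivative integrable, which is what \<open>fourier_product\<close> requires at
  each multiplication.\<close>

lemma nonlin_fourier:
  assumes u: "u \<in> L2_space" and A: "fourier u \<in> X2"
  shows "nonlin u \<in> L2_space" and "AE \<xi> in lborel. fourier (nonlin u) \<xi> = Fhat (fourier u) \<xi>"
proof -
  define a where "a = fourier u"
  have a: "a \<in> X2" using A by (simp add: a_def)
  note [measurable] = X2_measurable[OF a]
  let ?c = "complex_of_real (1 / (2 * pi))"
  have iu: "integrable lborel (fourier u)" using X2_self(3)[OF a a] by (simp add: a_def)
  define u2 where "u2 x = u x * u x" for x
  have u2: "u2 \<in> L2_space" "AE \<xi> in lborel. fourier u2 \<xi> = ?c * conv a a \<xi>"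
    using fourier_product[OF u u iu iu] by (auto simp: u2_def[abs_def] a_def)
  have X: "(\<lambda>\<xi>. ?c * conv a a \<xi>) \<in> X2" by (intro X2_scale X2_conv a)
  note X2c = X2_cong_AE[OF fourier_measurable[OF u2(1)] X u2(2)]
  have iu2: "integrable lborel (fourier u2)" by (rule X2_self(3)[OF X2c(1) X2c(1)])
  define u3 where "u3 x = u2 x * u x" for x
  have u3: "u3 \<in> L2_space" "AE \<xi> in lborel. fourier u3 \<xi> = ?c * (?c * conv (conv a a) a \<xi>)"
  proof -
    show "u3 \<in> L2_space" using fourier_product(1)[OF u2(1) u iu2 iu] by (simp add: u3_def[abs_def])
    have "conv (fourier u2) (fourier u) \<xi> = ?c * conv (conv a a) a \<xi>" for \<xi>
    proof -
      have "conv (fourier u2) (fourier u) \<xi> = conv (\<lambda>\<xi>. ?c * conv a a \<xi>) a \<xi>"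
        by (rule conv_cong_AE) (use u2 fourier_measurable[OF u2(1)] fourier_measurable[OF u] in \<open>auto simp: a_def\<close>)
      also have "\<dots> = ?c * conv (conv a a) a \<xi>" by (simp only: conv_def[of _ a \<xi>] mult.assoc integral_mult_right_zero)
      finally show ?thesis .
    qed
    then show "AE \<xi> in lborel. fourier u3 \<xi> = ?c * (?c * conv (conv a a) a \<xi>)"
      using fourier_product(2)[OF u2(1) u iu2 iu] by (simp add: u3_def[abs_def])
  qed
  define v where "v = deriv_x u"
  have dau: "(\<lambda>\<xi>. (\<i> * of_real \<xi>) * a \<xi>) \<in> L2_space" using X2_ixi_mult(1)[OF a] by (simp add: ixi_mult_def)
  have v: "v \<in> L2_space" "AE \<xi> in lborel. fourier v \<xi> = ixi_mult a \<xi>"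
    using multiplier_AE[OF u _ _ dau] unfolding v_def deriv_x_def ixi_mult_def by (simp_all add: a_def)
  have dam: "ixi_mult a \<in> borel_measurable borel" using borel_measurable_integrable[OF X2_ixi_mult(3)[OF a]] by simp
  have iv: "integrable lborel (fourier v)"
    by (rule integrable_AE_eq[OF X2_ixi_mult(3)[OF a] fourier_measurable[OF v(1)] v(2)])
  define v2 where "v2 x = v x * v x" for x
  have v2: "v2 \<in> L2_space" "AE \<xi> in lborel. fourier v2 \<xi> = ?c * conv (ixi_mult a) (ixi_mult a) \<xi>"
  proof -
    show "v2 \<in> L2_space" using fourier_product(1)[OF v(1) v(1) iv iv] by (simp add: v2_def[abs_def])
    have "conv (fourier v) (fourier v) \<xi> = conv (ixi_mult a) (ixi_mult a) \<xi>" for \<xi>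
      by (rule conv_cong_AE) (use v fourier_measurable[OF v(1)] dam in auto)
    then show "AE \<xi> in lborel. fourier v2 \<xi> = ?c * conv (ixi_mult a) (ixi_mult a) \<xi>"
      using fourier_product(2)[OF v(1) v(1) iv iv] by (simp add: v2_def[abs_def])
  qed
  have \<tau>\<psi>m: "(\<lambda>\<xi>. complex_of_real (\<tau> \<xi>)) \<in> borel_measurable borel" "(\<lambda>\<xi>. complex_of_real (\<psi> \<xi>)) \<in> borel_measurable borel"
    by measurable
  have c2: "(\<lambda>\<xi>. ?c * conv (ixi_mult a) (ixi_mult a) \<xi>) \<in> L2_space" by (intro L2_scale conv_ixi_mult_L2 a)
  have c3: "(\<lambda>\<xi>. ?c * (?c * conv (conv a a) a \<xi>)) \<in> L2_space"
    using X2_self(1) X2_scale[OF X2_scale[OF X2_conv(1)[OF X2_conv(1)[OF a a] a]]] by blast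
  define m1 where "m1 = fourier_multiplier (\<lambda>\<xi>. of_real (\<tau> \<xi>)) u2"
  define m2 where "m2 = fourier_multiplier (\<lambda>\<xi>. of_real (\<psi> \<xi>)) v2"
  define m3 where "m3 = fourier_multiplier (\<lambda>\<xi>. of_real (\<psi> \<xi>)) u3"
  have m1: "m1 \<in> L2_space" "AE \<xi> in lborel. fourier m1 \<xi> = of_real (\<tau> \<xi>) * (?c * conv a a \<xi>)"
    unfolding m1_def
    by (rule multiplier_AE[OF u2 \<tau>\<psi>m(1) j3_L2[OF tau_L2(1)[OF X]]];
        use X2_measurable[OF X] in measurable)+
  have m2: "m2 \<in> L2_space" "AE \<xi> in lborel. fourier m2 \<xi> = of_real (\<psi> \<xi>) * (?c * conv (ixi_mult a) (ixi_mult a) \<xi>)"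
    unfolding m2_def
    by (rule multiplier_AE[OF v2 \<tau>\<psi>m(2) j3_L2[OF psi_L2(1)[OF c2]]];
        use L2_measurable[OF c2] in measurable)+
  have m3: "m3 \<in> L2_space" "AE \<xi> in lborel. fourier m3 \<xi> = of_real (\<psi> \<xi>) * (?c * (?c * conv (conv a a) a \<xi>))"
    unfolding m3_def
    by (rule multiplier_AE[OF u3 \<tau>\<psi>m(2) j3_L2[OF psi_L2(1)[OF c3]]];
        use L2_measurable[OF c3] in measurable)+
  have n: "nonlin u = (\<lambda>x. (m1 x - 7/48 * m2 x) - 1/8 * m3 x)"
    unfolding kdvbbm_nonlinearity_def m1_def m2_def m3_def u2_def u3_def v2_def v_def
    by (simp add: power2_eq_square power3_eq_cube)
  have m12: "(\<lambda>x. m1 x - 7/48 * m2 x) \<in> L2_space" by (intro L2_diff L2_scale m1 m2)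
  show "nonlin u \<in> L2_space" unfolding n by (intro L2_diff L2_scale m12 m3)
  have "AE \<xi> in lborel. fourier (nonlin u) \<xi> = fourier m1 \<xi> - 7/48 * fourier m2 \<xi> - 1/8 * fourier m3 \<xi>"
    unfolding n using fourier_diff[OF m12 L2_scale[OF m3(1), of "1/8"]] fourier_scale[OF m3(1), of "1/8"]
      fourier_diff[OF m1(1) L2_scale[OF m2(1), of "7/48"]] fourier_scale[OF m2(1), of "7/48"]
    by eventually_elim (simp only:)
  then show "AE \<xi> in lborel. fourier (nonlin u) \<xi> = Fhat (fourier u) \<xi>"
    using m1(2) m2(2) m3(2) unfolding a_def[symmetric] by eventually_elim (simp add: Fhat_def)
qed

definition a :: "real \<Rightarrow> real \<Rightarrow> complex" where "a t = fourier (complexify (\<eta> t))"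
text \<open>Together with \<open>a\<close> this is the Fourier side of the Cauchy problem.
  \<open>G\<close> is the nonlinear term seen in the frame of the linear flow; the profile below has
  time derivative - \<i> * G t.\<close>

definition a0 :: "real \<Rightarrow> complex" where "a0 = fourier (complexify \<eta>0)"
definition G :: "real \<Rightarrow> real \<Rightarrow> complex" where "G t = (\<lambda>\<xi>. E1 t \<xi> * Fhat (a t) \<xi>)"

lemma eta_sobolev: "0 \<le> t \<Longrightarrow> complexify (\<eta> t) \<in> sobolev_space 2"
  using sol by (simp add: kdvbbm_global_solution_def)

lemma eta_L2: "0 \<le> t \<Longrightarrow> complexify (\<eta> t) \<in> L2_space"
  by (rule sobolev_L2[OF eta_sobolev])

lemma a_X2: "0 \<le> t \<Longrightarrow> a t \<in> X2"
  unfolding a_def by (rule sobolev_X2(1)[OF eta_sobolev])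

lemma a0_X2: "a0 \<in> X2"
  unfolding a0_def by (rule sobolev_X2(1)[OF \<eta>0])

lemma G_X2: "0 \<le> t \<Longrightarrow> G t \<in> X2"
  unfolding G_def by (intro E1_X2 Fhat_X2 a_X2)

lemma a_real:
  assumes t: "0 \<le> t" shows "AE \<xi> in lborel. a t (- \<xi>) = cnj (a t \<xi>)"
proof -
  have "AE \<xi> in lborel. a t \<xi> = cnj (a t (- \<xi>))"
    using fourier_cnj[OF eta_L2[OF t]] by (simp add: a_def)
  then show ?thesis by eventually_elim simp
qed

lemma a_tendsto:
  assumes t: "0 \<le> t"
  shows "((\<lambda>s. X2_norm (\<lambda>\<xi>. a s \<xi> - a t \<xi>)) \<longlongrightarrow> 0) (at t within {0..})"
proof -
  have lim: "((\<lambda>s. 2 * sobolev_norm 2 (complexify (\<lambda>x. \<eta> s x - \<eta> t x))) \<longlongrightarrow> 0) (at t within {0..})"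
    using tendsto_mult_right_zero[of "\<lambda>s. sobolev_norm 2 (complexify (\<lambda>x. \<eta> s x - \<eta> t x))"] sol t
    by (auto simp: kdvbbm_global_solution_def)
  have le: "X2_norm (\<lambda>\<xi>. a s \<xi> - a t \<xi>) \<le> 2 * sobolev_norm 2 (complexify (\<lambda>x. \<eta> s x - \<eta> t x))" if s: "s \<in> {0..}" for s
  proof -
    let ?d = "\<lambda>x. complexify (\<eta> s) x - complexify (\<eta> t) x"
    have d: "?d \<in> L2_space" using s t by (intro L2_diff eta_L2) auto
    have X: "(\<lambda>\<xi>. a s \<xi> - a t \<xi>) \<in> X2" using s t by (intro X2_diff a_X2) auto
    have ae: "AE \<xi> in lborel. fourier ?d \<xi> = a s \<xi> - a t \<xi>"
      unfolding a_def using fourier_diff[OF eta_L2 eta_L2, of s t] s t by simp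
    note * = X2_cong_AE[OF fourier_measurable[OF d] X ae]
    have "X2_norm (fourier ?d) \<le> 2 * sobolev_norm 2 ?d" by (rule sobolev_X2(2)[OF X2_sobolev[OF d *(1)]])
    then show ?thesis using *(2) by simp
  qed
  show ?thesis
  proof (rule tendsto_sandwich[OF _ _ tendsto_const lim])
    show "\<forall>\<^sub>F s in at t within {0..}. 0 \<le> X2_norm (\<lambda>\<xi>. a s \<xi> - a t \<xi>)" by simp
    show "\<forall>\<^sub>F s in at t within {0..}. X2_norm (\<lambda>\<xi>. a s \<xi> - a t \<xi>) \<le> 2 * sobolev_norm 2 (complexify (\<lambda>x. \<eta> s x - \<eta> t x))"
      using le unfolding eventually_at_filter by (intro always_eventually) blast
  qed
qed

lemma E1_diff: "norm (E1 s \<xi> - E1 t \<xi>) \<le> \<bar>s - t\<bar> * \<bar>\<phi> \<xi>\<bar>"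
proof -
  have "E1 s \<xi> - E1 t \<xi> = E1 t \<xi> * (exp (\<i> * of_real ((s - t) * \<phi> \<xi>)) - 1)"
    unfolding right_diff_distrib E1_def exp_add[symmetric] by (simp add: algebra_simps)
  then have "norm (E1 s \<xi> - E1 t \<xi>) = norm (exp (\<i> * of_real ((s - t) * \<phi> \<xi>)) - 1)" by (simp add: norm_mult)
  also have "\<dots> \<le> \<bar>(s - t) * \<phi> \<xi>\<bar>" using iexp_approx1[of "(s - t) * \<phi> \<xi>" 0] by simp
  finally show ?thesis by (simp add: abs_mult)
qed

text \<open>If \<open>\<phi>\<close> is unbounded, multiplication by \<open>E1 t\<close> is not
  continuous in t uniformly on \<open>X2\<close>. The bound |s - t| |\<phi>| for the difference of
  phases costs one derivative, and \<open>Fhat (a t)\<close> has one to spare.\<close>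

lemma G_tendsto:
  assumes t: "0 \<le> t"
  shows "((\<lambda>s. X2_norm (\<lambda>\<xi>. G s \<xi> - G t \<xi>)) \<longlongrightarrow> 0) (at t within {0..})"
proof -
  define Z where "Z = Cs * L2_norm (wt j3 (Fhat (a t)))"
  have F: "((\<lambda>s. X2_norm (\<lambda>\<xi>. Fhat (a s) \<xi> - Fhat (a t) \<xi>)) \<longlongrightarrow> 0) (at t within {0..})"
    by (rule Fhat_tendsto[OF _ a_X2[OF t] a_tendsto[OF t]]) (simp add: a_X2)
  have "((\<lambda>s. X2_norm (\<lambda>\<xi>. Fhat (a s) \<xi> - Fhat (a t) \<xi>) + \<bar>s - t\<bar> * Z) \<longlongrightarrow> 0 + \<bar>t - t\<bar> * Z) (at t within {0..})"
    by (intro tendsto_intros F)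
  then have lim: "((\<lambda>s. X2_norm (\<lambda>\<xi>. Fhat (a s) \<xi> - Fhat (a t) \<xi>) + \<bar>s - t\<bar> * Z) \<longlongrightarrow> 0) (at t within {0..})" by simp
  have le: "X2_norm (\<lambda>\<xi>. G s \<xi> - G t \<xi>) \<le> X2_norm (\<lambda>\<xi>. Fhat (a s) \<xi> - Fhat (a t) \<xi>) + \<bar>s - t\<bar> * Z" if s: "s \<in> {0..}" for s
  proof -
    have s0: "0 \<le> s" using s by simp
    have d: "(\<lambda>\<xi>. Fhat (a s) \<xi> - Fhat (a t) \<xi>) \<in> X2" by (intro X2_diff Fhat_X2 a_X2 s0 t)
    let ?r = "\<lambda>\<xi>. (E1 s \<xi> - E1 t \<xi>) * Fhat (a t) \<xi>"
    have r: "?r \<in> X2"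
    proof -
      have "?r = (\<lambda>\<xi>. E1 s \<xi> * Fhat (a t) \<xi> - E1 t \<xi> * Fhat (a t) \<xi>)" by (simp add: left_diff_distrib)
      then show ?thesis by (simp add: X2_diff E1_X2 Fhat_X2 a_X2 t)
    qed
    have "X2_norm (\<lambda>\<xi>. G s \<xi> - G t \<xi>) = X2_norm (\<lambda>\<xi>. E1 s \<xi> * (Fhat (a s) \<xi> - Fhat (a t) \<xi>) + ?r \<xi>)"
      by (rule arg_cong[where f=X2_norm]) (simp add: G_def fun_eq_iff algebra_simps)
    also have "\<dots> \<le> X2_norm (\<lambda>\<xi>. E1 s \<xi> * (Fhat (a s) \<xi> - Fhat (a t) \<xi>)) + X2_norm ?r"
      by (intro X2_norm_triangle E1_X2 d r)
    also have "X2_norm (\<lambda>\<xi>. E1 s \<xi> * (Fhat (a s) \<xi> - Fhat (a t) \<xi>)) = X2_norm (\<lambda>\<xi>. Fhat (a s) \<xi> - Fhat (a t) \<xi>)"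
      by (rule E1_X2_norm[OF d])
    also have "X2_norm ?r \<le> (\<bar>s - t\<bar> * Cs) * L2_norm (wt j3 (Fhat (a t)))"
      unfolding X2_norm_def
    proof (rule L2_dominated(2)[OF _ Fhat_L2[OF a_X2[OF t]]])
      show "wt (\<lambda>\<xi>. (jb \<xi>)\<^sup>2) ?r \<in> borel_measurable borel" using X2_wt_L2[OF r] by (rule L2_measurable)
      show "0 \<le> \<bar>s - t\<bar> * Cs" using Cs_nonneg by simp
      show "AE \<xi> in lborel. norm (wt (\<lambda>\<xi>. (jb \<xi>)\<^sup>2) ?r \<xi>) \<le> \<bar>s - t\<bar> * Cs * norm (wt j3 (Fhat (a t)) \<xi>)"
      proof (rule AE_I2)
        fix \<xi>
        have "norm (wt (\<lambda>\<xi>. (jb \<xi>)\<^sup>2) ?r \<xi>) = (jb \<xi>)\<^sup>2 * (norm (E1 s \<xi> - E1 t \<xi>) * norm (Fhat (a t) \<xi>))"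
          by (simp add: norm_wt norm_mult)
        also have "\<dots> \<le> (jb \<xi>)\<^sup>2 * ((\<bar>s - t\<bar> * (Cs * jb \<xi>)) * norm (Fhat (a t) \<xi>))"
          by (intro mult_left_mono mult_right_mono order_trans[OF E1_diff] phi_le) auto
        also have "\<dots> = \<bar>s - t\<bar> * Cs * norm (wt j3 (Fhat (a t)) \<xi>)"
          by (simp add: norm_wt power2_eq_square power3_eq_cube)
        finally show "norm (wt (\<lambda>\<xi>. (jb \<xi>)\<^sup>2) ?r \<xi>) \<le> \<bar>s - t\<bar> * Cs * norm (wt j3 (Fhat (a t)) \<xi>)" .
      qed
    qed
    finally show ?thesis by (simp add: Z_def mult.assoc)
  qed
  show ?thesis
  proof (rule tendsto_sandwich[OF _ _ tendsto_const lim])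
    show "\<forall>\<^sub>F s in at t within {0..}. 0 \<le> X2_norm (\<lambda>\<xi>. G s \<xi> - G t \<xi>)" by simp
    show "\<forall>\<^sub>F s in at t within {0..}. X2_norm (\<lambda>\<xi>. G s \<xi> - G t \<xi>) \<le> X2_norm (\<lambda>\<xi>. Fhat (a s) \<xi> - Fhat (a t) \<xi>) + \<bar>s - t\<bar> * Z"
      using le unfolding eventually_at_filter by (intro always_eventually) blast
  qed
qed

section \<open>The Duhamel integral and the profile\<close>

definition DI :: "real \<Rightarrow> real \<Rightarrow> complex" where
  "DI t = (SOME I. has_sobolev_integral 2 (\<lambda>s. prop (t - s) (nonlin (complexify (\<eta> s)))) I 0 t \<and>
        (AE x in lborel. complexify (\<eta> t) x = prop t (complexify \<eta>0) x - \<i> * I x))"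

lemma DI:
  assumes "0 \<le> t"
  shows "has_sobolev_integral 2 (\<lambda>s. prop (t - s) (nonlin (complexify (\<eta> s)))) (DI t) 0 t"
    and "AE x in lborel. complexify (\<eta> t) x = prop t (complexify \<eta>0) x - \<i> * DI t x"
proof -
  have "\<exists>I. has_sobolev_integral 2 (\<lambda>s. prop (t - s) (nonlin (complexify (\<eta> s)))) I 0 t \<and>
        (AE x in lborel. complexify (\<eta> t) x = prop t (complexify \<eta>0) x - \<i> * I x)"
    using sol assms by (simp add: kdvbbm_global_solution_def)
  from someI_ex[OF this]
  show "has_sobolev_integral 2 (\<lambda>s. prop (t - s) (nonlin (complexify (\<eta> s)))) (DI t) 0 t"
    and "AE x in lborel. complexify (\<eta> t) x = prop t (complexify \<eta>0) x - \<i> * DI t x"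
    unfolding DI_def[symmetric] by auto
qed

lemma DI_sobolev: "0 \<le> t \<Longrightarrow> DI t \<in> sobolev_space 2"
  using DI(1) by (simp add: has_sobolev_integral_def)

text \<open>The Duhamel integrand depends on the final time t through the propagator. Multiplication
  by \<open>E1 t\<close> removes this dependence and leaves an integral of \<open>G\<close>, whose
  increments live on the interval between the two times.\<close>

definition J :: "real \<Rightarrow> real \<Rightarrow> complex" where "J t = (\<lambda>\<xi>. E1 t \<xi> * fourier (DI t) \<xi>)"

lemma J_X2: "0 \<le> t \<Longrightarrow> J t \<in> X2"
  unfolding J_def by (intro E1_X2 sobolev_X2 DI_sobolev)

lemma duhamel_fourier:
  assumes t: "0 \<le> t"
  shows "AE \<xi> in lborel. E1 t \<xi> * a t \<xi> = a0 \<xi> - \<i> * J t \<xi>"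
proof -
  have L0: "complexify \<eta>0 \<in> L2_space" by (rule sobolev_L2[OF \<eta>0])
  note p = prop_fourier[OF L0 a0_X2, unfolded a0_def, OF AE_I2[OF refl], of t]
  have LI: "DI t \<in> L2_space" by (rule sobolev_L2[OF DI_sobolev[OF t]])
  have "fourier (complexify (\<eta> t)) = fourier (\<lambda>x. prop t (complexify \<eta>0) x - \<i> * DI t x)"
    by (rule fourier_cong_AE[OF DI(2)[OF t]]) (intro L2_measurable eta_L2 t L2_diff L2_scale p LI)+
  then have "AE \<xi> in lborel. a t \<xi> = fourier (prop t (complexify \<eta>0)) \<xi> - fourier (\<lambda>x. \<i> * DI t x) \<xi>"
    unfolding a_def using fourier_diff[OF p(1) L2_scale[OF LI]] by simp
  with fourier_scale[OF LI, of \<i>] p(2)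
  show ?thesis
  proof eventually_elim
    case (elim \<xi>)
    have "E1 t \<xi> * a t \<xi> = (E1 t \<xi> * E1 (- t) \<xi>) * a0 \<xi> - \<i> * J t \<xi>"
      unfolding elim by (simp add: J_def a0_def algebra_simps)
    then show ?case by (simp add: E1_add)
  qed
qed

text \<open>Transform and phase act on a Riemann sum term by term, and phases do not change the norm
  of \<open>X2\<close>. The tolerance e / 2 absorbs the factor 2 between the norms in
  \<open>sobolev_X2\<close>.\<close>

lemma riemann_J:
  assumes t: "0 \<le> t" and e: "0 < e"
  shows "\<exists>d>0. \<forall>p. p tagged_division_of {0..t} \<and> (\<lambda>r. ball r d) fine p \<longrightarrow>
      X2_norm (\<lambda>\<xi>. (\<Sum>(r, K)\<in>p. of_real (measure lborel K) * G r \<xi>) - J t \<xi>) < e"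
proof -
  define g where "g s = prop (t - s) (nonlin (complexify (\<eta> s)))" for s
  obtain d where d: "d > 0" and le: "\<And>p. p tagged_division_of {0..t} \<Longrightarrow> (\<lambda>r. ball r d) fine p \<Longrightarrow>
        sobolev_norm 2 (\<lambda>x. (\<Sum>(r, K)\<in>p. of_real (measure lborel K) * g r x) - DI t x) < e / 2"
    using DI(1)[OF t] e unfolding has_sobolev_integral_def g_def[symmetric] by (meson half_gt_zero)
  have g: "g r \<in> L2_space" "AE \<xi> in lborel. fourier (g r) \<xi> = E1 (- (t - r)) \<xi> * Fhat (a r) \<xi>" if r: "0 \<le> r" for r
    unfolding g_def a_def
    by (rule prop_fourier[OF nonlin_fourier(1) Fhat_X2 nonlin_fourier(2)];
        use eta_L2[OF r] a_X2[OF r] in \<open>simp add: a_def\<close>)+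
  have LI: "DI t \<in> L2_space" by (rule sobolev_L2[OF DI_sobolev[OF t]])
  have IX: "fourier (DI t) \<in> X2" by (rule sobolev_X2(1)[OF DI_sobolev[OF t]])
  have "X2_norm (\<lambda>\<xi>. (\<Sum>(r, K)\<in>p. of_real (measure lborel K) * G r \<xi>) - J t \<xi>) < e"
    if p: "p tagged_division_of {0..t}" "(\<lambda>r. ball r d) fine p" for p
  proof -
    have fin: "finite p" using p by auto
    have tag: "0 \<le> fst z" if "z \<in> p" for z using tag_in_interval[OF p(1), of "fst z" "snd z"] that by simp
    let ?c = "\<lambda>z. complex_of_real (measure lborel (snd z))"
    define h where "h x = (\<Sum>z\<in>p. ?c z * g (fst z) x) - DI t x" for x
    have sL: "(\<lambda>x. \<Sum>z\<in>p. ?c z * g (fst z) x) \<in> L2_space" using tag by (intro L2_sum L2_scale g) auto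
    have hL: "h \<in> L2_space" unfolding h_def[abs_def] by (intro L2_diff sL LI)
    let ?H = "\<lambda>\<xi>. (\<Sum>z\<in>p. ?c z * (E1 (- (t - fst z)) \<xi> * Fhat (a (fst z)) \<xi>)) - fourier (DI t) \<xi>"
    have ae: "AE \<xi> in lborel. fourier h \<xi> = ?H \<xi>"
    proof -
      have "AE \<xi> in lborel. \<forall>z\<in>p. fourier (g (fst z)) \<xi> = E1 (- (t - fst z)) \<xi> * Fhat (a (fst z)) \<xi>"
        using g(2) tag by (intro AE_finite_allI fin) auto
      moreover have "AE \<xi> in lborel. fourier (\<lambda>x. \<Sum>z\<in>p. ?c z * g (fst z) x) \<xi> = (\<Sum>z\<in>p. ?c z * fourier (g (fst z)) \<xi>)"
        using tag g(1) by (intro fourier_sum fin) auto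
      ultimately show ?thesis
        using fourier_diff[OF sL LI] unfolding h_def[abs_def] by eventually_elim simp
    qed
    have HX: "?H \<in> X2" using tag by (intro X2_diff X2_sum X2_scale E1_X2 Fhat_X2 a_X2 IX) auto
    note hX = X2_cong_AE[OF fourier_measurable[OF hL] HX ae]
    have "X2_norm ?H \<le> 2 * sobolev_norm 2 h"
      using sobolev_X2(2)[OF X2_sobolev[OF hL hX(1)]] hX(2) by simp
    also have "\<dots> < e"
    proof -
      have "h = (\<lambda>x. (\<Sum>(r, K)\<in>p. of_real (measure lborel K) * g r x) - DI t x)"
        by (simp add: h_def fun_eq_iff split_beta)
      then show ?thesis using le[OF p] by simp
    qed
    finally have "X2_norm (\<lambda>\<xi>. E1 t \<xi> * ?H \<xi>) < e" unfolding E1_X2_norm[OF HX] .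
    moreover have "(\<lambda>\<xi>. E1 t \<xi> * ?H \<xi>) = (\<lambda>\<xi>. (\<Sum>(r, K)\<in>p. of_real (measure lborel K) * G r \<xi>) - J t \<xi>)"
    proof
      fix \<xi>
      have eq: "E1 t \<xi> * (?c z * (E1 (- (t - fst z)) \<xi> * Fhat (a (fst z)) \<xi>)) = ?c z * G (fst z) \<xi>" for z
      proof -
        have "E1 t \<xi> * E1 (- (t - fst z)) \<xi> = E1 (fst z) \<xi>" by (simp add: E1_add)
        moreover have "E1 t \<xi> * (?c z * (E1 (- (t - fst z)) \<xi> * Fhat (a (fst z)) \<xi>))
          = ?c z * ((E1 t \<xi> * E1 (- (t - fst z)) \<xi>) * Fhat (a (fst z)) \<xi>)" by (simp only: ac_simps)
        ultimately show ?thesis by (simp only: G_def)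
      qed
      have "(\<Sum>z\<in>p. E1 t \<xi> * (?c z * (E1 (- (t - fst z)) \<xi> * Fhat (a (fst z)) \<xi>))) = (\<Sum>z\<in>p. ?c z * G (fst z) \<xi>)"
        by (rule sum.cong[OF refl]) (rule eq)
      moreover have "(\<Sum>(r, K)\<in>p. of_real (measure lborel K) * G r \<xi>) = (\<Sum>z\<in>p. ?c z * G (fst z) \<xi>)"
        by (rule sum.cong) (auto simp: split_beta)
      ultimately show "E1 t \<xi> * ?H \<xi> = (\<Sum>(r, K)\<in>p. of_real (measure lborel K) * G r \<xi>) - J t \<xi>"
        by (simp only: J_def right_diff_distrib sum_distrib_left)
    qed
    ultimately show ?thesis by simp
  qed
  then show ?thesis using d by blast
qed

text \<open>The definition of the integral does not mention the value over {0..0}; it follows from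
  the single tagged interval {0..0}, which is fine for every gauge and has measure zero.\<close>

lemma J_0: "AE \<xi> in lborel. J 0 \<xi> = 0"
proof -
  have "X2_norm (J 0) \<le> 0 + e" if e: "0 < e" for e
  proof -
    obtain d where le0: "\<And>p. p tagged_division_of {0..0} \<Longrightarrow> (\<lambda>r. ball r d) fine p \<Longrightarrow>
      X2_norm (\<lambda>\<xi>. (\<Sum>(r, K)\<in>p. of_real (measure lborel K) * G r \<xi>) - J 0 \<xi>) < e" and d: "0 < d"
      using riemann_J[OF order_refl e] by blast
    have td: "{(0::real, {0..0::real})} tagged_division_of {0..0}"
      by (rule tagged_division_of_self_real) simp
    have "(\<lambda>r. ball r d) fine {(0::real, {0..0::real})}" using d by (simp add: fine_def)
    from le0[OF td this] have "X2_norm (\<lambda>\<xi>. (\<Sum>(r, K)\<in>{(0::real, {0..0::real})}. of_real (measure lborel K) * G r \<xi>) - J 0 \<xi>) < e" .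
    then have "X2_norm (\<lambda>\<xi>. (-1) * J 0 \<xi>) < e" by simp
    then show ?thesis unfolding X2_norm_scale by simp
  qed
  then have "X2_norm (J 0) \<le> 0" by (rule field_le_epsilon)
  then have "L2_norm (wt (\<lambda>\<xi>. (jb \<xi>)\<^sup>2) (J 0)) = 0" using X2_norm_nonneg[of "J 0"] unfolding X2_norm_def by linarith
  then have "AE \<xi> in lborel. wt (\<lambda>\<xi>. (jb \<xi>)\<^sup>2) (J 0) \<xi> = 0"
    using L2_norm_eq_0[OF X2_wt_L2[OF J_X2[OF order_refl]]] by simp
  then show ?thesis
  proof eventually_elim
    case (elim \<xi>)
    have "jb \<xi> \<noteq> 0" using jb_pos(1)[of \<xi>] by linarith
    then show ?case using elim by (simp add: wt_def)
  qed
qed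

text \<open>
  The profile $b(t) = e^{it\phi} \hat\eta(t)$.  It has the same weighted norms as $\hat\eta(t)$ but is
  differentiable in time with values in \<open>X2\<close>, although $\phi$ is unbounded.
\<close>

definition b :: "real \<Rightarrow> real \<Rightarrow> complex" where "b t = (\<lambda>\<xi>. a0 \<xi> - \<i> * J t \<xi>)"

lemma b_X2: "0 \<le> t \<Longrightarrow> b t \<in> X2"
  unfolding b_def by (intro X2_diff X2_scale a0_X2 J_X2)

text \<open>Right and left increments both come from \<open>riemann_increment\<close>, with t as the
  left or the right endpoint of the interval.\<close>

lemma b_increment:
  assumes t: "0 \<le> t" and e: "0 < e"
  shows "\<exists>d>0. \<forall>s\<in>{0..}. \<bar>s - t\<bar> < d \<longrightarrow>
    X2_norm (\<lambda>\<xi>. b s \<xi> - b t \<xi> - of_real (s - t) * (- \<i> * G t \<xi>)) \<le> e * \<bar>s - t\<bar>"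
proof -
  have "\<forall>\<^sub>F s in at t within {0..}. X2_norm (\<lambda>\<xi>. G s \<xi> - G t \<xi>) < e"
    using order_tendstoD(2)[OF G_tendsto[OF t] e] .
  then obtain d where d: "d > 0" and near': "\<And>s. 0 \<le> s \<Longrightarrow> s \<noteq> t \<Longrightarrow> dist s t < d \<Longrightarrow> X2_norm (\<lambda>\<xi>. G s \<xi> - G t \<xi>) < e"
    unfolding eventually_at by auto
  have near: "X2_norm (\<lambda>\<xi>. G s \<xi> - G t \<xi>) \<le> e" if "0 \<le> s" "\<bar>s - t\<bar> < d" for s
    using near'[of s] that e by (cases "s = t") (auto simp: dist_real_def)
  have "X2_norm (\<lambda>\<xi>. b s \<xi> - b t \<xi> - of_real (s - t) * (- \<i> * G t \<xi>)) \<le> e * \<bar>s - t\<bar>" if s: "0 \<le> s" "\<bar>s - t\<bar> < d" for s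
  proof (cases "t \<le> s")
    case True
    have "X2_norm (\<lambda>\<xi>. J s \<xi> - J t \<xi> - of_real (s - t) * G t \<xi>) \<le> e * (s - t)"
      by (rule riemann_increment[OF riemann_J J_X2 G_X2 t True t]) (use t s True near in auto)
    moreover have "(\<lambda>\<xi>. b s \<xi> - b t \<xi> - of_real (s - t) * (- \<i> * G t \<xi>)) = (\<lambda>\<xi>. - \<i> * (J s \<xi> - J t \<xi> - of_real (s - t) * G t \<xi>))"
      by (simp add: b_def fun_eq_iff algebra_simps)
    ultimately show ?thesis using True X2_norm_scale[of "- \<i>"] by (simp only:) simp
  next
    case False
    then have st: "s \<le> t" by simp
    have "X2_norm (\<lambda>\<xi>. J t \<xi> - J s \<xi> - of_real (t - s) * G t \<xi>) \<le> e * (t - s)"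
      by (rule riemann_increment[OF riemann_J J_X2 G_X2 s(1) st t]) (use t s st near in auto)
    moreover have "(\<lambda>\<xi>. b s \<xi> - b t \<xi> - of_real (s - t) * (- \<i> * G t \<xi>)) = (\<lambda>\<xi>. \<i> * (J t \<xi> - J s \<xi> - of_real (t - s) * G t \<xi>))"
      by (simp add: b_def fun_eq_iff algebra_simps)
    ultimately show ?thesis using st X2_norm_scale[of \<i>] by (simp only:) simp
  qed
  then show ?thesis using d by auto
qed

end

section \<open>The energy estimate\<close>

context kdvbbm_solution
begin

text \<open>The square root of the energy weight, so that the energy is the square of an L2 norm and
  the chain rule for such squares applies.\<close>

definition wE :: "real \<Rightarrow> real \<Rightarrow> real \<Rightarrow> real" where "wE \<sigma> N \<xi> = gw \<sigma> N \<xi> * sqrt (Dn \<xi>)"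

lemma wE_measurable [measurable]: "wE \<sigma> N \<in> borel_measurable borel"
  unfolding wE_def[abs_def] by measurable

lemma wE_nonneg [simp]: "0 \<le> wE \<sigma> N \<xi>"
  using Dn_pos[of \<xi>] by (simp add: wE_def)

lemma sqrt_Dn: "sqrt (Dn \<xi>) \<le> sqrt du * (jb \<xi>)\<^sup>2" "sqrt dl * (jb \<xi>)\<^sup>2 \<le> sqrt (Dn \<xi>)"
proof -
  have j: "sqrt ((jb \<xi>)^4) = (jb \<xi>)\<^sup>2" by (rule real_sqrt_unique) auto
  show "sqrt (Dn \<xi>) \<le> sqrt du * (jb \<xi>)\<^sup>2"
    using real_sqrt_le_mono[OF Dn_le[of \<xi>]] by (simp add: real_sqrt_mult j)
  show "sqrt dl * (jb \<xi>)\<^sup>2 \<le> sqrt (Dn \<xi>)"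
    using real_sqrt_le_mono[OF Dn_ge[of \<xi>]] by (simp add: real_sqrt_mult j)
qed

lemma wE_L2:
  assumes s: "0 \<le> \<sigma>" "0 \<le> N" and f: "f \<in> X2"
  shows "wt (wE \<sigma> N) f \<in> L2_space" and "L2_norm (wt (wE \<sigma> N) f) \<le> (cosh (\<sigma> * N) * sqrt du) * X2_norm f"
proof -
  note [measurable] = X2_measurable[OF f]
  have ae: "AE \<xi> in lborel. norm (wt (wE \<sigma> N) f \<xi>) \<le> (cosh (\<sigma> * N) * sqrt du) * norm (wt (\<lambda>\<xi>. (jb \<xi>)\<^sup>2) f \<xi>)"
  proof (rule AE_I2)
    fix \<xi>
    have "wE \<sigma> N \<xi> \<le> cosh (\<sigma> * N) * (sqrt du * (jb \<xi>)\<^sup>2)"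
      unfolding wE_def using Dn_pos[of \<xi>] by (intro mult_mono gw_bounded s sqrt_Dn) auto
    then have "wE \<sigma> N \<xi> * norm (f \<xi>) \<le> cosh (\<sigma> * N) * (sqrt du * (jb \<xi>)\<^sup>2) * norm (f \<xi>)" by (rule mult_right_mono) simp
    then show "norm (wt (wE \<sigma> N) f \<xi>) \<le> (cosh (\<sigma> * N) * sqrt du) * norm (wt (\<lambda>\<xi>. (jb \<xi>)\<^sup>2) f \<xi>)"
      by (simp add: norm_wt mult.assoc)
  qed
  have m: "wt (wE \<sigma> N) f \<in> borel_measurable borel" by measurable
  show "wt (wE \<sigma> N) f \<in> L2_space" and "L2_norm (wt (wE \<sigma> N) f) \<le> (cosh (\<sigma> * N) * sqrt du) * X2_norm f"
    using L2_dominated[OF m X2_wt_L2[OF f] ae] du_pos by (auto simp: X2_norm_def)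
qed

definition En :: "real \<Rightarrow> real \<Rightarrow> real \<Rightarrow> real" where
  "En \<sigma> N t = (L2_norm (wt (wE \<sigma> N) (b t)))\<^sup>2"

definition En' :: "real \<Rightarrow> real \<Rightarrow> real \<Rightarrow> real" where
  "En' \<sigma> N t = 2 * Re (LINT \<xi>|lborel. wt (wE \<sigma> N) (b t) \<xi> * cnj (wt (wE \<sigma> N) (\<lambda>\<xi>. - \<i> * G t \<xi>) \<xi>))"

lemma En_derivative:
  assumes s: "0 \<le> \<sigma>" "0 \<le> N" and t: "0 \<le> t"
  shows "(En \<sigma> N has_real_derivative En' \<sigma> N t) (at t within {0..})"
  unfolding En_def[abs_def] En'_def
proof (rule L2_norm_sq_has_derivative)
  show "wt (wE \<sigma> N) (b s) \<in> L2_space" if "s \<in> {0..}" for s using that by (intro wE_L2 s b_X2) simp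
  have GX: "(\<lambda>\<xi>. - \<i> * G t \<xi>) \<in> X2" by (intro X2_scale G_X2 t)
  then show "wt (wE \<sigma> N) (\<lambda>\<xi>. - \<i> * G t \<xi>) \<in> L2_space" by (intro wE_L2 s)
  fix e :: real assume e: "0 < e"
  define c where "c = cosh (\<sigma> * N) * sqrt du"
  have c: "0 \<le> c" using du_pos by (simp add: c_def)
  have "0 < e / (c + 1)" using e c by simp
  from b_increment[OF t this] obtain d where d: "d > 0" and le: "\<And>s. 0 \<le> s \<Longrightarrow> \<bar>s - t\<bar> < d \<Longrightarrow>
    X2_norm (\<lambda>\<xi>. b s \<xi> - b t \<xi> - of_real (s - t) * (- \<i> * G t \<xi>)) \<le> e / (c + 1) * \<bar>s - t\<bar>" by auto
  have "L2_norm (\<lambda>\<xi>. wt (wE \<sigma> N) (b r) \<xi> - wt (wE \<sigma> N) (b t) \<xi> - of_real (r - t) * wt (wE \<sigma> N) (\<lambda>\<xi>. - \<i> * G t \<xi>) \<xi>) \<le> e * \<bar>r - t\<bar>"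
    if r: "0 \<le> r" "\<bar>r - t\<bar> < d" for r
  proof -
    let ?f = "\<lambda>\<xi>. b r \<xi> - b t \<xi> - of_real (r - t) * (- \<i> * G t \<xi>)"
    have X: "?f \<in> X2" by (intro X2_diff X2_scale b_X2 G_X2 r t)
    have "(\<lambda>\<xi>. wt (wE \<sigma> N) (b r) \<xi> - wt (wE \<sigma> N) (b t) \<xi> - of_real (r - t) * wt (wE \<sigma> N) (\<lambda>\<xi>. - \<i> * G t \<xi>) \<xi>) = wt (wE \<sigma> N) ?f"
      by (simp only: wt_diff wt_scale)
    then have "L2_norm (\<lambda>\<xi>. wt (wE \<sigma> N) (b r) \<xi> - wt (wE \<sigma> N) (b t) \<xi> - of_real (r - t) * wt (wE \<sigma> N) (\<lambda>\<xi>. - \<i> * G t \<xi>) \<xi>) \<le> c * X2_norm ?f"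
      using wE_L2(2)[OF s X] by (simp only: c_def)
    also have "\<dots> \<le> c * (e / (c + 1) * \<bar>r - t\<bar>)" using c by (intro mult_left_mono le r)
    also have "\<dots> = (c / (c + 1)) * (e * \<bar>r - t\<bar>)" by simp
    also have "\<dots> \<le> 1 * (e * \<bar>r - t\<bar>)" using c e by (intro mult_right_mono) auto
    finally show ?thesis by simp
  qed
  then show "\<exists>d>0. \<forall>s\<in>{0..}. \<bar>s - t\<bar> < d \<longrightarrow>
       L2_norm (\<lambda>\<xi>. wt (wE \<sigma> N) (b s) \<xi> - wt (wE \<sigma> N) (b t) \<xi> - of_real (s - t) * wt (wE \<sigma> N) (\<lambda>\<xi>. - \<i> * G t \<xi>) \<xi>) \<le> e * \<bar>s - t\<bar>"
    using d by auto
qed (use t in simp)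

lemma b_eq:
  assumes "0 \<le> t" shows "AE \<xi> in lborel. b t \<xi> = E1 t \<xi> * a t \<xi>"
  using duhamel_fourier[OF assms] unfolding b_def by eventually_elim simp

text \<open>The phases of \<open>b\<close> and \<open>G\<close> cancel, so the linear flow leaves no
  trace in the energy derivative; up to conjugation and a factor \<i> the integrand is that of
  \<open>energy_form_bound\<close>.\<close>

lemma En'_bound:
  assumes s: "0 \<le> \<sigma>" "0 \<le> N" and t: "0 \<le> t"
  defines "Y \<equiv> X2_norm (wt (gw \<sigma> N) (a t))"
  shows "\<bar>En' \<sigma> N t\<bar> \<le> 2 * (Ke * \<sigma>\<^sup>2 * (Y^3 + Y^4))"
proof -
  note [measurable] = X2_measurable[OF a_X2[OF t]] X2_measurable[OF b_X2[OF t]] X2_measurable[OF G_X2[OF t]]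
    X2_measurable[OF Fhat_X2[OF a_X2[OF t]]]
  let ?I = "LINT \<xi>|lborel. of_real ((gw \<sigma> N \<xi>)\<^sup>2 * Dn \<xi>) * (cnj (a t \<xi>) * Fhat (a t) \<xi>)"
  have "(LINT \<xi>|lborel. wt (wE \<sigma> N) (b t) \<xi> * cnj (wt (wE \<sigma> N) (\<lambda>\<xi>. - \<i> * G t \<xi>) \<xi>))
     = (LINT \<xi>|lborel. \<i> * cnj (of_real ((gw \<sigma> N \<xi>)\<^sup>2 * Dn \<xi>) * (cnj (a t \<xi>) * Fhat (a t) \<xi>)))"
  proof (rule integral_cong_AE)
    show "AE \<xi> in lborel. wt (wE \<sigma> N) (b t) \<xi> * cnj (wt (wE \<sigma> N) (\<lambda>\<xi>. - \<i> * G t \<xi>) \<xi>)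
       = \<i> * cnj (of_real ((gw \<sigma> N \<xi>)\<^sup>2 * Dn \<xi>) * (cnj (a t \<xi>) * Fhat (a t) \<xi>))"
      using b_eq[OF t]
    proof eventually_elim
      case (elim \<xi>)
      have w2: "wE \<sigma> N \<xi> * wE \<sigma> N \<xi> = (gw \<sigma> N \<xi>)\<^sup>2 * Dn \<xi>"
        using Dn_pos[of \<xi>] by (simp add: wE_def power2_eq_square mult_ac flip: real_sqrt_mult)
      have E: "E1 t \<xi> * cnj (E1 t \<xi>) = 1" by (simp add: cnj_E1 E1_add)
      have "wt (wE \<sigma> N) (b t) \<xi> * cnj (wt (wE \<sigma> N) (\<lambda>\<xi>. - \<i> * G t \<xi>) \<xi>)
        = of_real (wE \<sigma> N \<xi> * wE \<sigma> N \<xi>) * (E1 t \<xi> * cnj (E1 t \<xi>)) * (\<i> * (a t \<xi> * cnj (Fhat (a t) \<xi>)))"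
        unfolding wt_def elim G_def by (simp add: mult_ac)
      then show ?case unfolding w2 E by (simp add: mult_ac)
    qed
  qed measurable
  also have "\<dots> = \<i> * cnj ?I" by (simp only: integral_mult_right_zero Bochner_Integration.integral_cnj)
  finally have "\<bar>En' \<sigma> N t\<bar> = 2 * \<bar>Re (\<i> * cnj ?I)\<bar>" unfolding En'_def by simp
  also have "\<dots> \<le> 2 * norm (\<i> * cnj ?I)" by (intro mult_left_mono abs_Re_le_cmod) simp
  also have "\<dots> = 2 * norm ?I" by (simp only: norm_mult complex_mod_cnj norm_ii mult_1)
  also have "\<dots> \<le> 2 * (Ke * \<sigma>\<^sup>2 * (Y^3 + Y^4))"
    unfolding Y_def by (intro mult_left_mono energy_form_bound s a_X2 t a_real) simp
  finally show ?thesis .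
qed

lemma weighted_norm_le_energy:
  assumes s: "0 \<le> \<sigma>" "0 \<le> N" and t: "0 \<le> t"
  shows "X2_norm (wt (gw \<sigma> N) (a t)) \<le> (1 / sqrt dl) * sqrt (En \<sigma> N t)"
proof -
  note [measurable] = X2_measurable[OF a_X2[OF t]]
  have ae: "AE \<xi> in lborel. norm (wt (\<lambda>\<xi>. (jb \<xi>)\<^sup>2) (wt (gw \<sigma> N) (a t)) \<xi>) \<le> (1 / sqrt dl) * norm (wt (wE \<sigma> N) (b t) \<xi>)"
    using b_eq[OF t]
  proof eventually_elim
    case (elim \<xi>)
    have "(jb \<xi>)\<^sup>2 \<le> (1 / sqrt dl) * sqrt (Dn \<xi>)" using sqrt_Dn(2)[of \<xi>] dl_pos by (simp add: field_simps)
    then have "(jb \<xi>)\<^sup>2 * (gw \<sigma> N \<xi> * norm (a t \<xi>)) \<le> (1 / sqrt dl) * sqrt (Dn \<xi>) * (gw \<sigma> N \<xi> * norm (a t \<xi>))"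
      by (rule mult_right_mono) simp
    moreover have "norm (wt (wE \<sigma> N) (b t) \<xi>) = gw \<sigma> N \<xi> * sqrt (Dn \<xi>) * norm (a t \<xi>)"
      unfolding norm_wt[of "wE \<sigma> N", OF wE_nonneg] elim norm_mult norm_E1 wE_def by simp
    ultimately show ?case by (simp add: norm_wt mult_ac)
  qed
  have m: "wt (\<lambda>\<xi>. (jb \<xi>)\<^sup>2) (wt (gw \<sigma> N) (a t)) \<in> borel_measurable borel" by measurable
  have "L2_norm (wt (\<lambda>\<xi>. (jb \<xi>)\<^sup>2) (wt (gw \<sigma> N) (a t))) \<le> (1 / sqrt dl) * L2_norm (wt (wE \<sigma> N) (b t))"
    by (rule L2_dominated(2)[OF m wE_L2(1)[OF s b_X2[OF t]] ae]) (use dl_pos in simp)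
  then show ?thesis by (simp add: X2_norm_def En_def)
qed

text \<open>Uniform in N because the truncated weight lies below cosh (\<sigma>0 * |\<xi>|). The
  constant is (2 * sqrt du)^2, with the 2 from \<open>jb_sq_le\<close>.\<close>

lemma En_0:
  assumes s: "0 \<le> \<sigma>" "0 \<le> N" "\<sigma> \<le> \<sigma>0" and g: "complexify \<eta>0 \<in> gevrey_space \<sigma>0 2"
  shows "En \<sigma> N 0 \<le> 4 * du * (gevrey_norm \<sigma>0 2 (complexify \<eta>0))\<^sup>2"
proof -
  note [measurable] = X2_measurable[OF b_X2[OF order_refl]]
  let ?h = "\<lambda>\<xi>. complex_of_real (gevrey_weight \<sigma>0 2 \<xi>) * a0 \<xi>"
  have h: "?h \<in> L2_space" using g by (simp add: gevrey_space_def a0_def)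
  have ae: "AE \<xi> in lborel. norm (wt (wE \<sigma> N) (b 0) \<xi>) \<le> (2 * sqrt du) * norm (?h \<xi>)"
    using J_0
  proof eventually_elim
    case (elim \<xi>)
    have "gw \<sigma> N \<xi> \<le> cosh (\<sigma>0 * \<bar>\<xi>\<bar>)"
      unfolding gw_def using s by (subst cosh_real_nonneg_le_iff) (auto intro!: mult_mono)
    moreover have "sqrt (Dn \<xi>) \<le> sqrt du * (2 * (1 + \<xi>\<^sup>2))"
      using order_trans[OF sqrt_Dn(1) mult_left_mono[OF jb_sq_le]] du_pos by simp
    ultimately have "wE \<sigma> N \<xi> \<le> cosh (\<sigma>0 * \<bar>\<xi>\<bar>) * (sqrt du * (2 * (1 + \<xi>\<^sup>2)))"
      unfolding wE_def using Dn_pos[of \<xi>] by (intro mult_mono) auto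
    then have "wE \<sigma> N \<xi> * norm (a0 \<xi>) \<le> cosh (\<sigma>0 * \<bar>\<xi>\<bar>) * (sqrt du * (2 * (1 + \<xi>\<^sup>2))) * norm (a0 \<xi>)"
      by (rule mult_right_mono) simp
    also have "\<dots> = (2 * sqrt du) * (\<bar>gevrey_weight \<sigma>0 2 \<xi>\<bar> * norm (a0 \<xi>))"
      by (simp add: gevrey_weight_2 abs_mult)
    finally show ?case using elim by (simp add: norm_wt b_def norm_mult)
  qed
  have m: "wt (wE \<sigma> N) (b 0) \<in> borel_measurable borel" by measurable
  have "L2_norm (wt (wE \<sigma> N) (b 0)) \<le> (2 * sqrt du) * L2_norm ?h"
    by (rule L2_dominated(2)[OF m h ae]) (use du_pos in simp)
  then have "En \<sigma> N 0 \<le> ((2 * sqrt du) * L2_norm ?h)\<^sup>2" unfolding En_def by (intro power_mono) auto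
  also have "\<dots> = 4 * du * (L2_norm ?h)\<^sup>2" using du_pos by (simp add: power_mult_distrib)
  finally show ?thesis by (simp add: gevrey_norm_def a0_def)
qed

text \<open>The summand 1 keeps M positive even for zero data; y bounds the weighted norm as long as
  the energy is at most 2 M. None of these constants depends on N, so the bootstrap gives a bound
  uniform in N at time T.\<close>

lemma gevrey_regularity:
  assumes g: "complexify \<eta>0 \<in> gevrey_space \<sigma>0 2" and \<sigma>: "0 \<le> \<sigma>" "\<sigma> \<le> \<sigma>0" and T: "0 \<le> T"
    and M: "M = 4 * du * (gevrey_norm \<sigma>0 2 (complexify \<eta>0))\<^sup>2 + 1" and y: "y = sqrt (2 * M / dl)"
    and small: "T * (2 * (Ke * \<sigma>\<^sup>2 * (y^3 + y^4))) < M"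
  shows "complexify (\<eta> T) \<in> gevrey_space \<sigma> 2"
proof -
  have M1: "1 \<le> M" using du_pos by (simp add: M)
  have y0: "0 \<le> y" using M1 dl_pos by (simp add: y)
  have Yy: "X2_norm (wt (gw \<sigma> N) (a t)) \<le> y" if "0 \<le> t" "0 \<le> N" "En \<sigma> N t \<le> 2 * M" for t N
  proof -
    have "X2_norm (wt (gw \<sigma> N) (a t)) \<le> (1 / sqrt dl) * sqrt (En \<sigma> N t)"
      by (rule weighted_norm_le_energy[OF \<sigma>(1) that(2,1)])
    also have "\<dots> \<le> (1 / sqrt dl) * sqrt (2 * M)" using that dl_pos by (intro mult_left_mono real_sqrt_le_mono) auto
    also have "\<dots> = y" by (simp add: y real_sqrt_divide)
    finally show ?thesis .
  qed
  have EnT: "En \<sigma> N T \<le> 2 * M" if N: "0 \<le> N" for N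
  proof (rule continuity_bootstrap[where E="En \<sigma> N" and E'="En' \<sigma> N"])
    show "(En \<sigma> N has_real_derivative En' \<sigma> N t) (at t within {0..})" if "0 \<le> t" for t
      by (rule En_derivative[OF \<sigma>(1) N that])
    show "\<bar>En' \<sigma> N t\<bar> \<le> 2 * (Ke * \<sigma>\<^sup>2 * (y^3 + y^4))" if t: "0 \<le> t" "En \<sigma> N t \<le> 2 * M" for t
    proof -
      have "(X2_norm (wt (gw \<sigma> N) (a t)))^k \<le> y^k" for k by (intro power_mono Yy t N) simp
      then have "2 * (Ke * \<sigma>\<^sup>2 * ((X2_norm (wt (gw \<sigma> N) (a t)))^3 + (X2_norm (wt (gw \<sigma> N) (a t)))^4)) \<le> 2 * (Ke * \<sigma>\<^sup>2 * (y^3 + y^4))"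
        using Ke_nonneg by (intro mult_left_mono add_mono) auto
      then show ?thesis using En'_bound[OF \<sigma>(1) N t(1)] by linarith
    qed
    show "En \<sigma> N 0 \<le> M" using En_0[OF \<sigma>(1) N \<sigma>(2) g] by (simp add: M)
  qed (use T small M1 in auto)
  have L: "complexify (\<eta> T) \<in> L2_space" by (rule eta_L2[OF T])
  note [measurable] = X2_measurable[OF a_X2[OF T]]
  have [measurable]: "(\<lambda>\<xi>. gevrey_weight \<sigma> 2 \<xi>) \<in> borel_measurable borel"
    unfolding gevrey_weight_2
    by (intro borel_measurable_continuous_onI continuous_intros)
  let ?F = "\<lambda>n \<xi>. ennreal ((norm (wt (\<lambda>\<xi>. (jb \<xi>)\<^sup>2) (wt (gw \<sigma> (real n)) (a T)) \<xi>))\<^sup>2)"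
  have "(\<integral>\<^sup>+\<xi>. ennreal ((norm (of_real (gevrey_weight \<sigma> 2 \<xi>) * a T \<xi>))\<^sup>2) \<partial>lborel)
      \<le> (\<integral>\<^sup>+\<xi>. liminf (\<lambda>n. ?F n \<xi>) \<partial>lborel)"
  proof (rule nn_integral_mono)
    \<comment> \<open>At a fixed frequency the truncated weight equals the full one as soon as n
      \<ge> |\<xi>|.\<close>
    fix \<xi>
    have "\<forall>\<^sub>F n in sequentially. \<bar>\<xi>\<bar> \<le> real n" using filterlim_real_sequentially eventually_ge_at_top
      by (auto simp: filterlim_at_top)
    then have "\<forall>\<^sub>F n in sequentially. ennreal ((norm (of_real (gevrey_weight \<sigma> 2 \<xi>) * a T \<xi>))\<^sup>2) \<le> ?F n \<xi>"
    proof eventually_elim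
      case (elim n)
      have "gw \<sigma> (real n) \<xi> = cosh (\<sigma> * \<bar>\<xi>\<bar>)" using elim by (simp add: gw_def min_def)
      then have "norm (of_real (gevrey_weight \<sigma> 2 \<xi>) * a T \<xi>) = (1 + \<xi>\<^sup>2) * (gw \<sigma> (real n) \<xi> * norm (a T \<xi>))"
        by (simp only: norm_mult norm_of_real gevrey_weight_2) (simp add: abs_mult)
      also have "\<dots> \<le> (jb \<xi>)\<^sup>2 * (gw \<sigma> (real n) \<xi> * norm (a T \<xi>))" by (intro mult_right_mono jb_sq_ge) simp
      finally have "norm (of_real (gevrey_weight \<sigma> 2 \<xi>) * a T \<xi>) \<le> norm (wt (\<lambda>\<xi>. (jb \<xi>)\<^sup>2) (wt (gw \<sigma> (real n)) (a T)) \<xi>)"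
        by (simp add: norm_wt)
      then show ?case by (intro ennreal_leI power_mono) auto
    qed
    then show "ennreal ((norm (of_real (gevrey_weight \<sigma> 2 \<xi>) * a T \<xi>))\<^sup>2) \<le> liminf (\<lambda>n. ?F n \<xi>)"
      by (rule Liminf_bounded)
  qed
  also have "\<dots> \<le> liminf (\<lambda>n. \<integral>\<^sup>+\<xi>. ?F n \<xi> \<partial>lborel)" by (rule nn_integral_liminf) measurable
  also have "\<dots> \<le> ennreal (y\<^sup>2)"
  proof (rule Liminf_le)
    show "\<forall>\<^sub>F n in sequentially. (\<integral>\<^sup>+\<xi>. ?F n \<xi> \<partial>lborel) \<le> ennreal (y\<^sup>2)"
    proof (rule always_eventually, rule allI)
      fix n
      have "(\<integral>\<^sup>+\<xi>. ?F n \<xi> \<partial>lborel) = ennreal ((X2_norm (wt (gw \<sigma> (real n)) (a T)))\<^sup>2)"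
        unfolding X2_norm_def by (rule L2_nn_integral[OF X2_wt_L2[OF X2_gw[OF \<sigma>(1) _ a_X2[OF T]]]]) simp
      also have "\<dots> \<le> ennreal (y\<^sup>2)" by (intro ennreal_leI power_mono Yy T EnT) auto
      finally show "(\<integral>\<^sup>+\<xi>. ?F n \<xi> \<partial>lborel) \<le> ennreal (y\<^sup>2)" .
    qed
  qed simp
  finally have *: "(\<integral>\<^sup>+\<xi>. ennreal ((norm (of_real (gevrey_weight \<sigma> 2 \<xi>) * a T \<xi>))\<^sup>2) \<partial>lborel) \<le> ennreal (y\<^sup>2)" .
  have "(\<lambda>\<xi>. of_real (gevrey_weight \<sigma> 2 \<xi>) * a T \<xi>) \<in> L2_space"
    by (rule L2_by_nn_integral(1)[OF _ * y0]) measurable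
  then show ?thesis using L by (simp add: gevrey_space_def a_def)
qed

end

section \<open>The choice of the radius\<close>

lemma gevrey_imp_sobolev:
  assumes g: "u \<in> gevrey_space \<sigma> 2" shows "u \<in> sobolev_space 2"
proof -
  have u: "u \<in> L2_space" and w: "(\<lambda>\<xi>. complex_of_real (gevrey_weight \<sigma> 2 \<xi>) * fourier u \<xi>) \<in> L2_space"
    using g by (auto simp: gevrey_space_def)
  note [measurable] = fourier_measurable[OF u]
  have "(\<lambda>\<xi>. complex_of_real (gevrey_weight 0 2 \<xi>) * fourier u \<xi>) \<in> L2_space"
  proof (rule L2_dominated(1)[OF _ w, of _ 1])
    show "AE \<xi> in lborel. norm (complex_of_real (gevrey_weight 0 2 \<xi>) * fourier u \<xi>) \<le> 1 * norm (complex_of_real (gevrey_weight \<sigma> 2 \<xi>) * fourier u \<xi>)"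
    proof (rule AE_I2)
      fix \<xi>
      have "1 * (1 + \<xi>\<^sup>2) \<le> cosh (\<sigma> * \<bar>\<xi>\<bar>) * (1 + \<xi>\<^sup>2)" by (intro mult_right_mono cosh_real_ge_1) auto
      then have "\<bar>gevrey_weight 0 2 \<xi>\<bar> \<le> \<bar>gevrey_weight \<sigma> 2 \<xi>\<bar>" unfolding abs_gevrey_weight_0 gevrey_weight_2 by simp
      then show "norm (complex_of_real (gevrey_weight 0 2 \<xi>) * fourier u \<xi>) \<le> 1 * norm (complex_of_real (gevrey_weight \<sigma> 2 \<xi>) * fourier u \<xi>)"
        by (simp only: norm_mult norm_of_real mult_1) (rule mult_right_mono, auto)
    qed
  qed (simp_all add: gevrey_weight_2)
  then show ?thesis using u by (simp add: gevrey_space_def)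
qed

text \<open>The function C is chosen before \<sigma>0, \<eta>0 and \<eta>: for given coefficients of
  the equation, the constant depends on the data only through their norm.\<close>

theorem theorem1:
  fixes \<gamma> \<gamma>1 \<gamma>2 \<delta>1 \<delta>2 :: real
  assumes "\<gamma>1 > 0" and "\<delta>1 > 0" and "\<gamma> = 7/48"
  shows "\<exists>C :: real \<Rightarrow> real. (\<forall>r\<ge>0. C r > 0) \<and>
    (\<forall>(\<sigma>0::real) (\<eta>0 :: real \<Rightarrow> real) (\<eta> :: real \<Rightarrow> real \<Rightarrow> real).
       \<sigma>0 > 0 \<longrightarrow>
       complexify \<eta>0 \<in> gevrey_space \<sigma>0 2 \<longrightarrow>
       kdvbbm_global_solution \<gamma> \<gamma>1 \<gamma>2 \<delta>1 \<delta>2 \<eta>0 \<eta> \<longrightarrow>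
       (\<exists>\<sigma> :: real \<Rightarrow> real.
          (\<forall>t>0. \<sigma> t > 0 \<and> complexify (\<eta> t) \<in> gevrey_space (\<sigma> t) 2) \<and>
          (\<forall>\<^sub>F t in at_top.
             \<sigma> t \<ge> C (gevrey_norm \<sigma>0 2 (complexify \<eta>0)) / sqrt t)))"
proof -
  interpret K: kdvbbm \<gamma>1 \<gamma>2 \<delta>1 \<delta>2 by unfold_locales (use assms in auto)
  define M where "M r = 4 * K.du * r\<^sup>2 + 1" for r :: real
  define y where "y r = sqrt (2 * M r / K.dl)" for r
  define A where "A r = 2 * (K.Ke * ((y r)^3 + (y r)^4))" for r
  \<comment> \<open>For \<sigma> = C / sqrt t the smallness condition reads A C^2 < M. The choice
    gives A C^2 \<le> M / 2: the 2 makes the inequality strict, and A + 1 keeps the denominator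
    positive whatever A is.\<close>
  define C where "C r = sqrt (M r / (2 * (A r + 1)))" for r
  have M1: "1 \<le> M r" for r using K.du_pos by (simp add: M_def)
  have y0: "0 \<le> y r" for r
    unfolding y_def using M1[of r] K.dl_pos by (intro real_sqrt_ge_zero divide_nonneg_pos) auto
  have A0: "0 \<le> A r" for r using y0[of r] K.Ke_nonneg by (simp add: A_def)
  have C_sq: "(C r)\<^sup>2 = M r / (2 * (A r + 1))" for r using M1[of r] A0[of r] by (simp add: C_def)
  have C_pos: "0 < C r" for r using M1[of r] A0[of r] by (simp add: C_def)
  show ?thesis
  proof (rule exI[of _ C], intro conjI allI impI C_pos)
    fix \<sigma>0 :: real and \<eta>0 :: "real \<Rightarrow> real" and \<eta> :: "real \<Rightarrow> real \<Rightarrow> real"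
    assume \<sigma>0: "\<sigma>0 > 0" and g: "complexify \<eta>0 \<in> gevrey_space \<sigma>0 2"
      and sol: "kdvbbm_global_solution \<gamma> \<gamma>1 \<gamma>2 \<delta>1 \<delta>2 \<eta>0 \<eta>"
    interpret kdvbbm_solution \<gamma>1 \<gamma>2 \<delta>1 \<delta>2 \<eta>0 \<eta>
      by unfold_locales (use sol assms gevrey_imp_sobolev[OF g] in auto)
    define r where "r = gevrey_norm \<sigma>0 2 (complexify \<eta>0)"
    \<comment> \<open>The energy estimate starts from the data and cannot use a radius beyond
      \<sigma>0; once t \<ge> (C r / \<sigma>0)^2 the second entry is the smaller one.\<close>
    define \<sigma> where "\<sigma> t = min \<sigma>0 (C r / sqrt t)" for t
    have "\<sigma> t > 0 \<and> complexify (\<eta> t) \<in> gevrey_space (\<sigma> t) 2" if t: "t > 0" for t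
    proof
      show pos: "\<sigma> t > 0" using t \<sigma>0 C_pos by (simp add: \<sigma>_def)
      have "(\<sigma> t)\<^sup>2 \<le> (C r / sqrt t)\<^sup>2" using pos by (intro power_mono) (auto simp: \<sigma>_def)
      then have "t * (\<sigma> t)\<^sup>2 \<le> (C r)\<^sup>2" using t by (simp add: power_divide field_simps)
      then have "A r * (t * (\<sigma> t)\<^sup>2) \<le> A r * (M r / (2 * (A r + 1)))" unfolding C_sq[symmetric] by (rule mult_left_mono[OF _ A0])
      also have "\<dots> = (A r / (A r + 1)) * (M r / 2)" by simp
      also have "\<dots> \<le> 1 * (M r / 2)" using A0[of r] M1[of r] by (intro mult_right_mono) auto
      also have "\<dots> < M r" using M1[of r] by simp
      finally have "t * (2 * (K.Ke * (\<sigma> t)\<^sup>2 * ((y r)^3 + (y r)^4))) < M r" unfolding A_def by (simp only: ac_simps)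
      then show "complexify (\<eta> t) \<in> gevrey_space (\<sigma> t) 2"
        by (intro gevrey_regularity[OF g _ _ _ M_def[of r, unfolded r_def] y_def[of r, unfolded r_def]])
           (use pos t in \<open>auto simp: r_def \<sigma>_def\<close>)
    qed
    moreover have "\<forall>\<^sub>F t in at_top. \<sigma> t \<ge> C r / sqrt t"
    proof -
      have "\<forall>\<^sub>F t in at_top. (C r / \<sigma>0)\<^sup>2 \<le> t" by (rule eventually_ge_at_top)
      then show ?thesis
      proof eventually_elim
        case (elim t)
        have q: "0 < C r / \<sigma>0" using C_pos \<sigma>0 by simp
        have "C r / \<sigma>0 \<le> sqrt t" by (rule real_le_rsqrt[OF elim])
        moreover have "0 < sqrt t" using calculation q by linarith
        ultimately have "C r / sqrt t \<le> \<sigma>0" using \<sigma>0 by (simp add: field_simps)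
        then show ?case by (simp add: \<sigma>_def)
      qed
    qed
    ultimately show "\<exists>\<sigma> :: real \<Rightarrow> real.
          (\<forall>t>0. \<sigma> t > 0 \<and> complexify (\<eta> t) \<in> gevrey_space (\<sigma> t) 2) \<and>
          (\<forall>\<^sub>F t in at_top. \<sigma> t \<ge> C (gevrey_norm \<sigma>0 2 (complexify \<eta>0)) / sqrt t)"
      unfolding r_def by blast
  qed
qed

end
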